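(* There is a randomized algorithm with the following property. For every constant $\gamma\in(0,1/2)$ and every $\beta>0$, when the input $q$ is generated by the noisy sorting model with parameter $\gamma$, except with probability $n^{-\beta}$ the algorithm: - outputs an optimal ranking for $q$; - runs in time $n^{O((\beta+1)\gamma^{-4})}$; - inspects at most $C\,n\log n$ of the comparison outcomes $q(a_i,a_j)$, where $C=C(\beta,\gamma)$.
   Context: There are $n$ items $a_1,\dots,a_n$. There is an unknown true order given by a permutation $\pi$ of $\{1,\dots,n\}$, where $a_i<a_j$ in the true order iff $\pi(i)<\pi(j)$. For every pair $i\neq j$ there is a comparison outcome $q(a_i,a_j)\in\{+1,-1\}$ with $q(a_j,a_i)=-q(a_i,a_j)$. If $\pi(i)>\pi(j)$ then $\Pr[q(a_i,a_j)=+1]\ge\tfrac12+\gamma$. Outcomes for distinct unordered pairs are independent. A ranking is a permutation $\sigma$ of $\{1,\dots,n\}$, with $\sigma(i)$ the position of $a_i$. Its score is $s_q(\sigma)=\sum_{(i,j):\sigma(i)>\sigma(j)}q(a_i,a_j)$. A ranking is optimal if it maximizes $s_q$. The algorithm accesses $q$ only through queries returning individual values $q(a_i,a_j)$. Its sampling complexity is the number of such queries. *)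

theory Defs
  imports "HOL-Probability.Probability" "HOL-Combinatorics.Permutations"
    "HOL-Library.Monad_Syntax"
begin

text \<open>Items are the numbers in \<open>{1..n}\<close>, and \<open>q i j\<close> is the outcome of comparing item
  \<open>i\<close> with item \<open>j\<close>; only its values on distinct \<open>i, j\<close> in \<open>{1..n}\<close> are meaningful. The law of the
  other values is left completely unconstrained, so an algorithm that has to work for all laws
  gains nothing from querying them.\<close>

type_synonym outcomes = "nat \<Rightarrow> nat \<Rightarrow> int"

definition score :: "nat \<Rightarrow> outcomes \<Rightarrow> (nat \<Rightarrow> nat) \<Rightarrow> int" where
  "score n q \<sigma> = (\<Sum>(i, j) \<in> {(i, j). i \<in> {1..n} \<and> j \<in> {1..n} \<and> \<sigma> i > \<sigma> j}. q i j)"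

definition optimal_ranking :: "nat \<Rightarrow> outcomes \<Rightarrow> (nat \<Rightarrow> nat) \<Rightarrow> bool" where
  "optimal_ranking n q \<sigma> \<longleftrightarrow>
     \<sigma> permutes {1..n} \<and> (\<forall>\<tau>. \<tau> permutes {1..n} \<longrightarrow> score n q \<tau> \<le> score n q \<sigma>)"

text \<open>\<open>Q\<close> is the law of the table \<open>q\<close>. The entries may have different biases; only the lower
  bound \<open>1/2 + \<gamma>\<close> is assumed. As \<open>q j i = - q i j\<close>, each unordered pair is represented by its
  entry with \<open>i < j\<close> in the independence requirement.\<close>

definition noisy_sorting :: "nat \<Rightarrow> real \<Rightarrow> (nat \<Rightarrow> nat) \<Rightarrow> outcomes pmf \<Rightarrow> bool" where
  "noisy_sorting n \<gamma> \<pi> Q \<longleftrightarrow>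
     \<pi> permutes {1..n} \<and>
     (\<forall>q \<in> set_pmf Q. \<forall>i \<in> {1..n}. \<forall>j \<in> {1..n}. i \<noteq> j \<longrightarrow>
        q i j \<in> {1, -1} \<and> q j i = - q i j) \<and>
     (\<forall>i \<in> {1..n}. \<forall>j \<in> {1..n}. \<pi> i > \<pi> j \<longrightarrow>
        measure_pmf.prob Q {q. q i j = 1} \<ge> 1 / 2 + \<gamma>) \<and>
     prob_space.indep_vars (measure_pmf Q) (\<lambda>_. count_space UNIV)
       (\<lambda>(i, j) q. q i j) {(i, j). 1 \<le> i \<and> i < j \<and> j \<le> n}"

text \<open>Algorithms are programs for a randomized random access machine whose memory cells hold
  integers and are addressed by integers. Arithmetic is restricted to addition and subtraction, so
  in \<open>t\<close> unit-cost steps the bit length of the numbers grows by at most \<open>O(t)\<close>; hence unit-cost time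
  is polynomially related to Turing machine time. \<open>Mem e\<close> reads the cell whose address is the value
  of \<open>e\<close>. In \<open>Assign\<close>, \<open>Query\<close> and \<open>Flip\<close> the first argument evaluates to the address of the
  cell that is written. \<open>Query\<close> is the only access to the comparison outcomes. Tests succeed iff
  the expression is positive.\<close>

datatype expr = Const int | Mem expr | Plus expr expr | Minus expr expr

datatype com =
    Skip
  | Assign expr expr
  | Query expr expr expr
  | Flip expr
  | Seq com com
  | Cond expr com com
  | Loop expr com

type_synonym mem = "int \<Rightarrow> int"

fun val :: "expr \<Rightarrow> mem \<Rightarrow> int" where
  "val (Const k) m = k"
| "val (Mem e) m = m (val e m)"
| "val (Plus a b) m = val a m + val b m"
| "val (Minus a b) m = val a m - val b m"

text \<open>A configuration consists of the commands still to be executed, the memory and the number of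
  queries made so far (repeated queries count each time). The machine has halted when no command
  is left.\<close>

type_synonym config = "com list \<times> mem \<times> nat"

fun step :: "outcomes \<Rightarrow> config \<Rightarrow> config pmf" where
  "step q ([], m, k) = return_pmf ([], m, k)"
| "step q (Skip # cs, m, k) = return_pmf (cs, m, k)"
| "step q (Assign a e # cs, m, k) = return_pmf (cs, m(val a m := val e m), k)"
| "step q (Query a e f # cs, m, k) =
     return_pmf (cs, m(val a m := q (nat (val e m)) (nat (val f m))), Suc k)"
| "step q (Flip a # cs, m, k) =
     map_pmf (\<lambda>b. (cs, m(val a m := of_bool b), k)) (bernoulli_pmf (1 / 2))"
| "step q (Seq c d # cs, m, k) = return_pmf (c # d # cs, m, k)"
| "step q (Cond e c d # cs, m, k) = return_pmf ((if val e m > 0 then c else d) # cs, m, k)"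
| "step q (Loop e c # cs, m, k) =
     return_pmf (if val e m > 0 then c # Loop e c # cs else cs, m, k)"

fun steps :: "outcomes \<Rightarrow> nat \<Rightarrow> config \<Rightarrow> config pmf" where
  "steps q 0 c = return_pmf c"
| "steps q (Suc t) c = bind_pmf (step q c) (steps q t)"

text \<open>The program receives \<open>n\<close> and the constants \<open>\<gamma>\<close> and \<open>\<beta>\<close>, the latter two only as the integers
  \<open>\<lceil>1/\<gamma>\<rceil>\<close> and \<open>\<lceil>\<beta>\<rceil>\<close>, since a memory cell cannot hold a real number. This rounds \<open>\<gamma>\<close> down to
  \<open>1/\<lceil>1/\<gamma>\<rceil> \<ge> 2\<gamma>/3\<close> (for \<open>\<gamma> < 1/2\<close>) and \<open>\<beta>\<close> up to \<open>\<lceil>\<beta>\<rceil> < \<beta> + 1\<close>, which only affects the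
  constants in the resource bounds. All other cells are initially 0.\<close>

definition initial :: "com \<Rightarrow> nat \<Rightarrow> real \<Rightarrow> real \<Rightarrow> config" where
  "initial P n \<gamma> \<beta> = ([P], (\<lambda>_. 0)(0 := int n, -1 := \<lceil>1 / \<gamma>\<rceil>, -2 := \<lceil>\<beta>\<rceil>), 0)"

text \<open>The position of item \<open>i\<close> in the output ranking is read from cell \<open>i\<close>.\<close>

definition output_ranking :: "nat \<Rightarrow> mem \<Rightarrow> nat \<Rightarrow> nat" where
  "output_ranking n m i = (if i \<in> {1..n} then nat (m (int i)) else i)"

text \<open>Joint law of the random input \<open>q\<close> and the configuration reached after \<open>t\<close> steps; the coin
  flips are independent of \<open>q\<close>. Halted configurations do not change any more, so a halted
  configuration after \<open>t\<close> steps means a running time of at most \<open>t\<close>.\<close>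

definition execution ::
    "com \<Rightarrow> nat \<Rightarrow> real \<Rightarrow> real \<Rightarrow> outcomes pmf \<Rightarrow> nat \<Rightarrow> (outcomes \<times> config) pmf" where
  "execution P n \<gamma> \<beta> Q t = do {
     q \<leftarrow> Q;
     c \<leftarrow> steps q t (initial P n \<gamma> \<beta>);
     return_pmf (q, c)
   }"

end

theory Submission
  imports Defs "HOL-Library.Nat_Bijection"
begin

text \<open>Items are inserted one at a time into a ranking of the earlier items that is optimal for them.
  An optimal ranking displaces no item by more than \<open>O(\<gamma>^(-4) log n)\<close>: partitioning a stretch of it by a
  threshold of the true order cannot raise the score, whereas by a Chernoff bound and a union bound over short sublists a
  large set of inverted pairs would. Hence a noisy binary search, which maintains multiplicative
  weights on blocks of length \<open>V = O(log n)\<close> and queries near the weighted median, locates a new item up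
  to a few blocks with \<open>O(log n)\<close> queries. Querying the new item against the \<open>O(log n)\<close> items around
  that place then yields all outcomes that can matter, as the order of pairs that are further apart is the
  same in all candidate rankings. The best ranking with displacements at most \<open>w = O(log n)\<close> is found by
  dynamic programming; its states are the sets of positions used so far, restricted to a window of
  width \<open>2 w\<close>, so that there are \<open>n 2^(2 w)\<close>, polynomially many, of them.

  The search for item \<open>k + 1\<close> only compares it with earlier items, while the ranking it runs on depends
  on outcomes between earlier items only. So one may condition on the latter.\<close>

section \<open>Concentration of comparison sums\<close>

text \<open>The obstacle is that an optimal ranking depends on all outcomes, and a union bound over
  all rankings is too costly at the scale of \<open>log n\<close>. It is avoided by letting the
  largest displacement \<open>d\<close> and the largest number \<open>R\<close> of items misplaced
  across a cut bound each other. Moving one item to its true place involves, up to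
  \<open>O(R)\<close> items, only sets fixed by the true order; this gives
  \<open>d = O(R / \<gamma>)\<close> unless \<open>d\<close> is small anyway. A cut yields
  \<open>R^2\<close> inverted pairs among at most \<open>2 d\<close> items; the
  \<open>n ^ (2 d)\<close> lists of such items cost \<open>2 d ln n\<close> against evidence of
  order \<open>\<gamma>^2 R^2\<close>. Together \<open>d = O(ln n / \<gamma>^4)\<close>, the origin
  of the fourth power.

  Whether two items are close is judged when the later one is inserted. Further insertions only
  widen gaps between ranks, so an outcome that was not asked for then is not missed afterwards.

  The program flips no coins, so all randomness is that of \<open>q\<close>. Runs record the queried
  pairs; this shows on which outcomes a stage can depend and thereby justifies the
  conditioning.\<close>

lemma exp_mgf_bound:
  fixes \<gamma> p :: real
  assumes "0 < \<gamma>" "\<gamma> < 1/2" "p \<ge> 1/2 + \<gamma>"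
  shows "exp \<gamma> - (exp \<gamma> - exp (- \<gamma>)) * p \<le> exp (- (\<gamma>\<^sup>2))"
proof -
  have a: "exp \<gamma> \<le> 1 + \<gamma> + \<gamma>\<^sup>2" using exp_bound[of \<gamma>] assms by simp
  \<comment> \<open>The product equals \<open>1 + \<gamma>^3\<close>.\<close>
  have "1 \<le> (1 - \<gamma> + \<gamma>\<^sup>2) * (1 + \<gamma>)"
    using assms by (simp add: algebra_simps power2_eq_square)
  also have "\<dots> \<le> (1 - \<gamma> + \<gamma>\<^sup>2) * exp \<gamma>"
    using assms exp_ge_add_one_self[of \<gamma>] by (intro mult_left_mono) auto
  finally have b: "exp (- \<gamma>) \<le> 1 - \<gamma> + \<gamma>\<^sup>2"
    by (simp add: exp_minus field_simps)
  \<comment> \<open>The left side is the mean of \<open>exp (- \<gamma> X)\<close> for a sign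
    \<open>X\<close> that is +1 with probability \<open>p\<close>. It decreases in \<open>p\<close>,
    so the worst bias is \<open>1/2 + \<gamma>\<close>, where the second-order bounds leave
    \<open>1 - \<gamma>^2\<close>.\<close>
  have "exp \<gamma> - (exp \<gamma> - exp (- \<gamma>)) * p \<le> exp \<gamma> - (exp \<gamma> - exp (- \<gamma>)) * (1/2 + \<gamma>)"
    using assms by (intro diff_left_mono mult_left_mono) auto
  also have "\<dots> = exp \<gamma> * (1/2 - \<gamma>) + exp (- \<gamma>) * (1/2 + \<gamma>)" by (simp add: algebra_simps)
  also have "\<dots> \<le> (1 + \<gamma> + \<gamma>\<^sup>2) * (1/2 - \<gamma>) + (1 - \<gamma> + \<gamma>\<^sup>2) * (1/2 + \<gamma>)"
    using a b assms by (intro add_mono mult_right_mono) auto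
  also have "\<dots> = 1 + - (\<gamma>\<^sup>2)" by (simp add: field_simps power2_eq_square)
  also have "\<dots> \<le> exp (- (\<gamma>\<^sup>2))" by (rule exp_ge_add_one_self)
  finally show ?thesis .
qed

locale noisy =
  fixes n :: nat and \<gamma> :: real and \<pi> :: "nat \<Rightarrow> nat" and Q :: "outcomes pmf"
  assumes model: "noisy_sorting n \<gamma> \<pi> Q" and \<gamma>: "0 < \<gamma>" "\<gamma> < 1/2"
begin

lemma pi_permutes: "\<pi> permutes {1..n}"
  using model by (simp add: noisy_sorting_def)

lemma pi_inject: "\<pi> i = \<pi> j \<longleftrightarrow> i = j"
  using permutes_inj[OF pi_permutes] by (auto simp: inj_def)

lemma outcome_values:
  assumes "q \<in> set_pmf Q" "i \<in> {1..n}" "j \<in> {1..n}" "i \<noteq> j"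
  shows "q i j \<in> {1, -1}" "q j i = - q i j"
  using model assms unfolding noisy_sorting_def by blast+

definition pairs :: "(nat \<times> nat) set" where
  "pairs = {(i, j). 1 \<le> i \<and> i < j \<and> j \<le> n}"

lemma finite_pairs: "finite pairs"
  by (rule finite_subset[of _ "{1..n} \<times> {1..n}"]) (auto simp: pairs_def)

lemma indep: "prob_space.indep_vars (measure_pmf Q) (\<lambda>_. count_space UNIV)
    (\<lambda>p q. q (fst p) (snd p)) pairs"
  using model by (simp add: noisy_sorting_def pairs_def case_prod_beta')

text \<open>Independence is given for pairs \<open>(i, j)\<close> with \<open>i < j\<close>, while
  the estimates use pairs \<open>(u, v)\<close> in true order, for which \<open>q v u\<close>
  favours +1. \<open>srt\<close> passes from the latter to the former, and \<open>orient\<close>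
  supplies the sign.\<close>

definition srt :: "nat \<times> nat \<Rightarrow> nat \<times> nat" where
  "srt p = (min (fst p) (snd p), max (fst p) (snd p))"

definition orient :: "nat \<times> nat \<Rightarrow> real" where
  "orient p = (if \<pi> (fst p) < \<pi> (snd p) then -1 else 1)"

lemma srt_pairs:
  assumes "fst p \<in> {1..n}" "snd p \<in> {1..n}" "\<pi> (fst p) < \<pi> (snd p)"
  shows "srt p \<in> pairs"
proof -
  have "fst p \<noteq> snd p" using assms by auto
  with assms show ?thesis by (auto simp: srt_def pairs_def)
qed

lemma srt_value:
  assumes "q \<in> set_pmf Q" "fst p \<in> {1..n}" "snd p \<in> {1..n}" "\<pi> (fst p) < \<pi> (snd p)"
  shows "orient (srt p) * q (fst (srt p)) (snd (srt p)) = q (snd p) (fst p)"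
proof -
  have "fst p \<noteq> snd p" using assms by auto
  with outcome_values(2)[OF assms(1-3)] assms(4) show ?thesis
    by (auto simp: srt_def orient_def min_def max_def)
qed

text \<open>Only one of the two orientations of an unordered pair agrees with \<open>\<pi>\<close>,
  so distinct pairs in true order use distinct independent outcomes.\<close>

lemma srt_inj: "inj_on srt {p. \<pi> (fst p) < \<pi> (snd p)}"
proof (rule inj_onI)
  fix p p' assume *: "p \<in> {p. \<pi> (fst p) < \<pi> (snd p)}" "p' \<in> {p. \<pi> (fst p) < \<pi> (snd p)}" "srt p = srt p'"
  obtain a b c d where "p = (a, b)" "p' = (c, d)" by (metis surj_pair)
  with * show "p = p'"
    by (auto simp: srt_def min_def max_def split: if_splits)
qed

lemma integrable_ind: "integrable (measure_pmf Q) (\<lambda>q. indicator A (F q) :: real)"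
  by (rule measure_pmf.integrable_const_bound[where B = 1]) (auto simp: indicator_def)

lemma integrable_exp:
  assumes "p \<in> pairs"
  shows "integrable (measure_pmf Q) (\<lambda>q. exp (- \<gamma> * (orient p * real_of_int (q (fst p) (snd p)))))"
proof (rule measure_pmf.integrable_const_bound[where B = "exp \<gamma>"])
  show "AE q in measure_pmf Q. norm (exp (- \<gamma> * (orient p * real_of_int (q (fst p) (snd p))))) \<le> exp \<gamma>"
    unfolding AE_measure_pmf_iff
  proof
    fix q assume "q \<in> set_pmf Q"
    from outcome_values(1)[OF this, of "fst p" "snd p"] assms
    have "q (fst p) (snd p) \<in> {1, -1}" by (auto simp: pairs_def)
    with \<gamma> show "norm (exp (- \<gamma> * (orient p * real_of_int (q (fst p) (snd p))))) \<le> exp \<gamma>"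
      by (auto simp: orient_def)
  qed
qed auto

lemma expectation_edge:
  assumes "fst p \<in> {1..n}" "snd p \<in> {1..n}" "\<pi> (fst p) < \<pi> (snd p)"
  shows "measure_pmf.expectation Q (\<lambda>q. exp (- \<gamma> * (orient (srt p) *
      real_of_int (q (fst (srt p)) (snd (srt p)))))) \<le> exp (- (\<gamma>\<^sup>2))"
proof -
  have ne: "fst p \<noteq> snd p" using assms by auto
  let ?A = "{q. q (snd p) (fst p) = 1}"
  have "measure_pmf.expectation Q (\<lambda>q. exp (- \<gamma> * (orient (srt p) *
      real_of_int (q (fst (srt p)) (snd (srt p)))))) =
    measure_pmf.expectation Q (\<lambda>q. exp \<gamma> - (exp \<gamma> - exp (- \<gamma>)) * indicator ?A q)"
  proof (rule integral_cong_AE)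
    show "AE q in measure_pmf Q. exp (- \<gamma> * (orient (srt p) *
      real_of_int (q (fst (srt p)) (snd (srt p))))) = exp \<gamma> - (exp \<gamma> - exp (- \<gamma>)) * indicator ?A q"
      unfolding AE_measure_pmf_iff
    proof
      fix q assume q: "q \<in> set_pmf Q"
      have "orient (srt p) * real_of_int (q (fst (srt p)) (snd (srt p))) = real_of_int (q (snd p) (fst p))"
        using srt_value[OF q assms] by simp
      moreover have "q (snd p) (fst p) \<in> {1, -1}"
        using outcome_values(1)[OF q assms(2,1)] ne by auto
      ultimately show "exp (- \<gamma> * (orient (srt p) *
      real_of_int (q (fst (srt p)) (snd (srt p))))) = exp \<gamma> - (exp \<gamma> - exp (- \<gamma>)) * indicator ?A q"
        by (auto simp: indicator_def)
    qed
  qed auto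
  also have "\<dots> = exp \<gamma> - (exp \<gamma> - exp (- \<gamma>)) * measure_pmf.prob Q ?A"
    using integrable_ind[of ?A "\<lambda>q. q"] by (subst Bochner_Integration.integral_diff) auto
  also have "\<dots> \<le> exp (- (\<gamma>\<^sup>2))"
  proof (rule exp_mgf_bound[OF \<gamma>])
    show "1 / 2 + \<gamma> \<le> measure_pmf.prob Q ?A"
      using model assms unfolding noisy_sorting_def by blast
  qed
  finally show ?thesis .
qed

definition agree :: "(nat \<times> nat) set \<Rightarrow> (nat \<times> nat \<Rightarrow> int) \<Rightarrow> outcomes set" where
  "agree I f = {q. \<forall>p \<in> I. q (fst p) (snd p) = f p}"

lemma agree_indicator:
  assumes "finite I"
  shows "(\<Prod>p\<in>I. indicator {f p} (q (fst p) (snd p)) :: real) = indicator (agree I f) q"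
proof (cases "q \<in> agree I f")
  case False
  then obtain p where "p \<in> I" "q (fst p) (snd p) \<noteq> f p" by (auto simp: agree_def)
  then have "(\<Prod>p\<in>I. indicator {f p} (q (fst p) (snd p)) :: real) = 0"
    using assms by (intro prod_zero) (auto intro!: bexI[of _ p])
  with False show ?thesis by simp
qed (auto simp: agree_def intro!: prod.neutral)

lemma expectation_prod:
  fixes g :: "nat \<times> nat \<Rightarrow> int \<Rightarrow> real"
  assumes "I \<subseteq> pairs" "\<And>p. p \<in> I \<Longrightarrow> integrable (measure_pmf Q) (\<lambda>q. g p (q (fst p) (snd p)))"
  shows "measure_pmf.expectation Q (\<lambda>q. \<Prod>p\<in>I. g p (q (fst p) (snd p))) =
     (\<Prod>p\<in>I. measure_pmf.expectation Q (\<lambda>q. g p (q (fst p) (snd p))))"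
    and "integrable (measure_pmf Q) (\<lambda>q. \<Prod>p\<in>I. g p (q (fst p) (snd p)))"
proof -
  have fin: "finite I" using assms(1) finite_pairs finite_subset by blast
  have ind: "prob_space.indep_vars (measure_pmf Q) (\<lambda>_. borel) (\<lambda>p q. g p (q (fst p) (snd p))) I"
    by (rule prob_space.indep_vars_compose2[OF prob_space_measure_pmf prob_space.indep_vars_subset[OF prob_space_measure_pmf indep assms(1)]]) simp
  show "measure_pmf.expectation Q (\<lambda>q. \<Prod>p\<in>I. g p (q (fst p) (snd p))) =
     (\<Prod>p\<in>I. measure_pmf.expectation Q (\<lambda>q. g p (q (fst p) (snd p))))"
    by (rule prob_space.indep_vars_lebesgue_integral[OF prob_space_measure_pmf fin ind assms(2)])
  show "integrable (measure_pmf Q) (\<lambda>q. \<Prod>p\<in>I. g p (q (fst p) (snd p)))"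
    by (rule prob_space.indep_vars_integrable[OF prob_space_measure_pmf fin ind assms(2)])
qed

text \<open>Conditioning on the outcomes in \<open>I\<close> is built into the exponential moment: the indicators of
  the conditioning event are further factors of the same independent product.\<close>

lemma chernoff:
  assumes I: "I \<subseteq> pairs" and M: "finite M"
    "\<And>u v. (u, v) \<in> M \<Longrightarrow> u \<in> {1..n} \<and> v \<in> {1..n} \<and> \<pi> u < \<pi> v \<and> (u, v) \<notin> I \<and> (v, u) \<notin> I"
  shows "measure_pmf.prob Q (agree I f \<inter> {q. real_of_int (\<Sum>(u, v)\<in>M. q v u) \<le> \<gamma> / 2 * real (card M)})
     \<le> measure_pmf.prob Q (agree I f) * exp (- (\<gamma>\<^sup>2 / 2 * real (card M)))"
proof -
  let ?E = "measure_pmf.expectation Q"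
  let ?B = "agree I f \<inter> {q. real_of_int (\<Sum>(u, v)\<in>M. q v u) \<le> \<gamma> / 2 * real (card M)}"
  define J where "J = srt ` M"
  have Mp: "fst p \<in> {1..n}" "snd p \<in> {1..n}" "\<pi> (fst p) < \<pi> (snd p)" if "p \<in> M" for p
    using M(2)[of "fst p" "snd p"] that by auto
  have J: "J \<subseteq> pairs" using srt_pairs Mp by (auto simp: J_def)
  have disj: "I \<inter> J = {}"
    using M(2) by (auto simp: J_def srt_def min_def max_def split: if_splits)
  have inj: "inj_on srt M" by (rule inj_on_subset[OF srt_inj]) (use Mp in auto)
  have fin: "finite I" "finite J" using I J finite_pairs finite_subset by blast+
  define g :: "nat \<times> nat \<Rightarrow> int \<Rightarrow> real" where
    "g p v = (if p \<in> I then indicator {f p} v else exp (- \<gamma> * (orient p * real_of_int v)))" for p v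
  have gI: "(\<Prod>p\<in>I. g p (q (fst p) (snd p))) = indicator (agree I f) q" for q
    using agree_indicator[OF fin(1), of f q] by (simp add: g_def)
  have gJ: "(\<Prod>p\<in>J. g p (q (fst p) (snd p))) = exp (- \<gamma> * real_of_int (\<Sum>(u, v)\<in>M. q v u))"
    if "q \<in> set_pmf Q" for q
  proof -
    have "(\<Prod>p\<in>J. g p (q (fst p) (snd p))) =
        (\<Prod>p\<in>J. exp (- \<gamma> * (orient p * real_of_int (q (fst p) (snd p)))))"
      using disj by (intro prod.cong) (auto simp: g_def)
    also have "\<dots> = (\<Prod>p\<in>M. exp (- \<gamma> * real_of_int (q (snd p) (fst p))))"
      unfolding J_def prod.reindex[OF inj] o_def
      using srt_value[OF that Mp] by (intro prod.cong refl arg_cong[of _ _ exp]) (simp del: of_int_eq_iff)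
    also have "\<dots> = exp (\<Sum>p\<in>M. - \<gamma> * real_of_int (q (snd p) (fst p)))"
      by (simp add: exp_sum M(1))
    also have "(\<Sum>p\<in>M. - \<gamma> * real_of_int (q (snd p) (fst p))) = - \<gamma> * real_of_int (\<Sum>(u, v)\<in>M. q v u)"
      by (simp add: sum_distrib_left case_prod_beta')
    finally show ?thesis .
  qed
  have gint: "integrable (measure_pmf Q) (\<lambda>q. g p (q (fst p) (snd p)))" if "p \<in> I \<union> J" for p
    using that I J integrable_ind[of "{f p}" "\<lambda>q. q (fst p) (snd p)"] integrable_exp[of p]
    unfolding g_def by (cases "p \<in> I") auto
  have IJ: "I \<union> J \<subseteq> pairs" using I J by blast
  have all: "(\<Prod>p\<in>I \<union> J. g p (q (fst p) (snd p))) =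
      indicator (agree I f) q * exp (- \<gamma> * real_of_int (\<Sum>(u, v)\<in>M. q v u))"
    if "q \<in> set_pmf Q" for q
    using gI gJ[OF that] by (simp add: prod.union_disjoint[OF fin disj])
  have "measure_pmf.prob Q ?B = ?E (indicator ?B)" by simp
  \<comment> \<open>Markov's inequality: on the bad event the exponent \<open>- \<gamma>\<close>
    times the sum is at least \<open>- \<gamma>^2 / 2 * card M\<close>, so the prefactor lifts the
    exponential to at least 1. Each factor of the product has mean at most
    \<open>exp (- \<gamma>^2)\<close>, which leaves half of the exponent in the end.\<close>
  also have "\<dots> \<le> ?E (\<lambda>q. exp (\<gamma>\<^sup>2 / 2 * card M) * (\<Prod>p\<in>I \<union> J. g p (q (fst p) (snd p))))"
  proof (rule integral_mono_AE)
    show "AE q in measure_pmf Q. indicator ?B q \<le>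
        exp (\<gamma>\<^sup>2 / 2 * card M) * (\<Prod>p\<in>I \<union> J. g p (q (fst p) (snd p)))"
      unfolding AE_measure_pmf_iff
    proof
      fix q assume q: "q \<in> set_pmf Q"
      show "indicator ?B q \<le> exp (\<gamma>\<^sup>2 / 2 * card M) * (\<Prod>p\<in>I \<union> J. g p (q (fst p) (snd p)))"
      proof (cases "q \<in> ?B")
        case True
        then have "\<gamma> * real_of_int (\<Sum>(u, v)\<in>M. q v u) \<le> \<gamma> * (\<gamma> / 2 * real (card M))"
          using \<gamma> by (intro mult_left_mono) auto
        then have "1 \<le> exp (\<gamma>\<^sup>2 / 2 * card M + - \<gamma> * real_of_int (\<Sum>(u, v)\<in>M. q v u))"
          by (simp add: power2_eq_square)
        with True show ?thesis unfolding all[OF q] exp_add by simp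
      qed (simp add: all[OF q])
    qed
    show "integrable (measure_pmf Q) (indicator ?B :: _ \<Rightarrow> real)"
      using integrable_ind[of ?B "\<lambda>x. x"] by simp
    show "integrable (measure_pmf Q) (\<lambda>q. exp (\<gamma>\<^sup>2 / 2 * card M) * (\<Prod>p\<in>I \<union> J. g p (q (fst p) (snd p))))"
      by (intro integrable_mult_right expectation_prod(2)[OF IJ gint])
  qed
  also have "\<dots> = exp (\<gamma>\<^sup>2 / 2 * card M) * (\<Prod>p\<in>I \<union> J. ?E (\<lambda>q. g p (q (fst p) (snd p))))"
    using expectation_prod(1)[OF IJ gint] by simp
  also have "(\<Prod>p\<in>I \<union> J. ?E (\<lambda>q. g p (q (fst p) (snd p)))) =
      (\<Prod>p\<in>I. ?E (\<lambda>q. g p (q (fst p) (snd p)))) * (\<Prod>p\<in>J. ?E (\<lambda>q. g p (q (fst p) (snd p))))"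
    by (rule prod.union_disjoint[OF fin disj])
  also have "(\<Prod>p\<in>I. ?E (\<lambda>q. g p (q (fst p) (snd p)))) = measure_pmf.prob Q (agree I f)"
    using expectation_prod(1)[OF I gint] by (simp add: gI)
  also have "(\<Prod>p\<in>J. ?E (\<lambda>q. g p (q (fst p) (snd p)))) \<le> exp (- (\<gamma>\<^sup>2)) ^ card M"
  proof -
    have "(\<Prod>p\<in>J. ?E (\<lambda>q. g p (q (fst p) (snd p)))) =
        (\<Prod>p\<in>J. ?E (\<lambda>q. exp (- \<gamma> * (orient p * real_of_int (q (fst p) (snd p))))))"
      using disj by (intro prod.cong refl Bochner_Integration.integral_cong) (auto simp: g_def)
    also have "\<dots> = (\<Prod>p\<in>M. ?E (\<lambda>q. exp (- \<gamma> * (orient (srt p) * real_of_int (q (fst (srt p)) (snd (srt p)))))))"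
      unfolding J_def prod.reindex[OF inj] o_def ..
    also have "\<dots> \<le> (\<Prod>p\<in>M. exp (- (\<gamma>\<^sup>2)))"
      using expectation_edge[OF Mp] by (intro prod_mono) (auto intro!: Bochner_Integration.integral_nonneg)
    finally show ?thesis by simp
  qed
  also have "exp (\<gamma>\<^sup>2 / 2 * card M) * (measure_pmf.prob Q (agree I f) * exp (- (\<gamma>\<^sup>2)) ^ card M) =
      measure_pmf.prob Q (agree I f) * exp (- (\<gamma>\<^sup>2 / 2 * real (card M)))"
    by (simp add: exp_of_nat_mult[symmetric] exp_add[symmetric] algebra_simps)
  finally show ?thesis by (simp add: mult_left_mono)
qed

corollary chernoff_unconditional:
  assumes "finite M" "\<And>u v. (u, v) \<in> M \<Longrightarrow> u \<in> {1..n} \<and> v \<in> {1..n} \<and> \<pi> u < \<pi> v"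
  shows "measure_pmf.prob Q {q. real_of_int (\<Sum>(u, v)\<in>M. q v u) \<le> \<gamma> / 2 * real (card M)}
     \<le> exp (- (\<gamma>\<^sup>2 / 2 * real (card M)))"
  using chernoff[of "{}" M f] assms by (simp add: agree_def)

end

section \<open>Displacement in optimal rankings\<close>

text \<open>The later item is the first argument of \<open>q\<close>, as in \<open>score\<close>,
  where \<open>i\<close> has the higher position. The two are linked by
  \<open>score_eq_lscore\<close>.\<close>

fun lscore :: "outcomes \<Rightarrow> nat list \<Rightarrow> int" where
  "lscore q [] = 0"
| "lscore q (x # xs) = (\<Sum>y\<leftarrow>xs. q y x) + lscore q xs"

lemma lscore_append:
  "lscore q (xs @ ys) = lscore q xs + lscore q ys + (\<Sum>x\<leftarrow>xs. \<Sum>y\<leftarrow>ys. q y x)"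
  by (induction xs) (simp_all add: algebra_simps)

definition opt_list :: "outcomes \<Rightarrow> nat set \<Rightarrow> nat list \<Rightarrow> bool" where
  "opt_list q A xs \<longleftrightarrow> distinct xs \<and> set xs = A \<and>
     (\<forall>ys. distinct ys \<and> set ys = A \<longrightarrow> lscore q ys \<le> lscore q xs)"

definition legal :: "outcomes \<Rightarrow> nat set \<Rightarrow> bool" where
  "legal q A \<longleftrightarrow> (\<forall>i\<in>A. \<forall>j\<in>A. i \<noteq> j \<longrightarrow> q i j \<in> {1, -1} \<and> q j i = - q i j)"

text \<open>If \<open>P\<close> says that the true rank lies below a cut, all these pairs stand in
  the wrong order in the list. Each is then a piece of evidence against the list, with
  \<open>q v u\<close> favouring +1.\<close>

fun inversions :: "(nat \<Rightarrow> bool) \<Rightarrow> nat list \<Rightarrow> (nat \<times> nat) set" where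
  "inversions P [] = {}"
| "inversions P (x # xs) = (if P x then {} else {u \<in> set xs. P u} \<times> {x}) \<union> inversions P xs"

lemma finite_inversions: "finite (inversions P xs)"
  by (induction xs) auto

lemma inversions_subset: "inversions P xs \<subseteq> {u \<in> set xs. P u} \<times> {v \<in> set xs. \<not> P v}"
  by (induction xs) auto

lemma inversions_append_low: "\<forall>x\<in>set as. P x \<Longrightarrow> inversions P (as @ xs) = inversions P xs"
  by (induction as) auto

lemma inversions_append_high: "\<forall>x\<in>set bs. \<not> P x \<Longrightarrow> inversions P (xs @ bs) = inversions P xs"
proof (induction xs)
  case Nil
  then show ?case by (induction bs) auto
qed auto

text \<open>The source of quadratic evidence: \<open>R\<close> low items right of a cut and
  \<open>R\<close> high items left of it already give \<open>R^2\<close> inversions.\<close>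

lemma inversions_product:
  "{u \<in> set r. P u} \<times> {v \<in> set l. \<not> P v} \<subseteq> inversions P (l @ r)"
  by (induction l) auto

text \<open>Partitioning reverses exactly the inverted pairs, and each reversal trades
  \<open>q u v = - q v u\<close> for \<open>q v u\<close>, whence the factor 2.\<close>

lemma lscore_partition:
  assumes "legal q A" "set xs \<subseteq> A" "distinct xs"
  shows "lscore q (filter P xs @ filter (\<lambda>x. \<not> P x) xs) =
    lscore q xs + 2 * (\<Sum>(u, v)\<in>inversions P xs. q v u)"
  using assms(2,3)
proof (induction xs)
  case (Cons x xs)
  have split: "(\<Sum>y\<leftarrow>xs. q y x) = (\<Sum>y\<leftarrow>filter P xs. q y x) + (\<Sum>y\<leftarrow>filter (\<lambda>x. \<not> P x) xs. q y x)"
    by (induction xs) auto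
  note IH = Cons.IH[OF _ distinct.simps(2)[THEN iffD1, OF Cons.prems(2), THEN conjunct2]]
  show ?case
  proof (cases "P x")
    case True
    with IH Cons.prems split show ?thesis by (simp add: lscore_append)
  next
    case False
    have anti: "q x u = - q u x" if "u \<in> set xs" for u
      using assms(1) Cons.prems that unfolding legal_def by (metis distinct.simps(2) list.set_intros(1,2) subsetD)
    have disj: "{u \<in> set xs. P u} \<times> {x} \<inter> inversions P xs = {}"
      using inversions_subset[of P xs] Cons.prems by auto
    have "(\<Sum>(u, v)\<in>inversions P (x # xs). q v u) =
        (\<Sum>(u, v)\<in>{u \<in> set xs. P u} \<times> {x}. q v u) + (\<Sum>(u, v)\<in>inversions P xs. q v u)"
      using False disj by (simp add: sum.union_disjoint finite_inversions)
    also have "(\<Sum>(u, v)\<in>{u \<in> set xs. P u} \<times> {x}. q v u) = (\<Sum>u\<in>{u \<in> set xs. P u}. q x u)"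
      by (simp add: sum.cartesian_product[symmetric])
    also have "\<dots> = (\<Sum>u\<leftarrow>filter P xs. q x u)"
      using Cons.prems by (subst sum_list_distinct_conv_sum_set) auto
    finally have M: "(\<Sum>(u, v)\<in>inversions P (x # xs). q v u) =
        (\<Sum>u\<leftarrow>filter P xs. q x u) + (\<Sum>(u, v)\<in>inversions P xs. q v u)" .
    have neg: "(\<Sum>u\<leftarrow>filter P xs. q u x) = - (\<Sum>u\<leftarrow>filter P xs. q x u)"
    proof -
      have "(\<Sum>u\<leftarrow>filter P xs. q u x) = (\<Sum>u\<leftarrow>filter P xs. - q x u)"
        using anti by (intro arg_cong[of _ _ sum_list] map_cong) auto
      then show ?thesis by (simp add: uminus_sum_list_map o_def)
    qed
    have swap: "(\<Sum>u\<leftarrow>ys. q x u + f u) = (\<Sum>u\<leftarrow>ys. q x u) + (\<Sum>u\<leftarrow>ys. f u)" for ys f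
      by (simp add: sum_list_addf)
    from IH Cons.prems have "lscore q (filter P xs @ filter (\<lambda>x. \<not> P x) xs) =
       lscore q xs + 2 * (\<Sum>(u, v)\<in>inversions P xs. q v u)" by simp
    then show ?thesis using False M neg split by (simp add: lscore_append swap)
  qed
qed simp

lemma lscore_move:
  "lscore q (as @ [i] @ ws @ bs) - lscore q (as @ ws @ [i] @ bs) = (\<Sum>v\<leftarrow>ws. q v i) - (\<Sum>v\<leftarrow>ws. q i v)"
proof -
  have *: "(\<Sum>x\<leftarrow>as. q i x + f x) = (\<Sum>x\<leftarrow>as. q i x) + (\<Sum>x\<leftarrow>as. f x)" for f
    by (simp add: sum_list_addf)
  show ?thesis by (simp add: lscore_append sum_list_addf algebra_simps)
qed

text \<open>As the sets have equal size, both differences have at most \<open>r\<close> elements,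
  and exchanging one for the other changes the sum by at most \<open>2 r\<close>. In its use below
  \<open>W\<close> is a stretch of the optimal ranking, hence random, and \<open>J\<close> is given
  by true ranks, so that a Chernoff bound applies to \<open>J\<close> directly.\<close>

lemma sum_exchange_bound:
  fixes f :: "'a \<Rightarrow> int"
  assumes "finite W" "finite J" "card W = card J" "card (W - J) \<le> r" "\<And>x. x \<in> W \<union> J \<Longrightarrow> \<bar>f x\<bar> \<le> 1"
    "sum f W \<le> 0"
  shows "sum f J \<le> 2 * int r"
proof -
  have "card (W - J) = card (J - W)"
    using assms(1-3) by (metis card_Diff_subset_Int diff_diff_cancel finite_Int inf_commute)
  have *: "\<bar>sum f X\<bar> \<le> int (card X)" if "X \<subseteq> W \<union> J" for X
  proof -
    have "\<bar>sum f X\<bar> \<le> (\<Sum>x\<in>X. \<bar>f x\<bar>)" by (rule sum_abs)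
    also have "\<dots> \<le> (\<Sum>x\<in>X. 1)" using assms(5) that by (intro sum_mono) blast
    finally show ?thesis by simp
  qed
  have "sum f J = sum f (J \<inter> W) + sum f (J - W)" "sum f W = sum f (J \<inter> W) + sum f (W - J)"
    using sum.Int_Diff[OF assms(2), of f W] sum.Int_Diff[OF assms(1), of f J] by (simp_all add: Int_commute)
  moreover have "\<bar>sum f (J - W)\<bar> \<le> r" "\<bar>sum f (W - J)\<bar> \<le> r"
  proof -
    have "J - W \<subseteq> W \<union> J" "W - J \<subseteq> W \<union> J" by auto
    from *[OF this(1)] *[OF this(2)] assms(4) \<open>card (W - J) = card (J - W)\<close>
    show "\<bar>sum f (J - W)\<bar> \<le> r" "\<bar>sum f (W - J)\<bar> \<le> r" by linarith+
  qed
  ultimately show ?thesis using assms(6) by linarith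
qed

locale ordered_items =
  fixes A :: "nat set" and \<rho> :: "nat \<Rightarrow> nat" and k :: nat and q :: outcomes and xs :: "nat list"
  assumes rank: "bij_betw \<rho> A {..<k}" and legal: "legal q A" and opt: "opt_list q A xs"
begin

lemma fin: "finite A" using rank bij_betw_finite by blast
lemma set_xs: "set xs = A" and dist: "distinct xs" using opt by (auto simp: opt_list_def)
lemma len: "length xs = k"
  using bij_betw_same_card[OF rank] distinct_card[OF dist] set_xs by simp

lemma nth_in: "p < k \<Longrightarrow> xs ! p \<in> A"
  using len set_xs nth_mem by blast

lemma card_rank: "X \<subseteq> {..<k} \<Longrightarrow> card {x \<in> A. \<rho> x \<in> X} = card X"
proof -
  assume X: "X \<subseteq> {..<k}"
  have "bij_betw \<rho> {x \<in> A. \<rho> x \<in> X} X"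
    using rank X unfolding bij_betw_def by (auto intro: inj_on_subset)
  then show ?thesis by (rule bij_betw_same_card)
qed

lemma q_abs: "i \<in> A \<Longrightarrow> j \<in> A \<Longrightarrow> i \<noteq> j \<Longrightarrow> \<bar>q i j\<bar> \<le> 1"
  using legal unfolding legal_def by fastforce

lemma q_anti: "i \<in> A \<Longrightarrow> j \<in> A \<Longrightarrow> i \<noteq> j \<Longrightarrow> q j i = - q i j"
  using legal unfolding legal_def by blast

lemma move_left:
  assumes "xs = as @ ws @ [i] @ bs"
  shows "(\<Sum>v\<in>set ws. q v i) \<le> 0"
proof -
  have "lscore q (as @ [i] @ ws @ bs) \<le> lscore q xs"
    using opt dist assms by (auto simp: opt_list_def)
  then have "(\<Sum>v\<leftarrow>ws. q v i) - (\<Sum>v\<leftarrow>ws. q i v) \<le> 0"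
    using lscore_move[of q as i ws bs] assms by simp
  moreover have "(\<Sum>v\<leftarrow>ws. q v i) = (\<Sum>v\<in>set ws. q v i)" "(\<Sum>v\<leftarrow>ws. q i v) = (\<Sum>v\<in>set ws. q i v)"
    using dist assms by (simp_all add: sum_list_distinct_conv_sum_set)
  moreover have "(\<Sum>v\<in>set ws. q i v) = (\<Sum>v\<in>set ws. - q v i)"
    using dist set_xs assms by (intro sum.cong refl q_anti) auto
  ultimately show ?thesis by (simp add: sum_negf)
qed

lemma move_right:
  assumes "xs = as @ [i] @ ws @ bs"
  shows "(\<Sum>v\<in>set ws. q i v) \<le> 0"
proof -
  have "lscore q (as @ ws @ [i] @ bs) \<le> lscore q xs"
    using opt dist assms by (auto simp: opt_list_def)
  then have "(\<Sum>v\<leftarrow>ws. q v i) - (\<Sum>v\<leftarrow>ws. q i v) \<ge> 0"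
    using lscore_move[of q as i ws bs] assms by simp
  moreover have "(\<Sum>v\<leftarrow>ws. q v i) = (\<Sum>v\<in>set ws. q v i)" "(\<Sum>v\<leftarrow>ws. q i v) = (\<Sum>v\<in>set ws. q i v)"
    using dist assms by (simp_all add: sum_list_distinct_conv_sum_set)
  moreover have "(\<Sum>v\<in>set ws. q v i) = (\<Sum>v\<in>set ws. - q i v)"
    using dist set_xs assms by (intro sum.cong refl q_anti) auto
  ultimately show ?thesis by (simp add: sum_negf)
qed

definition crossing :: "nat \<Rightarrow> nat" where
  "crossing c = card {x \<in> set (drop c xs). \<rho> x < c}"

text \<open>Exactly \<open>c\<close> items belong left of the cut and exactly \<open>c\<close> stand
  there, so there are as many intruders as missing items.\<close>

lemma crossing_left:
  assumes "c \<le> k"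
  shows "card {x \<in> set (take c xs). c \<le> \<rho> x} = crossing c"
proof -
  have dj: "set (take c xs) \<inter> set (drop c xs) = {}" "set (take c xs) \<union> set (drop c xs) = A"
    using dist set_xs by (metis append_take_drop_id distinct_append, metis append_take_drop_id set_append)
  have "card {x \<in> A. \<rho> x \<in> {..<c}} = c" using assms by (subst card_rank) auto
  moreover have "{x \<in> A. \<rho> x \<in> {..<c}} = {x \<in> set (take c xs). \<rho> x < c} \<union> {x \<in> set (drop c xs). \<rho> x < c}"
    using dj by auto
  ultimately have 1: "card {x \<in> set (take c xs). \<rho> x < c} + crossing c = c"
    unfolding crossing_def using dj by (subst card_Un_disjoint[symmetric]) auto
  have "card (set (take c xs)) = c" using assms len dist by (simp add: distinct_card)
  moreover have "set (take c xs) = {x \<in> set (take c xs). \<rho> x < c} \<union> {x \<in> set (take c xs). c \<le> \<rho> x}" by auto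
  ultimately have "card {x \<in> set (take c xs). \<rho> x < c} + card {x \<in> set (take c xs). c \<le> \<rho> x} = c"
    by (subst card_Un_disjoint[symmetric]) auto
  with 1 show ?thesis by simp
qed

lemma segment_split:
  assumes "a \<le> b" "b \<le> k"
  shows "xs = take a xs @ drop a (take b xs) @ drop b xs" "length (drop a (take b xs)) = b - a"
    "set (drop a (take b xs)) \<subseteq> set (drop a xs)" "set (drop a (take b xs)) \<subseteq> set (take b xs)"
proof -
  have "take b xs = take a xs @ drop a (take b xs)"
    using assms by (metis append_take_drop_id min.absorb1 take_take)
  then show "xs = take a xs @ drop a (take b xs) @ drop b xs"
    by (metis append.assoc append_take_drop_id)
  show "length (drop a (take b xs)) = b - a" using assms len by simp
  show "set (drop a (take b xs)) \<subseteq> set (drop a xs)"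
    by (metis drop_take set_take_subset)
  show "set (drop a (take b xs)) \<subseteq> set (take b xs)" by (rule set_drop_subset)
qed

text \<open>Moving \<open>i\<close> left to its true position \<open>t\<close> passes the stretch
  \<open>W\<close> at positions \<open>t\<close> to \<open>p - 1\<close> and gains nothing.
  \<open>W\<close> and \<open>J\<close> both have \<open>p - t\<close> elements. An item of
  \<open>W\<close> outside \<open>J\<close> has rank below \<open>t\<close> or above
  \<open>p\<close> and so is misplaced across the cut \<open>t\<close> or the cut
  \<open>p + 1\<close>; there are at most \<open>2 R\<close> of these.\<close>

lemma displaced_right:
  assumes R: "\<And>c. c \<le> k \<Longrightarrow> crossing c \<le> R" and p: "p < k" "\<rho> (xs ! p) < p"
  defines "i \<equiv> xs ! p"
  shows "(\<Sum>j \<in> {j \<in> A. \<rho> i < \<rho> j \<and> \<rho> j \<le> p}. q j i) \<le> 4 * int R"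
    and "card {j \<in> A. \<rho> i < \<rho> j \<and> \<rho> j \<le> p} = p - \<rho> i"
proof -
  define t where "t = \<rho> i"
  let ?J = "{j \<in> A. t < \<rho> j \<and> \<rho> j \<le> p}"
  let ?W = "drop t (take p xs)"
  have tp: "t < p" using p by (simp add: t_def i_def)
  have J: "?J = {x \<in> A. \<rho> x \<in> {t<..p}}" by auto
  show cJ: "card {j \<in> A. \<rho> i < \<rho> j \<and> \<rho> j \<le> p} = p - \<rho> i"
    using p J t_def by (subst t_def[symmetric], subst J, subst card_rank) auto
  note seg = segment_split[of t p]
  have xs: "xs = take t xs @ ?W @ [i] @ drop (Suc p) xs"
    using seg(1) tp p len by (simp add: i_def Cons_nth_drop_Suc)
  have dW: "distinct ?W" "i \<notin> set ?W"
    using subst[OF xs, where P = distinct, OF dist] by auto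
  have WA: "set ?W \<subseteq> A" using set_xs by (auto dest: in_set_dropD in_set_takeD)
  have cW: "card (set ?W) = p - t" using dW(1) seg(2) tp p by (simp add: distinct_card)
  have rk: "\<rho> x \<noteq> t" if "x \<in> set ?W" for x
    using rank that WA dW(2) nth_in[OF p(1)] unfolding bij_betw_def inj_on_def t_def i_def by blast
  have sub: "set ?W - ?J \<subseteq> {x \<in> set (drop t xs). \<rho> x < t} \<union> {x \<in> set (take (Suc p) xs). Suc p \<le> \<rho> x}"
  proof
    fix x assume x: "x \<in> set ?W - ?J"
    then have "\<rho> x < t \<or> Suc p \<le> \<rho> x" using rk[of x] WA by fastforce
    moreover have "x \<in> set (drop t xs)" "x \<in> set (take (Suc p) xs)"
      using x seg(3,4) tp p set_take_subset_set_take[of p "Suc p" xs] by auto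
    ultimately show "x \<in> {x \<in> set (drop t xs). \<rho> x < t} \<union> {x \<in> set (take (Suc p) xs). Suc p \<le> \<rho> x}" by auto
  qed
  have "card (set ?W - ?J) \<le> card {x \<in> set (drop t xs). \<rho> x < t} + card {x \<in> set (take (Suc p) xs). Suc p \<le> \<rho> x}"
    by (rule order_trans[OF card_mono[OF _ sub] card_Un_le]) auto
  also have "\<dots> \<le> R + R"
    using R[of t] R[of "Suc p"] crossing_left[of "Suc p"] tp p by (simp add: crossing_def)
  finally have c2: "card (set ?W - ?J) \<le> 2 * R" by simp
  have "(\<Sum>j\<in>?J. q j i) \<le> 2 * int (2 * R)"
  proof (rule sum_exchange_bound[OF _ _ _ c2])
    show "card (set ?W) = card ?J" using cW cJ by (simp add: t_def)
    show "(\<Sum>j\<in>set ?W. q j i) \<le> 0" by (rule move_left[OF xs])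
    show "\<bar>q x i\<bar> \<le> 1" if "x \<in> set ?W \<union> ?J" for x
      using that WA dW(2) nth_in[OF p(1)] by (intro q_abs) (auto simp: i_def t_def)
  qed (use fin in auto)
  then show "(\<Sum>j \<in> {j \<in> A. \<rho> i < \<rho> j \<and> \<rho> j \<le> p}. q j i) \<le> 4 * int R"
    by (simp add: t_def)
qed

text \<open>The mirror image, with \<open>i\<close> moved right past positions \<open>p + 1\<close>
  to \<open>t\<close> and the cuts \<open>p\<close> and \<open>t + 1\<close>.\<close>

lemma displaced_left:
  assumes R: "\<And>c. c \<le> k \<Longrightarrow> crossing c \<le> R" and p: "p < k" "p < \<rho> (xs ! p)"
  defines "i \<equiv> xs ! p"
  shows "(\<Sum>j \<in> {j \<in> A. p \<le> \<rho> j \<and> \<rho> j < \<rho> i}. q i j) \<le> 4 * int R"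
    and "card {j \<in> A. p \<le> \<rho> j \<and> \<rho> j < \<rho> i} = \<rho> i - p"
proof -
  define t where "t = \<rho> i"
  let ?J = "{j \<in> A. p \<le> \<rho> j \<and> \<rho> j < t}"
  let ?W = "drop (Suc p) (take (Suc t) xs)"
  have tp: "p < t" using p by (simp add: t_def i_def)
  have tk: "t < k" using nth_in[OF p(1)] rank unfolding t_def i_def bij_betw_def by blast
  have J: "?J = {x \<in> A. \<rho> x \<in> {p..<t}}" by auto
  show cJ: "card {j \<in> A. p \<le> \<rho> j \<and> \<rho> j < \<rho> i} = \<rho> i - p"
    using tk J t_def by (subst t_def[symmetric], subst J, subst card_rank) auto
  note seg = segment_split[of "Suc p" "Suc t"]
  have xs: "xs = take p xs @ [i] @ ?W @ drop (Suc t) xs"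
    using seg(1) tp tk p len by (simp add: i_def take_Suc_conv_app_nth)
  have dW: "distinct ?W" "i \<notin> set ?W"
    using subst[OF xs, where P = distinct, OF dist] by auto
  have WA: "set ?W \<subseteq> A" using set_xs by (auto dest: in_set_dropD in_set_takeD)
  have cW: "card (set ?W) = t - p" using dW(1) seg(2) tp tk by (simp add: distinct_card)
  have rk: "\<rho> x \<noteq> t" if "x \<in> set ?W" for x
    using rank that WA dW(2) nth_in[OF p(1)] unfolding bij_betw_def inj_on_def t_def i_def by blast
  have sub: "set ?W - ?J \<subseteq> {x \<in> set (drop p xs). \<rho> x < p} \<union> {x \<in> set (take (Suc t) xs). Suc t \<le> \<rho> x}"
  proof
    fix x assume x: "x \<in> set ?W - ?J"
    then have "\<rho> x < p \<or> Suc t \<le> \<rho> x" using rk[of x] WA by fastforce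
    moreover have "x \<in> set (drop p xs)" "x \<in> set (take (Suc t) xs)"
      using x seg(3,4) tp tk set_drop_subset_set_drop[of p "Suc p" xs] by auto
    ultimately show "x \<in> {x \<in> set (drop p xs). \<rho> x < p} \<union> {x \<in> set (take (Suc t) xs). Suc t \<le> \<rho> x}" by auto
  qed
  have "card (set ?W - ?J) \<le> card {x \<in> set (drop p xs). \<rho> x < p} + card {x \<in> set (take (Suc t) xs). Suc t \<le> \<rho> x}"
    by (rule order_trans[OF card_mono[OF _ sub] card_Un_le]) auto
  also have "\<dots> \<le> R + R"
    using R[of p] R[of "Suc t"] crossing_left[of "Suc t"] tp tk by (simp add: crossing_def)
  finally have c2: "card (set ?W - ?J) \<le> 2 * R" by simp
  have "(\<Sum>j\<in>?J. q i j) \<le> 2 * int (2 * R)"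
  proof (rule sum_exchange_bound[OF _ _ _ c2])
    show "card (set ?W) = card ?J" using cW cJ by (simp add: t_def)
    show "(\<Sum>j\<in>set ?W. q i j) \<le> 0" by (rule move_right[OF xs])
    show "\<bar>q i x\<bar> \<le> 1" if "x \<in> set ?W \<union> ?J" for x
      using that WA dW(2) nth_in[OF p(1)] by (intro q_abs) (auto simp: i_def t_def)
  qed (use fin in auto)
  then show "(\<Sum>j \<in> {j \<in> A. p \<le> \<rho> j \<and> \<rho> j < \<rho> i}. q i j) \<le> 4 * int R"
    by (simp add: t_def)
qed

text \<open>If nothing is displaced by more than \<open>d\<close>, sorting by the cut \<open>c\<close> only affects the positions
  within \<open>d\<close> of \<open>c\<close>, so that few items determine the set of inverted pairs.\<close>

lemma cut_inversions:
  assumes d: "\<And>p. p < k \<Longrightarrow> \<rho> (xs ! p) \<le> p + d \<and> p \<le> \<rho> (xs ! p) + d" and "c \<le> k"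
  obtains w where "distinct w" "set w \<subseteq> A" "length w \<le> 2 * d"
    "(\<Sum>(u, v) \<in> inversions (\<lambda>x. \<rho> x < c) w. q v u) \<le> 0"
    "crossing c ^ 2 \<le> card (inversions (\<lambda>x. \<rho> x < c) w)"
proof -
  let ?P = "\<lambda>x. \<rho> x < c"
  define a b where "a = c - d" and "b = min k (c + d)"
  define w where "w = drop a (take b xs)"
  have ab: "a \<le> b" "b \<le> k" using assms(2) by (auto simp: a_def b_def)
  note seg = segment_split[OF ab, folded w_def]
  have low: "\<forall>x\<in>set (take a xs). ?P x"
  proof
    fix x assume "x \<in> set (take a xs)"
    then obtain p where "p < a" "x = xs ! p" using len ab by (auto simp: in_set_conv_nth)
    with d[of p] ab show "?P x" by (auto simp: a_def)
  qed
  have high: "\<forall>x\<in>set (drop b xs). \<not> ?P x"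
  proof
    fix x assume "x \<in> set (drop b xs)"
    then obtain p where "p < k - b" "x = xs ! (b + p)" using len ab by (auto simp: in_set_conv_nth)
    moreover from this have "b = c + d" by (auto simp: b_def min_def)
    ultimately show "\<not> ?P x" using d[of "b + p"] by fastforce
  qed
  have inv: "inversions ?P xs = inversions ?P w"
  proof -
    have "inversions ?P xs = inversions ?P (w @ drop b xs)"
      using inversions_append_low[OF low, of "w @ drop b xs"] seg(1) by simp
    with inversions_append_high[OF high, of w] show ?thesis by simp
  qed
  have "crossing c * crossing c = card ({u \<in> set (drop c xs). ?P u} \<times> {v \<in> set (take c xs). \<not> ?P v})"
    using crossing_left[OF assms(2)] by (simp add: card_cartesian_product crossing_def not_less)
  also have "\<dots> \<le> card (inversions ?P xs)"
    using inversions_product[of "drop c xs" ?P "take c xs"] by (intro card_mono finite_inversions) simp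
  finally have card: "crossing c ^ 2 \<le> card (inversions ?P w)" by (simp add: inv power2_eq_square)
  have "distinct (filter ?P xs @ filter (\<lambda>x. \<not> ?P x) xs)"
    "set (filter ?P xs @ filter (\<lambda>x. \<not> ?P x) xs) = A" using dist set_xs by auto
  then have "lscore q (filter ?P xs @ filter (\<lambda>x. \<not> ?P x) xs) \<le> lscore q xs"
    using opt unfolding opt_list_def by blast
  with lscore_partition[OF legal, of xs ?P] set_xs dist inv
  have "(\<Sum>(u, v) \<in> inversions ?P w. q v u) \<le> 0" by simp
  moreover have "distinct w" "set w \<subseteq> A"
    using dist set_xs by (auto simp: w_def dest: in_set_dropD in_set_takeD)
  moreover have "length w \<le> 2 * d" using seg(2) by (simp add: a_def b_def min_def split: if_splits)
  ultimately show thesis using card that by blast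
qed

end

text \<open>If \<open>d\<close> exceeds the first term, then \<open>b \<le> d\<close> and
  \<open>d \<gamma> \<le> 8 R\<close>. So \<open>R^2 \<gamma>^2 \<le> 6 d l\<close>, hence
  \<open>d^2 \<gamma>^4 \<le> 64 * 6 * d l\<close>, which is the constant 384.\<close>

lemma displacement_numeric:
  fixes d R b l \<gamma> :: real
  assumes "0 < \<gamma>" "\<gamma> < 1/2" "l \<ge> 1/2" "b > 0" "d \<ge> 0" "R \<ge> 0"
    "d \<le> 2 * b * l / \<gamma>\<^sup>2 \<or> d \<le> 8 * R / \<gamma>" "R = 0 \<or> R\<^sup>2 * \<gamma>\<^sup>2 / 2 < (2 * d + b) * l"
  shows "d \<le> max (2 * b * l / \<gamma>\<^sup>2) (384 * l / \<gamma> ^ 4)"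
proof (cases "d \<le> 2 * b * l / \<gamma>\<^sup>2")
  case False
  then have dR: "d \<le> 8 * R / \<gamma>" and d: "d > 2 * b * l / \<gamma>\<^sup>2" using assms(7) by auto
  have "0 \<le> 2 * b * l / \<gamma>\<^sup>2" using assms(3,4) by simp
  then have dpos: "d > 0" using d by linarith
  have "R \<noteq> 0" using dR dpos by auto
  then have R2: "R\<^sup>2 * \<gamma>\<^sup>2 < 2 * (2 * d + b) * l" using assms(8) by (simp add: algebra_simps)
  have "b \<le> 2 * b * l / \<gamma>\<^sup>2"
  proof -
    have "\<gamma>\<^sup>2 \<le> 1" using assms(1,2) by (simp add: power_le_one)
    have "b * \<gamma>\<^sup>2 \<le> b * 1" using \<open>\<gamma>\<^sup>2 \<le> 1\<close> assms(4) by (intro mult_left_mono) auto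
    also have "\<dots> \<le> b * (2 * l)" using assms(3,4) by (intro mult_left_mono) auto
    finally show ?thesis using assms(1) by (simp add: field_simps)
  qed
  then have bd: "b \<le> d" using d by simp
  have "d * \<gamma> \<le> 8 * R" using dR assms(1) by (simp add: field_simps)
  then have "(d * \<gamma>)\<^sup>2 \<le> (8 * R)\<^sup>2" using assms(1,5) by (intro power_mono) auto
  then have "(d * \<gamma>)\<^sup>2 * \<gamma>\<^sup>2 \<le> 64 * (R\<^sup>2 * \<gamma>\<^sup>2)"
    using mult_right_mono[of "(d * \<gamma>)\<^sup>2" "(8 * R)\<^sup>2" "\<gamma>\<^sup>2"] by (simp add: power_mult_distrib)
  also have "\<dots> \<le> 64 * (2 * (2 * d + b) * l)" using R2 by simp
  also have "\<dots> \<le> 64 * (2 * (2 * d + d) * l)" using bd assms(3) by (intro mult_left_mono mult_right_mono) auto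
  finally have "d * (d * \<gamma> ^ 4) \<le> d * (384 * l)"
    by (simp add: power2_eq_square power4_eq_xxxx algebra_simps)
  then have "d * \<gamma> ^ 4 \<le> 384 * l" using dpos by simp
  then have "d \<le> 384 * l / \<gamma> ^ 4" using assms(1) by (simp add: field_simps)
  then show ?thesis by simp
qed simp

text \<open>Take an item of maximal displacement \<open>d\<close> and a cut of maximal crossing
  \<open>R\<close>. If \<open>d\<close> exceeds the first term of the maximum, the comparisons of
  the item with those ranked between its true and its actual position sum to more than
  \<open>\<gamma> d / 2\<close> by \<open>up\<close> or \<open>down\<close>, but to at most
  \<open>4 R\<close> by optimality. At the cut, \<open>R^2\<close> inversions in a list of at most
  \<open>2 d\<close> items have a sum of at most 0, which \<open>cut\<close> excludes once
  \<open>\<gamma>^2 R^2 / 2\<close> reaches \<open>(2 d + b) l\<close>. The hypothesis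
  \<open>cut\<close> charges \<open>l\<close>, which stands for \<open>ln n\<close>, per list entry
  because it has to survive a union bound over all lists of the same length.\<close>

theorem (in ordered_items) displacement:
  fixes \<gamma> b l :: real
  assumes par: "0 < \<gamma>" "\<gamma> < 1/2" "l \<ge> 1/2" "b > 0"
    and up: "\<And>i c. i \<in> A \<Longrightarrow> 2 * b * l / \<gamma>\<^sup>2 \<le> card {j \<in> A. \<rho> i < \<rho> j \<and> \<rho> j \<le> c} \<Longrightarrow> c < k \<Longrightarrow>
      real_of_int (\<Sum>j \<in> {j \<in> A. \<rho> i < \<rho> j \<and> \<rho> j \<le> c}. q j i)
        > \<gamma> / 2 * card {j \<in> A. \<rho> i < \<rho> j \<and> \<rho> j \<le> c}"
    and down: "\<And>i c. i \<in> A \<Longrightarrow> 2 * b * l / \<gamma>\<^sup>2 \<le> card {j \<in> A. c \<le> \<rho> j \<and> \<rho> j < \<rho> i} \<Longrightarrow> c < k \<Longrightarrow>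
      real_of_int (\<Sum>j \<in> {j \<in> A. c \<le> \<rho> j \<and> \<rho> j < \<rho> i}. q i j)
        > \<gamma> / 2 * card {j \<in> A. c \<le> \<rho> j \<and> \<rho> j < \<rho> i}"
    and cut: "\<And>w c. distinct w \<Longrightarrow> set w \<subseteq> A \<Longrightarrow> c \<le> k \<Longrightarrow>
      (real (length w) + b) * l \<le> \<gamma>\<^sup>2 / 2 * card (inversions (\<lambda>x. \<rho> x < c) w) \<Longrightarrow>
      real_of_int (\<Sum>(u, v) \<in> inversions (\<lambda>x. \<rho> x < c) w. q v u)
        > \<gamma> / 2 * card (inversions (\<lambda>x. \<rho> x < c) w)"
    and p: "p < k"
  shows "\<bar>real (\<rho> (xs ! p)) - real p\<bar> \<le> max (2 * b * l / \<gamma>\<^sup>2) (384 * l / \<gamma> ^ 4)"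
proof -
  let ?f = "\<lambda>p. nat \<bar>int (\<rho> (xs ! p)) - int p\<bar>"
  define d where "d = Max (?f ` {..<k})"
  define R where "R = Max (crossing ` {..k})"
  have R: "crossing c \<le> R" if "c \<le> k" for c using that by (auto simp: R_def intro: Max_ge)
  have dmax: "?f p' \<le> d" if "p' < k" for p' using that by (auto simp: d_def intro: Max_ge)
  have "d \<in> ?f ` {..<k}" unfolding d_def using p by (intro Max_in) auto
  then obtain p0 where p0: "p0 < k" "d = ?f p0" by blast
  have "R \<in> crossing ` {..k}" unfolding R_def by (intro Max_in) auto
  then obtain c0 where c0: "c0 \<le> k" "R = crossing c0" by blast
  have h1: "real d \<le> 2 * b * l / \<gamma>\<^sup>2 \<or> real d \<le> 8 * real R / \<gamma>"
  proof (rule ccontr)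
    assume "\<not> ?thesis"
    then have big: "2 * b * l / \<gamma>\<^sup>2 \<le> real d" "8 * real R / \<gamma> < real d" by auto
    have "0 \<le> 8 * real R / \<gamma>" using par by simp
    then have "d > 0" using big(2) by linarith
    then consider "\<rho> (xs ! p0) < p0" "d = p0 - \<rho> (xs ! p0)" | "p0 < \<rho> (xs ! p0)" "d = \<rho> (xs ! p0) - p0"
      using p0(2) by linarith
    then have "\<gamma> / 2 * d < 4 * R"
    proof cases
      case 1
      let ?s = "\<Sum>j \<in> {j \<in> A. \<rho> (xs ! p0) < \<rho> j \<and> \<rho> j \<le> p0}. q j (xs ! p0)"
      have "real_of_int ?s > \<gamma> / 2 * d"
        using up[OF nth_in[OF p0(1)], of p0] displaced_right(2)[OF R p0(1) 1(1)] big(1) 1(2) p0(1)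
        by (simp del: of_int_sum)
      moreover have "real_of_int ?s \<le> real_of_int (4 * int R)"
        using displaced_right(1)[OF R p0(1) 1(1)] by (simp only: of_int_le_iff)
      ultimately show ?thesis by simp
    next
      case 2
      let ?s = "\<Sum>j \<in> {j \<in> A. p0 \<le> \<rho> j \<and> \<rho> j < \<rho> (xs ! p0)}. q (xs ! p0) j"
      have "real_of_int ?s > \<gamma> / 2 * d"
        using down[OF nth_in[OF p0(1)], of p0] displaced_left(2)[OF R p0(1) 2(1)] big(1) 2(2) p0(1)
        by (simp del: of_int_sum)
      moreover have "real_of_int ?s \<le> real_of_int (4 * int R)"
        using displaced_left(1)[OF R p0(1) 2(1)] by (simp only: of_int_le_iff)
      ultimately show ?thesis by simp
    qed
  then show False using big(2) par by (simp add: field_simps)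
  qed
  have h2: "real R = 0 \<or> (real R)\<^sup>2 * \<gamma>\<^sup>2 / 2 < (2 * real d + b) * l"
  proof (rule ccontr)
    assume "\<not> ?thesis"
    then have neg: "(2 * real d + b) * l \<le> (real R)\<^sup>2 * \<gamma>\<^sup>2 / 2" by auto
    have "\<rho> (xs ! p') \<le> p' + d \<and> p' \<le> \<rho> (xs ! p') + d" if "p' < k" for p'
      using dmax[OF that] by linarith
    from cut_inversions[OF this c0(1)] obtain w where w: "distinct w" "set w \<subseteq> A" "length w \<le> 2 * d"
      "(\<Sum>(u, v) \<in> inversions (\<lambda>x. \<rho> x < c0) w. q v u) \<le> 0"
      "crossing c0 ^ 2 \<le> card (inversions (\<lambda>x. \<rho> x < c0) w)" by blast
    have "(real (length w) + b) * l \<le> (2 * real d + b) * l"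
      using w(3) par by (intro mult_right_mono) auto
    also have "\<dots> \<le> \<gamma>\<^sup>2 / 2 * (real R)\<^sup>2" using neg by (simp add: mult.commute)
    also have "\<dots> \<le> \<gamma>\<^sup>2 / 2 * card (inversions (\<lambda>x. \<rho> x < c0) w)"
      using w(5) c0(2) by (intro mult_left_mono) (auto simp flip: of_nat_power)
    finally have "real_of_int (\<Sum>(u, v) \<in> inversions (\<lambda>x. \<rho> x < c0) w. q v u)
        > \<gamma> / 2 * card (inversions (\<lambda>x. \<rho> x < c0) w)" by (rule cut[OF w(1,2) c0(1)])
    moreover have "\<gamma> / 2 * card (inversions (\<lambda>x. \<rho> x < c0) w) \<ge> 0" using par by simp
    ultimately have "real_of_int (\<Sum>(u, v) \<in> inversions (\<lambda>x. \<rho> x < c0) w. q v u) > 0" by linarith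
    with w(4) show False by linarith
  qed
  have "\<bar>real (\<rho> (xs ! p)) - real p\<bar> \<le> real d" using dmax[OF p] by linarith
  also have "\<dots> \<le> max (2 * b * l / \<gamma>\<^sup>2) (384 * l / \<gamma> ^ 4)"
    by (rule displacement_numeric[OF par _ _ h1 h2]) auto
  finally show ?thesis .
qed

section \<open>Noisy binary search\<close>

definition median :: "nat \<Rightarrow> (nat \<Rightarrow> nat) \<Rightarrow> nat" where
  "median B \<mu> = (LEAST r. (\<Sum>p\<le>B. \<mu> p) \<le> 2 * (\<Sum>p\<le>r. \<mu> p))"

text \<open>An answer at \<open>b\<close> is never held against candidates within distance 1 of \<open>b\<close>, because tests close
  to the true position are unreliable.\<close>

definition supports :: "bool \<Rightarrow> nat \<Rightarrow> nat \<Rightarrow> bool" where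
  "supports a b p \<longleftrightarrow> (if a then b \<le> p + 1 else p \<le> b + 1)"

text \<open>Doubling the supported candidates, rather than halving the refuted ones, keeps the
  weights integral and needs only addition.\<close>

definition reweigh :: "bool \<Rightarrow> nat \<Rightarrow> (nat \<Rightarrow> nat) \<Rightarrow> nat \<Rightarrow> nat" where
  "reweigh a b \<mu> p = (if supports a b p then 2 * \<mu> p else \<mu> p)"

text \<open>Despite the tolerance of 1, a test at \<open>r - 2\<close> that points downwards
  supports nothing in \<open>{r..}\<close>, and one at \<open>r + 2\<close> that points upwards
  supports nothing in \<open>{..r}\<close>; in both cases half of the weight falls behind. If
  neither happens, the target is close to the median. The condition \<open>r + 2 < B\<close> keeps
  the tests inside full blocks.\<close>

definition search_step :: "nat \<Rightarrow> bool \<times> bool \<Rightarrow> (nat \<Rightarrow> nat) \<Rightarrow> nat \<Rightarrow> nat" where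
  "search_step B a \<mu> = (let r = median B \<mu>; \<mu>' = if 2 \<le> r then reweigh (fst a) (r - 2) \<mu> else \<mu> in
     if r + 2 < B then reweigh (snd a) (r + 2) \<mu>' else \<mu>')"

fun weights :: "nat \<Rightarrow> (nat \<Rightarrow> bool \<times> bool) \<Rightarrow> nat \<Rightarrow> nat \<Rightarrow> nat" where
  "weights B \<omega> 0 = (\<lambda>_. 1)"
| "weights B \<omega> (Suc t) = search_step B (\<omega> t) (weights B \<omega> t)"

abbreviation pivot :: "nat \<Rightarrow> (nat \<Rightarrow> bool \<times> bool) \<Rightarrow> nat \<Rightarrow> nat" where
  "pivot B \<omega> t \<equiv> median B (weights B \<omega> t)"

text \<open>The negation of \<open>supports a b X\<close>: only answers about blocks at distance at
  least 2 from the target can be wrong.\<close>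

definition wrong :: "nat \<Rightarrow> nat \<Rightarrow> bool \<Rightarrow> bool" where
  "wrong X b a \<longleftrightarrow> (if a then X + 2 \<le> b else b + 2 \<le> X)"

text \<open>The test of step \<open>t\<close> below (\<open>True\<close>) or above (\<open>False\<close>) the pivot, where it is performed.\<close>

definition test_at :: "nat \<Rightarrow> (nat \<Rightarrow> bool \<times> bool) \<Rightarrow> nat \<times> bool \<Rightarrow> nat \<Rightarrow> bool" where
  "test_at B \<omega> z b \<longleftrightarrow> (if snd z then 2 \<le> pivot B \<omega> (fst z) \<and> b = pivot B \<omega> (fst z) - 2
     else pivot B \<omega> (fst z) + 2 < B \<and> b = pivot B \<omega> (fst z) + 2)"

definition answer :: "(nat \<Rightarrow> bool \<times> bool) \<Rightarrow> nat \<times> bool \<Rightarrow> bool" where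
  "answer \<omega> z = (if snd z then fst (\<omega> (fst z)) else snd (\<omega> (fst z)))"

definition lies :: "nat \<Rightarrow> (nat \<Rightarrow> bool \<times> bool) \<Rightarrow> nat \<Rightarrow> nat \<Rightarrow> (nat \<times> bool) set" where
  "lies B \<omega> X T = {z. fst z < T \<and> (\<exists>b. test_at B \<omega> z b \<and> wrong X b (answer \<omega> z))}"

lemma weights_pos: "weights B \<omega> t p > 0"
  by (induction t arbitrary: p) (auto simp: search_step_def reweigh_def Let_def)

lemma weights_cong: "(\<And>s. s < t \<Longrightarrow> \<omega> s = \<omega>' s) \<Longrightarrow> weights B \<omega> t = weights B \<omega>' t"
  by (induction t) auto

lemma median_props:
  assumes "\<mu> 0 > 0"
  shows "median B \<mu> \<le> B" "(\<Sum>p\<le>B. \<mu> p) \<le> 2 * (\<Sum>p\<le>median B \<mu>. \<mu> p)"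
    "2 * (\<Sum>p<median B \<mu>. \<mu> p) < (\<Sum>p\<le>B. \<mu> p)"
proof -
  let ?P = "\<lambda>r. (\<Sum>p\<le>B. \<mu> p) \<le> 2 * (\<Sum>p\<le>r. \<mu> p)"
  have "?P B" by simp
  then show "median B \<mu> \<le> B" "?P (median B \<mu>)"
    unfolding median_def by (rule Least_le, rule LeastI)
  have "(\<Sum>p\<le>B. \<mu> p) > 0" using assms by (meson finite_atMost atMost_iff le0 less_le_trans member_le_sum zero_le)
  moreover have "\<not> ?P r" if "median B \<mu> = Suc r" for r
    using not_less_Least[of r ?P] that by (simp add: median_def)
  ultimately show "2 * (\<Sum>p<median B \<mu>. \<mu> p) < (\<Sum>p\<le>B. \<mu> p)"
    by (cases "median B \<mu>") (auto simp: lessThan_Suc_atMost)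
qed

text \<open>At least half of the weight grows by at most half of the factor:
  \<open>1/2 + 1/2 * 1/2 = 3/4\<close>.\<close>

lemma weighted_sum_drop:
  fixes g \<mu> :: "nat \<Rightarrow> real"
  assumes "finite A" "S \<subseteq> A" "\<And>p. p \<in> A \<Longrightarrow> 0 \<le> \<mu> p" "\<And>p. p \<in> A \<Longrightarrow> g p \<le> f"
    "\<And>p. p \<in> S \<Longrightarrow> g p \<le> f / 2" "sum \<mu> A \<le> 2 * sum \<mu> S" "f \<ge> 0"
  shows "(\<Sum>p\<in>A. g p * \<mu> p) \<le> 3 / 4 * f * sum \<mu> A"
proof -
  have "(\<Sum>p\<in>A. g p * \<mu> p) = (\<Sum>p\<in>A - S. g p * \<mu> p) + (\<Sum>p\<in>S. g p * \<mu> p)"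
    by (rule sum.subset_diff[OF assms(2,1)])
  also have "\<dots> \<le> (\<Sum>p\<in>A - S. f * \<mu> p) + (\<Sum>p\<in>S. f / 2 * \<mu> p)"
    using assms(2-5) by (intro add_mono sum_mono mult_right_mono) auto
  also have "\<dots> = f * (sum \<mu> (A - S) + sum \<mu> S) - f / 2 * sum \<mu> S"
    by (simp add: sum_distrib_left[symmetric] algebra_simps flip: sum_divide_distrib)
  also have "sum \<mu> (A - S) + sum \<mu> S = sum \<mu> A"
    using sum.subset_diff[OF assms(2,1), of \<mu>] by simp
  also have "f * sum \<mu> A - f / 2 * sum \<mu> S \<le> f * sum \<mu> A - f / 2 * (sum \<mu> A / 2)"
    using assms(6,7) by (intro diff_left_mono mult_left_mono) auto
  finally show ?thesis by (simp add: algebra_simps)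
qed

text \<open>The radius 6 is 3 + 3: when both tests point to the median, the target is within 3 of
  it, and the candidates more than 3 away from the median are left unsupported by one of the
  tests.\<close>

definition far :: "nat \<Rightarrow> nat \<Rightarrow> nat set" where
  "far B X = {p. p \<le> B \<and> (p + 6 < X \<or> X + 6 < p)}"

text \<open>Neither relative weight alone is sure to shrink in a given step, but their product is.
  Once it is below 1, the far weight is smaller than that of the target, which
  \<open>search_correct\<close> exploits.\<close>

definition potential :: "nat \<Rightarrow> nat \<Rightarrow> (nat \<Rightarrow> nat) \<Rightarrow> real" where
  "potential B X \<mu> = real (\<Sum>p\<le>B. \<mu> p) * real (\<Sum>p\<in>far B X. \<mu> p) / (real (\<mu> X))\<^sup>2"

lemma finite_far: "finite (far B X)" and far_subset: "far B X \<subseteq> {..B}"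
  by (auto simp: far_def)

text \<open>A truthful step either shrinks the total weight, relative to that of \<open>X\<close>, by a factor \<open>3/4\<close>, or
  halves the relative weight far from \<open>X\<close>; neither quantity ever grows in such a step.\<close>

lemma potential_step:
  assumes X: "X \<le> B" and pos: "\<And>p. \<mu> p > 0"
  defines "r \<equiv> median B \<mu>"
  shows "potential B X (search_step B a \<mu>) \<le> 16 * potential B X \<mu>"
    and "\<lbrakk>2 \<le> r \<Longrightarrow> \<not> wrong X (r - 2) (fst a); r + 2 < B \<Longrightarrow> \<not> wrong X (r + 2) (snd a)\<rbrakk> \<Longrightarrow>
      potential B X (search_step B a \<mu>) \<le> 3 / 4 * potential B X \<mu>"
proof -
  define g :: "nat \<Rightarrow> nat" where "g p = (if 2 \<le> r \<and> supports (fst a) (r - 2) p then 2 else 1) *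
     (if r + 2 < B \<and> supports (snd a) (r + 2) p then 2 else 1)" for p
  define f :: nat where "f = (if 2 \<le> r then 2 else 1) * (if r + 2 < B then 2 else 1)"
  define W where "W = real (\<Sum>p\<le>B. \<mu> p)"
  define F where "F = real (\<Sum>p\<in>far B X. \<mu> p)"
  define W' where "W' = (\<Sum>p\<le>B. real (g p) * real (\<mu> p))"
  define F' where "F' = (\<Sum>p\<in>far B X. real (g p) * real (\<mu> p))"
  have st: "search_step B a \<mu> p = g p * \<mu> p" for p
    by (auto simp: search_step_def reweigh_def g_def Let_def r_def)
  have pot': "potential B X (search_step B a \<mu>) = W' * F' / (real (g X) * real (\<mu> X))\<^sup>2"
    by (simp add: potential_def st W'_def F'_def)
  have pot: "potential B X \<mu> = W * F / (real (\<mu> X))\<^sup>2"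
    by (simp add: potential_def W_def F_def)
  have gf: "g p \<le> f" "1 \<le> g p" "f \<le> 4" "f \<ge> 1" for p by (auto simp: g_def f_def)
  have nn: "W \<ge> 0" "F \<ge> 0" "W' \<ge> 0" "F' \<ge> 0" by (auto simp: W_def F_def W'_def F'_def intro: sum_nonneg)
  have \<mu>X: "real (\<mu> X) > 0" using pos by simp
  have W'f: "W' \<le> f * W"
    unfolding W'_def W_def of_nat_sum sum_distrib_left using gf by (intro sum_mono mult_right_mono) auto
  have F'f: "F' \<le> f * F"
    unfolding F'_def F_def of_nat_sum sum_distrib_left using gf by (intro sum_mono mult_right_mono) auto
  have "W' * F' \<le> (f * W) * (f * F)" using W'f F'f nn by (intro mult_mono) auto
  also have "\<dots> = real f * real f * (W * F)" by simp
  also have "\<dots> \<le> 4 * 4 * (W * F)" using gf(3) nn by (intro mult_right_mono mult_mono) auto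
  finally have "W' * F' \<le> 16 * (W * F)" by simp
  moreover have "(real (\<mu> X))\<^sup>2 \<le> (real (g X) * real (\<mu> X))\<^sup>2"
    using gf(2)[of X] \<mu>X by (intro power_mono) (simp_all add: Suc_le_eq)
  ultimately have "W' * F' / (real (g X) * real (\<mu> X))\<^sup>2 \<le> 16 * (W * F) / (real (\<mu> X))\<^sup>2"
    using nn \<mu>X by (intro frac_le) auto
  then show "potential B X (search_step B a \<mu>) \<le> 16 * potential B X \<mu>"
    by (simp add: pot pot')
  assume ok: "2 \<le> r \<Longrightarrow> \<not> wrong X (r - 2) (fst a)" "r + 2 < B \<Longrightarrow> \<not> wrong X (r + 2) (snd a)"
  have "2 \<le> r \<Longrightarrow> supports (fst a) (r - 2) X" "r + 2 < B \<Longrightarrow> supports (snd a) (r + 2) X"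
    using ok by (simp_all add: wrong_def supports_def split: if_splits)
  then have gX: "g X = f" by (auto simp: g_def f_def)
  note med = median_props[of \<mu> B, OF pos, folded r_def]
  have key: "W' * F' \<le> 3 / 4 * (real f)\<^sup>2 * (W * F)"
  proof -
    have shrink: "W' \<le> 3 / 4 * real f * W" if "S \<subseteq> {..B}" "\<And>p. p \<in> S \<Longrightarrow> 2 * g p \<le> f"
      "(\<Sum>p\<le>B. \<mu> p) \<le> 2 * sum \<mu> S" for S
      unfolding W'_def W_def of_nat_sum
    proof (rule weighted_sum_drop[OF _ that(1)])
      show "real (g p) \<le> real f / 2" if "p \<in> S" for p
        using \<open>\<And>p. p \<in> S \<Longrightarrow> 2 * g p \<le> f\<close>[OF that] by linarith
      show "(\<Sum>p\<le>B. real (\<mu> p)) \<le> 2 * (\<Sum>p\<in>S. real (\<mu> p))"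
        using that(3) by (simp flip: of_nat_sum)
    qed (use gf in auto)
    have fin: "W' * F' \<le> 3 / 4 * (real f)\<^sup>2 * (W * F)" if "W' \<le> 3 / 4 * real f * W"
    proof -
      have "W' * F' \<le> (3 / 4 * real f * W) * (real f * F)"
        using that F'f nn by (intro mult_mono) auto
      then show ?thesis by (simp add: power2_eq_square algebra_simps)
    qed
    consider (1) "2 \<le> r" "\<not> fst a" | (2) "r + 2 < B" "snd a"
      | (3) "2 \<le> r \<longrightarrow> fst a" "r + 2 < B \<longrightarrow> \<not> snd a" by blast
    then show ?thesis
    proof cases
      case 1
      have "(\<Sum>p\<le>B. \<mu> p) = (\<Sum>p<r. \<mu> p) + (\<Sum>p\<in>{r..B}. \<mu> p)"
        using med(1) by (subst sum.union_disjoint[symmetric]) (auto intro!: sum.cong)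
      with med(3) have "(\<Sum>p\<le>B. \<mu> p) \<le> 2 * (\<Sum>p\<in>{r..B}. \<mu> p)" by linarith
      with 1 show ?thesis by (intro fin shrink[of "{r..B}"]) (auto simp: g_def f_def supports_def)
    next
      case 2
      with med show ?thesis by (intro fin shrink[of "{..r}"]) (auto simp: g_def f_def supports_def)
    next
      case 3
      \<comment> \<open>Both tests point towards the median and are truthful, so they trap the
        target around it. Where a test is missing, the border of the range has the same
        effect.\<close>
      have Xr: "r \<le> X + 3" "X \<le> r + 3"
        using ok 3 X by (simp_all add: wrong_def) linarith+
      have "real (g p) \<le> real f / 2" if "p \<in> far B X" for p
        using that 3 Xr by (auto simp: far_def g_def f_def supports_def)
      then have "F' \<le> (\<Sum>p\<in>far B X. real f / 2 * real (\<mu> p))"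
        unfolding F'_def by (intro sum_mono mult_right_mono) auto
      also have "\<dots> = real f / 2 * F" by (simp add: F_def sum_distrib_left)
      finally have "W' * F' \<le> (real f * W) * (real f / 2 * F)"
        using W'f nn by (intro mult_mono) auto
      also have "\<dots> = 1 / 2 * ((real f)\<^sup>2 * (W * F))" by (simp add: power2_eq_square)
      also have "\<dots> \<le> 3 / 4 * ((real f)\<^sup>2 * (W * F))" using nn by (intro mult_right_mono) auto
      finally show ?thesis by simp
    qed
  qed
  have "W' * F' / (real (g X) * real (\<mu> X))\<^sup>2 \<le> 3 / 4 * (real f)\<^sup>2 * (W * F) / (real f * real (\<mu> X))\<^sup>2"
    unfolding gX by (rule divide_right_mono[OF key]) simp
  also have "\<dots> = 3 / 4 * (W * F / (real (\<mu> X))\<^sup>2)"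
    using gf(4) \<mu>X by (simp add: power_mult_distrib field_simps)
  finally show "potential B X (search_step B a \<mu>) \<le> 3 / 4 * potential B X \<mu>"
    by (simp add: pot pot')
qed

text \<open>All weights start at 1, so the potential starts at most at \<open>(B + 1)^2\<close>. A
  step with a lie may multiply both weights by 4 without any gain of the target, hence 16.
  \<open>L\<close> counts steps and not lies, since both tests of a step can be wrong.\<close>

lemma potential_bound:
  fixes B X T t :: nat and \<omega> :: "nat \<Rightarrow> bool \<times> bool"
  assumes "X \<le> B"
  defines "L \<equiv> \<lambda>t. card {s. s < t \<and> s \<in> fst ` lies B \<omega> X T}"
  assumes "t \<le> T"
  shows "potential B X (weights B \<omega> t) \<le> (real B + 1)\<^sup>2 * 16 ^ L t * (3 / 4) ^ (t - L t)"
  using assms(3)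
proof (induction t)
  case 0
  have "real (card (far B X)) \<le> real B + 1"
    using card_mono[OF _ far_subset[of B X]] by simp
  then have "(real B + 1) * real (card (far B X)) \<le> (real B + 1) * (real B + 1)"
    by (intro mult_left_mono) auto
  then show ?case by (simp add: potential_def L_def power2_eq_square add.commute)
next
  case (Suc t)
  let ?\<Phi> = "potential B X (weights B \<omega> t)"
  have Lt: "L t \<le> t"
    unfolding L_def using card_mono[of "{..<t}" "{s. s < t \<and> s \<in> fst ` lies B \<omega> X T}"] by auto
  have IH: "?\<Phi> \<le> (real B + 1)\<^sup>2 * 16 ^ L t * (3 / 4) ^ (t - L t)" using Suc by simp
  note st = potential_step[of X B "weights B \<omega> t" "\<omega> t", OF assms(1) weights_pos]
  show ?case
  proof (cases "t \<in> fst ` lies B \<omega> X T")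
    case True
    then have "{s. s < Suc t \<and> s \<in> fst ` lies B \<omega> X T} = insert t {s. s < t \<and> s \<in> fst ` lies B \<omega> X T}"
      by auto
    then have "L (Suc t) = Suc (L t)" by (simp add: L_def)
    with st(1) IH show ?thesis by simp
  next
    case False
    then have "{s. s < Suc t \<and> s \<in> fst ` lies B \<omega> X T} = {s. s < t \<and> s \<in> fst ` lies B \<omega> X T}"
      using less_Suc_eq by auto
    then have L: "L (Suc t) = L t" by (simp add: L_def)
    have "(t, True) \<notin> lies B \<omega> X T" "(t, False) \<notin> lies B \<omega> X T"
      using False by force+
    then have "potential B X (search_step B (\<omega> t) (weights B \<omega> t)) \<le> 3 / 4 * ?\<Phi>"
      using Suc.prems by (intro st(2)) (auto simp: lies_def test_at_def answer_def)
    with IH L Lt show ?thesis by (simp add: Suc_diff_le)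
  qed
qed

text \<open>With at most \<open>e\<close> lying steps among \<open>32 e\<close>, the potential ends
  at no more than \<open>(B + 1)^2 (16 (3/4)^31)^e\<close>, and \<open>16 (3/4)^31 < 1/256\<close>;
  this is the origin of the 32. A potential below 1 makes the far weight smaller than that of the
  target, hence less than half of the total, so the median cannot be far.\<close>

theorem search_correct:
  assumes "X \<le> B" "(real B + 1)\<^sup>2 < 256 ^ e" "card (lies B \<omega> X (32 * e)) < e"
  shows "pivot B \<omega> (32 * e) \<le> X + 6 \<and> X \<le> pivot B \<omega> (32 * e) + 6"
proof (rule ccontr)
  assume neg: "\<not> ?thesis"
  define L where "L = card {s. s < 32 * e \<and> s \<in> fst ` lies B \<omega> X (32 * e)}"
  define \<mu> where "\<mu> = weights B \<omega> (32 * e)"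
  let ?W = "\<Sum>p\<le>B. \<mu> p" and ?F = "\<Sum>p\<in>far B X. \<mu> p"
  have pos: "\<mu> p > 0" for p by (simp add: \<mu>_def weights_pos)
  have fl: "finite (lies B \<omega> X (32 * e))"
    by (rule finite_subset[of _ "{..<32 * e} \<times> UNIV"]) (auto simp: lies_def)
  have "L \<le> card (fst ` lies B \<omega> X (32 * e))" unfolding L_def using fl by (intro card_mono) auto
  also have "\<dots> \<le> card (lies B \<omega> X (32 * e))" by (rule card_image_le[OF fl])
  finally have L: "L \<le> e" using assms(3) by simp
  have "potential B X \<mu> \<le> (real B + 1)\<^sup>2 * 16 ^ L * (3 / 4) ^ (32 * e - L)"
    using potential_bound[OF assms(1) order_refl, of \<omega> "32 * e"] by (simp add: L_def \<mu>_def)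
  also have "\<dots> \<le> (real B + 1)\<^sup>2 * 16 ^ e * (3 / 4) ^ (31 * e)"
    using L by (intro mult_mono power_increasing power_decreasing) auto
  also have "\<dots> = (real B + 1)\<^sup>2 * (16 * (3 / 4) ^ 31) ^ e"
    by (simp add: power_mult_distrib power_mult)
  also have "\<dots> \<le> (real B + 1)\<^sup>2 * (1 / 256) ^ e"
    by (intro mult_left_mono power_mono) (auto simp: power_divide)
  also have "\<dots> < 1" using assms(2) by (simp add: power_divide field_simps)
  finally have "real ?W * real ?F < (real (\<mu> X))\<^sup>2"
    using pos[of X] by (simp add: potential_def field_simps)
  then have "real (?W * ?F) < real (\<mu> X * \<mu> X)" by (simp add: power2_eq_square)
  then have "?W * ?F < \<mu> X * \<mu> X" by (simp only: of_nat_less_iff)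
  moreover have W: "?F + \<mu> X \<le> ?W"
  proof -
    have "?F + \<mu> X = (\<Sum>p\<in>insert X (far B X). \<mu> p)" using finite_far by (simp add: far_def)
    also have "\<dots> \<le> ?W" using assms(1) far_subset by (intro sum_mono2) auto
    finally show ?thesis .
  qed
  ultimately have F: "?F < \<mu> X"
    using pos[of X] mult_le_mono[of "\<mu> X" ?W "\<mu> X" ?F] by (meson add_leE not_less)
  note med = median_props[of \<mu> B, OF pos]
  from neg consider "median B \<mu> + 6 < X" | "X + 6 < median B \<mu>" by (auto simp: \<mu>_def)
  then show False
  proof cases
    case 1
    then have "(\<Sum>p\<le>median B \<mu>. \<mu> p) \<le> ?F"
      using med(1) finite_far by (intro sum_mono2) (auto simp: far_def)
    with med(2) W F show False by linarith
  next
    case 2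
    have "?W = (\<Sum>p<median B \<mu>. \<mu> p) + (\<Sum>p\<in>{median B \<mu>..B}. \<mu> p)"
      using med(1) by (subst sum.union_disjoint[symmetric]) (auto intro!: sum.cong)
    moreover have "(\<Sum>p\<in>{median B \<mu>..B}. \<mu> p) \<le> ?F"
      using 2 finite_far by (intro sum_mono2) (auto simp: far_def)
    ultimately show False using med(3) W F by linarith
  qed
qed

text \<open>Also applied to an item outside \<open>{1..k}\<close>, for which it is the place where
  the item belongs among the first \<open>k\<close>.\<close>

definition rank_in :: "(nat \<Rightarrow> nat) \<Rightarrow> nat \<Rightarrow> nat \<Rightarrow> nat" where
  "rank_in \<pi> k i = card {j \<in> {1..k}. \<pi> j < \<pi> i}"

lemma rank_in_mono: "\<pi> i \<le> \<pi> j \<Longrightarrow> rank_in \<pi> k i \<le> rank_in \<pi> k j"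
  unfolding rank_in_def by (intro card_mono) auto

lemma rank_in_less:
  assumes "i \<in> {1..k}" "\<pi> i < \<pi> j"
  shows "rank_in \<pi> k i < rank_in \<pi> k j"
proof -
  have "i \<in> {l \<in> {1..k}. \<pi> l < \<pi> j}" "i \<notin> {l \<in> {1..k}. \<pi> l < \<pi> i}" using assms by auto
  moreover have "{l \<in> {1..k}. \<pi> l < \<pi> i} \<subseteq> {l \<in> {1..k}. \<pi> l < \<pi> j}" using assms by auto
  ultimately have "{l \<in> {1..k}. \<pi> l < \<pi> i} \<subset> {l \<in> {1..k}. \<pi> l < \<pi> j}" by blast
  then show ?thesis unfolding rank_in_def by (intro psubset_card_mono) auto
qed

lemma rank_in_lessD: "rank_in \<pi> k i < rank_in \<pi> k j \<Longrightarrow> \<pi> i < \<pi> j"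
  using rank_in_mono[of \<pi> j i k] by (cases "\<pi> i < \<pi> j") auto

lemma rank_in_bij:
  assumes "inj \<pi>"
  shows "bij_betw (rank_in \<pi> k) {1..k} {..<k}"
proof -
  have inj: "inj_on (rank_in \<pi> k) {1..k}"
  proof (rule inj_onI)
    fix i j assume *: "i \<in> {1..k}" "j \<in> {1..k}" "rank_in \<pi> k i = rank_in \<pi> k j"
    have "\<not> \<pi> i < \<pi> j" "\<not> \<pi> j < \<pi> i" using rank_in_less[of i k \<pi> j] rank_in_less[of j k \<pi> i] * by auto
    then have "\<pi> i = \<pi> j" by linarith
    then show "i = j" using assms by (simp add: inj_eq)
  qed
  have "rank_in \<pi> k i < k" if "i \<in> {1..k}" for i
  proof -
    have "i \<notin> {l \<in> {1..k}. \<pi> l < \<pi> i}" by simp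
    with that have "{l \<in> {1..k}. \<pi> l < \<pi> i} \<subset> {1..k}" by blast
    then have "card {l \<in> {1..k}. \<pi> l < \<pi> i} < card {1..k}" by (intro psubset_card_mono) auto
    then show ?thesis by (simp add: rank_in_def)
  qed
  then have "rank_in \<pi> k ` {1..k} \<subseteq> {..<k}" by auto
  moreover have "card (rank_in \<pi> k ` {1..k}) = card {..<k}" using inj by (simp add: card_image)
  ultimately have "rank_in \<pi> k ` {1..k} = {..<k}" by (intro card_subset_eq) auto
  with inj show ?thesis by (rule bij_betw_imageI)
qed

text \<open>Step \<open>t\<close> of the search for the item \<open>x\<close> uses the \<open>t\<close>-th group of \<open>m\<close> items of a block of
  \<open>ys\<close>, so that no item is compared twice with \<open>x\<close>.\<close>

definition test_sum :: "outcomes \<Rightarrow> nat list \<Rightarrow> nat \<Rightarrow> nat \<Rightarrow> nat \<Rightarrow> nat \<Rightarrow> nat \<Rightarrow> int" where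
  "test_sum q ys V m x b t = (\<Sum>j<m. q x (ys ! (b * V + t * m + j)))"

text \<open>Working with fixed answer sequences removes the adaptivity: once \<open>\<omega>\<close>
  and \<open>ys\<close> are given, the tested blocks are known in advance. Answers to tests that are
  not performed are left free.\<close>

definition transcript :: "outcomes \<Rightarrow> nat list \<Rightarrow> nat \<Rightarrow> nat \<Rightarrow> nat \<Rightarrow> nat \<Rightarrow> nat \<Rightarrow> (nat \<Rightarrow> bool \<times> bool) \<Rightarrow> bool" where
  "transcript q ys B V m x T \<omega> \<longleftrightarrow> (\<forall>z b. fst z < T \<longrightarrow> test_at B \<omega> z b \<longrightarrow>
     answer \<omega> z = (test_sum q ys V m x b (fst z) > 0))"

definition near_sorted :: "(nat \<Rightarrow> nat) \<Rightarrow> nat \<Rightarrow> nat \<Rightarrow> nat list \<Rightarrow> bool" where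
  "near_sorted \<pi> k d ys \<longleftrightarrow> distinct ys \<and> set ys = {1..k} \<and>
     (\<forall>p<k. p \<le> rank_in \<pi> k (ys ! p) + d \<and> rank_in \<pi> k (ys ! p) \<le> p + d)"

definition lying_search where
  "lying_search \<pi> q ys V m x T e \<longleftrightarrow> (\<exists>\<omega>. transcript q ys ((x - 1) div V) V m x T \<omega> \<and>
     e \<le> card (lies ((x - 1) div V) \<omega> (rank_in \<pi> (x - 1) x div V) T))"

lemma test_at_cong:
  assumes "\<And>s. s < T \<Longrightarrow> \<omega> s = \<omega>' s" "fst z < T"
  shows "test_at B \<omega> z = test_at B \<omega>' z"
proof -
  have "weights B \<omega> (fst z) = weights B \<omega>' (fst z)" using assms by (intro weights_cong) auto
  then show ?thesis by (intro ext) (simp add: test_at_def)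
qed

lemma answer_cong: "\<omega> (fst z) = \<omega>' (fst z) \<Longrightarrow> answer \<omega> z = answer \<omega>' z"
  by (simp add: answer_def)

lemma lies_cong:
  assumes "\<And>s. s < T \<Longrightarrow> \<omega> s = \<omega>' s"
  shows "lies B \<omega> X T = lies B \<omega>' X T"
proof -
  have "answer \<omega> z = answer \<omega>' z" if "fst z < T" for z using assms[OF that] by (rule answer_cong)
  then show ?thesis unfolding lies_def
    by (intro Collect_cong conj_cong refl) (simp add: test_at_cong[OF assms])
qed

lemma transcript_cong:
  assumes "\<And>s. s < T \<Longrightarrow> \<omega> s = \<omega>' s"
  shows "transcript q ys B V m x T \<omega> = transcript q ys B V m x T \<omega>'"
proof -
  have "answer \<omega> z = answer \<omega>' z" if "fst z < T" for z using assms[OF that] by (rule answer_cong)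
  then show ?thesis unfolding transcript_def
    by (intro all_cong1 imp_cong refl) (simp_all add: test_at_cong[OF assms])
qed

text \<open>The two tests of a step lie strictly on opposite sides of the pivot, so step and block
  tell which test it was. Hence different tests query different items; \<open>b < B\<close> keeps
  these inside full blocks.\<close>

lemma test_at_bound:
  assumes "test_at B \<omega> z b"
  shows "b < B" "test_at B \<omega> (fst z, s) b \<Longrightarrow> s = snd z"
proof -
  have "pivot B \<omega> (fst z) \<le> B" by (rule median_props(1)[OF weights_pos])
  then show "b < B" using assms by (cases "snd z") (auto simp: test_at_def)
  show "s = snd z" if "test_at B \<omega> (fst z, s) b"
  proof -
    have "if s then b < pivot B \<omega> (fst z) else pivot B \<omega> (fst z) < b"
      using that by (cases s) (auto simp: test_at_def)
    moreover have "if snd z then b < pivot B \<omega> (fst z) else pivot B \<omega> (fst z) < b"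
      using assms by (cases "snd z") (auto simp: test_at_def)
    ultimately show ?thesis by (cases s; cases "snd z"; simp)
  qed
qed

section \<open>Probability of a misleading search, conditional on the outcomes between earlier
  items\<close>

context noisy
begin

lemma inj_pi: "inj \<pi>" using pi_inject by (auto simp: inj_def)

definition prefix_pairs :: "nat \<Rightarrow> (nat \<times> nat) set" where
  "prefix_pairs k = {(i, j). 1 \<le> i \<and> i < j \<and> j \<le> k}"

lemma prefix_pairs_subset: "k \<le> n \<Longrightarrow> prefix_pairs k \<subseteq> pairs"
  by (auto simp: prefix_pairs_def pairs_def)

text \<open>For fixed \<open>\<omega>\<close> the lying tests are known beforehand. They compare
  \<open>x\<close> with at least \<open>m e\<close> distinct items, whose true side is opposite to
  the answer, and the transcript forces the sum of the correctly oriented outcomes to be at most 0.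
  All these pairs contain \<open>x\<close>, which is newer than the items of \<open>ys\<close>, so
  the Chernoff bound holds conditionally on the outcomes between earlier items.\<close>

lemma lying_transcript:
  assumes x: "x = Suc k" "x \<le> n" and ns: "near_sorted \<pi> k V ys" and V: "V = T * m" "T > 0" "m > 0"
    and e: "e \<le> card (lies (k div V) \<omega> (rank_in \<pi> k x div V) T)"
  shows "measure_pmf.prob Q (agree (prefix_pairs k) f \<inter> {q. transcript q ys (k div V) V m x T \<omega>})
    \<le> measure_pmf.prob Q (agree (prefix_pairs k) f) * exp (- (\<gamma>\<^sup>2 / 2 * real (m * e)))"
proof -
  let ?B = "k div V" and ?X = "rank_in \<pi> k x div V"
  let ?L = "lies ?B \<omega> ?X T"
  have Vpos: "V > 0" using V by simp
  have ys: "distinct ys" "set ys = {1..k}" "length ys = k"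
    using ns distinct_card[of ys] by (auto simp: near_sorted_def)
  define blk where "blk z = (THE b. test_at ?B \<omega> z b)" for z
  have blk: "test_at ?B \<omega> z (blk z)" "wrong ?X (blk z) (answer \<omega> z)" "fst z < T" if "z \<in> ?L" for z
  proof -
    from that obtain b where b: "fst z < T" "test_at ?B \<omega> z b" "wrong ?X b (answer \<omega> z)"
      by (auto simp: lies_def)
    have "blk z = b" unfolding blk_def using b(2) by (intro the_equality) (auto simp: test_at_def split: if_splits)
    with b show "test_at ?B \<omega> z (blk z)" "wrong ?X (blk z) (answer \<omega> z)" "fst z < T" by auto
  qed
  define pos where "pos zj = blk (fst zj) * V + fst (fst zj) * m + snd zj" for zj :: "(nat \<times> bool) \<times> nat"
  define D where "D = ?L \<times> {..<m}"
  have off: "fst z * m + j < V" if "z \<in> ?L" "j < m" for z j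
  proof -
    have "fst z * m + j < Suc (fst z) * m" using that by simp
    also have "\<dots> \<le> T * m" using blk(3)[OF that(1)] by (intro mult_le_mono) auto
    finally show ?thesis by (simp add: V)
  qed
  have pos_div: "pos (z, j) div V = blk z" "pos (z, j) mod V = fst z * m + j" if "z \<in> ?L" "j < m" for z j
    using off[OF that] Vpos by (simp_all add: pos_def add.assoc)
  have pos_k: "pos (z, j) < k" if "z \<in> ?L" "j < m" for z j
  proof -
    have "pos (z, j) < Suc (blk z) * V" using off[OF that] by (simp add: pos_def)
    also have "\<dots> \<le> k div V * V" using test_at_bound(1)[OF blk(1)[OF that(1)]] by (intro mult_le_mono) auto
    also have "\<dots> \<le> k" by simp
    finally show ?thesis .
  qed
  have pos_inj: "inj_on pos D"
  proof (rule inj_onI)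
    fix a a' assume a: "a \<in> D" "a' \<in> D" "pos a = pos a'"
    obtain z j z' j' where zj: "a = (z, j)" "a' = (z', j')" by (metis surj_pair)
    then have zj': "z \<in> ?L" "j < m" "z' \<in> ?L" "j' < m" using a by (auto simp: D_def)
    have b: "blk z = blk z'" using pos_div(1)[OF zj'(1,2)] pos_div(1)[OF zj'(3,4)] a(3) zj by simp
    have eq: "fst z * m + j = fst z' * m + j'"
      using pos_div(2)[OF zj'(1,2)] pos_div(2)[OF zj'(3,4)] a(3) zj by simp
    have "(fst z * m + j) div m = fst z" "(fst z' * m + j') div m = fst z'" using zj' by auto
    then have f: "fst z = fst z'" using eq by simp
    with eq have j: "j = j'" by simp
    have "test_at ?B \<omega> (fst z, snd z') (blk z)" using blk(1)[OF zj'(3)] b f by simp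
    from test_at_bound(2)[OF blk(1)[OF zj'(1)] this] have "snd z' = snd z" .
    with j show "a = a'" using f zj by (simp add: prod_eq_iff)
  qed
  \<comment> \<open>Blocks two apart leave a full block of length \<open>V\<close> between
    \<open>x\<close> and the tested items, and \<open>ys\<close> displaces these by at most
    \<open>V\<close>.\<close>
  have side: "if answer \<omega> z then \<pi> x < \<pi> (ys ! pos (z, j)) else \<pi> (ys ! pos (z, j)) < \<pi> x"
    if "z \<in> ?L" "j < m" for z j
  proof -
    let ?y = "ys ! pos (z, j)"
    have y: "?y \<in> {1..k}" using pos_k[OF that] ys nth_mem by metis
    have r: "pos (z, j) \<le> rank_in \<pi> k ?y + V" "rank_in \<pi> k ?y \<le> pos (z, j) + V"
      using ns pos_k[OF that] by (auto simp: near_sorted_def)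
    have P: "blk z * V \<le> pos (z, j)" "pos (z, j) < blk z * V + V"
      using off[OF that] by (auto simp: pos_def)
    have Xl: "?X * V \<le> rank_in \<pi> k x" "rank_in \<pi> k x < ?X * V + V"
      using div_mult_mod_eq[of "rank_in \<pi> k x" V] mod_less_divisor[OF Vpos, of "rank_in \<pi> k x"] by linarith+
    show ?thesis
    proof (cases "answer \<omega> z")
      case True
      then have "?X + 2 \<le> blk z" using blk(2)[OF that(1)] by (simp add: wrong_def)
      then have "(?X + 2) * V \<le> blk z * V" by (intro mult_le_mono) auto
      then have "?X * V + 2 * V \<le> blk z * V" by (simp only: add_mult_distrib)
      then have "rank_in \<pi> k x < rank_in \<pi> k ?y" using Xl r P by linarith
      then show ?thesis using True rank_in_lessD by auto
    next
      case False
      then have "blk z + 2 \<le> ?X" using blk(2)[OF that(1)] by (simp add: wrong_def)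
      then have "(blk z + 2) * V \<le> ?X * V" by (intro mult_le_mono) auto
      then have "blk z * V + 2 * V \<le> ?X * V" by (simp only: add_mult_distrib)
      then have "rank_in \<pi> k ?y < rank_in \<pi> k x" using Xl r P by linarith
      then show ?thesis using False rank_in_lessD by auto
    qed
  qed
  define pr where "pr a = (if answer \<omega> (fst a) then (x, ys ! pos a) else (ys ! pos a, x))" for a
  define M where "M = pr ` D"
  have finL: "finite ?L" by (rule finite_subset[of _ "{..<T} \<times> UNIV"]) (auto simp: lies_def)
  have finM: "finite M" using finL by (simp add: M_def D_def)
  have nx: "ys ! pos a \<in> {1..k}" if "a \<in> D" for a
  proof -
    have "pos a < length ys" using that pos_k[of "fst a" "snd a"] ys by (auto simp: D_def)
    then show ?thesis using ys nth_mem by metis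
  qed
  have inj: "inj_on pr D"
  proof (rule inj_onI)
    fix a a' assume a: "a \<in> D" "a' \<in> D" "pr a = pr a'"
    with nx[OF a(1)] nx[OF a(2)] x have "ys ! pos a = ys ! pos a'" by (auto simp: pr_def split: if_splits)
    moreover have "pos a < length ys" "pos a' < length ys"
      using a pos_k[of "fst a" "snd a"] pos_k[of "fst a'" "snd a'"] ys by (auto simp: D_def)
    ultimately have "pos a = pos a'" using ys(1) by (simp add: nth_eq_iff_index_eq)
    then show "a = a'" using pos_inj a by (auto simp: inj_on_def)
  qed
  have card: "card M = m * card ?L"
    unfolding M_def using inj by (simp add: card_image D_def card_cartesian_product)
  have Mok: "u \<in> {1..n} \<and> v \<in> {1..n} \<and> \<pi> u < \<pi> v \<and> (u, v) \<notin> prefix_pairs k \<and> (v, u) \<notin> prefix_pairs k"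
    if uv: "(u, v) \<in> M" for u v
  proof -
    from uv obtain a where a: "a \<in> D" "pr a = (u, v)" by (auto simp: M_def)
    from a(1) have "fst a \<in> ?L" "snd a < m" by (auto simp: D_def)
    from side[OF this] nx[OF a(1)] a(2) x show ?thesis
      by (auto simp: pr_def prefix_pairs_def split: if_splits)
  qed
  have sum_neg: "(\<Sum>(u, v)\<in>M. q v u) \<le> 0"
    if q: "q \<in> set_pmf Q" "transcript q ys ?B V m x T \<omega>" for q
  proof -
    have "(\<Sum>(u, v)\<in>M. q v u) = (\<Sum>a\<in>D. case pr a of (u, v) \<Rightarrow> q v u)"
      unfolding M_def by (simp add: sum.reindex[OF inj] o_def)
    also have "\<dots> = (\<Sum>z\<in>?L. \<Sum>j<m. case pr (z, j) of (u, v) \<Rightarrow> q v u)"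
      unfolding D_def by (simp add: sum.cartesian_product case_prod_beta')
    also have "\<dots> \<le> (\<Sum>z\<in>?L. 0)"
    proof (rule sum_mono)
      fix z assume z: "z \<in> ?L"
      have ans: "answer \<omega> z = (test_sum q ys V m x (blk z) (fst z) > 0)"
        using q(2) blk(1,3)[OF z] unfolding transcript_def by blast
      have ts: "test_sum q ys V m x (blk z) (fst z) = (\<Sum>j<m. q x (ys ! pos (z, j)))"
        by (simp add: test_sum_def pos_def)
      show "(\<Sum>j<m. case pr (z, j) of (u, v) \<Rightarrow> q v u) \<le> 0"
      proof (cases "answer \<omega> z")
        case True
        have "(\<Sum>j<m. case pr (z, j) of (u, v) \<Rightarrow> q v u) = (\<Sum>j<m. - q x (ys ! pos (z, j)))"
        proof (rule sum.cong[OF refl])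
          fix j assume "j \<in> {..<m}"
          then have "ys ! pos (z, j) \<in> {1..k}" using z by (intro nx) (auto simp: D_def)
          then show "(case pr (z, j) of (u, v) \<Rightarrow> q v u) = - q x (ys ! pos (z, j))"
            using outcome_values(2)[OF q(1), of x "ys ! pos (z, j)"] True x by (auto simp: pr_def)
        qed
        then show ?thesis using ans ts True by (simp add: sum_negf)
      next
        case False
        then show ?thesis using ans ts by (simp add: pr_def not_less)
      qed
    qed
    finally show ?thesis by simp
  qed
  have "measure_pmf.prob Q (agree (prefix_pairs k) f \<inter> {q. transcript q ys ?B V m x T \<omega>})
    = measure_pmf.prob Q ((agree (prefix_pairs k) f \<inter> {q. transcript q ys ?B V m x T \<omega>}) \<inter> set_pmf Q)"
    by (simp add: measure_Int_set_pmf)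
  also have "\<dots> \<le> measure_pmf.prob Q (agree (prefix_pairs k) f \<inter>
      {q. real_of_int (\<Sum>(u, v)\<in>M. q v u) \<le> \<gamma> / 2 * real (card M)})"
  proof (rule measure_pmf.finite_measure_mono)
    have "real_of_int (\<Sum>(u, v)\<in>M. q v u) \<le> \<gamma> / 2 * real (card M)"
      if "q \<in> set_pmf Q" "transcript q ys ?B V m x T \<omega>" for q
    proof -
      have "real_of_int (\<Sum>(u, v)\<in>M. q v u) \<le> 0" using sum_neg[OF that] by (simp only: of_int_le_0_iff)
      also have "\<dots> \<le> \<gamma> / 2 * real (card M)" using \<gamma> by simp
      finally show ?thesis .
    qed
    then show "agree (prefix_pairs k) f \<inter> {q. transcript q ys ?B V m x T \<omega>} \<inter> set_pmf Q \<subseteq>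
      agree (prefix_pairs k) f \<inter> {q. real_of_int (\<Sum>(u, v)\<in>M. q v u) \<le> \<gamma> / 2 * real (card M)}"
      by blast
  qed simp
  also have "\<dots> \<le> measure_pmf.prob Q (agree (prefix_pairs k) f) * exp (- (\<gamma>\<^sup>2 / 2 * real (card M)))"
    using x by (intro chernoff prefix_pairs_subset finM Mok) auto
  also have "\<dots> \<le> measure_pmf.prob Q (agree (prefix_pairs k) f) * exp (- (\<gamma>\<^sup>2 / 2 * real (m * e)))"
  proof -
    have "real (m * e) \<le> real (card M)" using e by (simp add: card mult_left_mono)
    then show ?thesis by (intro mult_left_mono) (auto intro!: mult_left_mono)
  qed
  finally show ?thesis .
qed

text \<open>A union bound over the \<open>4 ^ T\<close> answer sequences of length \<open>T\<close>;
  later entries influence neither the transcript nor the lies.\<close>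

lemma lying_search_bound:
  assumes x: "x = Suc k" "x \<le> n" and ns: "near_sorted \<pi> k V ys" and V: "V = T * m" "T > 0" "m > 0"
  shows "measure_pmf.prob Q (agree (prefix_pairs k) f \<inter> {q. lying_search \<pi> q ys V m x T e})
    \<le> measure_pmf.prob Q (agree (prefix_pairs k) f) * (4 ^ T * exp (- (\<gamma>\<^sup>2 / 2 * real (m * e))))"
proof -
  define \<Omega> where "\<Omega> = {w :: (bool \<times> bool) list. length w = T}"
  have c\<Omega>: "card \<Omega> = 4 ^ T"
    using card_lists_length_eq[of "UNIV :: (bool \<times> bool) set" T] by (simp add: \<Omega>_def)
  have f\<Omega>: "finite \<Omega>"
    using finite_lists_length_eq[of "UNIV :: (bool \<times> bool) set" T] by (simp add: \<Omega>_def)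
  let ?A = "agree (prefix_pairs k) f"
  let ?S = "{w \<in> \<Omega>. e \<le> card (lies (k div V) ((!) w) (rank_in \<pi> k x div V) T)}"
  have "{q. lying_search \<pi> q ys V m x T e} \<subseteq> (\<Union>w\<in>?S. {q. transcript q ys (k div V) V m x T ((!) w)})"
  proof
    fix q assume "q \<in> {q. lying_search \<pi> q ys V m x T e}"
    then obtain \<omega> where \<omega>: "transcript q ys (k div V) V m x T \<omega>"
      "e \<le> card (lies (k div V) \<omega> (rank_in \<pi> k x div V) T)"
      using x by (auto simp: lying_search_def)
    let ?w = "map \<omega> [0..<T]"
    have c: "\<omega> s = (!) ?w s" if "s < T" for s using that by simp
    have "?w \<in> ?S" "transcript q ys (k div V) V m x T ((!) ?w)"
      using \<omega> lies_cong[OF c] transcript_cong[OF c] by (auto simp: \<Omega>_def)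
    then show "q \<in> (\<Union>w\<in>?S. {q. transcript q ys (k div V) V m x T ((!) w)})" by blast
  qed
  then have "measure_pmf.prob Q (?A \<inter> {q. lying_search \<pi> q ys V m x T e}) \<le>
      measure_pmf.prob Q (\<Union>w\<in>?S. ?A \<inter> {q. transcript q ys (k div V) V m x T ((!) w)})"
    by (intro measure_pmf.finite_measure_mono) auto
  also have "\<dots> \<le> (\<Sum>w\<in>?S. measure_pmf.prob Q (?A \<inter> {q. transcript q ys (k div V) V m x T ((!) w)}))"
    using f\<Omega> by (intro measure_pmf.finite_measure_subadditive_finite) auto
  also have "\<dots> \<le> (\<Sum>w\<in>?S. measure_pmf.prob Q ?A * exp (- (\<gamma>\<^sup>2 / 2 * real (m * e))))"
    by (intro sum_mono lying_transcript[OF x ns V]) auto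
  also have "\<dots> \<le> (\<Sum>w\<in>\<Omega>. measure_pmf.prob Q ?A * exp (- (\<gamma>\<^sup>2 / 2 * real (m * e))))"
    using f\<Omega> by (intro sum_mono2) auto
  also have "\<dots> = measure_pmf.prob Q ?A * (4 ^ T * exp (- (\<gamma>\<^sup>2 / 2 * real (m * e))))"
    by (simp add: c\<Omega>)
  finally show ?thesis .
qed

end

section \<open>Dynamic programming over rankings of bounded displacement\<close>

text \<open>A feasible prefix of length \<open>p\<close> lists positions (into a given ranking of \<open>K\<close> items) that move
  by at most \<open>w\<close>, and contains all positions that can no longer be placed after it.\<close>

definition feasible :: "nat \<Rightarrow> nat \<Rightarrow> nat list \<Rightarrow> bool" where
  "feasible K w js \<longleftrightarrow> distinct js \<and>
     (\<forall>i<length js. js ! i < K \<and> js ! i \<le> i + w \<and> i \<le> js ! i + w) \<and> {j. j + w < length js} \<subseteq> set js"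

lemma feasible_Nil: "feasible K w []"
  by (simp add: feasible_def)

text \<open>When a prefix grows by one entry, exactly one further position expires, namely
  \<open>length js - w\<close>; the last conjunct asks that it has been placed.\<close>

lemma feasible_snoc:
  "feasible K w (js @ [j]) \<longleftrightarrow> feasible K w js \<and> j \<notin> set js \<and> j < K \<and> j \<le> length js + w \<and>
     length js \<le> j + w \<and> (length js < w \<or> length js - w \<in> insert j (set js))"
proof -
  let ?p = "length js"
  have "{i. i + w < Suc ?p} = (if ?p < w then {} else insert (?p - w) {i. i + w < ?p})" by auto
  moreover have "j \<in> {i. i + w < ?p} \<longleftrightarrow> \<not> ?p \<le> j + w" by auto
  ultimately show ?thesis
    unfolding feasible_def by (auto simp: nth_append less_Suc_eq)
qed

lemma feasible_permutation:
  assumes "distinct js" "set js = {..<K}" "\<And>i. i < K \<Longrightarrow> js ! i \<le> i + w \<and> i \<le> js ! i + w"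
  shows "feasible K w js"
proof -
  have "length js = K" using distinct_card[OF assms(1)] assms(2) by simp
  with assms show ?thesis unfolding feasible_def by (auto simp: in_set_conv_nth set_eq_iff)
qed

text \<open>The state reached by a prefix is its set, shifted by \<open>w\<close> to make room for \<open>w\<close> dummy positions
  that are placed from the start, and seen through a window of width \<open>2 w\<close>.\<close>

definition placed :: "nat \<Rightarrow> nat list \<Rightarrow> nat set" where
  "placed w js = {..<w} \<union> (\<lambda>j. j + w) ` set js"

definition window :: "nat \<Rightarrow> nat list \<Rightarrow> nat set" where
  "window w js = {x. x + length js \<in> placed w js}"

text \<open>The binary encoding suits the machine: placing a position adds a power of 2, and
  advancing the window is halving.\<close>

definition code :: "nat \<Rightarrow> nat list \<Rightarrow> nat" where
  "code w js = set_encode (window w js)"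

lemma finite_window: "finite (window w js)"
proof (rule finite_subset)
  show "window w js \<subseteq> (\<lambda>a. a - length js) ` placed w js"
    by (force simp: window_def)
qed (simp add: placed_def)

lemma window_subset:
  assumes "feasible K w js"
  shows "window w js \<subseteq> {..<2 * w}"
proof
  fix x assume "x \<in> window w js"
  then consider "x + length js < w" | j where "j \<in> set js" "x + length js = j + w"
    by (auto simp: window_def placed_def)
  then show "x \<in> {..<2 * w}"
  proof cases
    case 2
    then obtain i where "i < length js" "j = js ! i" by (auto simp: in_set_conv_nth)
    with assms 2 show ?thesis by (fastforce simp: feasible_def)
  qed auto
qed

lemma set_encode_lessThan: "set_encode {..<N} = 2 ^ N - 1"
  using mask_eq_sum_exp_nat[of N] by (simp add: set_encode_def lessThan_def)

lemma code_less:
  assumes "feasible K w js"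
  shows "code w js < 2 ^ (2 * w)"
proof -
  have "code w js \<le> set_encode {..<2 * w}"
    unfolding code_def set_encode_def using window_subset[OF assms] by (intro sum_mono2) auto
  then show ?thesis by (simp add: set_encode_lessThan le_less_trans)
qed

lemma code_Nil: "code w [] = 2 ^ w - 1"
proof -
  have "window w [] = {..<w}" by (auto simp: window_def placed_def)
  then show ?thesis by (simp add: code_def set_encode_lessThan)
qed

text \<open>Once all of \<open>{..<K}\<close> is used, the placed set is \<open>{..<K + w}\<close>
  in whatever order it arose. So all complete prefixes share one state, equal to that of the empty
  prefix, and a single entry holds the optimum.\<close>

lemma code_complete:
  assumes "feasible K w js" "length js = K"
  shows "code w js = 2 ^ w - 1" "set js = {..<K}"
proof -
  have "set js \<subseteq> {..<K}" using assms by (auto simp: feasible_def in_set_conv_nth)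
  moreover have "card (set js) = K" using assms by (simp add: feasible_def distinct_card)
  ultimately show s: "set js = {..<K}" by (intro card_subset_eq) auto
  have "x \<in> window w js \<longleftrightarrow> x < w" for x
  proof -
    have "x + K \<in> (\<lambda>j. j + w) ` {..<K} \<longleftrightarrow> w \<le> x + K \<and> x < w"
      by (auto simp: image_iff intro!: bexI[of _ "x + K - w"])
    then show ?thesis unfolding window_def placed_def assms(2) s by auto
  qed
  then have "window w js = {..<w}" by auto
  then show "code w js = 2 ^ w - 1" by (simp add: code_def set_encode_lessThan)
qed

text \<open>Left of the window everything has been placed, by feasibility, so the window and the
  length determine the whole set.\<close>

lemma code_determines_set:
  assumes "feasible K w js" "feasible K w js'" "length js = length js'" "code w js = code w js'"
  shows "set js = set js'"
proof -
  have win: "window w js = window w js'"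
    using assms(4) finite_window by (simp add: code_def set_encode_eq)
  have low: "x \<in> placed w js" if "x < length js" "feasible K w js" for x js
  proof (cases "x < w")
    case False
    then have "x - w \<in> set js" using that by (auto simp: feasible_def)
    then show ?thesis using False by (auto simp: placed_def intro!: image_eqI[of _ _ "x - w"])
  qed (simp add: placed_def)
  have "x \<in> placed w js \<longleftrightarrow> x \<in> placed w js'" for x
  proof (cases "x < length js")
    case True
    then show ?thesis using low assms by metis
  next
    case False
    have "x \<in> placed w js \<longleftrightarrow> x - length js \<in> window w js" if "\<not> x < length js" for js
      using that by (simp add: window_def)
    then show ?thesis using False win assms(3) by metis
  qed
  moreover have "j \<in> set js \<longleftrightarrow> j + w \<in> placed w js" for j js by (auto simp: placed_def)
  ultimately show ?thesis by blast
qed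

lemma window_snoc:
  assumes "length js \<le> j + w"
  shows "insert (j + w - length js) (window w js) = {x. x + length js \<in> placed w (js @ [j])}"
  using assms by (auto simp: window_def placed_def)

text \<open>The bit of a new position \<open>j\<close> is not yet set, so the addition does not
  carry. The lowest bit of \<open>M\<close> belongs to the position that expires now: feasibility
  requires it to be set, and halving shifts it out of the window.\<close>

lemma code_snoc:
  assumes "j \<notin> set js" "length js \<le> j + w"
  defines "M \<equiv> code w js + 2 ^ (j + w - length js)"
  shows "odd M \<longleftrightarrow> length js < w \<or> length js - w \<in> insert j (set js)"
    and "M div 2 = code w (js @ [j])"
proof -
  let ?b = "j + w - length js"
  have nin: "?b \<notin> window w js" using assms by (auto simp: window_def placed_def)
  have M: "M = set_encode (insert ?b (window w js))"
    using set_encode_insert[OF finite_window nin] by (simp add: M_def code_def)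
  have "odd M \<longleftrightarrow> 0 \<in> insert ?b (window w js)"
    unfolding M using even_set_encode_iff[of "insert ?b (window w js)"] finite_window by auto
  also have "\<dots> \<longleftrightarrow> length js \<in> placed w (js @ [j])"
    using window_snoc[OF assms(2)] by auto
  also have "\<dots> \<longleftrightarrow> length js < w \<or> length js - w \<in> insert j (set js)"
  proof (cases "length js < w")
    case False
    then obtain d where "length js = d + w" by (metis le_add_diff_inverse2 not_less)
    then show ?thesis by (auto simp: placed_def)
  qed (simp add: placed_def)
  finally show "odd M \<longleftrightarrow> length js < w \<or> length js - w \<in> insert j (set js)" .
  have "Suc -` insert ?b (window w js) = window w (js @ [j])"
    unfolding window_snoc[OF assms(2)] by (auto simp: window_def)
  then show "M div 2 = code w (js @ [j])"
    unfolding M code_def set_encode_vimage_Suc[symmetric] by simp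
qed

lemma lscore_snoc: "lscore g (js @ [j]) = lscore g js + (\<Sum>y\<leftarrow>js. g j y)"
  by (simp add: lscore_append)

text \<open>An entry of the table holds the score of a prefix, its last position and the state before it.\<close>

type_synonym table = "nat \<Rightarrow> nat \<Rightarrow> (int \<times> nat \<times> nat) option"

fun chain :: "table \<Rightarrow> nat \<Rightarrow> nat \<Rightarrow> nat list" where
  "chain tb 0 s = []"
| "chain tb (Suc p) s = (case tb (Suc p) s of None \<Rightarrow> [] | Some (v, j, s') \<Rightarrow> chain tb p s' @ [j])"

lemma chain_cong: "(\<And>p' s. p' \<le> p \<Longrightarrow> tb p' s = tb' p' s) \<Longrightarrow> chain tb p s = chain tb' p s"
  by (induction p arbitrary: s) (auto split: option.splits)

definition sound :: "nat \<Rightarrow> nat \<Rightarrow> (nat \<Rightarrow> nat \<Rightarrow> int) \<Rightarrow> table \<Rightarrow> nat \<Rightarrow> bool" where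
  "sound K w g tb p \<longleftrightarrow> (\<forall>s v j s'. tb p s = Some (v, j, s') \<longrightarrow> feasible K w (chain tb p s) \<and>
     length (chain tb p s) = p \<and> code w (chain tb p s) = s \<and> lscore g (chain tb p s) = v)"

definition dominates :: "(nat \<Rightarrow> nat \<Rightarrow> int) \<Rightarrow> nat \<Rightarrow> table \<Rightarrow> nat list \<Rightarrow> bool" where
  "dominates g w tb js \<longleftrightarrow> (\<exists>v j s'. tb (length js) (code w js) = Some (v, j, s') \<and> lscore g js \<le> v)"

definition complete :: "nat \<Rightarrow> nat \<Rightarrow> (nat \<Rightarrow> nat \<Rightarrow> int) \<Rightarrow> table \<Rightarrow> nat \<Rightarrow> bool" where
  "complete K w g tb p \<longleftrightarrow> (\<forall>js. feasible K w js \<longrightarrow> length js = p \<longrightarrow> dominates g w tb js)"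

text \<open>The loop invariant within a level: \<open>D\<close> collects the processed combinations
  of a state and a window offset \<open>b\<close>. The position belonging to \<open>b\<close> is
  \<open>p + b - w\<close>.\<close>

definition explored :: "nat \<Rightarrow> nat \<Rightarrow> (nat \<Rightarrow> nat \<Rightarrow> int) \<Rightarrow> table \<Rightarrow> nat \<Rightarrow> (nat \<times> nat) set \<Rightarrow> bool" where
  "explored K w g tb p D \<longleftrightarrow> (\<forall>(s, b)\<in>D. \<forall>j. tb p s \<noteq> None \<longrightarrow> j + w = p + b \<longrightarrow>
     feasible K w (chain tb p s @ [j]) \<longrightarrow> dominates g w tb (chain tb p s @ [j]))"

text \<open>Bellman's principle: the gain from appending \<open>j\<close> depends only on the set of
  the prefix, and the state determines this set. So a prefix may be replaced by the best one with
  the same state.\<close>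

lemma explored_all:
  assumes "sound K w g tb p" "complete K w g tb p" "explored K w g tb p ({..<2 ^ (2 * w)} \<times> {..2 * w})"
  shows "complete K w g tb (Suc p)"
  unfolding complete_def
proof (intro allI impI)
  fix js' assume js': "feasible K w js'" "length js' = Suc p"
  then obtain js j where js: "js' = js @ [j]" by (metis length_Suc_conv_rev)
  with js' have f: "feasible K w js" "length js = p" "j \<notin> set js" "j \<le> p + w" "p \<le> j + w"
    using feasible_snoc[of K w js j] by auto
  with assms(2) obtain v i s' where tb: "tb p (code w js) = Some (v, i, s')" "lscore g js \<le> v"
    by (auto simp: complete_def dominates_def)
  let ?js = "chain tb p (code w js)"
  from assms(1) tb(1) have c: "feasible K w ?js" "length ?js = p" "code w ?js = code w js" "lscore g ?js = v"
    by (auto simp: sound_def)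
  have set: "set ?js = set js" using code_determines_set[OF c(1) f(1)] c f(2) by simp
  have f2: "feasible K w (?js @ [j])" using js' f c set js by (simp add: feasible_snoc)
  have "code w js < 2 ^ (2 * w)" by (rule code_less[OF f(1)])
  then have "(code w js, j + w - p) \<in> {..<2 ^ (2 * w)} \<times> {..2 * w}" using f by simp
  with assms(3) tb(1) f2 f have dom: "dominates g w tb (?js @ [j])"
    unfolding explored_def by fastforce
  have "window w (?js @ [j]) = window w (js @ [j])" using set c f by (simp add: window_def placed_def)
  moreover have "lscore g (js @ [j]) \<le> lscore g (?js @ [j])"
  proof -
    have "(\<Sum>y\<leftarrow>js. g j y) = (\<Sum>y\<leftarrow>?js. g j y)"
      using set f(1) c(1) by (simp add: feasible_def sum_list_distinct_conv_sum_set)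
    then show ?thesis using tb(2) c(4) by (simp add: lscore_snoc)
  qed
  ultimately show "dominates g w tb js'"
    using dom c f js by (auto simp: dominates_def code_def)
qed

text \<open>Chains of level \<open>p\<close> visit no higher level, so an update at level
  \<open>p + 1\<close> does not affect them. An entry gives way only to one with at least its score,
  so pairs already in \<open>D\<close> remain explored.\<close>

lemma explored_update:
  assumes tb': "tb' = tb(Suc p := (tb (Suc p))(c := Some (v, j, s)))"
    and "sound K w g tb p" "sound K w g tb (Suc p)" "explored K w g tb p D" "tb p s \<noteq> None"
    and f: "feasible K w (chain tb p s @ [j])" "j + w = p + b" "c = code w (chain tb p s @ [j])"
      "v = lscore g (chain tb p s @ [j])"
    and better: "\<And>v' j' s'. tb (Suc p) c = Some (v', j', s') \<Longrightarrow> v' \<le> v"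
  shows "sound K w g tb' (Suc p)" "explored K w g tb' p (insert (s, b) D)"
proof -
  have ch: "chain tb' p s = chain tb p s" for s by (rule chain_cong) (simp add: tb')
  have len: "length (chain tb p s) = p" using assms(2,5) by (auto simp: sound_def)
  show "sound K w g tb' (Suc p)"
    unfolding sound_def
  proof (intro allI impI)
    fix s1 v1 j1 s2 assume *: "tb' (Suc p) s1 = Some (v1, j1, s2)"
    show "feasible K w (chain tb' (Suc p) s1) \<and> length (chain tb' (Suc p) s1) = Suc p \<and>
       code w (chain tb' (Suc p) s1) = s1 \<and> lscore g (chain tb' (Suc p) s1) = v1"
    proof (cases "s1 = c")
      case True
      then have "tb' (Suc p) s1 = Some (v, j, s)" by (simp add: tb')
      then show ?thesis using * f len True by (auto simp: ch)
    next
      case False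
      then have "tb (Suc p) s1 = Some (v1, j1, s2)" using * by (simp add: tb')
      moreover from this have "chain tb' (Suc p) s1 = chain tb (Suc p) s1" using * ch by simp
      ultimately show ?thesis using assms(3) unfolding sound_def by metis
    qed
  qed
  have dom: "dominates g w tb' js" if "dominates g w tb js" "length js = Suc p" for js
    using that better by (fastforce simp: dominates_def tb' split: if_splits)
  have new: "dominates g w tb' (chain tb p s @ [j])"
    using f len by (simp add: dominates_def tb')
  have tbp: "tb' p = tb p" by (simp add: tb')
  show "explored K w g tb' p (insert (s, b) D)"
    unfolding explored_def
  proof (intro ballI)
    fix z assume "z \<in> insert (s, b) D"
    then obtain s1 b1 where z: "z = (s1, b1)" and D: "(s1, b1) \<in> insert (s, b) D" by (cases z) auto
    have "dominates g w tb' (chain tb' p s1 @ [j1])" if nn: "tb' p s1 \<noteq> None" "j1 + w = p + b1"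
      "feasible K w (chain tb' p s1 @ [j1])" for j1
    proof (cases "(s1, b1) = (s, b)")
      case True
      then have "j1 = j" using nn(2) f(2) by simp
      with new True show ?thesis by (simp add: ch)
    next
      case False
      have "length (chain tb p s1) = p" using nn(1) assms(2) tbp by (auto simp: sound_def)
      moreover have "dominates g w tb (chain tb p s1 @ [j1])"
        using False D nn assms(4) tbp unfolding explored_def ch by fastforce
      ultimately show ?thesis by (simp add: ch dom)
    qed
    then show "case z of (s, b) \<Rightarrow> \<forall>j. tb' p s \<noteq> None \<longrightarrow> j + w = p + b \<longrightarrow>
      feasible K w (chain tb' p s @ [j]) \<longrightarrow> dominates g w tb' (chain tb' p s @ [j])"
      by (simp add: z)
  qed
qed

lemma explored_skip:
  assumes "explored K w g tb p D"
    and "\<And>j. tb p s \<noteq> None \<Longrightarrow> j + w = p + b \<Longrightarrow> feasible K w (chain tb p s @ [j]) \<Longrightarrow>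
      dominates g w tb (chain tb p s @ [j])"
  shows "explored K w g tb p (insert (s, b) D)"
  using assms unfolding explored_def by auto

section \<open>Running times of programs\<close>

text \<open>Runs with exact time and with the list of queried pairs. \<open>Flip\<close> has no
  rule, since the program is deterministic. The trace yields both the number of queries and the
  outcomes on which a run can depend.\<close>

inductive big :: "outcomes \<Rightarrow> com \<Rightarrow> mem \<Rightarrow> mem \<Rightarrow> nat \<Rightarrow> (nat \<times> nat) list \<Rightarrow> bool"
  for q where
  "big q Skip m m (Suc 0) []"
| "big q (Assign a e) m (m(val a m := val e m)) (Suc 0) []"
| "big q (Query a e f) m (m(val a m := q (nat (val e m)) (nat (val f m)))) (Suc 0)
     [(nat (val e m), nat (val f m))]"
| "big q c m m' t tr \<Longrightarrow> big q d m' m'' t' tr' \<Longrightarrow> big q (Seq c d) m m'' (Suc (t + t')) (tr @ tr')"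
| "val e m > 0 \<Longrightarrow> big q c m m' t tr \<Longrightarrow> big q (Cond e c d) m m' (Suc t) tr"
| "val e m \<le> 0 \<Longrightarrow> big q d m m' t tr \<Longrightarrow> big q (Cond e c d) m m' (Suc t) tr"
| "val e m \<le> 0 \<Longrightarrow> big q (Loop e c) m m (Suc 0) []"
| "val e m > 0 \<Longrightarrow> big q c m m' t tr \<Longrightarrow> big q (Loop e c) m' m'' t' tr' \<Longrightarrow>
     big q (Loop e c) m m'' (Suc (t + t')) (tr @ tr')"

lemma steps_add: "steps q (s + t) c = bind_pmf (steps q s c) (steps q t)"
proof (induction s arbitrary: c)
  case (Suc s)
  then have "steps q (s + t) = (\<lambda>c. bind_pmf (steps q s c) (steps q t))" by (rule ext)
  then show ?case by (simp add: bind_assoc_pmf)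
qed (simp add: bind_return_pmf)

lemma big_steps:
  assumes "big q c m m' t tr"
  shows "steps q t (c # cs, m, k) = return_pmf (cs, m', k + length tr)"
  using assms
proof (induction arbitrary: cs k)
  case (4 c m m' t tr d m'' t' tr')
  then show ?case by (simp add: bind_return_pmf steps_add add.assoc)
next
  case (8 e m c m' t tr m'' t' tr')
  then show ?case by (simp add: bind_return_pmf steps_add add.assoc)
qed (simp_all add: bind_return_pmf)

lemma steps_halted: "steps q t ([], m, k) = return_pmf ([], m, k)"
  by (induction t) (simp_all add: bind_return_pmf)

lemma big_steps_halt:
  assumes "big q c m m' t tr" "t \<le> s"
  shows "steps q s ([c], m, k) = return_pmf ([], m', k + length tr)"
  using big_steps[OF assms(1), of "[]" k] steps_add[of q t "s - t" "([c], m, k)"] assms(2)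
  by (simp add: bind_return_pmf steps_halted)

lemma big_det:
  assumes "big q c m m1 t1 tr1" "big q c m m2 t2 tr2"
  shows "m1 = m2 \<and> length tr1 = length tr2"
  using big_steps_halt[OF assms(1), of "max t1 t2" 0] big_steps_halt[OF assms(2), of "max t1 t2" 0]
  by simp

text \<open>Turns traces into statements about dependence. Applied to the stages, it shows that the
  ranking before an insertion is a function of the outcomes between earlier items
  (\<open>stage_mem_local\<close>).\<close>

lemma big_local:
  "big q c m m' t tr \<Longrightarrow> (\<And>i j. (i, j) \<in> set tr \<Longrightarrow> q i j = q' i j) \<Longrightarrow> big q' c m m' t tr"
proof (induction rule: big.induct)
  case (3 a e f m)
  then have "q (nat (val e m)) (nat (val f m)) = q' (nat (val e m)) (nat (val f m))" by simp
  then show ?case using big.intros(3)[of q' a e f m] by metis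
next
  case 4
  then show ?case by (intro big.intros(4)) auto
next
  case 5
  then show ?case by (intro big.intros(5)) auto
next
  case 6
  then show ?case by (intro big.intros(6)) auto
next
  case 8
  then show ?case by (intro big.intros(8)) auto
qed (rule big.intros; assumption)+

text \<open>Each value of type \<open>vr\<close> names an integer-indexed array; array \<open>a\<close> occupies the addresses
  \<open>-(64 i + addr a)\<close>, so that non-negative indices never meet the output cells and \<open>vN\<close>, \<open>vG\<close>,
  \<open>vB\<close> at index 0 are the input cells. Scalars are arrays used at index 0 only. A name is a pair of
  digits, so that a few datatype rules decide whether two names differ.

  The main arrays are: \<open>vL\<close>, the current ranking of the items up to \<open>vK\<close>; \<open>vZ\<close>, the same with the new item
  \<open>vX\<close> inserted; \<open>vTAB\<close>, the outcomes known so far; \<open>vMU\<close>, the weights of the search; \<open>vF\<close>, \<open>vS\<close>, \<open>vJ\<close>, \<open>vP\<close>,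
  the table of the dynamic program (stage in which the entry was written, score, last position, previous
  state); \<open>vROW\<close>, \<open>vBV\<close>, \<open>vPB\<close>, \<open>vPOW\<close>, the multiples of the row length, of \<open>V\<close> and of the number of states,
  and the powers of 2, which replace multiplication.\<close>

datatype dg = D0 | D1 | D2 | D3 | D4 | D5 | D6 | D7

type_synonym vr = "dg \<times> dg"

primrec dgv :: "dg \<Rightarrow> int" where
  "dgv D0 = 0" | "dgv D1 = 1" | "dgv D2 = 2" | "dgv D3 = 3" | "dgv D4 = 4" | "dgv D5 = 5"
| "dgv D6 = 6" | "dgv D7 = 7"

definition addr :: "vr \<Rightarrow> int" where
  "addr a = 8 * dgv (fst a) + dgv (snd a)"

abbreviation (input) "vN \<equiv> (D0, D0)"
abbreviation (input) "vG \<equiv> (D0, D1)"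
abbreviation (input) "vB \<equiv> (D0, D2)"
abbreviation (input) "vLg \<equiv> (D0, D3)"
abbreviation (input) "vPw \<equiv> (D0, D4)"
abbreviation (input) "vE \<equiv> (D0, D5)"
abbreviation (input) "vM \<equiv> (D0, D6)"
abbreviation (input) "vT \<equiv> (D0, D7)"
abbreviation (input) "vV \<equiv> (D1, D0)"
abbreviation (input) "vW \<equiv> (D1, D1)"
abbreviation (input) "vCC \<equiv> (D1, D2)"
abbreviation (input) "vSZ \<equiv> (D1, D3)"
abbreviation (input) "vROW \<equiv> (D1, D4)"
abbreviation (input) "vBV \<equiv> (D1, D5)"
abbreviation (input) "vPB \<equiv> (D1, D6)"
abbreviation (input) "vPOW \<equiv> (D1, D7)"
abbreviation (input) "vL \<equiv> (D2, D0)"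
abbreviation (input) "vK \<equiv> (D2, D1)"
abbreviation (input) "vMU \<equiv> (D2, D2)"
abbreviation (input) "vZ \<equiv> (D2, D3)"
abbreviation (input) "vTAB \<equiv> (D2, D4)"
abbreviation (input) "vF \<equiv> (D2, D5)"
abbreviation (input) "vS \<equiv> (D2, D6)"
abbreviation (input) "vJ \<equiv> (D2, D7)"
abbreviation (input) "vP \<equiv> (D3, D0)"
abbreviation (input) "vi \<equiv> (D3, D1)"
abbreviation (input) "vX \<equiv> (D3, D3)"
abbreviation (input) "vR \<equiv> (D3, D4)"
abbreviation (input) "vBB \<equiv> (D3, D5)"
abbreviation (input) "vPP \<equiv> (D3, D6)"
abbreviation (input) "vSUM \<equiv> (D3, D7)"
abbreviation (input) "vTOT \<equiv> (D4, D0)"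
abbreviation (input) "vACC \<equiv> (D4, D1)"
abbreviation (input) "vPOS \<equiv> (D4, D2)"
abbreviation (input) "vTM \<equiv> (D4, D3)"
abbreviation (input) "vMASK \<equiv> (D4, D4)"
abbreviation (input) "vLEV \<equiv> (D4, D5)"
abbreviation (input) "vMM \<equiv> (D4, D6)"
abbreviation (input) "vPL \<equiv> (D4, D7)"
abbreviation (input) "vOK \<equiv> (D5, D0)"
abbreviation (input) "vGAIN \<equiv> (D5, D1)"
abbreviation (input) "vH \<equiv> (D5, D2)"
abbreviation (input) "vJJ \<equiv> (D5, D3)"
abbreviation (input) "vTMP \<equiv> (D5, D4)"
abbreviation (input) "vU \<equiv> (D5, D5)"
abbreviation (input) "vj \<equiv> (D5, D6)"
abbreviation (input) "vp \<equiv> (D5, D7)"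

lemma dgv_inject: "dgv a = dgv b \<longleftrightarrow> a = b"
  by (cases a; cases b; simp)

lemma dgv_range: "0 \<le> dgv a" "dgv a < 8"
  by (cases a; simp)+

lemma addr_divmod: "dgv (fst a) = addr a div 8" "dgv (snd a) = addr a mod 8"
  using dgv_range[of "snd a"] by (simp_all add: addr_def)

lemma addr_inject: "addr a = addr b \<longleftrightarrow> a = b"
proof
  assume "addr a = addr b"
  then have "dgv (fst a) = dgv (fst b)" "dgv (snd a) = dgv (snd b)"
    by (simp_all only: addr_divmod)
  then show "a = b" by (simp add: dgv_inject prod_eq_iff)
qed simp

lemma addr_range: "0 \<le> addr a" "addr a < 64"
  using dgv_range[of "fst a"] dgv_range[of "snd a"] unfolding addr_def by linarith+

definition loc :: "vr \<Rightarrow> int \<Rightarrow> int" where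
  "loc a i = - (64 * i + addr a)"

lemma loc_inject: "loc a i = loc b j \<longleftrightarrow> a = b \<and> i = j"
proof
  assume *: "loc a i = loc b j"
  have "i = - loc a i div 64" for a :: vr and i :: int
    using addr_range[of a] by (simp add: loc_def)
  with * have "i = j" by metis
  with * show "a = b \<and> i = j" by (simp add: loc_def addr_inject)
qed auto

type_synonym arrs = "vr \<Rightarrow> int \<Rightarrow> int"

definition arr :: "mem \<Rightarrow> arrs" where
  "arr m a i = m (loc a i)"

definition up :: "arrs \<Rightarrow> vr \<Rightarrow> int \<Rightarrow> int \<Rightarrow> arrs" where
  "up h a i v = h(a := (h a)(i := v))"

lemma up_apply [simp]: "up h a i v b = (if b = a then (h a)(i := v) else h b)"
  by (simp add: up_def)

lemma arr_update: "arr (m(loc a i := v)) = up (arr m) a i v"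
  by (rule ext)+ (auto simp: arr_def loc_inject)

text \<open>Expressions over arrays; \<open>cx\<close> compiles them to machine expressions, so that
  program proofs need only \<open>ev\<close>.\<close>

datatype hx = N int | X vr hx  | Add hx hx (infixl \<open>\<oplus>\<close> 65) | Sub hx hx (infixl \<open>\<ominus>\<close> 65)

abbreviation sc0 :: "vr \<Rightarrow> hx" (\<open>\<section>_\<close> [1000] 1000) where "\<section>a \<equiv> X a (N 0)"

fun ev :: "hx \<Rightarrow> arrs \<Rightarrow> int" where
  "ev (N k) h = k"
| "ev (X a e) h = h a (ev e h)"
| "ev (Add d e) h = ev d h + ev e h"
| "ev (Sub d e) h = ev d h - ev e h"

text \<open>Indices are scaled by \<open>64 = 2 ^ 6\<close> through repeated doubling, as the
  machine has no multiplication.\<close>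

fun dbl :: "nat \<Rightarrow> expr \<Rightarrow> expr" where
  "dbl 0 e = e"
| "dbl (Suc k) e = Plus (dbl k e) (dbl k e)"

lemma val_dbl [simp]: "val (dbl k e) m = 2 ^ k * val e m"
  by (induction k) simp_all

definition adr :: "vr \<Rightarrow> expr \<Rightarrow> expr" where
  "adr a e = Minus (Const (- addr a)) (dbl 6 e)"

lemma val_adr [simp]: "val (adr a e) m = loc a (val e m)"
  by (simp add: adr_def loc_def)

fun cx :: "hx \<Rightarrow> expr" where
  "cx (N k) = Const k"
| "cx (X a e) = Mem (adr a (cx e))"
| "cx (Add d e) = Plus (cx d) (cx e)"
| "cx (Sub d e) = Minus (cx d) (cx e)"

lemma val_cx [simp]: "val (cx e) m = ev e (arr m)"
  by (induction e) (simp_all add: arr_def)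

definition SET :: "vr \<Rightarrow> hx \<Rightarrow> hx \<Rightarrow> com" where
  "SET a i e = Assign (adr a (cx i)) (cx e)"
definition QRY :: "vr \<Rightarrow> hx \<Rightarrow> hx \<Rightarrow> hx \<Rightarrow> com" where
  "QRY a i e f = Query (adr a (cx i)) (cx e) (cx f)"
definition IFP :: "hx \<Rightarrow> com \<Rightarrow> com \<Rightarrow> com" where
  "IFP e c d = Cond (cx e) c d"
definition WHILE :: "hx \<Rightarrow> com \<Rightarrow> com" where
  "WHILE e c = Loop (cx e) c"
abbreviation LET :: "vr \<Rightarrow> hx \<Rightarrow> com" where
  "LET a e \<equiv> SET a (N 0) e"
abbreviation Seqr (infixr \<open>;;\<close> 60) where "c ;; d \<equiv> Seq c d"

text \<open>A loop whose number of iterations is at most \<open>Y\<close> adds 2 to the exponent of the time bound.\<close>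

fun ex :: "com \<Rightarrow> nat" where
  "ex (Seq c d) = ex c + ex d + 1"
| "ex (Cond e c d) = ex c + ex d + 1"
| "ex (Loop e c) = ex c + 2"
| "ex _ = 0"

text \<open>A total-correctness judgement in backward style. The time bound is read off the syntax:
  \<open>Y\<close> bounds the iterations of every loop and \<open>ex\<close> counts the factors, so
  the program proofs contain no time accounting.\<close>

definition H :: "outcomes \<Rightarrow> nat \<Rightarrow> com \<Rightarrow> arrs \<Rightarrow> (nat \<times> nat) list \<Rightarrow>
    (arrs \<Rightarrow> (nat \<times> nat) list \<Rightarrow> bool) \<Rightarrow> bool" where
  "H q Y c h tr R \<longleftrightarrow> (\<forall>m. arr m = h \<longrightarrow>
     (\<exists>m' t tr'. big q c m m' t tr' \<and> t \<le> Y ^ ex c \<and> R (arr m') (tr @ tr')))"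

lemma H_conseq: "H q Y c h tr R \<Longrightarrow> (\<And>h' tr'. R h' tr' \<Longrightarrow> R' h' tr') \<Longrightarrow> H q Y c h tr R'"
  unfolding H_def by blast

lemma H_skip: "R h tr \<Longrightarrow> H q Y Skip h tr R"
  unfolding H_def using big.intros(1) by fastforce

lemma H_set: "R (up h a (ev i h) (ev e h)) tr \<Longrightarrow> H q Y (SET a i e) h tr R"
  unfolding H_def SET_def
proof (intro allI impI)
  fix m assume R: "R (up h a (ev i h) (ev e h)) tr" and m: "arr m = h"
  show "\<exists>m' t tr'. big q (Assign (adr a (cx i)) (cx e)) m m' t tr' \<and>
      t \<le> Y ^ ex (Assign (adr a (cx i)) (cx e)) \<and> R (arr m') (tr @ tr')"
    by (rule exI, rule exI, rule exI, rule conjI, rule big.intros(2)) (use R m in \<open>simp add: arr_update\<close>)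
qed

lemma H_qry:
  "R (up h a (ev i h) (q (nat (ev e h)) (nat (ev f h)))) (tr @ [(nat (ev e h), nat (ev f h))]) \<Longrightarrow>
   H q Y (QRY a i e f) h tr R"
  unfolding H_def QRY_def
proof (intro allI impI)
  fix m assume R: "R (up h a (ev i h) (q (nat (ev e h)) (nat (ev f h))))
      (tr @ [(nat (ev e h), nat (ev f h))])" and m: "arr m = h"
  show "\<exists>m' t tr'. big q (Query (adr a (cx i)) (cx e) (cx f)) m m' t tr' \<and>
      t \<le> Y ^ ex (Query (adr a (cx i)) (cx e) (cx f)) \<and> R (arr m') (tr @ tr')"
    by (rule exI, rule exI, rule exI, rule conjI, rule big.intros(3)) (use R m in \<open>simp add: arr_update\<close>)
qed

lemma H_seq:
  assumes "H q Y c h tr (\<lambda>h' tr'. H q Y d h' tr' R)" "Y \<ge> 3"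
  shows "H q Y (Seq c d) h tr R"
  unfolding H_def
proof (intro allI impI)
  fix m assume "arr m = h"
  with assms(1) obtain m' t tr' where 1: "big q c m m' t tr'" "t \<le> Y ^ ex c"
    "H q Y d (arr m') (tr @ tr') R" unfolding H_def[of q Y c] by blast
  from 1(3) obtain m'' t' tr'' where 2: "big q d m' m'' t' tr''" "t' \<le> Y ^ ex d"
    "R (arr m'') ((tr @ tr') @ tr'')" unfolding H_def by blast
  have "Suc (t + t') \<le> Y ^ ex (Seq c d)"
  proof -
    define A B where "A = Y ^ ex c" and "B = Y ^ ex d"
    have AB: "A \<ge> 1" "B \<ge> 1" using assms(2) by (auto simp: A_def B_def)
    have "A * 1 \<le> A * B" "1 * B \<le> A * B" using AB by (intro mult_le_mono; simp)+
    then have "Suc (A + B) \<le> 3 * (A * B)" using AB by linarith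
    also have "\<dots> \<le> Y * (A * B)" using assms(2) by simp
    finally show ?thesis using 1 2 by (simp add: A_def B_def power_add)
  qed
  with big.intros(4)[OF 1(1) 2(1)] 2(3)
  show "\<exists>m' t tr'. big q (Seq c d) m m' t tr' \<and> t \<le> Y ^ ex (Seq c d) \<and> R (arr m') (tr @ tr')"
    by (intro exI[of _ m''] exI[of _ "Suc (t + t')"] exI[of _ "tr' @ tr''"]) simp
qed

lemma H_if:
  assumes "ev e h > 0 \<Longrightarrow> H q Y c h tr R" "ev e h \<le> 0 \<Longrightarrow> H q Y d h tr R" "Y \<ge> 3"
  shows "H q Y (IFP e c d) h tr R"
  unfolding H_def
proof (intro allI impI)
  fix m assume m: "arr m = h"
  define A B where "A = Y ^ ex c" and "B = Y ^ ex d"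
  have AB: "A \<ge> 1" "B \<ge> 1" using assms(3) by (auto simp: A_def B_def)
  have "A * 1 \<le> A * B" "1 * B \<le> A * B" using AB by (intro mult_le_mono; simp)+
  then have "Suc A \<le> 3 * (A * B)" "Suc B \<le> 3 * (A * B)" using AB by linarith+
  moreover have "3 * (A * B) \<le> Y * (A * B)" using assms(3) by simp
  moreover have "Y ^ ex (IFP e c d) = Y * (A * B)" by (simp add: IFP_def A_def B_def power_add)
  ultimately have le: "Suc A \<le> Y ^ ex (IFP e c d)" "Suc B \<le> Y ^ ex (IFP e c d)"
    by (metis order_trans)+
  show "\<exists>m' t tr'. big q (IFP e c d) m m' t tr' \<and> t \<le> Y ^ ex (IFP e c d) \<and>
      R (arr m') (tr @ tr')"
  proof (cases "ev e h > 0")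
    case True
    with assms(1) m obtain m' t tr' where 1: "big q c m m' t tr'" "t \<le> A" "R (arr m') (tr @ tr')"
      unfolding H_def A_def by blast
    then have "big q (IFP e c d) m m' (Suc t) tr'"
      unfolding IFP_def using True m by (intro big.intros) auto
    moreover have "Suc t \<le> Y ^ ex (IFP e c d)" using 1 le by linarith
    ultimately show ?thesis using 1 by blast
  next
    case False
    with assms(2) m obtain m' t tr' where 1: "big q d m m' t tr'" "t \<le> B" "R (arr m') (tr @ tr')"
      unfolding H_def B_def by (metis not_less)
    then have "big q (IFP e c d) m m' (Suc t) tr'"
      unfolding IFP_def using False m by (intro big.intros(6)) auto
    moreover have "Suc t \<le> Y ^ ex (IFP e c d)" using 1 le by linarith
    ultimately show ?thesis using 1 by blast
  qed
qed

lemma big_loop_count: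
  assumes "\<And>i m tr. i < K \<Longrightarrow> I i m tr \<Longrightarrow> val e m > 0 \<and>
      (\<exists>m' t tr'. big q c m m' t tr' \<and> t \<le> B \<and> I (Suc i) m' (tr @ tr'))"
    and "\<And>m tr. I K m tr \<Longrightarrow> val e m \<le> 0" "j \<le> K" "I j m tr"
  shows "\<exists>m' t tr'. big q (Loop e c) m m' t tr' \<and> t \<le> (K - j) * Suc B + 1 \<and> I K m' (tr @ tr')"
  using assms(3,4)
proof (induction "K - j" arbitrary: j m tr)
  case 0
  then have "j = K" by simp
  with 0 assms(2) show ?case
    by (intro exI[of _ m] exI[of _ "Suc 0"] exI[of _ "[]"]) (auto intro: big.intros(7))
next
  case (Suc x)
  then have "j < K" by simp
  from assms(1)[OF this Suc.prems(2)] obtain m' t tr' where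
    1: "val e m > 0" "big q c m m' t tr'" "t \<le> B" "I (Suc j) m' (tr @ tr')" by blast
  have "x = K - Suc j" "Suc j \<le> K" using Suc.hyps(2) \<open>j < K\<close> by auto
  from Suc.hyps(1)[OF this 1(4)] obtain m'' t' tr'' where
    2: "big q (Loop e c) m' m'' t' tr''" "t' \<le> (K - Suc j) * Suc B + 1"
    "I K m'' ((tr @ tr') @ tr'')" by blast
  have "K - j = Suc (K - Suc j)" using \<open>j < K\<close> by simp
  then have "Suc (t + t') \<le> (K - j) * Suc B + 1" using 1(3) 2(2) by simp
  with big.intros(8)[OF 1(1,2) 2(1)] 2(3) show ?case
    by (intro exI[of _ m''] exI[of _ "Suc (t + t')"] exI[of _ "tr' @ tr''"]) simp
qed

lemma H_while:
  assumes "I 0 h tr"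
    "\<And>i h tr. i < K \<Longrightarrow> I i h tr \<Longrightarrow> ev e h > 0"
    "\<And>i h tr. i < K \<Longrightarrow> I i h tr \<Longrightarrow> H q Y c h tr (I (Suc i))"
    "\<And>h tr. I K h tr \<Longrightarrow> ev e h \<le> 0" "\<And>h tr. I K h tr \<Longrightarrow> R h tr" "K \<le> Y" "Y \<ge> 3"
  shows "H q Y (WHILE e c) h tr R"
  unfolding H_def
proof (intro allI impI)
  fix m assume m: "arr m = h"
  define B where "B = Y ^ ex c"
  have "B \<ge> 1" using assms(7) by (simp add: B_def)
  have "\<exists>m' t tr'. big q (Loop (cx e) c) m m' t tr' \<and> t \<le> (K - 0) * Suc B + 1 \<and>
      I K (arr m') (tr @ tr')"
  proof (rule big_loop_count[where I = "\<lambda>i m. I i (arr m)"])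
    fix i m tr assume "i < K" "I i (arr m) tr"
    with assms(2,3) show "val (cx e) m > 0 \<and>
      (\<exists>m' t tr'. big q c m m' t tr' \<and> t \<le> B \<and> I (Suc i) (arr m') (tr @ tr'))"
      unfolding H_def B_def by (metis val_cx)
  qed (use assms m in auto)
  then obtain m' t tr' where 1: "big q (Loop (cx e) c) m m' t tr'" "t \<le> K * Suc B + 1"
      "I K (arr m') (tr @ tr')" by auto
  have "K * Suc B + 1 \<le> Y * (2 * B) + Y * B"
    using assms(6,7) \<open>B \<ge> 1\<close> by (intro add_mono mult_le_mono) (auto simp: Suc_le_eq)
  also have "\<dots> = 3 * (Y * B)" by simp
  also have "\<dots> \<le> Y * (Y * B)" using assms(7) by (intro mult_le_mono) auto
  finally have "t \<le> Y ^ ex (WHILE e c)" using 1(2) by (simp add: WHILE_def B_def)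
  with 1 assms(5) show "\<exists>m' t tr'. big q (WHILE e c) m m' t tr' \<and> t \<le> Y ^ ex (WHILE e c) \<and>
      R (arr m') (tr @ tr')" unfolding WHILE_def by blast
qed

section \<open>The sorting program\<close>

definition TBL :: "vr \<Rightarrow> hx \<Rightarrow> hx \<Rightarrow> com" where
  "TBL a s c = SET a (N 0) (N 0) ;; LET vi (N 0) ;;
     WHILE (c \<ominus> \<section>vi) (SET a (\<section>vi \<oplus> N 1) (X a \<section>vi \<oplus> s) ;; LET vi (\<section>vi \<oplus> N 1))"

definition MUL :: "vr \<Rightarrow> hx \<Rightarrow> hx \<Rightarrow> com" where
  "MUL a c s = TBL vTMP s c ;; LET a (X vTMP c)"

definition MEDIAN :: com where
  "MEDIAN = LET vTOT (N 0) ;; LET vi (N 0) ;;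
     WHILE (\<section>vBB \<oplus> N 1 \<ominus> \<section>vi) (LET vTOT (\<section>vTOT \<oplus> X vMU \<section>vi) ;; LET vi (\<section>vi \<oplus> N 1)) ;;
     LET vR (N 0) ;; LET vACC (X vMU (N 0)) ;;
     WHILE (\<section>vTOT \<ominus> \<section>vACC \<ominus> \<section>vACC)
       (LET vR (\<section>vR \<oplus> N 1) ;; LET vACC (\<section>vACC \<oplus> X vMU \<section>vR))"

definition TEST :: com where
  "TEST = LET vSUM (N 0) ;; LET vj (N 0) ;;
     WHILE (\<section>vM \<ominus> \<section>vj)
       (QRY vTMP (N 0) \<section>vX (X vL (X vBV \<section>vPP \<oplus> \<section>vTM \<oplus> \<section>vj)) ;;
        LET vSUM (\<section>vSUM \<oplus> \<section>vTMP) ;; LET vj (\<section>vj \<oplus> N 1)) ;;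
     LET vi (N 0) ;;
     WHILE (\<section>vBB \<oplus> N 1 \<ominus> \<section>vi)
       (IFP \<section>vSUM
          (IFP (\<section>vi \<oplus> N 2 \<ominus> \<section>vPP) (SET vMU \<section>vi (X vMU \<section>vi \<oplus> X vMU \<section>vi)) Skip)
          (IFP (\<section>vPP \<oplus> N 2 \<ominus> \<section>vi) (SET vMU \<section>vi (X vMU \<section>vi \<oplus> X vMU \<section>vi)) Skip) ;;
        LET vi (\<section>vi \<oplus> N 1))"

text \<open>The first loop stops at \<open>k div V\<close>, advancing \<open>vBB\<close> as long as
  the next multiple of \<open>V\<close> is at most \<open>k\<close>. The group offset
  \<open>t m\<close> is accumulated in \<open>vTM\<close>, again to avoid a multiplication.\<close>

definition SEARCH :: com where
  "SEARCH = LET vX (\<section>vK \<oplus> N 1) ;; LET vBB (N 0) ;;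
     WHILE (\<section>vK \<oplus> N 1 \<ominus> X vBV (\<section>vBB \<oplus> N 1)) (LET vBB (\<section>vBB \<oplus> N 1)) ;;
     LET vi (N 0) ;;
     WHILE (\<section>vBB \<oplus> N 1 \<ominus> \<section>vi) (SET vMU \<section>vi (N 1) ;; LET vi (\<section>vi \<oplus> N 1)) ;;
     LET vTM (N 0) ;; LET vp (N 0) ;;
     WHILE (\<section>vT \<ominus> \<section>vp)
       (MEDIAN ;;
        IFP (\<section>vR \<ominus> N 1) (LET vPP (\<section>vR \<ominus> N 2) ;; TEST) Skip ;;
        IFP (\<section>vBB \<ominus> \<section>vR \<ominus> N 2) (LET vPP (\<section>vR \<oplus> N 2) ;; TEST) Skip ;;
        LET vTM (\<section>vTM \<oplus> \<section>vM) ;; LET vp (\<section>vp \<oplus> N 1)) ;;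
     MEDIAN ;; LET vPOS (X vBV \<section>vR)"

section \<open>Frame conditions and correctness of the search program\<close>

definition eqx :: "vr set \<Rightarrow> arrs \<Rightarrow> arrs \<Rightarrow> bool" where
  "eqx A h h' \<longleftrightarrow> (\<forall>b. b \<notin> A \<longrightarrow> h' b = h b)"

lemma eqx_refl: "eqx A h h" by (simp add: eqx_def)

lemma eqx_up: "eqx A h h' \<Longrightarrow> a \<in> A \<Longrightarrow> eqx A h (up h' a i v)" by (simp add: eqx_def)
lemma eqxD: "eqx A h h' \<Longrightarrow> b \<notin> A \<Longrightarrow> h' b = h b" unfolding eqx_def by blast
lemma eqx_trans: "eqx A h h' \<Longrightarrow> eqx B h' h'' \<Longrightarrow> A \<subseteq> C \<Longrightarrow> B \<subseteq> C \<Longrightarrow> eqx C h h''"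
  unfolding eqx_def by (metis subsetD)
lemmas eqx_intros = eqx_refl eqx_up

definition LST :: "vr \<Rightarrow> arrs \<Rightarrow> nat list \<Rightarrow> bool" where
  "LST a h xs \<longleftrightarrow> (\<forall>i<length xs. h a (int i) = int (xs ! i))"

lemma LST_eqx: "LST a h xs \<Longrightarrow> eqx A h h' \<Longrightarrow> a \<notin> A \<Longrightarrow> LST a h' xs"
  unfolding LST_def using eqxD by metis

lemma LST_nth: "LST a h xs \<Longrightarrow> i < length xs \<Longrightarrow> h a (int i) = int (xs ! i)"
  by (simp add: LST_def)

locale machine =
  fixes n m T V w cc Y :: nat
  assumes V: "V = T * m" "0 < T" "0 < m"
    and Y: "n + 2 \<le> Y" "T \<le> Y" "m \<le> Y" "2 ^ (2 * w) \<le> Y" "2 * w + 1 \<le> Y" "3 \<le> Y"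
begin

lemmas Hseq = H_seq[OF _ Y(6)]
lemmas Hif = H_if[OF _ _ Y(6)]
lemmas Hwhile = H_while[OF _ _ _ _ _ _ Y(6)]

lemma Vpos: "0 < V" using V by simp

definition CON :: "arrs \<Rightarrow> bool" where
  "CON h \<longleftrightarrow> h vN 0 = int n \<and> h vM 0 = int m \<and> h vT 0 = int T \<and> h vW 0 = int w \<and> h vCC 0 = int cc \<and>
     h vSZ 0 = 2 ^ (2 * w) \<and>
     (\<forall>i\<le>n + 1. h vROW (int i) = int (i * (n + 1)) \<and> h vBV (int i) = int (i * V) \<and>
        h vPB (int i) = int (i * 2 ^ (2 * w))) \<and>
     (\<forall>i\<le>2 * w. h vPOW (int i) = 2 ^ i)"

definition con_vars :: "vr set" where
  "con_vars = {vN, vM, vT, vW, vCC, vSZ, vROW, vBV, vPB, vPOW}"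

lemma CON_eqx:
  assumes "CON h" "eqx A h h'" "A \<inter> con_vars = {}"
  shows "CON h'"
proof -
  have "\<And>b. b \<in> con_vars \<Longrightarrow> h' b = h b" using assms by (auto simp: eqx_def)
  then show ?thesis using assms(1) by (simp add: CON_def con_vars_def)
qed

lemma H_TBL:
  assumes "a \<noteq> vi" "\<And>h'. eqx {a, vi} h h' \<Longrightarrow> ev s h' = sv" "\<And>h'. eqx {a, vi} h h' \<Longrightarrow> ev c h' = int cv"
    "cv \<le> Y"
    "\<And>h'. eqx {a, vi} h h' \<Longrightarrow> (\<And>j. j \<le> cv \<Longrightarrow> h' a (int j) = int j * sv) \<Longrightarrow> R h' tr"
  shows "H q Y (TBL a s c) h tr R"
  unfolding TBL_def
  apply (rule Hseq H_set)+
  apply (rule Hwhile[where K = cv and I = "\<lambda>i h' tr'. tr' = tr \<and> eqx {a, vi} h h' \<and> h' vi 0 = int i \<and>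
     (\<forall>j\<le>i. h' a (int j) = int j * sv)"])
  subgoal using assms(1) by (auto intro!: eqx_intros)
  subgoal using assms(3) by simp
  subgoal for i h' tr'
    apply (rule Hseq H_set)+
    using assms(1,2) by (auto intro!: eqx_intros simp: algebra_simps le_Suc_eq)
  subgoal using assms(3) by simp
  subgoal using assms(5) by auto
  by (rule assms(4))

lemma H_MUL:
  assumes "\<And>h'. eqx {vTMP, vi} h h' \<Longrightarrow> ev s h' = sv" "\<And>h'. eqx {vTMP, vi} h h' \<Longrightarrow> ev c h' = int cv"
    "cv \<le> Y" "a \<notin> {vTMP, vi}"
    "\<And>h'. eqx {vTMP, vi, a} h h' \<Longrightarrow> h' a 0 = int cv * sv \<Longrightarrow> R h' tr"
  shows "H q Y (MUL a c s) h tr R"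
  unfolding MUL_def
  apply (rule Hseq)
  apply (rule H_TBL[OF _ assms(1,2,3)])
     apply simp
    apply assumption
   apply assumption
  apply (rule H_set)
  apply (rule assms(5))
  subgoal by (auto simp: eqx_def)
  subgoal using assms(2) by simp
  done

lemma H_MEDIAN:
  assumes "h vBB 0 = int B" "\<And>p. p \<le> B \<Longrightarrow> h vMU (int p) = int (\<mu> p)" "\<mu> 0 > 0" "B \<le> n"
    "\<And>h'. eqx {vTOT, vi, vR, vACC} h h' \<Longrightarrow> h' vR 0 = int (median B \<mu>) \<Longrightarrow> R h' tr"
  shows "H q Y MEDIAN h tr R"
proof -
  note med = median_props[of \<mu> B, OF assms(3)]
  show ?thesis
  unfolding MEDIAN_def
  apply (rule Hseq H_set)+
  apply (rule Hwhile[where K = "B + 1" and I = "\<lambda>i h' tr'. tr' = tr \<and> eqx {vTOT, vi} h h' \<and>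
     h' vi 0 = int i \<and> h' vTOT 0 = int (\<Sum>p<i. \<mu> p)"])
  subgoal by (auto intro!: eqx_intros)
  subgoal using assms(1) by (simp add: eqx_def)
  subgoal for i h' tr'
    apply (rule Hseq H_set)+
    using assms(2)[of i] by (auto intro!: eqx_intros simp: eqx_def)
  subgoal using assms(1) by (simp add: eqx_def)
  subgoal for h1 tr1
    apply (rule Hseq H_set)+
    apply (rule Hwhile[where K = "median B \<mu>" and I = "\<lambda>i h' tr'. tr' = tr \<and>
       eqx {vTOT, vi, vR, vACC} h h' \<and> h' vTOT 0 = int (\<Sum>p\<le>B. \<mu> p) \<and>
       h' vR 0 = int i \<and> h' vACC 0 = int (\<Sum>p\<le>i. \<mu> p)"])
    subgoal using assms(2)[of 0] by (auto intro!: eqx_intros simp: eqx_def lessThan_Suc_atMost)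
    subgoal for i h' tr'
    proof -
      assume "i < median B \<mu>" and I: "tr' = tr \<and>
       eqx {vTOT, vi, vR, vACC} h h' \<and> h' vTOT 0 = int (\<Sum>p\<le>B. \<mu> p) \<and>
       h' vR 0 = int i \<and> h' vACC 0 = int (\<Sum>p\<le>i. \<mu> p)"
      then have "(\<Sum>p\<le>i. \<mu> p) \<le> (\<Sum>p<median B \<mu>. \<mu> p)" by (intro sum_mono2) auto
      with med(3) have "2 * (\<Sum>p\<le>i. \<mu> p) < (\<Sum>p\<le>B. \<mu> p)" by linarith
      then show ?thesis using I by (simp del: of_nat_sum)
    qed
    subgoal for i h' tr'
      apply (rule Hseq H_set)+
      using assms(2)[of "Suc i"] med(1) by (auto intro!: eqx_intros simp: eqx_def add.commute)
    subgoal using med(2) by (simp del: of_nat_sum)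
    subgoal using assms(5) by auto
    subgoal using med(1) assms(4) Y(1) by simp
    done
  subgoal using assms(4) Y(1) by simp
  done
qed

lemma H_TEST:
  assumes con: "CON h" and x: "h vX 0 = int x" and b: "h vPP 0 = int b" "b \<le> n" and t: "h vTM 0 = int (t * m)"
    and L: "LST vL h ys" and bd: "b * V + t * m + m \<le> length ys"
    and B: "h vBB 0 = int B" "B \<le> n" and MU: "\<And>p. p \<le> B \<Longrightarrow> h vMU (int p) = int (\<mu> p)"
    and R: "\<And>h'. eqx {vSUM, vj, vTMP, vi, vMU} h h' \<Longrightarrow>
      (\<And>p. p \<le> B \<Longrightarrow> h' vMU (int p) = int (reweigh (test_sum q ys V m x b t > 0) b \<mu> p)) \<Longrightarrow>
      R h' (tr @ map (\<lambda>j. (x, ys ! (b * V + t * m + j))) [0..<m])"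
  shows "H q Y TEST h tr R"
proof -
  have BV: "h vBV (int b) = int (b * V)" and M: "h vM 0 = int m" using con b(2) by (auto simp: CON_def)
  show ?thesis
  unfolding TEST_def
  apply (rule Hseq H_set)+
  apply (rule Hwhile[where K = m and I = "\<lambda>i h' tr'. tr' = tr @ map (\<lambda>j. (x, ys ! (b * V + t * m + j))) [0..<i] \<and>
     eqx {vSUM, vj, vTMP} h h' \<and> h' vj 0 = int i \<and> h' vSUM 0 = (\<Sum>j<i. q x (ys ! (b * V + t * m + j)))"])
  subgoal by (auto intro!: eqx_intros)
  subgoal using M by (simp add: eqx_def)
  subgoal for i h' tr'
    apply (rule Hseq H_set H_qry)+
    using LST_nth[OF L, of "b * V + t * m + i"] bd BV x b t
    by (auto intro!: eqx_intros simp: eqx_def)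
  subgoal using M by (simp add: eqx_def)
  subgoal for h1 tr1
    apply (rule Hseq H_set)+
    apply (rule Hwhile[where K = "B + 1" and I = "\<lambda>i h' tr'. tr' = tr1 \<and>
       eqx {vSUM, vj, vTMP, vi, vMU} h h' \<and> h' vi 0 = int i \<and> h' vSUM 0 = test_sum q ys V m x b t \<and>
       (\<forall>p\<le>B. h' vMU (int p) = int (if p < i then reweigh (test_sum q ys V m x b t > 0) b \<mu> p else \<mu> p))"])
    subgoal using MU by (auto intro!: eqx_intros simp: eqx_def test_sum_def)
    subgoal using B by (simp add: eqx_def)
    subgoal for i h' tr'
      apply (intro Hseq H_set Hif H_skip)
      using b by (auto intro!: eqx_intros simp: eqx_def reweigh_def supports_def less_Suc_eq split: if_splits)
    subgoal using B by (simp add: eqx_def)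
    subgoal using R by auto
    subgoal using B Y(1) by simp
    done
  subgoal using Y(3) by simp
  done
qed

text \<open>Answers determine pivots, and pivots determine which blocks are asked. Recursion on the
  weights resolves the circle, because the pivot of step \<open>t\<close> depends only on earlier
  answers.\<close>

lemma ex_transcript:
  obtains \<omega> where "\<And>t. \<omega> t = (test_sum q ys V m x (pivot B \<omega> t - 2) t > 0,
    test_sum q ys V m x (pivot B \<omega> t + 2) t > 0)" "\<And>T. transcript q ys B V m x T \<omega>"
proof -
  define nxt where "nxt t \<mu> = (test_sum q ys V m x (median B \<mu> - 2) t > 0,
    test_sum q ys V m x (median B \<mu> + 2) t > 0)" for t and \<mu> :: "nat \<Rightarrow> nat"
  define rw where "rw = rec_nat (\<lambda>_. 1) (\<lambda>t \<mu>. search_step B (nxt t \<mu>) \<mu>)"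
  define \<omega> where "\<omega> t = nxt t (rw t)" for t
  have "weights B \<omega> t = rw t" for t
    by (induction t) (simp_all add: rw_def \<omega>_def)
  then have \<omega>: "\<omega> t = (test_sum q ys V m x (pivot B \<omega> t - 2) t > 0,
    test_sum q ys V m x (pivot B \<omega> t + 2) t > 0)" for t by (simp add: \<omega>_def nxt_def)
  moreover have "transcript q ys B V m x T \<omega>" for T
    unfolding transcript_def
  proof (intro allI impI)
    fix z b assume "test_at B \<omega> z b"
    then show "answer \<omega> z = (0 < test_sum q ys V m x b (fst z))"
      using \<omega>[of "fst z"] by (cases "snd z") (simp_all add: test_at_def answer_def)
  qed
  ultimately show thesis using that by blast
qed

lemma H_SEARCH:
  assumes con: "CON h" and K: "h vK 0 = int k" "k < n" and L: "LST vL h ys" "length ys = k"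
    and \<omega>: "\<And>t. \<omega> t = (test_sum q ys V m (Suc k) (pivot (k div V) \<omega> t - 2) t > 0,
    test_sum q ys V m (Suc k) (pivot (k div V) \<omega> t + 2) t > 0)"
    and R: "\<And>h' tr'. eqx {vX, vBB, vi, vMU, vTM, vp, vTOT, vR, vACC, vPP, vSUM, vj, vTMP, vPOS} h h' \<Longrightarrow>
      h' vX 0 = int (Suc k) \<Longrightarrow> h' vPOS 0 = int (pivot (k div V) \<omega> T * V) \<Longrightarrow>
      length tr' \<le> length tr + 2 * T * m \<Longrightarrow> set tr' \<subseteq> set tr \<union> {Suc k} \<times> set ys \<Longrightarrow> R h' tr'"
  shows "H q Y SEARCH h tr R"
proof -
  let ?B = "k div V"
  let ?A = "{vX, vBB, vi, vMU, vTM, vp, vTOT, vR, vACC, vPP, vSUM, vj, vTMP}"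
  have BV: "h vBV (int i) = int (i * V)" if "i \<le> n + 1" for i using con that by (simp add: CON_def)
  have Bk: "?B \<le> k" by simp
  have Bn: "?B \<le> n" using K(2) Bk by linarith
  have TM: "h vT 0 = int T" "h vM 0 = int m" using con by (auto simp: CON_def)
  have in_range: "b * V + t * m + m \<le> length ys" if "b < ?B" "t < T" for b t
  proof -
    have "t * m + m \<le> V" using that V(1) mult_le_mono1[of "Suc t" T m] by simp
    then have "b * V + t * m + m \<le> Suc b * V" by simp
    also have "\<dots> \<le> ?B * V" using that by (intro mult_le_mono1) simp
    also have "\<dots> \<le> k" by simp
    finally show ?thesis by (simp add: L)
  qed
  \<comment> \<open>Here \<open>t\<close> counts tests; a step makes at most two of them, which
    explains \<open>TR (2 * t)\<close> in the loop invariant.\<close>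
  define TR where "TR t tr' \<longleftrightarrow> length tr' \<le> length tr + t * m \<and> set tr' \<subseteq> set tr \<union> {Suc k} \<times> set ys"
    for t and tr' :: "(nat \<times> nat) list"
  have TR_add: "TR (Suc s) (tr' @ map (\<lambda>j. (Suc k, ys ! (b * V + t * m + j))) [0..<m])"
    if "TR s tr'" "b * V + t * m + m \<le> length ys" for s t b tr'
  proof -
    have "ys ! (b * V + t * m + j) \<in> set ys" if "j < m" for j
      using that \<open>b * V + t * m + m \<le> length ys\<close> by (intro nth_mem) simp
    then show ?thesis using that(1) by (auto simp: TR_def)
  qed
  have TR_mono: "TR s tr' \<Longrightarrow> s \<le> s' \<Longrightarrow> TR s' tr'" for s s' tr'
    unfolding TR_def using mult_le_mono1[of s s' m] by linarith
  define W where "W = weights ?B \<omega>"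
  have Wpos: "W t p > 0" for t p by (simp add: W_def weights_pos)
  have med: "median ?B (W t) \<le> ?B" for t by (rule median_props(1)[OF Wpos])
  have Wstep: "W (Suc t) = (let r = median ?B (W t);
      \<mu> = if 2 \<le> r then reweigh (test_sum q ys V m (Suc k) (r - 2) t > 0) (r - 2) (W t) else W t in
      if r + 2 < ?B then reweigh (test_sum q ys V m (Suc k) (r + 2) t > 0) (r + 2) \<mu> else \<mu>)" for t
    using \<omega>[of t] by (simp add: W_def search_step_def Let_def)
  define INV where "INV t h' \<longleftrightarrow> eqx ?A h h' \<and> h' vX 0 = int (Suc k) \<and> h' vBB 0 = int ?B \<and>
     h' vTM 0 = int (t * m) \<and> h' vp 0 = int t" for t h'
  have pre: "CON h'" "LST vL h' ys" if "INV t h'" for t h'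
    using that CON_eqx[OF con, of ?A h'] LST_eqx[OF L(1), of ?A h'] by (auto simp: INV_def con_vars_def)
  have INV_eqx: "INV t h''" if "INV t h'" "eqx {vTOT, vi, vR, vACC, vPP, vSUM, vj, vTMP, vMU} h' h''" for t h' h''
    using that eqx_trans[of ?A h h' _ h'' ?A] by (auto simp: INV_def eqx_def)
  have TESTS: "H q Y TEST h' tr' (\<lambda>h'' tr''. INV t h'' \<and> TR (Suc s) tr'' \<and> h'' vR 0 = h' vR 0 \<and>
      (\<forall>p\<le>?B. h'' vMU (int p) = int (reweigh (test_sum q ys V m (Suc k) b t > 0) b \<mu> p)))"
    if "INV t h'" "TR s tr'" "h' vPP 0 = int b" "b < ?B" "t < T" "\<And>p. p \<le> ?B \<Longrightarrow> h' vMU (int p) = int (\<mu> p)"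
    for h' tr' b \<mu> t s
  proof (rule H_TEST[where B = ?B and x = "Suc k" and ys = ys and b = b and t = t and \<mu> = \<mu>])
    fix h'' assume e: "eqx {vSUM, vj, vTMP, vi, vMU} h' h''"
      and MU: "\<And>p. p \<le> ?B \<Longrightarrow> h'' vMU (int p) = int (reweigh (test_sum q ys V m (Suc k) b t > 0) b \<mu> p)"
    have "INV t h''" by (rule INV_eqx[OF that(1)]) (use e in \<open>auto simp: eqx_def\<close>)
    moreover have "h'' vR 0 = h' vR 0" using e by (simp add: eqx_def)
    ultimately show "INV t h'' \<and> TR (Suc s) (tr' @ map (\<lambda>j. (Suc k, ys ! (b * V + t * m + j))) [0..<m]) \<and>
      h'' vR 0 = h' vR 0 \<and>
      (\<forall>p\<le>?B. h'' vMU (int p) = int (reweigh (test_sum q ys V m (Suc k) b t > 0) b \<mu> p))"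
      using TR_add[OF that(2) in_range[OF that(4,5)]] MU by blast
  qed (use that pre[OF that(1)] in_range[OF that(4,5)] Bn in \<open>auto simp: INV_def\<close>)
  show ?thesis
    unfolding SEARCH_def
    apply (rule Hseq H_set)+
    apply (rule Hwhile[where K = ?B and I = "\<lambda>i h' tr'. tr' = tr \<and> eqx ?A h h' \<and>
       h' vX 0 = int (Suc k) \<and> h' vBB 0 = int i"])
    subgoal using K by (auto intro!: eqx_intros)
    subgoal for i h' tr'
    proof -
      assume "i < ?B" and I: "tr' = tr \<and> eqx ?A h h' \<and> h' vX 0 = int (Suc k) \<and> h' vBB 0 = int i"
      then have "Suc i * V \<le> ?B * V" by (intro mult_le_mono1) simp
      also have "\<dots> \<le> k" by simp
      finally have "int (Suc i * V) \<le> int k" by (simp only: of_nat_le_iff)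
      moreover have "h vBV (1 + int i) = int (Suc i * V)" using BV[of "Suc i"] \<open>i < ?B\<close> Bn by simp
      ultimately show ?thesis using I K(1) by (simp add: eqx_def add.commute)
    qed
    subgoal for i h' tr'
      apply (rule H_set)
      by (auto intro!: eqx_intros)
    subgoal for h' tr'
    proof -
      assume I: "tr' = tr \<and> eqx ?A h h' \<and> h' vX 0 = int (Suc k) \<and> h' vBB 0 = int ?B"
      have "k < Suc ?B * V" using dividend_less_div_times[OF Vpos, of k] by simp
      then have "int k < int (Suc ?B * V)" by (simp only: of_nat_less_iff)
      moreover have "h vBV (1 + int ?B) = int (Suc ?B * V)" using BV[of "Suc ?B"] Bn by simp
      ultimately show ?thesis using I K(1) by (simp add: eqx_def add.commute)
    qed
    subgoal for h1 tr1
      apply (rule Hseq H_set)+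
      apply (rule Hwhile[where K = "?B + 1" and I = "\<lambda>i h' tr'. tr' = tr \<and> eqx ?A h h' \<and>
         h' vX 0 = int (Suc k) \<and> h' vBB 0 = int ?B \<and> h' vi 0 = int i \<and> (\<forall>p<i. h' vMU (int p) = 1)"])
      subgoal by (auto intro!: eqx_intros)
      subgoal by simp
      subgoal for i h' tr'
        apply (rule Hseq H_set)+
        by (auto intro!: eqx_intros)
      subgoal by simp
      subgoal for h2 tr2
        apply (rule Hseq H_set)+
        apply (rule Hwhile[where K = T and I = "\<lambda>t h' tr'. INV t h' \<and> TR (2 * t) tr' \<and>
           (\<forall>p\<le>?B. h' vMU (int p) = int (W t p))"])
        subgoal by (auto intro!: eqx_intros simp: INV_def TR_def W_def)
        subgoal using TM by (auto simp: INV_def eqx_def)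
        subgoal for t h' tr'
        proof -
          assume tT: "t < T" and I: "INV t h' \<and> TR (2 * t) tr' \<and> (\<forall>p\<le>?B. h' vMU (int p) = int (W t p))"
          let ?r = "median ?B (W t)"
          let ?\<mu> = "if 2 \<le> ?r then reweigh (test_sum q ys V m (Suc k) (?r - 2) t > 0) (?r - 2) (W t) else W t"
          show ?thesis
            apply (rule Hseq)
            apply (rule H_MEDIAN[where B = ?B and \<mu> = "W t"])
            subgoal using I by (simp add: INV_def)
            subgoal using I by simp
            subgoal by (rule Wpos)
            subgoal by (rule Bn)
            subgoal for h3
              apply (rule Hseq)
              apply (rule H_conseq[where R = "\<lambda>h'' tr''. INV t h'' \<and> TR (Suc (2 * t)) tr'' \<and>
                h'' vR 0 = int ?r \<and> (\<forall>p\<le>?B. h'' vMU (int p) = int (?\<mu> p))"])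
              subgoal
              proof -
                assume e: "eqx {vTOT, vi, vR, vACC} h' h3" and r: "h3 vR 0 = int ?r"
                have I3: "INV t h3" by (rule INV_eqx) (use I e in \<open>auto simp: eqx_def\<close>)
                have M3: "h3 vMU (int p) = int (W t p)" if "p \<le> ?B" for p
                  using I e that by (simp add: eqx_def)
                show ?thesis
                  apply (intro Hif Hseq H_set H_skip)
                  subgoal
                    apply (rule H_conseq)
                     apply (rule TESTS[where t = t and s = "2 * t" and b = "?r - 2" and \<mu> = "W t"])
                    subgoal by (rule INV_eqx[OF I3]) (auto intro!: eqx_intros)
                    subgoal using I by simp
                    subgoal using r by simp
                    subgoal using r med[of t] by simp
                    subgoal by (rule tT)
                    subgoal using M3 by simp
                    subgoal using r by auto
                    done
                  subgoal using I I3 M3 r TR_mono[of "2 * t" tr' "Suc (2 * t)"] by auto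
                  done
              qed
              subgoal for h4 tr4
                apply (rule Hseq)
                apply (rule H_conseq[where R = "\<lambda>h'' tr''. INV t h'' \<and> TR (2 * Suc t) tr'' \<and>
                  (\<forall>p\<le>?B. h'' vMU (int p) = int (W (Suc t) p))"])
                subgoal
                proof -
                  assume I4: "INV t h4 \<and> TR (Suc (2 * t)) tr4 \<and>
                    h4 vR 0 = int ?r \<and> (\<forall>p\<le>?B. h4 vMU (int p) = int (?\<mu> p))"
                  then have B4: "h4 vBB 0 = int ?B" by (simp add: INV_def)
                  show ?thesis
                    apply (intro Hif Hseq H_set H_skip)
                    subgoal
                      apply (rule H_conseq)
                       apply (rule TESTS[where t = t and s = "Suc (2 * t)" and b = "?r + 2" and \<mu> = ?\<mu>])
                      subgoal by (rule INV_eqx[OF I4[THEN conjunct1]]) (auto intro!: eqx_intros)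
                      subgoal using I4 by simp
                      subgoal using I4 by simp
                      subgoal using I4 B4 by simp
                      subgoal by (rule tT)
                      subgoal using I4 by simp
                      subgoal using I4 B4 by (simp add: Wstep Let_def)
                      done
                    subgoal using I4 B4 TR_mono[of "Suc (2 * t)" tr4 "2 * Suc t"] by (auto simp: Wstep Let_def)
                    done
                qed
                subgoal for h5 tr5
                  apply (rule Hseq H_set)+
                  using TM by (auto simp: INV_def intro!: eqx_intros simp: eqx_def)
                done
              done
            done
        qed
        subgoal using TM by (auto simp: INV_def eqx_def)
        subgoal for h3 tr3
          apply (rule Hseq)
          apply (rule H_MEDIAN[where B = ?B and \<mu> = "W T"])
          subgoal by (simp add: INV_def)
          subgoal by simp
          subgoal by (rule Wpos)
          subgoal by (rule Bn)
          subgoal for h4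
            apply (rule H_set)
            apply (rule R)
            subgoal
              apply (rule eqx_trans[where A = ?A and h' = h3 and B = "{vTOT, vi, vR, vACC, vPOS}"])
              by (auto simp: INV_def eqx_def)
            subgoal by (simp add: INV_def eqx_def)
            subgoal using BV[of "median ?B (W T)"] med[of T] Bn by (simp add: INV_def eqx_def W_def)
            subgoal by (simp add: TR_def)
            subgoal by (simp add: TR_def)
            done
          done
        subgoal by (rule Y(2))
        done
      subgoal using Bn Y(1) by simp
      done
    subgoal using Bn Y(1) by simp
    done
qed

end

section \<open>The insertion of one item as a program\<close>

definition INSERT :: com where
  "INSERT = LET vi (N 0) ;;
     WHILE (\<section>vK \<ominus> \<section>vi)
       (IFP (\<section>vPOS \<ominus> \<section>vi) (SET vZ \<section>vi (X vL \<section>vi)) (SET vZ (\<section>vi \<oplus> N 1) (X vL \<section>vi)) ;;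
        LET vi (\<section>vi \<oplus> N 1)) ;;
     SET vZ \<section>vPOS \<section>vX"

definition ASK :: com where
  "ASK = QRY vTMP (N 0) \<section>vX (X vZ \<section>vi) ;;
     SET vTAB (X vROW \<section>vX \<oplus> X vZ \<section>vi) \<section>vTMP ;;
     SET vTAB (X vROW (X vZ \<section>vi) \<oplus> \<section>vX) (N 0 \<ominus> \<section>vTMP)"

definition COMPARE :: com where
  "COMPARE = LET vi (N 0) ;;
     WHILE (\<section>vX \<ominus> \<section>vi)
       (IFP (\<section>vPOS \<ominus> \<section>vi)
          (IFP (\<section>vCC \<oplus> N 1 \<ominus> \<section>vPOS \<oplus> \<section>vi) ASK Skip)
          (IFP (\<section>vi \<ominus> \<section>vPOS) (IFP (\<section>vCC \<oplus> N 1 \<ominus> \<section>vi \<oplus> \<section>vPOS) ASK Skip) Skip) ;;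
        LET vi (\<section>vi \<oplus> N 1))"

text \<open>Listing a prefix by its predecessor links both adds up what \<open>vJJ\<close> gains
  against it and detects whether \<open>vJJ\<close> has been placed before, so that entries need not
  store their prefix.\<close>

definition WALK :: com where
  "WALK = LET vGAIN (N 0) ;; LET vOK (N 1) ;; LET vPL \<section>vLEV ;; LET vMM \<section>vMASK ;;
     WHILE \<section>vPL
       (LET vTMP (X vJ (X vPB \<section>vPL \<oplus> \<section>vMM)) ;;
        IFP (\<section>vJJ \<ominus> \<section>vTMP) Skip (IFP (\<section>vTMP \<ominus> \<section>vJJ) Skip (LET vOK (N 0))) ;;
        LET vGAIN (\<section>vGAIN \<oplus> X vTAB (X vROW (X vZ \<section>vJJ) \<oplus> X vZ \<section>vTMP)) ;;
        LET vMM (X vP (X vPB \<section>vPL \<oplus> \<section>vMM)) ;;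
        LET vPL (\<section>vPL \<ominus> N 1))"

definition WRITE :: com where
  "WRITE = SET vF \<section>vTMP \<section>vX ;; SET vS \<section>vTMP \<section>vGAIN ;; SET vJ \<section>vTMP \<section>vJJ ;; SET vP \<section>vTMP \<section>vMASK"

definition UPDATE :: com where
  "UPDATE = LET vTMP (X vPB (\<section>vLEV \<oplus> N 1) \<oplus> \<section>vH) ;;
     LET vGAIN (\<section>vGAIN \<oplus> X vS (X vPB \<section>vLEV \<oplus> \<section>vMASK)) ;;
     IFP (X vF \<section>vTMP \<ominus> \<section>vK) (IFP (\<section>vGAIN \<ominus> X vS \<section>vTMP) WRITE Skip) WRITE"

text \<open>\<open>vH\<close> is found by counting, for lack of a division. Whether
  \<open>vTMP\<close> exceeds twice \<open>vH\<close> afterwards is its parity, which is the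
  remaining feasibility condition by \<open>code_snoc\<close>.\<close>

definition EXTEND :: com where
  "EXTEND = WALK ;;
     IFP \<section>vOK
       (LET vTMP (\<section>vMASK \<oplus> X vPOW \<section>vU) ;; LET vH (N 0) ;;
        WHILE (\<section>vTMP \<ominus> N 1 \<ominus> \<section>vH \<ominus> \<section>vH) (LET vH (\<section>vH \<oplus> N 1)) ;;
        IFP (\<section>vTMP \<ominus> \<section>vH \<ominus> \<section>vH) UPDATE Skip)
       Skip"

definition TRANS :: com where
  "TRANS = LET vJJ (\<section>vLEV \<oplus> \<section>vU \<ominus> \<section>vW) ;;
     IFP (\<section>vJJ \<oplus> N 1) (IFP (\<section>vX \<ominus> \<section>vJJ) EXTEND Skip) Skip"

definition STATE :: com where
  "STATE = IFP (X vF (X vPB \<section>vLEV \<oplus> \<section>vMASK) \<ominus> \<section>vK)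
     (LET vU (N 0) ;;
      WHILE (\<section>vW \<oplus> \<section>vW \<oplus> N 1 \<ominus> \<section>vU) (TRANS ;; LET vU (\<section>vU \<oplus> N 1))) Skip"

definition LEVEL :: com where
  "LEVEL = LET vMASK (N 0) ;; WHILE (\<section>vSZ \<ominus> \<section>vMASK) (STATE ;; LET vMASK (\<section>vMASK \<oplus> N 1))"

definition TABLE :: com where
  "TABLE = SET vF (X vPOW \<section>vW \<ominus> N 1) \<section>vX ;; SET vS (X vPOW \<section>vW \<ominus> N 1) (N 0) ;;
     LET vLEV (N 0) ;; WHILE (\<section>vX \<ominus> \<section>vLEV) (LEVEL ;; LET vLEV (\<section>vLEV \<oplus> N 1))"

definition RECON :: com where
  "RECON = LET vPL \<section>vX ;; LET vMM (X vPOW \<section>vW \<ominus> N 1) ;;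
     WHILE \<section>vPL
       (SET vL (\<section>vPL \<ominus> N 1) (X vZ (X vJ (X vPB \<section>vPL \<oplus> \<section>vMM))) ;;
        LET vMM (X vP (X vPB \<section>vPL \<oplus> \<section>vMM)) ;;
        LET vPL (\<section>vPL \<ominus> N 1))"

definition STAGE :: com where
  "STAGE = SEARCH ;; INSERT ;; COMPARE ;; TABLE ;; RECON ;; LET vK (\<section>vK \<oplus> N 1)"

definition insert_at :: "nat \<Rightarrow> nat \<Rightarrow> nat list \<Rightarrow> nat list" where
  "insert_at pos x ys = take pos ys @ x # drop pos ys"

definition asked :: "outcomes \<Rightarrow> nat \<Rightarrow> nat set \<Rightarrow> outcomes \<Rightarrow> outcomes" where
  "asked q x A f a b = (if a = x \<and> b \<in> A then q x b else if b = x \<and> a \<in> A then - q x a else f a b)"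

definition near :: "nat \<Rightarrow> nat \<Rightarrow> nat \<Rightarrow> bool" where
  "near cc pos i \<longleftrightarrow> i \<noteq> pos \<and> i \<le> pos + cc \<and> pos \<le> i + cc"

lemma length_near: "length (filter (near cc pos) [0..<i]) \<le> 2 * cc + 1"
proof -
  have "length (filter (near cc pos) [0..<i]) = card (set (filter (near cc pos) [0..<i]))"
    by (rule distinct_card[symmetric]) simp
  also have "\<dots> \<le> card {pos - cc..pos + cc}" by (intro card_mono) (auto simp: near_def)
  finally show ?thesis by simp
qed

lemma mult_add_inject:
  fixes a b c d k :: nat
  assumes "b < k" "d < k" "a * k + b = c * k + d"
  shows "a = c \<and> b = d"
proof -
  have "(a * k + b) div k = a" "(c * k + d) div k = c" using assms(1,2) by simp_all
  then have "a = c" using assms(3) by metis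
  then show ?thesis using assms(3) by simp
qed

context machine
begin

lemma H_INSERT:
  assumes "LST vL h ys" "h vK 0 = int (length ys)" "h vX 0 = int x" "h vPOS 0 = int pos" "pos \<le> length ys"
    "length ys \<le> n" and R: "\<And>h'. eqx {vi, vZ} h h' \<Longrightarrow> LST vZ h' (insert_at pos x ys) \<Longrightarrow> R h' tr"
  shows "H q Y INSERT h tr R"
  unfolding INSERT_def
  apply (rule Hseq H_set)+
  apply (rule Hwhile[where K = "length ys" and I = "\<lambda>i h' tr'. tr' = tr \<and> eqx {vi, vZ} h h' \<and>
     h' vi 0 = int i \<and> (\<forall>j<i. h' vZ (if j < pos then int j else int j + 1) = int (ys ! j))"])
  subgoal by (auto intro!: eqx_intros)
  subgoal using assms by (simp add: eqx_def)
  subgoal for i h' tr'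
    apply (intro Hseq H_set Hif)
    using assms(4) LST_nth[OF assms(1), of i]
    by (auto intro!: eqx_intros simp: eqx_def less_Suc_eq)
  subgoal using assms by (simp add: eqx_def)
  subgoal for h' tr'
    apply (rule H_set)
    apply (simp only:)
    apply (rule R)
    subgoal by (auto intro!: eqx_intros)
    subgoal
    proof -
      assume I: "tr' = tr \<and> eqx {vi, vZ} h h' \<and> h' vi 0 = int (length ys) \<and>
        (\<forall>j<length ys. h' vZ (if j < pos then int j else int j + 1) = int (ys ! j))"
      then have p: "h' vPOS 0 = int pos" "h' vX 0 = int x" using assms by (auto simp: eqx_def)
      show ?thesis
        unfolding LST_def
      proof (intro allI impI)
        fix j assume j: "j < length (insert_at pos x ys)"
        consider "j < pos" | "j = pos" | j' where "j = Suc j'" "pos \<le> j'" "j' < length ys"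
          using j assms(5) by (cases "j < pos"; cases "j = pos"; cases j) (auto simp: insert_at_def)
        then show "up h' vZ (ev \<section>vPOS h') (ev \<section>vX h') vZ (int j) = int (insert_at pos x ys ! j)"
        proof cases
          case 1
          then have "h' vZ (int j) = int (ys ! j)"
            using I[THEN conjunct2, THEN conjunct2, THEN conjunct2, rule_format, of j] assms(5) by simp
          then show ?thesis using 1 p assms(5) by (simp add: insert_at_def nth_append)
        next
          case 2
          then show ?thesis using p assms(5) by (simp add: insert_at_def nth_append)
        next
          case 3
          then have "h' vZ (int j' + 1) = int (ys ! j')" using I[THEN conjunct2, THEN conjunct2, THEN conjunct2, rule_format, of j'] by simp
          then show ?thesis using 3 p assms(5)
            by (simp add: insert_at_def nth_append Suc_diff_le add.commute)
        qed
      qed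
    qed
    done
  subgoal using assms(6) Y(1) by simp
  done

definition TABREL :: "arrs \<Rightarrow> outcomes \<Rightarrow> bool" where
  "TABREL h f \<longleftrightarrow> (\<forall>a\<in>{1..n}. \<forall>b\<in>{1..n}. h vTAB (int (a * (n + 1) + b)) = f a b)"

lemma TABREL_D: "TABREL h f \<Longrightarrow> a \<in> {1..n} \<Longrightarrow> b \<in> {1..n} \<Longrightarrow> h vTAB (int (a * (n + 1) + b)) = f a b"
  by (simp add: TABREL_def)

lemma TABREL_eqx: "TABREL h f \<Longrightarrow> eqx A h h' \<Longrightarrow> vTAB \<notin> A \<Longrightarrow> TABREL h' f"
  unfolding TABREL_def using eqxD by metis

lemma TABREL_ask:
  assumes "TABREL h (asked q x A f)" "x \<in> {1..n}" "y \<in> {1..n}" "y \<noteq> x" "h' vTAB = (h vTAB)(int (x * (n + 1) + y) := q x y,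
    int (y * (n + 1) + x) := - q x y)"
  shows "TABREL h' (asked q x (insert y A) f)"
  unfolding TABREL_def
proof (intro ballI)
  fix a b assume ab: "a \<in> {1..n}" "b \<in> {1..n}"
  have 1: "a * (n + 1) + b = x * (n + 1) + y \<longleftrightarrow> a = x \<and> b = y"
    using mult_add_inject[of b "n + 1" y a x] ab assms by auto
  have 2: "a * (n + 1) + b = y * (n + 1) + x \<longleftrightarrow> a = y \<and> b = x"
    using mult_add_inject[of b "n + 1" x a y] ab assms by auto
  have "h' vTAB (int (a * (n + 1) + b)) = (if a = y \<and> b = x then - q x y else if a = x \<and> b = y then q x y
     else h vTAB (int (a * (n + 1) + b)))"
    unfolding assms(5) fun_upd_apply of_nat_eq_iff 1 2 by simp
  then show "h' vTAB (int (a * (n + 1) + b)) = asked q x (insert y A) f a b"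
    using TABREL_D[OF assms(1) ab] assms(4) by (auto simp: asked_def)
qed

lemma H_ASK:
  assumes "CON h" "x \<in> {1..n}" "y \<in> {1..n}" "y \<noteq> x" "h vX 0 = int x" "h vi 0 = int i" "h vZ (int i) = int y"
    "TABREL h (asked q x A f)"
    "\<And>h'. eqx {vTMP, vTAB} h h' \<Longrightarrow> TABREL h' (asked q x (insert y A) f) \<Longrightarrow> R h' (tr @ [(x, y)])"
  shows "H q Y ASK h tr R"
proof -
  have r: "h vROW (int x) = int (x * (n + 1))" "h vROW (int y) = int (y * (n + 1))"
    using assms(1-3) by (auto simp: CON_def)
  show ?thesis
  unfolding ASK_def
  apply (rule Hseq H_set H_qry)+
  apply (simp only: ev.simps up_apply)
  using assms(5-7) r
  apply (simp del: of_nat_mult of_nat_add add: of_nat_add[symmetric])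
  apply (rule assms(9))
  subgoal by (auto simp: eqx_def)
  subgoal by (rule TABREL_ask[OF assms(8,2,3,4)]) simp
  done
qed

lemma H_COMPARE:
  assumes con: "CON h" and L: "LST vZ h zs" "distinct zs" "set zs = {1..x}" "length zs = x" "x \<in> {1..n}"
    and X: "h vX 0 = int x" "h vPOS 0 = int pos" "pos < x" "zs ! pos = x"
    and T: "TABREL h f"
    and R: "\<And>h'. eqx {vi, vTMP, vTAB} h h' \<Longrightarrow>
      TABREL h' (asked q x ((!) zs ` {i. i < x \<and> near cc pos i}) f) \<Longrightarrow>
      R h' (tr @ map (\<lambda>i. (x, zs ! i)) (filter (near cc pos) [0..<x]))"
  shows "H q Y COMPARE h tr R"
proof -
  have C: "h vCC 0 = int cc" using con by (simp add: CON_def)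
  define INV where "INV i h' tr' \<longleftrightarrow> tr' = tr @ map (\<lambda>i. (x, zs ! i)) (filter (near cc pos) [0..<i]) \<and>
    eqx {vi, vTMP, vTAB} h h' \<and> TABREL h' (asked q x ((!) zs ` {j. j < i \<and> near cc pos j}) f)" for i h' tr'
  have e0: "asked q x ((!) zs ` {j. j < 0 \<and> near cc pos j}) f = f"
    by (auto simp: asked_def fun_eq_iff)
  have yes: "H q Y ASK h' tr' (\<lambda>h'' tr''. INV (Suc i) h'' tr'' \<and> h'' vi 0 = int i)"
    if "INV i h' tr'" "h' vi 0 = int i" "near cc pos i" "i < x" for i h' tr'
  proof -
    have zi: "zs ! i \<in> {1..n}" "zs ! i \<noteq> x"
    proof -
      have "zs ! i \<in> set zs" using that(4) L by (intro nth_mem) simp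
      then show "zs ! i \<in> {1..n}" using L by auto
      show "zs ! i \<noteq> x" using that(3,4) X(3,4) L(2,4) nth_eq_iff_index_eq[of zs i pos] by (auto simp: near_def)
    qed
    have ins: "(!) zs ` {j. j < Suc i \<and> near cc pos j} = insert (zs ! i) ((!) zs ` {j. j < i \<and> near cc pos j})"
      using that(3) less_Suc_eq by auto
    show ?thesis
      apply (rule H_ASK[OF _ L(5) zi, where i = i and A = "(!) zs ` {j. j < i \<and> near cc pos j}" and f = f])
      subgoal by (rule CON_eqx[OF con, of "{vi, vTMP, vTAB}"]) (use that in \<open>auto simp: INV_def con_vars_def\<close>)
      subgoal using that X by (simp add: INV_def eqx_def)
      subgoal by (rule that(2))
      subgoal using that LST_nth[OF L(1), of i] L(4) by (simp add: INV_def eqx_def)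
      subgoal using that by (simp add: INV_def)
      subgoal for h''
        unfolding INV_def ins using that by (auto simp: INV_def eqx_def)
      done
  qed
  have no: "INV (Suc i) h' tr'" if "INV i h' tr'" "\<not> near cc pos i" for i h' tr'
  proof -
    have "{j. j < Suc i \<and> near cc pos j} = {j. j < i \<and> near cc pos j}" using that(2) less_Suc_eq by auto
    with that show ?thesis by (simp add: INV_def)
  qed
  show ?thesis
  unfolding COMPARE_def
  apply (rule Hseq H_set)+
  apply (rule Hwhile[where K = x and I = "\<lambda>i h' tr'. INV i h' tr' \<and> h' vi 0 = int i"])
  subgoal using TABREL_eqx[OF T, of "{vi}"] e0 by (auto simp: INV_def eqx_def)
  subgoal using X by (simp add: INV_def eqx_def)
  subgoal for i h' tr'
  proof -
    assume i: "i < x" and I: "INV i h' tr' \<and> h' vi 0 = int i"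
    then have v: "h' vPOS 0 = int pos" "h' vCC 0 = int cc" using X C by (auto simp: INV_def eqx_def)
    have inc: "INV (Suc i) (up h'' vi (ev (N 0) h'') (ev (\<section>vi \<oplus> N 1) h'')) tr'' \<and>
        up h'' vi (ev (N 0) h'') (ev (\<section>vi \<oplus> N 1) h'') vi 0 = int (Suc i)"
      if "INV (Suc i) h'' tr'' \<and> h'' vi 0 = int i" for h'' tr''
      using that TABREL_eqx[of h'' _ "{vi}" "up h'' vi 0 (int i + 1)"]
      by (auto simp: INV_def eqx_def)
    show ?thesis
      apply (rule Hseq)
      apply (rule H_conseq[where R = "\<lambda>h'' tr''. INV (Suc i) h'' tr'' \<and> h'' vi 0 = int i"])
       apply (intro Hif H_skip)
      subgoal by (rule yes) (use I i v in \<open>auto simp: near_def\<close>)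
      subgoal using no I v by (auto simp: near_def)
      subgoal by (rule yes) (use I i v in \<open>auto simp: near_def\<close>)
      subgoal using no I v by (auto simp: near_def)
      subgoal using no I v by (auto simp: near_def)
      subgoal by (rule H_set) (rule inc)
      done
  qed
  subgoal using X by (simp add: INV_def eqx_def)
  subgoal using R by (auto simp: INV_def)
  subgoal using L(5) Y(1) by simp
  done
qed

end

section \<open>The table of the dynamic program in memory\<close>

abbreviation gain :: "nat list \<Rightarrow> outcomes \<Rightarrow> nat \<Rightarrow> nat \<Rightarrow> int" where
  "gain zs f a b \<equiv> f (zs ! a) (zs ! b)"

context machine
begin

abbreviation SZ :: nat where "SZ \<equiv> 2 ^ (2 * w)"

lemma start_less: "2 ^ w - 1 < SZ"
proof -
  have "(2 :: nat) ^ w \<le> 2 ^ (2 * w)" by (intro power_increasing) auto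
  then show ?thesis by (meson diff_less less_le_trans zero_less_numeral zero_less_power zero_less_one)
qed

text \<open>Entries written in earlier stages carry smaller tags in \<open>vF\<close> and count as empty.\<close>

definition REP :: "arrs \<Rightarrow> nat \<Rightarrow> table \<Rightarrow> bool" where
  "REP h k tb \<longleftrightarrow> (\<forall>i. h vF i \<le> int (Suc k)) \<and> (\<forall>p\<le>n. \<forall>s<SZ.
     case tb p s of None \<Rightarrow> h vF (int (p * SZ + s)) \<le> int k
     | Some (v, j, s') \<Rightarrow> h vF (int (p * SZ + s)) = int (Suc k) \<and> h vS (int (p * SZ + s)) = v \<and>
         (p > 0 \<longrightarrow> h vJ (int (p * SZ + s)) = int j \<and> h vP (int (p * SZ + s)) = int s'))"

text \<open>Predecessor links never dangle, so \<open>WALK\<close> and \<open>RECON\<close> can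
  follow them down to level 0.\<close>

definition WFT :: "nat \<Rightarrow> table \<Rightarrow> bool" where
  "WFT K tb \<longleftrightarrow> (\<forall>p s v j s'. tb p s = Some (v, j, s') \<longrightarrow>
     s < SZ \<and> (p > 0 \<longrightarrow> j < K \<and> tb (p - 1) s' \<noteq> None))"

lemma REP_entry:
  assumes "REP h k tb" "p \<le> n" "s < SZ"
  shows "case tb p s of None \<Rightarrow> h vF (int (p * SZ + s)) \<le> int k
     | Some (v, j, s') \<Rightarrow> h vF (int (p * SZ + s)) = int (Suc k) \<and> h vS (int (p * SZ + s)) = v \<and>
         (p > 0 \<longrightarrow> h vJ (int (p * SZ + s)) = int j \<and> h vP (int (p * SZ + s)) = int s')"
  using assms unfolding REP_def by blast

lemma REP_None:
  assumes "REP h k tb" "p \<le> n" "s < SZ"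
  shows "tb p s = None \<longleftrightarrow> h vF (int (p * SZ + s)) \<le> int k"
proof (cases "tb p s")
  case (Some a)
  then show ?thesis using REP_entry[OF assms] by (cases a) simp
qed (use REP_entry[OF assms] in simp)

lemma REP_Some:
  assumes "REP h k tb" "p \<le> n" "s < SZ" "tb p s = Some (v, j, s')"
  shows "h vF (int (p * SZ + s)) = int (Suc k)" "h vS (int (p * SZ + s)) = v"
    "p > 0 \<Longrightarrow> h vJ (int (p * SZ + s)) = int j" "p > 0 \<Longrightarrow> h vP (int (p * SZ + s)) = int s'"
  using REP_entry[OF assms(1-3)] by (simp_all add: assms(4))

lemma REP_eqx:
  assumes "REP h k tb" "eqx A h h'" "A \<inter> {vF, vS, vJ, vP} = {}"
  shows "REP h' k tb"
proof -
  have eqs: "h' vF = h vF" "h' vS = h vS" "h' vJ = h vJ" "h' vP = h vP"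
    using assms(2,3) by (auto intro!: eqxD[where A = A])
  show ?thesis using assms(1) unfolding REP_def eqs .
qed

lemma REP_write:
  assumes "REP h k tb" "p \<le> n" "p > 0" "c < SZ" "i = int (p * SZ + c)"
    "h' vF = (h vF)(i := int (Suc k))" "h' vS = (h vS)(i := v)"
    "h' vJ = (h vJ)(i := int j)" "h' vP = (h vP)(i := int s)"
  shows "REP h' k (tb(p := (tb p)(c := Some (v, j, s))))"
  unfolding REP_def
proof (intro conjI allI impI)
  show "h' vF i \<le> int (Suc k)" for i using assms(1,6) by (simp add: REP_def)
  fix p' s' assume ps: "p' \<le> n" "s' < SZ"
  have eq: "int (p' * SZ + s') = i \<longleftrightarrow> p' = p \<and> s' = c"
    unfolding assms(5) of_nat_eq_iff using mult_add_inject[of s' SZ c p' p] ps assms(4) by auto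
  have old: "case tb p' s' of None \<Rightarrow> h vF (int (p' * SZ + s')) \<le> int k
     | Some (v, j, s'') \<Rightarrow> h vF (int (p' * SZ + s')) = int (Suc k) \<and> h vS (int (p' * SZ + s')) = v \<and>
         (p' > 0 \<longrightarrow> h vJ (int (p' * SZ + s')) = int j \<and> h vP (int (p' * SZ + s')) = int s'')"
    using assms(1) ps unfolding REP_def by blast
  show "case (tb(p := (tb p)(c := Some (v, j, s)))) p' s' of None \<Rightarrow> h' vF (int (p' * SZ + s')) \<le> int k
     | Some (v, j, s'') \<Rightarrow> h' vF (int (p' * SZ + s')) = int (Suc k) \<and> h' vS (int (p' * SZ + s')) = v \<and>
         (p' > 0 \<longrightarrow> h' vJ (int (p' * SZ + s')) = int j \<and> h' vP (int (p' * SZ + s')) = int s'')"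
  proof (cases "p' = p \<and> s' = c")
    case True
    then show ?thesis using assms(3,6-9) eq by simp
  next
    case False
    then have "(tb(p := (tb p)(c := Some (v, j, s)))) p' s' = tb p' s'" by auto
    moreover have "int (p' * SZ + s') \<noteq> i" using eq False by blast
    ultimately show ?thesis using old unfolding assms(6-9) by (simp only: fun_upd_apply if_False)
  qed
qed

definition ENV :: "nat \<Rightarrow> nat list \<Rightarrow> outcomes \<Rightarrow> arrs \<Rightarrow> bool" where
  "ENV k zs f h \<longleftrightarrow> CON h \<and> h vX 0 = int (Suc k) \<and> h vK 0 = int k \<and> LST vZ h zs \<and> TABREL h f \<and>
     length zs = Suc k \<and> set zs \<subseteq> {1..n} \<and> Suc k \<le> n"

definition env_vars :: "vr set" where
  "env_vars = con_vars \<union> {vX, vK, vZ, vTAB}"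

lemma ENV_eqx:
  assumes "ENV k zs f h" "eqx A h h'" "A \<inter> env_vars = {}"
  shows "ENV k zs f h'"
proof -
  have "A \<inter> con_vars = {}" "vX \<notin> A" "vK \<notin> A" "vZ \<notin> A" "vTAB \<notin> A" using assms(3) by (auto simp: env_vars_def)
  with assms(1) CON_eqx[of h A h'] LST_eqx[of vZ h zs A h'] TABREL_eqx[of h f A h'] eqxD[OF assms(2)]
  show ?thesis by (simp add: ENV_def assms(2))
qed

text \<open>Level \<open>p\<close> is final and level \<open>p + 1\<close> under construction. The
  last clause provides that the level after that is empty, hence trivially \<open>sound\<close> when
  \<open>DPI_next\<close> moves on.\<close>

definition DPI :: "nat \<Rightarrow> nat list \<Rightarrow> outcomes \<Rightarrow> nat \<Rightarrow> table \<Rightarrow> (nat \<times> nat) set \<Rightarrow> bool" where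
  "DPI k zs f p tb D \<longleftrightarrow> WFT (Suc k) tb \<and> sound (Suc k) w (gain zs f) tb p \<and>
     sound (Suc k) w (gain zs f) tb (Suc p) \<and> complete (Suc k) w (gain zs f) tb p \<and>
     explored (Suc k) w (gain zs f) tb p D \<and> (\<forall>p'>Suc p. \<forall>s. tb p' s = None)"

lemma ENV_consts:
  assumes "ENV k zs f h"
  shows "h vW 0 = int w" "h vSZ 0 = int SZ" "h vX 0 = int (Suc k)" "h vK 0 = int k"
    "\<And>p. p \<le> n + 1 \<Longrightarrow> h vPB (int p) = int (p * SZ)" "\<And>i. i \<le> 2 * w \<Longrightarrow> h vPOW (int i) = int (2 ^ i)"
    "\<And>i. i \<le> n + 1 \<Longrightarrow> h vROW (int i) = int (i * (n + 1))"
    "\<And>i. i \<le> k \<Longrightarrow> h vZ (int i) = int (zs ! i)" "\<And>i. i \<le> k \<Longrightarrow> zs ! i \<in> {1..n}"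
proof -
  have *: "CON h" "h vX 0 = int (Suc k)" "h vK 0 = int k" "LST vZ h zs" "length zs = Suc k" "set zs \<subseteq> {1..n}"
    using assms by (simp_all only: ENV_def)
  show "h vX 0 = int (Suc k)" "h vK 0 = int k" by (rule *)+
  show "h vW 0 = int w" "h vSZ 0 = int SZ" "\<And>p. p \<le> n + 1 \<Longrightarrow> h vPB (int p) = int (p * SZ)"
    "\<And>i. i \<le> 2 * w \<Longrightarrow> h vPOW (int i) = int (2 ^ i)"
    "\<And>i. i \<le> n + 1 \<Longrightarrow> h vROW (int i) = int (i * (n + 1))"
    using *(1) by (simp_all add: CON_def)
  show "h vZ (int i) = int (zs ! i)" "zs ! i \<in> {1..n}" if "i \<le> k" for i
    using *(4,5,6) that LST_nth[of vZ h zs i] nth_mem[of i zs] by (simp, metis le_imp_less_Suc subsetD)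
qed

lemma H_WALK:
  assumes env: "ENV k zs f h" and rep: "REP h k tb" and wf: "WFT (Suc k) tb"
    and p: "p \<le> Suc k" "tb p s \<noteq> None" "length (chain tb p s) = p" "set (chain tb p s) \<subseteq> {..k}"
    and v: "h vLEV 0 = int p" "h vMASK 0 = int s" "h vJJ 0 = int j" "j \<le> k"
    and R: "\<And>h'. eqx {vGAIN, vOK, vPL, vMM, vTMP} h h' \<Longrightarrow>
      h' vOK 0 = (if j \<in> set (chain tb p s) then 0 else 1) \<Longrightarrow>
      h' vGAIN 0 = (\<Sum>y\<leftarrow>chain tb p s. gain zs f j y) \<Longrightarrow> R h' tr"
  shows "H q Y WALK h tr R"
proof -
  define js where "js = chain tb p s"
  have js: "length js = p" "set js \<subseteq> {..k}" using p by (simp_all add: js_def)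
  note C = ENV_consts[OF env]
  have kn: "Suc k \<le> n" using env by (simp add: ENV_def)
  \<comment> \<open>The links lead backwards, so after \<open>i\<close> rounds the last
    \<open>i\<close> entries of the prefix have been read.\<close>
  define INV where "INV i h' \<longleftrightarrow> eqx {vGAIN, vOK, vPL, vMM, vTMP} h h' \<and> h' vPL 0 = int (p - i) \<and>
     (\<exists>s'. h' vMM 0 = int s' \<and> tb (p - i) s' \<noteq> None \<and> chain tb (p - i) s' = take (p - i) js) \<and>
     h' vOK 0 = (if j \<in> set (drop (p - i) js) then 0 else 1) \<and>
     h' vGAIN 0 = (\<Sum>y\<leftarrow>drop (p - i) js. gain zs f j y)" for i h'
  show ?thesis
    unfolding WALK_def
    apply (rule Hseq H_set)+
    apply (rule Hwhile[where K = p and I = "\<lambda>i h' tr'. tr' = tr \<and> INV i h'"])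
    subgoal using v p js by (auto intro!: eqx_intros exI[of _ s] simp: INV_def js_def)
    subgoal by (simp add: INV_def)
    subgoal for i h' tr'
    proof -
      assume i: "i < p" and I: "tr' = tr \<and> INV i h'"
      then obtain s' where s': "h' vMM 0 = int s'" "tb (p - i) s' \<noteq> None" "chain tb (p - i) s' = take (p - i) js"
        by (auto simp: INV_def)
      obtain p' where p': "p - i = Suc p'" "p - Suc i = p'" using i by (cases "p - i") auto
      obtain u jj s'' where tb: "tb (Suc p') s' = Some (u, jj, s'')" using s'(2) p' by auto
      have sz: "s' < SZ" "tb p' s'' \<noteq> None" "jj < Suc k" using wf tb unfolding WFT_def by fastforce+
      have pl: "p' < length js" using p' js by simp
      have ch: "chain tb p' s'' @ [jj] = take p' js @ [js ! p']"
        using s'(3) p' tb pl by (simp add: take_Suc_conv_app_nth)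
      then have jj: "jj = js ! p'" "chain tb p' s'' = take p' js" by auto
      have dr: "drop p' js = jj # drop (Suc p') js" using pl jj by (simp add: Cons_nth_drop_Suc)
      have e: "eqx {vGAIN, vOK, vPL, vMM, vTMP} h h'" using I by (simp add: INV_def)
      have rep': "REP h' k tb" by (rule REP_eqx[OF rep e]) simp
      have env': "ENV k zs f h'" by (rule ENV_eqx[OF env e]) (simp add: env_vars_def con_vars_def)
      note C' = ENV_consts[OF env']
      have pn: "Suc p' \<le> n" using p' p(1) kn by linarith
      have mem: "h' vPB (int (p - i)) = int (Suc p' * SZ)" "h' vJ (int (Suc p' * SZ + s')) = int jj"
        "h' vP (int (Suc p' * SZ + s')) = int s''"
        using C'(5)[of "Suc p'"] pn p' REP_Some[OF rep' pn sz(1) tb] by auto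
      have tab: "h' vTAB (int (zs ! j * (n + 1) + zs ! jj)) = gain zs f j jj"
        using env' C'(9)[OF v(4)] C'(9)[of jj] sz(3) by (intro TABREL_D) (auto simp: ENV_def)
      have Zj: "h' vZ (int j) = int (zs ! j)" "h' vZ (int jj) = int (zs ! jj)"
        "h' vROW (int (zs ! j)) = int (zs ! j * (n + 1))" "h' vJJ 0 = int j"
        using C'(8)[OF v(4)] C'(8)[of jj] C'(7)[of "zs ! j"] C'(9)[OF v(4)] sz(3) v(3) e by (auto simp: eqx_def)
      have PL: "h' vPL 0 = int (Suc p')" using I p' by (simp add: INV_def)
      have idx: "h' vPB (int (Suc p')) + int s' = int (Suc p' * SZ + s')" using mem(1) p' by simp
      define h1 where "h1 = up h' vTMP 0 (int jj)"
      have goal2: "H q Y (LET vGAIN (\<section>vGAIN \<oplus> X vTAB (X vROW (X vZ \<section>vJJ) \<oplus> X vZ \<section>vTMP)) ;;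
        LET vMM (X vP (X vPB \<section>vPL \<oplus> \<section>vMM)) ;; LET vPL (\<section>vPL \<ominus> N 1)) h2 tr (\<lambda>h' tr'. tr' = tr \<and> INV (Suc i) h')"
        if h2: "eqx {vOK} h1 h2" "h2 vOK 0 = (if j \<in> set (drop p' js) then 0 else 1)" for h2
      proof -
        have eq: "h2 vJJ = h' vJJ" "h2 vZ = h' vZ" "h2 vROW = h' vROW" "h2 vTAB = h' vTAB" "h2 vPB = h' vPB"
          "h2 vPL = h' vPL" "h2 vMM = h' vMM" "h2 vP = h' vP" "h2 vTMP 0 = int jj" "h2 vGAIN = h' vGAIN"
          using h2(1) by (simp_all add: eqx_def h1_def)
        have tab': "h' vTAB (int (zs ! j * (n + 1)) + int (zs ! jj)) = gain zs f j jj"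
          using tab by (simp only: of_nat_add)
        have G: "h' vGAIN 0 = (\<Sum>y\<leftarrow>drop (Suc p') js. gain zs f j y)" using I p' by (simp add: INV_def)
        have E: "eqx {vGAIN, vOK, vPL, vMM, vTMP} h h2"
          using e h2(1) by (auto simp: eqx_def h1_def)
        show ?thesis
          apply (rule Hseq H_set)+
          apply (intro conjI refl)
          unfolding INV_def p'(2)
          apply (intro conjI)
          subgoal by (intro eqx_up E) auto
          subgoal using eq PL by simp
          subgoal using eq PL s' idx mem jj sz(2) by (intro exI[of _ s'']) simp
          subgoal using h2(2) by simp
          subgoal using eq Zj tab' G dr by simp
          done
      qed
      have OK: "h' vOK 0 = (if j \<in> set (drop (Suc p') js) then 0 else 1)" using I p' by (simp add: INV_def)
      show ?thesis
        apply (rule Hseq H_set)+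
        apply (subgoal_tac "up h' vTMP (ev (N 0) h') (ev (X vJ (X vPB \<section>vPL \<oplus> \<section>vMM)) h') = h1")
        apply (simp only:)
        apply (rule H_conseq[where R = "\<lambda>h2 tr2. tr2 = tr \<and> eqx {vOK} h1 h2 \<and>
           h2 vOK 0 = (if j \<in> set (drop p' js) then 0 else 1)"])
        subgoal
          apply (intro Hif H_skip H_set)
          using OK Zj I by (auto simp: h1_def dr eqx_def)
        subgoal using goal2 I by auto
        subgoal using PL s' idx mem by (simp add: h1_def)
        done
    qed
    subgoal by (simp add: INV_def)
    subgoal using R by (auto simp: INV_def js_def)
    subgoal using p(1) kn Y(1) by simp
    done
qed

end

lemma insert_at_props:
  assumes "distinct ys" "set ys = {1..k}" "length ys = k" "pos \<le> k"
  shows "distinct (insert_at pos (Suc k) ys)" "set (insert_at pos (Suc k) ys) = {1..Suc k}"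
    "length (insert_at pos (Suc k) ys) = Suc k" "insert_at pos (Suc k) ys ! pos = Suc k"
proof -
  have ys: "take pos ys @ drop pos ys = ys" by simp
  have "set (take pos ys) \<union> set (drop pos ys) = {1..k}" using assms(2) ys by (metis set_append)
  moreover from this have "Suc k \<notin> set (take pos ys) \<union> set (drop pos ys)" by auto
  moreover have "distinct (take pos ys)" "distinct (drop pos ys)" "set (take pos ys) \<inter> set (drop pos ys) = {}"
    using assms(1) by (simp_all add: set_take_disj_set_drop_if_distinct)
  ultimately have u: "set (take pos ys) \<union> set (drop pos ys) = {1..k}" "Suc k \<notin> set (take pos ys)"
    "Suc k \<notin> set (drop pos ys)" "distinct (take pos ys)" "distinct (drop pos ys)"
    "set (take pos ys) \<inter> set (drop pos ys) = {}" by blast+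
  show "distinct (insert_at pos (Suc k) ys)" unfolding insert_at_def using u(2-6) by simp
  have "set (insert_at pos (Suc k) ys) = insert (Suc k) (set (take pos ys) \<union> set (drop pos ys))"
    by (simp add: insert_at_def)
  also have "\<dots> = {1..Suc k}" unfolding u(1) by auto
  finally show "set (insert_at pos (Suc k) ys) = {1..Suc k}" .
  show "length (insert_at pos (Suc k) ys) = Suc k" "insert_at pos (Suc k) ys ! pos = Suc k"
    using assms(3,4) by (simp_all add: insert_at_def nth_append)
qed

context machine
begin

definition trans_vars :: "vr set" where
  "trans_vars = {vJJ, vOK, vGAIN, vPL, vMM, vTMP, vH, vF, vS, vJ, vP}"

text \<open>Level \<open>p\<close> is kept as it was, so a state that \<open>STATE\<close> found
  occupied stays occupied through all its transitions.\<close>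

definition POST :: "nat \<Rightarrow> nat list \<Rightarrow> outcomes \<Rightarrow> nat \<Rightarrow> table \<Rightarrow> (nat \<times> nat) set \<Rightarrow> arrs \<Rightarrow> arrs \<Rightarrow> bool" where
  "POST k zs f p tb D h h' \<longleftrightarrow> eqx trans_vars h h' \<and>
     (\<exists>tb'. tb' p = tb p \<and> DPI k zs f p tb' D \<and> REP h' k tb')"

lemma DPI_skip:
  assumes "DPI k zs f p tb D"
    "\<And>j. tb p s \<noteq> None \<Longrightarrow> j + w = p + b \<Longrightarrow> feasible (Suc k) w (chain tb p s @ [j]) \<Longrightarrow>
      dominates (gain zs f) w tb (chain tb p s @ [j])"
  shows "DPI k zs f p tb (insert (s, b) D)"
  using assms(1) explored_skip[OF _ assms(2)] unfolding DPI_def by blast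

lemma DPI_update:
  assumes D: "DPI k zs f p tb D" and s: "tb p s = Some e" and j: "j + w = p + b"
    and f: "feasible (Suc k) w (chain tb p s @ [j])" "c = code w (chain tb p s @ [j])"
      "v = lscore (gain zs f) (chain tb p s @ [j])"
    and better: "\<And>v' j' s'. tb (Suc p) c = Some (v', j', s') \<Longrightarrow> v' \<le> v"
  shows "DPI k zs f p (tb(Suc p := (tb (Suc p))(c := Some (v, j, s)))) (insert (s, b) D)"
proof -
  let ?tb = "tb(Suc p := (tb (Suc p))(c := Some (v, j, s)))"
  have D': "WFT (Suc k) tb" "sound (Suc k) w (gain zs f) tb p" "sound (Suc k) w (gain zs f) tb (Suc p)"
    "complete (Suc k) w (gain zs f) tb p" "explored (Suc k) w (gain zs f) tb p D"
    "\<forall>p'>Suc p. \<forall>s. tb p' s = None" using D by (auto simp: DPI_def)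
  have snn: "tb p s \<noteq> None" using s by simp
  have len: "length (chain tb p s) = p" using D'(2) s by (cases e) (auto simp: sound_def)
  note u = explored_update[OF refl D'(2,3,5) snn f(1) j f(2,3) better]
  have ch: "chain ?tb p s' = chain tb p s'" for s' by (rule chain_cong) simp
  have "sound (Suc k) w (gain zs f) ?tb p" using D'(2) by (simp add: sound_def ch)
  moreover have "complete (Suc k) w (gain zs f) ?tb p"
    using D'(4) by (auto simp: complete_def dominates_def)
  moreover have "WFT (Suc k) ?tb"
    unfolding WFT_def
  proof (intro allI impI)
    fix p' s1 v1 j1 s2 assume a: "?tb p' s1 = Some (v1, j1, s2)"
    have "c < SZ" using code_less[OF f(1)] f(2) by simp
    moreover have "j < Suc k" using f(1) by (simp add: feasible_snoc)
    moreover have "?tb (p' - 1) s' \<noteq> None" if "tb (p' - 1) s' \<noteq> None" for s'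
      using that by auto
    moreover have "tb p' s1 = Some (v1, j1, s2) \<Longrightarrow> s1 < SZ \<and> (p' > 0 \<longrightarrow> j1 < Suc k \<and> tb (p' - 1) s2 \<noteq> None)"
      using D'(1) unfolding WFT_def by blast
    ultimately show "s1 < SZ \<and> (0 < p' \<longrightarrow> j1 < Suc k \<and> ?tb (p' - 1) s2 \<noteq> None)"
      using a snn by (cases "p' = Suc p \<and> s1 = c") (auto split: if_splits)
  qed
  ultimately show ?thesis using u D'(6) by (simp add: DPI_def)
qed

lemma DPI_chain:
  assumes "DPI k zs f p tb D" "tb p s = Some (v, j, s')"
  shows "length (chain tb p s) = p" "set (chain tb p s) \<subseteq> {..k}" "feasible (Suc k) w (chain tb p s)"
    "code w (chain tb p s) = s" "v = lscore (gain zs f) (chain tb p s)" "s < SZ"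
proof -
  have *: "feasible (Suc k) w (chain tb p s) \<and>
     length (chain tb p s) = p \<and> code w (chain tb p s) = s \<and> lscore (gain zs f) (chain tb p s) = v"
    using assms unfolding DPI_def sound_def by blast
  then show "length (chain tb p s) = p" "feasible (Suc k) w (chain tb p s)"
    "code w (chain tb p s) = s" "v = lscore (gain zs f) (chain tb p s)" by auto
  show "set (chain tb p s) \<subseteq> {..k}" using * by (force simp: feasible_def in_set_conv_nth)
  show "s < SZ" using assms unfolding DPI_def WFT_def by blast
qed

lemma H_WRITE:
  assumes "h vTMP 0 = i" "h vX 0 = x" "h vGAIN 0 = g" "h vJJ 0 = j" "h vMASK 0 = s"
    "\<And>h'. eqx {vF, vS, vJ, vP} h h' \<Longrightarrow> h' vF = (h vF)(i := x) \<Longrightarrow> h' vS = (h vS)(i := g) \<Longrightarrow>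
      h' vJ = (h vJ)(i := j) \<Longrightarrow> h' vP = (h vP)(i := s) \<Longrightarrow> R h' tr"
  shows "H q Y WRITE h tr R"
  unfolding WRITE_def
  apply (rule Hseq H_set)+
  apply (rule assms(6))
  using assms(1-5) by (simp_all add: eqx_def)

lemma H_EXTEND:
  assumes env: "ENV k zs f h" and rep: "REP h k tb" and D: "DPI k zs f p tb D"
    and p: "p \<le> k" "tb p s \<noteq> None" "b \<le> 2 * w"
    and v: "h vLEV 0 = int p" "h vMASK 0 = int s" "h vU 0 = int b" "h vJJ 0 = int j" "j \<le> k" "j + w = p + b"
  shows "H q Y EXTEND h tr (\<lambda>h' tr'. tr' = tr \<and> POST k zs f p tb (insert (s, b) D) h h')"
proof -
  obtain u j0 s0 where tb: "tb p s = Some (u, j0, s0)" using p(2) by auto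
  note ch = DPI_chain[OF D tb]
  let ?js = "chain tb p s"
  have kn: "Suc k \<le> n" using env by (simp add: ENV_def)
  have wf: "WFT (Suc k) tb" using D by (simp add: DPI_def)
  define M where "M = s + 2 ^ b"
  define c where "c = M div 2"
  have jb: "j + w - p = b" "p \<le> j + w" "j \<le> p + w" using v(6) p(3) by auto
  \<comment> \<open>The range conditions of \<open>feasible_snoc\<close> follow from
    \<open>b \<le> 2 * w\<close> and \<open>j \<le> k\<close>. What is left are the novelty of
    \<open>j\<close>, decided by \<open>WALK\<close>, and the parity of \<open>M\<close>.\<close>
  have fs: "feasible (Suc k) w (?js @ [j]) \<longleftrightarrow> j \<notin> set ?js \<and> odd M" and
    cc: "j \<notin> set ?js \<Longrightarrow> c = code w (?js @ [j])"
  proof -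
    have *: "odd M \<longleftrightarrow> p < w \<or> p - w \<in> insert j (set ?js)" "c = code w (?js @ [j])" if "j \<notin> set ?js"
      using code_snoc[OF that, of w] jb ch by (simp_all add: M_def c_def)
    then show "j \<notin> set ?js \<Longrightarrow> c = code w (?js @ [j])" by blast
    show "feasible (Suc k) w (?js @ [j]) \<longleftrightarrow> j \<notin> set ?js \<and> odd M"
      using feasible_snoc[of "Suc k" w ?js j] ch *(1) jb v(5) by auto
  qed
  have bm: "(2 :: nat) ^ b \<le> SZ" using p(3) by (intro power_increasing) auto
  have "M < 2 * SZ" using ch(6) bm unfolding M_def by linarith
  then have cSZ: "c < SZ" unfolding c_def by linarith
  have nof: "POST k zs f p tb (insert (s, b) D) h h'"
    if "eqx {vGAIN, vOK, vPL, vMM, vTMP, vH} h h'" "\<not> feasible (Suc k) w (?js @ [j])" for h'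
  proof -
    have "DPI k zs f p tb (insert (s, b) D)"
    proof (rule DPI_skip[OF D])
      fix i assume "i + w = p + b" "feasible (Suc k) w (?js @ [i])"
      then have "i = j" using v(6) by simp
      with \<open>feasible (Suc k) w (?js @ [i])\<close> that(2) show "dominates (gain zs f) w tb (?js @ [i])" by simp
    qed
    moreover have "REP h' k tb" by (rule REP_eqx[OF rep that(1)]) simp
    moreover have "eqx trans_vars h h'" using that(1) by (auto simp: eqx_def trans_vars_def)
    ultimately show ?thesis unfolding POST_def by blast
  qed
  show ?thesis
    unfolding EXTEND_def
    apply (rule Hseq)
    apply (rule H_WALK[OF env rep wf _ p(2) ch(1,2) v(1,2,4,5)])
    subgoal using p(1) by simp
    subgoal for h2
    proof -
      assume e2: "eqx {vGAIN, vOK, vPL, vMM, vTMP} h h2"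
        and ok: "h2 vOK 0 = (if j \<in> set ?js then 0 else 1)"
        and gn: "h2 vGAIN 0 = (\<Sum>y\<leftarrow>?js. gain zs f j y)"
      have env2: "ENV k zs f h2" by (rule ENV_eqx[OF env e2]) (simp add: env_vars_def con_vars_def)
      note C = ENV_consts[OF env2]
      have v2: "h2 vLEV 0 = int p" "h2 vMASK 0 = int s" "h2 vU 0 = int b" "h2 vJJ 0 = int j"
        using v e2 by (auto simp: eqx_def)
      have TMP: "h2 vMASK 0 + h2 vPOW (h2 vU 0) = int M" using v2 C(6)[OF p(3)] by (simp add: M_def)
      have rep2: "REP h2 k tb" by (rule REP_eqx[OF rep e2]) simp
      show ?thesis
      proof (rule Hif)
        assume "ev \<section>vOK h2 \<le> 0"
        then have "\<not> feasible (Suc k) w (?js @ [j])" using ok fs by (auto split: if_splits)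
        then show "H q Y Skip h2 tr (\<lambda>h' tr'. tr' = tr \<and> POST k zs f p tb (insert (s, b) D) h h')"
          by (intro H_skip conjI refl nof) (use e2 in \<open>auto simp: eqx_def\<close>)
      next
        assume "ev \<section>vOK h2 > 0"
        then have jn: "j \<notin> set ?js" using ok by (auto split: if_splits)
        show "H q Y (LET vTMP (\<section>vMASK \<oplus> X vPOW \<section>vU) ;; LET vH (N 0) ;;
          WHILE (\<section>vTMP \<ominus> N 1 \<ominus> \<section>vH \<ominus> \<section>vH) (LET vH (\<section>vH \<oplus> N 1)) ;;
          IFP (\<section>vTMP \<ominus> \<section>vH \<ominus> \<section>vH) UPDATE Skip) h2 tr
           (\<lambda>h' tr'. tr' = tr \<and> POST k zs f p tb (insert (s, b) D) h h')"
          apply (rule Hseq H_set)+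
          apply (rule Hwhile[where K = c and I = "\<lambda>i h' tr'. tr' = tr \<and> eqx {vTMP, vH} h2 h' \<and>
             h' vTMP 0 = int M \<and> h' vH 0 = int i"])
          subgoal using TMP by (auto intro!: eqx_intros)
          subgoal unfolding c_def by (simp; linarith?)
          subgoal
            apply (rule H_set)
            by (auto intro!: eqx_intros)
          subgoal unfolding c_def by (simp; linarith?)
          subgoal for h3 tr3
          proof (rule Hif)
            assume I: "tr3 = tr \<and> eqx {vTMP, vH} h2 h3 \<and> h3 vTMP 0 = int M \<and> h3 vH 0 = int c"
            have e3: "eqx {vGAIN, vOK, vPL, vMM, vTMP, vH} h h3"
              by (rule eqx_trans[OF e2, of "{vTMP, vH}"]) (use I in auto)
            {
              assume "ev (\<section>vTMP \<ominus> \<section>vH \<ominus> \<section>vH) h3 \<le> 0"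
              then have "int M \<le> 2 * int c" using I by simp
              then have "even M" unfolding c_def by presburger
              then show "H q Y Skip h3 tr3 (\<lambda>h' tr'. tr' = tr \<and> POST k zs f p tb (insert (s, b) D) h h')"
                by (intro H_skip conjI nof e3) (use I fs in auto)
            }
            assume "0 < ev (\<section>vTMP \<ominus> \<section>vH \<ominus> \<section>vH) h3"
            then have "2 * int c < int M" using I by simp
            then have "odd M" unfolding c_def by presburger
            then have fe: "feasible (Suc k) w (?js @ [j])" using fs jn by simp
            define val where "val = lscore (gain zs f) (?js @ [j])"
            have val: "val = (\<Sum>y\<leftarrow>?js. gain zs f j y) + u" using ch(5) by (simp add: val_def lscore_snoc)
            define i1 where "i1 = int (Suc p * SZ + c)"
            have env3: "ENV k zs f h3" by (rule ENV_eqx[OF env e3]) (simp add: env_vars_def con_vars_def)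
            note C3 = ENV_consts[OF env3]
            have rep3: "REP h3 k tb" by (rule REP_eqx[OF rep e3]) simp
            have v3: "h3 vLEV 0 = int p" "h3 vMASK 0 = int s" "h3 vJJ 0 = int j" "h3 vGAIN = h2 vGAIN"
              using v2 I by (auto simp: eqx_def)
            have S: "h3 vS (h3 vPB (int p) + int s) = u"
              using REP_Some(2)[OF rep3 _ ch(6) tb] C3(5)[of p] p(1) kn by simp
            have PB: "h3 vPB (int p + 1) + int c = i1"
              using C3(5)[of "Suc p"] p(1) kn by (simp add: i1_def add.commute)
            let ?h = "up (up h3 vTMP 0 i1) vGAIN 0 val"
            have e4: "eqx {vGAIN, vOK, vPL, vMM, vTMP, vH} h ?h" by (intro eqx_up e3) auto
            have rep4: "REP ?h k tb" by (rule REP_eqx[OF rep e4]) simp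
            have written: "POST k zs f p tb (insert (s, b) D) h h'"
              if w': "eqx {vF, vS, vJ, vP} ?h h'" "h' vF = (?h vF)(i1 := int (Suc k))" "h' vS = (?h vS)(i1 := val)"
                "h' vJ = (?h vJ)(i1 := int j)" "h' vP = (?h vP)(i1 := int s)"
                and better: "\<And>v' j' s'. tb (Suc p) c = Some (v', j', s') \<Longrightarrow> v' \<le> val" for h'
            proof -
              let ?tb = "tb(Suc p := (tb (Suc p))(c := Some (val, j, s)))"
              have "REP h' k ?tb"
                by (rule REP_write[OF rep4 _ _ cSZ i1_def w'(2-5)]) (use p(1) kn in auto)
              moreover have "DPI k zs f p ?tb (insert (s, b) D)"
                by (rule DPI_update[OF D tb v(6) fe cc[OF jn] val_def better])
              moreover have "eqx trans_vars h h'"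
                by (rule eqx_trans[OF e4 w'(1)]) (auto simp: trans_vars_def)
              moreover have "?tb p = tb p" by simp
              ultimately show ?thesis unfolding POST_def by blast
            qed
            have X4: "?h vTMP 0 = i1" "?h vX 0 = int (Suc k)" "?h vGAIN 0 = val" "?h vJJ 0 = int j" "?h vMASK 0 = int s"
              using v3 C3(3) by simp_all
            have F4: "?h vF i1 \<le> int k \<longleftrightarrow> tb (Suc p) c = None"
              using REP_None[OF rep4 _ cSZ, of "Suc p"] p(1) kn by (simp add: i1_def)
            show "H q Y UPDATE h3 tr3 (\<lambda>h' tr'. tr' = tr \<and> POST k zs f p tb (insert (s, b) D) h h')"
              unfolding UPDATE_def
              apply (rule Hseq H_set)+
              apply (subgoal_tac "up (up h3 vTMP (ev (N 0) h3) (ev (X vPB (\<section>vLEV \<oplus> N 1) \<oplus> \<section>vH) h3)) vGAIN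
                (ev (N 0) (up h3 vTMP (ev (N 0) h3) (ev (X vPB (\<section>vLEV \<oplus> N 1) \<oplus> \<section>vH) h3)))
                (ev (\<section>vGAIN \<oplus> X vS (X vPB \<section>vLEV \<oplus> \<section>vMASK))
                  (up h3 vTMP (ev (N 0) h3) (ev (X vPB (\<section>vLEV \<oplus> N 1) \<oplus> \<section>vH) h3))) = ?h")
               apply (simp only:)
               apply (intro Hif H_skip)
              subgoal
                apply (rule H_WRITE[where h = ?h and i = i1 and x = "int (Suc k)" and g = val and j = "int j" and s = "int s"])
                     apply (rule X4)+
                apply (intro conjI written; (assumption | rule I[THEN conjunct1])?)
              proof -
                fix v' j' s'
                assume a: "0 < ev (\<section>vGAIN \<ominus> X vS \<section>vTMP) ?h" and t: "tb (Suc p) c = Some (v', j', s')"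
                have "?h vS i1 = v'" using REP_Some(2)[OF rep4 _ cSZ t] p(1) kn by (simp add: i1_def)
                with a show "v' \<le> val" by simp
              qed
              subgoal
              proof -
                assume a: "0 < ev (X vF \<section>vTMP \<ominus> \<section>vK) ?h" "ev (\<section>vGAIN \<ominus> X vS \<section>vTMP) ?h \<le> 0"
                have "\<not> ?h vF i1 \<le> int k" using a(1) C3(4) by simp
                then obtain v' j' s' where t: "tb (Suc p) c = Some (v', j', s')" using F4 by auto
                have "?h vS i1 = v'" using REP_Some(2)[OF rep4 _ cSZ t] p(1) kn by (simp add: i1_def)
                then have le: "val \<le> v'" using a(2) by simp
                have "DPI k zs f p tb (insert (s, b) D)"
                proof (rule DPI_skip[OF D])
                  fix i assume "i + w = p + b" "feasible (Suc k) w (?js @ [i])"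
                  then have "i = j" using v(6) by simp
                  then show "dominates (gain zs f) w tb (?js @ [i])"
                    using t le cc[OF jn] ch(1) by (auto simp: dominates_def val_def)
                qed
                moreover have "eqx trans_vars h ?h" by (rule eqx_trans[OF e4 eqx_refl[of "{}"]]) (auto simp: trans_vars_def)
                ultimately show ?thesis using I rep4 unfolding POST_def by blast
              qed
              subgoal
                apply (rule H_WRITE[where h = ?h and i = i1 and x = "int (Suc k)" and g = val and j = "int j" and s = "int s"])
                     apply (rule X4)+
                apply (intro conjI written; (assumption | rule I[THEN conjunct1])?)
              proof -
                fix v' j' s'
                assume a: "ev (X vF \<section>vTMP \<ominus> \<section>vK) ?h \<le> 0" and t: "tb (Suc p) c = Some (v', j', s')"
                have "?h vF i1 \<le> int k" using a C3(4) by simp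
                with F4 t show "v' \<le> val" by simp
              qed
              subgoal using v3 I S PB gn val by (simp add: eqx_def)
              done
          qed
          subgoal using cSZ Y(4) by simp
          done
      qed
    qed
    done
qed

lemma H_TRANS:
  assumes env: "ENV k zs f h" and rep: "REP h k tb" and D: "DPI k zs f p tb D"
    and p: "p \<le> k" "tb p s \<noteq> None" "b \<le> 2 * w"
    and v: "h vLEV 0 = int p" "h vMASK 0 = int s" "h vU 0 = int b"
  shows "H q Y TRANS h tr (\<lambda>h' tr'. tr' = tr \<and> POST k zs f p tb (insert (s, b) D) h h')"
proof -
  note C = ENV_consts[OF env]
  let ?h = "up h vJJ 0 (int p + int b - int w)"
  have e: "eqx {vJJ} h ?h" by (auto intro!: eqx_intros)
  have env': "ENV k zs f ?h" by (rule ENV_eqx[OF env e]) (simp add: env_vars_def con_vars_def)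
  have rep': "REP ?h k tb" by (rule REP_eqx[OF rep e]) simp
  have nof: "POST k zs f p tb (insert (s, b) D) h ?h" if "\<And>j. j \<le> k \<Longrightarrow> j + w \<noteq> p + b"
  proof -
    have "DPI k zs f p tb (insert (s, b) D)"
      using that by (intro DPI_skip[OF D]) (auto simp: feasible_snoc)
    moreover have "eqx trans_vars h ?h" by (rule eqx_trans[OF e eqx_refl[of "{}"]]) (auto simp: trans_vars_def)
    ultimately show ?thesis using rep' unfolding POST_def by blast
  qed
  show ?thesis
    unfolding TRANS_def
    apply (rule Hseq H_set)+
    apply (subgoal_tac "up h vJJ (ev (N 0) h) (ev (\<section>vLEV \<oplus> \<section>vU \<ominus> \<section>vW) h) = ?h")
     apply (simp only:)
     apply (intro Hif H_skip)
    subgoal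
    proof -
      assume a: "0 < ev (\<section>vJJ \<oplus> N 1) ?h" "0 < ev (\<section>vX \<ominus> \<section>vJJ) ?h"
      define j where "j = p + b - w"
      have ge: "w \<le> p + b" using a(1) by simp
      have j: "j + w = p + b" "j \<le> k" using a(2) ge C(3) by (simp_all add: j_def)
      have jj: "?h vJJ 0 = int j" using ge by (simp add: j_def)
      show ?thesis
        apply (rule H_conseq)
         apply (rule H_EXTEND[OF env' rep' D p _ _ _ jj j(2,1)])
        subgoal using v by simp
        subgoal using v by simp
        subgoal using v by simp
        subgoal for h' tr'
        proof -
          assume P: "tr' = tr \<and> POST k zs f p tb (insert (s, b) D) ?h h'"
          have "eqx trans_vars h h'"
            by (rule eqx_trans[OF e, of trans_vars]) (use P in \<open>auto simp: POST_def trans_vars_def\<close>)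
          then show ?thesis using P by (simp add: POST_def)
        qed
        done
    qed
    subgoal
    proof (intro conjI refl nof)
      fix j assume a: "ev (\<section>vX \<ominus> \<section>vJJ) ?h \<le> 0" and "j \<le> k"
      then show "j + w \<noteq> p + b" using C(3) by simp
    qed
    subgoal
    proof (intro conjI refl nof)
      fix j assume a: "ev (\<section>vJJ \<oplus> N 1) ?h \<le> 0" and "j \<le> k"
      then show "j + w \<noteq> p + b" by simp
    qed
    subgoal using v C(1) by simp
    done
qed

lemma H_STATE:
  assumes env: "ENV k zs f h" and rep: "REP h k tb" and D: "DPI k zs f p tb D"
    and p: "p \<le> k" "s < SZ" and v: "h vLEV 0 = int p" "h vMASK 0 = int s"
  shows "H q Y STATE h tr (\<lambda>h' tr'. tr' = tr \<and> eqx (insert vU trans_vars) h h' \<and>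
    (\<exists>tb'. DPI k zs f p tb' (D \<union> {s} \<times> {..2 * w}) \<and> REP h' k tb'))"
proof -
  note C = ENV_consts[OF env]
  have kn: "p \<le> n" using env p by (simp add: ENV_def)
  have F: "h vF (h vPB (int p) + int s) \<le> int k \<longleftrightarrow> tb p s = None"
    using REP_None[OF rep kn p(2)] C(5)[of p] kn by simp
  have dis: "insert vU trans_vars \<inter> env_vars = {}" by (auto simp: trans_vars_def env_vars_def con_vars_def)
  show ?thesis
    unfolding STATE_def
  proof (rule Hif)
    assume "ev (X vF (X vPB \<section>vLEV \<oplus> \<section>vMASK) \<ominus> \<section>vK) h \<le> 0"
    then have "tb p s = None" using F v C by simp
    then have "explored (Suc k) w (gain zs f) tb p (D \<union> {s} \<times> {..2 * w})"
      using D unfolding DPI_def explored_def by auto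
    then have "DPI k zs f p tb (D \<union> {s} \<times> {..2 * w})" using D by (simp add: DPI_def)
    then show "H q Y Skip h tr (\<lambda>h' tr'. tr' = tr \<and> eqx (insert vU trans_vars) h h' \<and>
      (\<exists>tb'. DPI k zs f p tb' (D \<union> {s} \<times> {..2 * w}) \<and> REP h' k tb'))"
      by (intro H_skip conjI refl eqx_refl exI[of _ tb] rep)
  next
    assume "0 < ev (X vF (X vPB \<section>vLEV \<oplus> \<section>vMASK) \<ominus> \<section>vK) h"
    then have snn: "tb p s \<noteq> None" using F v C by simp
    show "H q Y (LET vU (N 0) ;; WHILE (\<section>vW \<oplus> \<section>vW \<oplus> N 1 \<ominus> \<section>vU) (TRANS ;; LET vU (\<section>vU \<oplus> N 1))) h tr
       (\<lambda>h' tr'. tr' = tr \<and> eqx (insert vU trans_vars) h h' \<and>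
        (\<exists>tb'. DPI k zs f p tb' (D \<union> {s} \<times> {..2 * w}) \<and> REP h' k tb'))"
      apply (rule Hseq H_set)+
      apply (rule Hwhile[where K = "2 * w + 1" and I = "\<lambda>b h' tr'. tr' = tr \<and> eqx (insert vU trans_vars) h h' \<and>
         h' vU 0 = int b \<and> (\<exists>tb'. tb' p = tb p \<and> DPI k zs f p tb' (D \<union> {s} \<times> {..<b}) \<and> REP h' k tb')"])
      subgoal
      proof -
        have "eqx {vU} h (up h vU 0 0)" by (auto intro!: eqx_intros)
        from REP_eqx[OF rep this] D show ?thesis by (auto intro!: eqx_intros)
      qed
      subgoal using C(1) by (simp add: eqx_def trans_vars_def)
      subgoal for b h' tr'
      proof -
        assume b: "b < 2 * w + 1" and I: "tr' = tr \<and> eqx (insert vU trans_vars) h h' \<and>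
         h' vU 0 = int b \<and> (\<exists>tb'. tb' p = tb p \<and> DPI k zs f p tb' (D \<union> {s} \<times> {..<b}) \<and> REP h' k tb')"
        then obtain tb' where tb': "tb' p = tb p" "DPI k zs f p tb' (D \<union> {s} \<times> {..<b})" "REP h' k tb'" by blast
        have e: "eqx (insert vU trans_vars) h h'" using I by simp
        have v': "h' vLEV 0 = int p" "h' vMASK 0 = int s" using v e by (simp_all add: eqx_def trans_vars_def)
        have Dins: "insert (s, b) (D \<union> {s} \<times> {..<b}) = D \<union> {s} \<times> {..<Suc b}" by auto
        show ?thesis
          apply (rule Hseq)
          apply (rule H_conseq)
           apply (rule H_TRANS[OF ENV_eqx[OF env e dis] tb'(3,2) p(1) _ _ v', where b = b])
          subgoal using tb' snn by simp
          subgoal using b by simp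
          subgoal using I by simp
          subgoal for h2 tr2
          proof -
            assume P: "tr2 = tr' \<and> POST k zs f p tb' (insert (s, b) (D \<union> {s} \<times> {..<b})) h' h2"
            then obtain tb2 where t: "tb2 p = tb' p" "DPI k zs f p tb2 (D \<union> {s} \<times> {..<Suc b})" "REP h2 k tb2"
              and e2: "eqx trans_vars h' h2" unfolding POST_def Dins by blast
            have "h2 vU 0 = int b" using I e2 by (simp add: eqx_def trans_vars_def)
            moreover have "eqx (insert vU trans_vars) h h2"
              by (rule eqx_trans[OF e e2]) auto
            moreover have "REP (up h2 vU 0 (int b + 1)) k tb2"
              by (rule REP_eqx[OF t(3), of "{vU}"]) (auto intro!: eqx_intros)
            ultimately show ?thesis
              using P I t tb'(1) by (intro H_set conjI exI[of _ tb2] eqx_up) auto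
          qed
          done
      qed
      subgoal using C(1) by (simp add: eqx_def trans_vars_def)
      subgoal by (auto simp: lessThan_Suc_atMost)
      subgoal by (rule Y(5))
      done
  qed
qed

definition level_vars :: "vr set" where "level_vars = {vU, vMASK} \<union> trans_vars"

lemma H_LEVEL:
  assumes env: "ENV k zs f h" and rep: "REP h k tb" and D: "DPI k zs f p tb {}"
    and p: "p \<le> k" and v: "h vLEV 0 = int p"
  shows "H q Y LEVEL h tr (\<lambda>h' tr'. tr' = tr \<and> eqx level_vars h h' \<and>
    (\<exists>tb'. DPI k zs f p tb' ({..<SZ} \<times> {..2 * w}) \<and> REP h' k tb'))"
proof -
  note C = ENV_consts[OF env]
  have dis: "level_vars \<inter> env_vars = {}" by (auto simp: level_vars_def trans_vars_def env_vars_def con_vars_def)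
  show ?thesis
    unfolding LEVEL_def
    apply (rule Hseq H_set)+
    apply (rule Hwhile[where K = SZ and I = "\<lambda>s h' tr'. tr' = tr \<and> eqx level_vars h h' \<and>
       h' vMASK 0 = int s \<and> (\<exists>tb'. DPI k zs f p tb' ({..<s} \<times> {..2 * w}) \<and> REP h' k tb')"])
    subgoal
    proof -
      have "eqx {vMASK} h (up h vMASK 0 0)" by (auto intro!: eqx_intros)
      from REP_eqx[OF rep this] D show ?thesis by (auto intro!: eqx_intros simp: level_vars_def)
    qed
    subgoal using C(2) by (simp add: eqx_def level_vars_def trans_vars_def flip: of_nat_power)
    subgoal for s h' tr'
    proof -
      assume s: "s < SZ" and I: "tr' = tr \<and> eqx level_vars h h' \<and>
         h' vMASK 0 = int s \<and> (\<exists>tb'. DPI k zs f p tb' ({..<s} \<times> {..2 * w}) \<and> REP h' k tb')"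
      then obtain tb' where tb': "DPI k zs f p tb' ({..<s} \<times> {..2 * w})" "REP h' k tb'" by blast
      have e: "eqx level_vars h h'" using I by simp
      have v': "h' vLEV 0 = int p" "h' vMASK 0 = int s" using v e I by (simp_all add: eqx_def level_vars_def trans_vars_def)
      have Dins: "{..<s} \<times> {..2 * w} \<union> {s} \<times> {..2 * w} = {..<Suc s} \<times> {..2 * w}" by auto
      show ?thesis
        apply (rule Hseq)
        apply (rule H_conseq)
         apply (rule H_STATE[OF ENV_eqx[OF env e dis] tb'(2,1) p s v'])
        subgoal for h2 tr2
        proof -
          assume P: "tr2 = tr' \<and> eqx (insert vU trans_vars) h' h2 \<and>
            (\<exists>tb'. DPI k zs f p tb' ({..<s} \<times> {..2 * w} \<union> {s} \<times> {..2 * w}) \<and> REP h2 k tb')"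
          then obtain tb2 where t: "DPI k zs f p tb2 ({..<Suc s} \<times> {..2 * w})" "REP h2 k tb2"
            unfolding Dins by blast
          have e2: "eqx (insert vU trans_vars) h' h2" using P by simp
          have "h2 vMASK 0 = int s" using v' e2 by (simp add: eqx_def trans_vars_def)
          moreover have "eqx level_vars h h2"
            by (rule eqx_trans[OF e e2]) (auto simp: level_vars_def)
          moreover have "REP (up h2 vMASK 0 (int s + 1)) k tb2"
            by (rule REP_eqx[OF t(2), of "{vMASK}"]) (auto intro!: eqx_intros)
          ultimately show ?thesis
            using P I t by (intro H_set conjI exI[of _ tb2] eqx_up) (auto simp: level_vars_def)
        qed
        done
    qed
    subgoal using C(2) by (simp add: eqx_def level_vars_def trans_vars_def flip: of_nat_power)
    subgoal by auto
    subgoal by (rule Y(4))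
    done
qed

lemma DPI_next:
  assumes "DPI k zs f p tb ({..<SZ} \<times> {..2 * w})"
  shows "DPI k zs f (Suc p) tb {}"
proof -
  have "complete (Suc k) w (gain zs f) tb (Suc p)"
    using assms explored_all unfolding DPI_def by blast
  then show ?thesis using assms by (auto simp: DPI_def sound_def explored_def)
qed

definition table_vars :: "vr set" where "table_vars = insert vLEV level_vars"

lemma H_TABLE:
  assumes env: "ENV k zs f h" and F: "\<And>i. h vF i \<le> int k"
  shows "H q Y TABLE h tr (\<lambda>h' tr'. tr' = tr \<and> eqx table_vars h h' \<and>
    (\<exists>tb. DPI k zs f (Suc k) tb {} \<and> REP h' k tb))"
proof -
  note C = ENV_consts[OF env]
  have dis: "table_vars \<inter> env_vars = {}"
    by (auto simp: table_vars_def level_vars_def trans_vars_def env_vars_def con_vars_def)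
  \<comment> \<open>The only entry is that of the empty prefix, whose state is given by
    \<open>code_Nil\<close>; this value accounts for the dummy positions.\<close>
  define tb0 :: table where "tb0 p s = (if p = 0 \<and> s = 2 ^ w - 1 then Some (0, 0, 0) else None)" for p s
  have i0: "h vPOW (int w) - 1 = int (2 ^ w - 1)" using C(6)[of w] by (simp add: of_nat_diff)
  let ?i = "int (2 ^ w - 1)"
  have D0: "DPI k zs f 0 tb0 {}"
    using start_less by (auto simp: DPI_def WFT_def sound_def complete_def explored_def dominates_def tb0_def
      feasible_Nil code_Nil)
  have R0: "REP h' k tb0" if "h' vF = (h vF)(?i := int (Suc k))" "h' vS = (h vS)(?i := 0)" for h'
    unfolding REP_def
  proof (intro conjI allI impI)
    show "h' vF i \<le> int (Suc k)" for i using that(1) F[of i] by simp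
    fix p s :: nat assume s: "s < SZ"
    have eq: "int (p * SZ + s) = ?i \<longleftrightarrow> p = 0 \<and> s = 2 ^ w - 1"
      using mult_add_inject[of s SZ "2 ^ w - 1" p 0] s start_less unfolding of_nat_eq_iff by auto
    show "case tb0 p s of None \<Rightarrow> h' vF (int (p * SZ + s)) \<le> int k
     | Some (v, j, s') \<Rightarrow> h' vF (int (p * SZ + s)) = int (Suc k) \<and> h' vS (int (p * SZ + s)) = v \<and>
         (p > 0 \<longrightarrow> h' vJ (int (p * SZ + s)) = int j \<and> h' vP (int (p * SZ + s)) = int s')"
      unfolding that fun_upd_apply eq using F by (simp add: tb0_def)
  qed
  show ?thesis
    unfolding TABLE_def
    apply (rule Hseq H_set)+
    apply (rule Hwhile[where K = "Suc k" and I = "\<lambda>p h' tr'. tr' = tr \<and> eqx table_vars h h' \<and>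
       h' vLEV 0 = int p \<and> (\<exists>tb. DPI k zs f p tb {} \<and> REP h' k tb)"])
    subgoal using D0 R0 i0 C by (auto intro!: eqx_intros exI[of _ tb0] simp: table_vars_def level_vars_def trans_vars_def)
    subgoal using C(3) by (simp add: eqx_def table_vars_def level_vars_def trans_vars_def)
    subgoal for p h' tr'
    proof -
      assume p: "p < Suc k" and I: "tr' = tr \<and> eqx table_vars h h' \<and>
       h' vLEV 0 = int p \<and> (\<exists>tb. DPI k zs f p tb {} \<and> REP h' k tb)"
      then obtain tb where tb: "DPI k zs f p tb {}" "REP h' k tb" by blast
      have e: "eqx table_vars h h'" using I by simp
      show ?thesis
        apply (rule Hseq)
        apply (rule H_conseq)
         apply (rule H_LEVEL[OF ENV_eqx[OF env e dis] tb(2,1)])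
        subgoal using p by simp
        subgoal using I by simp
        subgoal for h2 tr2
        proof -
          assume P: "tr2 = tr' \<and> eqx level_vars h' h2 \<and>
            (\<exists>tb'. DPI k zs f p tb' ({..<SZ} \<times> {..2 * w}) \<and> REP h2 k tb')"
          then obtain tb2 where t: "DPI k zs f (Suc p) tb2 {}" "REP h2 k tb2" using DPI_next by blast
          have e2: "eqx level_vars h' h2" using P by simp
          have "h2 vLEV 0 = int p" using I e2 by (simp add: eqx_def level_vars_def trans_vars_def)
          moreover have "eqx table_vars h h2"
            by (rule eqx_trans[OF e e2]) (auto simp: table_vars_def)
          moreover have "REP (up h2 vLEV 0 (int p + 1)) k tb2"
            by (rule REP_eqx[OF t(2), of "{vLEV}"]) (auto intro!: eqx_intros)
          ultimately show ?thesis
            using P I t by (intro H_set conjI exI[of _ tb2] eqx_up) (auto simp: table_vars_def)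
        qed
        done
    qed
    subgoal using C(3) by (simp add: eqx_def table_vars_def level_vars_def trans_vars_def)
    subgoal by auto
    subgoal using env Y(1) by (simp add: ENV_def)
    done
qed

lemma DPI_final:
  assumes "DPI k zs f (Suc k) tb {}"
  obtains v j s' where "tb (Suc k) (2 ^ w - 1) = Some (v, j, s')"
    "\<And>js. feasible (Suc k) w js \<Longrightarrow> length js = Suc k \<Longrightarrow>
      lscore (gain zs f) js \<le> lscore (gain zs f) (chain tb (Suc k) (2 ^ w - 1))"
proof -
  have dom: "\<exists>v j s'. tb (Suc k) (2 ^ w - 1) = Some (v, j, s') \<and> lscore (gain zs f) js \<le> v"
    if "feasible (Suc k) w js" "length js = Suc k" for js
  proof -
    have "dominates (gain zs f) w tb js" using assms that unfolding DPI_def complete_def by blast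
    then show ?thesis using that(2) code_complete(1)[OF that] by (simp add: dominates_def)
  qed
  \<comment> \<open>Leaving everything in place is feasible, so the final entry exists.\<close>
  have "feasible (Suc k) w [0..<Suc k]" by (rule feasible_permutation) (auto simp del: upt_Suc)
  from dom[OF this] obtain v j s' where t: "tb (Suc k) (2 ^ w - 1) = Some (v, j, s')" by auto
  show thesis
  proof (rule that[OF t])
    fix js assume "feasible (Suc k) w js" "length js = Suc k"
    from dom[OF this] t DPI_chain(5)[OF assms t]
    show "lscore (gain zs f) js \<le> lscore (gain zs f) (chain tb (Suc k) (2 ^ w - 1))"
      by (simp del: chain.simps)
  qed
qed

lemma H_RECON:
  assumes env: "ENV k zs f h" and rep: "REP h k tb" and D: "DPI k zs f (Suc k) tb {}"
    and R: "\<And>h'. eqx {vPL, vMM, vL} h h' \<Longrightarrow>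
      LST vL h' (map ((!) zs) (chain tb (Suc k) (2 ^ w - 1))) \<Longrightarrow> R h' tr"
  shows "H q Y RECON h tr R"
proof -
  define js where "js = chain tb (Suc k) (2 ^ w - 1)"
  obtain v0 j0 s0 where t0: "tb (Suc k) (2 ^ w - 1) = Some (v0, j0, s0)" by (rule DPI_final[OF D]) (rule that)
  note ch = DPI_chain[OF D t0, folded js_def]
  note C = ENV_consts[OF env]
  have kn: "Suc k \<le> n" using env by (simp add: ENV_def)
  have wf: "WFT (Suc k) tb" using D by (simp add: DPI_def)
  let ?K = "Suc k"
  define INV where "INV i h' \<longleftrightarrow> eqx {vPL, vMM, vL} h h' \<and> h' vPL 0 = int (?K - i) \<and>
     (\<exists>s'. h' vMM 0 = int s' \<and> tb (?K - i) s' \<noteq> None \<and> chain tb (?K - i) s' = take (?K - i) js) \<and>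
     (\<forall>r<?K. ?K - i \<le> r \<longrightarrow> h' vL (int r) = int (zs ! (js ! r)))" for i h'
  show ?thesis
    unfolding RECON_def
    apply (rule Hseq H_set)+
    apply (rule Hwhile[where K = ?K and I = "\<lambda>i h' tr'. tr' = tr \<and> INV i h'"])
    subgoal
    proof -
      have "h vPOW (int w) - 1 = int (2 ^ w - 1)" using C(6)[of w] by (simp add: of_nat_diff)
      moreover have "chain tb ?K (2 ^ w - 1) = take ?K js" using ch(1) js_def by simp
      ultimately show ?thesis
        unfolding INV_def
        apply (intro conjI refl exI[of _ "2 ^ w - 1"])
        subgoal by (auto intro!: eqx_intros)
        subgoal using C(3) by simp
        subgoal using C(1) by simp
        subgoal using t0 by (simp del: chain.simps)
        subgoal by simp
        subgoal by simp
        done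
    qed
    subgoal by (simp add: INV_def)
    subgoal for i h' tr'
    proof -
      assume i: "i < ?K" and I: "tr' = tr \<and> INV i h'"
      then obtain s' where s': "h' vMM 0 = int s'" "tb (?K - i) s' \<noteq> None" "chain tb (?K - i) s' = take (?K - i) js"
        by (auto simp: INV_def)
      obtain p' where p': "?K - i = Suc p'" "?K - Suc i = p'" using i by (cases "?K - i") auto
      obtain u jj s'' where tb: "tb (Suc p') s' = Some (u, jj, s'')" using s'(2) p' by auto
      have sz: "s' < SZ" "tb p' s'' \<noteq> None" "jj < Suc k" using wf tb unfolding WFT_def by fastforce+
      have pl: "p' < length js" using p' ch(1) by simp
      have c: "chain tb p' s'' @ [jj] = take p' js @ [js ! p']"
        using s'(3) p' tb pl by (simp add: take_Suc_conv_app_nth)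
      then have jj: "jj = js ! p'" "chain tb p' s'' = take p' js" by auto
      have e: "eqx {vPL, vMM, vL} h h'" using I by (simp add: INV_def)
      have rep': "REP h' k tb" by (rule REP_eqx[OF rep e]) simp
      have env': "ENV k zs f h'" by (rule ENV_eqx[OF env e]) (simp add: env_vars_def con_vars_def)
      note C' = ENV_consts[OF env']
      have pn: "Suc p' \<le> n" using p' kn by linarith
      have idx: "h' vPB (1 + int p') + int s' = int (Suc p' * SZ + s')" using C'(5)[of "Suc p'"] pn by simp
      have mem: "h' vJ (int (Suc p' * SZ + s')) = int jj" "h' vP (int (Suc p' * SZ + s')) = int s''"
        "h' vZ (int jj) = int (zs ! jj)"
        using REP_Some[OF rep' pn sz(1) tb] C'(8)[of jj] sz(3) by auto
      have PL: "h' vPL 0 = 1 + int p'" using I p' by (simp add: INV_def)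
      have L: "\<forall>r<?K. Suc p' \<le> r \<longrightarrow> h' vL (int r) = int (zs ! (js ! r))" using I p' by (simp add: INV_def)
      show ?thesis
        apply (rule Hseq H_set)+
        apply (rule conjI)
        subgoal using I by simp
        unfolding INV_def p'(2)
        apply (intro conjI)
        subgoal by (intro eqx_up e) auto
        subgoal using PL by simp
        subgoal using PL s' idx mem jj sz(2) by (intro exI[of _ s'']) simp
        subgoal using PL s' idx mem jj(1) L by (auto simp: Suc_le_eq)
        done
    qed
    subgoal by (simp add: INV_def)
    subgoal for h' tr'
      using R[of h', folded js_def] ch(1) by (auto simp: INV_def LST_def)
    subgoal using kn Y(1) by simp
    done
qed

text \<open>The effect of an insertion without reference to the machine, so that
  \<open>stage_good\<close> argues about lists only. The table \<open>f'\<close> may be wrong about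
  pairs that were never asked; optimality is claimed here with respect to \<open>f'\<close>
  alone.\<close>

definition stage :: "outcomes \<Rightarrow> nat list \<Rightarrow> outcomes \<Rightarrow> nat list \<Rightarrow> outcomes \<Rightarrow> bool" where
  "stage q ys f ys' f' \<longleftrightarrow> (\<exists>\<omega> pos zs js. transcript q ys (length ys div V) V m (Suc (length ys)) T \<omega> \<and>
     pos = pivot (length ys div V) \<omega> T * V \<and> zs = insert_at pos (Suc (length ys)) ys \<and>
     f' = asked q (Suc (length ys)) ((!) zs ` {i. i < Suc (length ys) \<and> near cc pos i}) f \<and>
     ys' = map ((!) zs) js \<and> feasible (Suc (length ys)) w js \<and> length js = Suc (length ys) \<and>
     (\<forall>js'. feasible (Suc (length ys)) w js' \<longrightarrow> length js' = Suc (length ys) \<longrightarrow>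
        lscore (gain zs f') js' \<le> lscore (gain zs f') js))"

definition ST :: "arrs \<Rightarrow> nat \<Rightarrow> nat list \<Rightarrow> outcomes \<Rightarrow> bool" where
  "ST h k ys f \<longleftrightarrow> CON h \<and> h vK 0 = int k \<and> LST vL h ys \<and> distinct ys \<and> set ys = {1..k} \<and>
     length ys = k \<and> TABREL h f \<and> (\<forall>i. h vF i \<le> int k)"

lemma H_STAGE:
  assumes st: "ST h k ys f" and k: "k < n"
  shows "H q Y STAGE h tr (\<lambda>h' tr'. \<exists>ys' f'. stage q ys f ys' f' \<and> ST h' (Suc k) ys' f' \<and>
    length tr' \<le> length tr + (2 * T * m + 2 * cc + 1) \<and> set tr' \<subseteq> set tr \<union> {Suc k} \<times> {1..k})"
proof -
  have s: "CON h" "h vK 0 = int k" "LST vL h ys" "distinct ys" "set ys = {1..k}" "length ys = k"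
    "TABREL h f" "\<And>i. h vF i \<le> int k" using st by (auto simp: ST_def)
  obtain \<omega> where \<omega>: "\<And>t. \<omega> t = (test_sum q ys V m (Suc k) (pivot (k div V) \<omega> t - 2) t > 0,
    test_sum q ys V m (Suc k) (pivot (k div V) \<omega> t + 2) t > 0)"
    and tra: "transcript q ys (k div V) V m (Suc k) T \<omega>" 
    by (rule ex_transcript[where q = q and ys = ys and x = "Suc k" and B = "k div V"]) (rule that; assumption)
  define pos where "pos = pivot (k div V) \<omega> T * V"
  have pk: "pos \<le> k"
  proof -
    have "pivot (k div V) \<omega> T \<le> k div V" by (rule median_props(1)[OF weights_pos])
    then have "pos \<le> k div V * V" unfolding pos_def by (rule mult_le_mono1)
    then show ?thesis using div_times_less_eq_dividend[of k V] by linarith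
  qed
  define zs where "zs = insert_at pos (Suc k) ys"
  note z = insert_at_props[OF s(4,5,6) pk, folded zs_def]
  define f' where "f' = asked q (Suc k) ((!) zs ` {i. i < Suc k \<and> near cc pos i}) f"
  show ?thesis
    unfolding STAGE_def
    apply (rule Hseq)
    apply (rule H_SEARCH[OF s(1,2) k s(3,6) \<omega>])
    subgoal for h1 tr1
      apply (rule Hseq)
    proof (rule H_INSERT)
      assume e1: "eqx {vX, vBB, vi, vMU, vTM, vp, vTOT, vR, vACC, vPP, vSUM, vj, vTMP, vPOS} h h1"
        and x1: "h1 vX 0 = int (Suc k)" and p1: "h1 vPOS 0 = int (pivot (k div V) \<omega> T * V)"
        and t1: "length tr1 \<le> length tr + 2 * T * m" "set tr1 \<subseteq> set tr \<union> {Suc k} \<times> set ys"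
      show "LST vL h1 ys" by (rule LST_eqx[OF s(3) e1]) simp
      show "h1 vK 0 = int (length ys)" using s(2,6) e1 by (simp add: eqx_def)
      show "h1 vX 0 = int (Suc k)" by (rule x1)
      show "h1 vPOS 0 = int pos" using p1 by (simp add: pos_def)
      show "pos \<le> length ys" "length ys \<le> n" using pk s(6) k by auto
      fix h2 assume e2: "eqx {vi, vZ} h1 h2" and Z2: "LST vZ h2 (insert_at pos (Suc k) ys)"
      have con1: "CON h1" by (rule CON_eqx[OF s(1) e1]) (simp add: con_vars_def)
      have con2: "CON h2" by (rule CON_eqx[OF con1 e2]) (simp add: con_vars_def)
      have tab2: "TABREL h2 f" by (rule TABREL_eqx[OF TABREL_eqx[OF s(7) e1] e2]) auto
      have near_tr: "length (map (\<lambda>i. (Suc k, zs ! i)) (filter (near cc pos) [0..<Suc k])) \<le> 2 * cc + 1"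
        using length_near[of cc pos "Suc k"] by (simp only: length_map)
      have near_set: "set (map (\<lambda>i. (Suc k, zs ! i)) (filter (near cc pos) [0..<Suc k])) \<subseteq> {Suc k} \<times> {1..k}"
      proof -
        have "zs ! i \<in> {1..k}" if "i < Suc k" "near cc pos i" for i
        proof -
          have "zs ! i \<in> set zs" using that z(3) by (intro nth_mem) simp
          moreover have "zs ! i \<noteq> Suc k"
            using that pk z(1,3,4) nth_eq_iff_index_eq[of zs i pos] by (auto simp: near_def)
          ultimately show ?thesis using z(2) by auto
        qed
        then show ?thesis by auto
      qed
      show "H q Y (COMPARE ;; TABLE ;; RECON ;; LET vK (\<section>vK \<oplus> N 1)) h2 tr1
        (\<lambda>h' tr'. \<exists>ys' f'. stage q ys f ys' f' \<and> ST h' (Suc k) ys' f' \<and>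
          length tr' \<le> length tr + (2 * T * m + 2 * cc + 1) \<and> set tr' \<subseteq> set tr \<union> {Suc k} \<times> {1..k})"
        apply (rule Hseq)
        apply (rule H_COMPARE[where zs = zs and x = "Suc k" and pos = pos and f = f])
        subgoal by (rule con2)
        subgoal using Z2 by (simp add: zs_def)
        subgoal by (rule z)
        subgoal by (rule z)
        subgoal by (rule z)
        subgoal using k by simp
        subgoal using x1 e2 by (simp add: eqx_def)
        subgoal using p1 e2 by (simp add: eqx_def pos_def)
        subgoal using pk by simp
        subgoal by (rule z)
        subgoal by (rule tab2)
        subgoal for h3
        proof -
          assume e3: "eqx {vi, vTMP, vTAB} h2 h3"
            and T3: "TABREL h3 (asked q (Suc k) ((!) zs ` {i. i < Suc k \<and> near cc pos i}) f)"
          let ?tr = "tr1 @ map (\<lambda>i. (Suc k, zs ! i)) (filter (near cc pos) [0..<Suc k])"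
          have tr: "length ?tr \<le> length tr + (2 * T * m + 2 * cc + 1)" "set ?tr \<subseteq> set tr \<union> {Suc k} \<times> {1..k}"
          proof -
            show "length ?tr \<le> length tr + (2 * T * m + 2 * cc + 1)"
              using t1(1) near_tr by (simp only: length_append)
            show "set ?tr \<subseteq> set tr \<union> {Suc k} \<times> {1..k}"
              unfolding set_append using t1(2)[unfolded s(5)] near_set by blast
          qed
          have env3: "ENV k zs f' h3"
            unfolding ENV_def f'_def
          proof (intro conjI)
            show "CON h3" by (rule CON_eqx[OF con2 e3]) (simp add: con_vars_def)
            show "h3 vX 0 = int (Suc k)" using x1 e2 e3 by (simp add: eqx_def)
            show "h3 vK 0 = int k" using s(2) e1 e2 e3 by (simp add: eqx_def)
            show "LST vZ h3 zs" using LST_eqx[OF Z2 e3] by (simp add: zs_def)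
          qed (use T3 z k in auto)
          have F3: "h3 vF i \<le> int k" for i using s(8) e1 e2 e3 by (simp add: eqx_def)
          show ?thesis
            apply (rule Hseq)
            apply (rule H_conseq)
             apply (rule H_TABLE[OF env3 F3])
            subgoal for h4 tr4
            proof -
              assume P4: "tr4 = ?tr \<and> eqx table_vars h3 h4 \<and> (\<exists>tb. DPI k zs f' (Suc k) tb {} \<and> REP h4 k tb)"
              then obtain tb where tb: "DPI k zs f' (Suc k) tb {}" "REP h4 k tb" by blast
              have env4: "ENV k zs f' h4"
                by (rule ENV_eqx[OF env3]) (use P4 in \<open>auto simp: table_vars_def level_vars_def trans_vars_def env_vars_def con_vars_def\<close>)
              obtain v0 j0 s0 where t0: "tb (Suc k) (2 ^ w - 1) = Some (v0, j0, s0)"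
                and best: "\<And>js. feasible (Suc k) w js \<Longrightarrow> length js = Suc k \<Longrightarrow>
                  lscore (gain zs f') js \<le> lscore (gain zs f') (chain tb (Suc k) (2 ^ w - 1))"
                by (rule DPI_final[OF tb(1)]) (rule that; assumption)
              define js where "js = chain tb (Suc k) (2 ^ w - 1)"
              note ch = DPI_chain[OF tb(1) t0, folded js_def]
              have "stage q ys f (map ((!) zs) js) f'"
                unfolding stage_def s(6)
                by (rule exI[of _ \<omega>], rule exI[of _ pos], rule exI[of _ zs], rule exI[of _ js])
                  (use tra ch best in \<open>simp add: pos_def zs_def f'_def js_def del: chain.simps\<close>)
              moreover have "distinct (map ((!) zs) js)" "set (map ((!) zs) js) = {1..Suc k}"
              proof -
                have sj: "set js = {..<Suc k}" by (rule code_complete(2)[OF ch(3,1)])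
                have dj: "distinct js" using ch(3) by (simp add: feasible_def)
                have "inj_on ((!) zs) {..<length zs}" using z(1) by (auto intro: inj_on_nth)
                then show "distinct (map ((!) zs) js)" using dj sj z(3) by (simp add: distinct_map)
                have "(!) zs ` {..<length zs} = set zs" by (auto simp: set_conv_nth)
                then show "set (map ((!) zs) js) = {1..Suc k}" using sj z(2,3) by simp
              qed
              moreover have "length (map ((!) zs) js) = Suc k" using ch by simp
              ultimately show ?thesis
                apply -
                apply (rule Hseq)
                apply (rule H_RECON[OF env4 tb(2,1)])
                subgoal for h5
                  apply (rule H_set)
                  apply (rule exI[of _ "map ((!) zs) js"], rule exI[of _ f'])
                  unfolding ST_def
                proof (intro conjI)
                  assume e5: "eqx {vPL, vMM, vL} h4 h5"
                    and L5: "LST vL h5 (map ((!) zs) (chain tb (Suc k) (2 ^ w - 1)))"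
                  let ?h = "up h5 vK (ev (N 0) h5) (ev (\<section>vK \<oplus> N 1) h5)"
                  have e6: "eqx {vPL, vMM, vL, vK} h4 ?h" using e5 by (auto simp: eqx_def)
                  have c4: "CON h4" "TABREL h4 f'" "h4 vK 0 = int k" using env4 by (auto simp: ENV_def)
                  show "CON ?h" by (rule CON_eqx[OF c4(1) e6]) (simp add: con_vars_def)
                  show "?h vK 0 = int (Suc k)" using c4(3) e5 by (simp add: eqx_def)
                  show "LST vL ?h (map ((!) zs) js)" using L5 by (simp add: LST_def js_def del: chain.simps)
                  show "TABREL ?h f'" by (rule TABREL_eqx[OF c4(2) e6]) simp
                  show "\<forall>i. ?h vF i \<le> int (Suc k)" using tb(2) e6 by (simp add: REP_def eqx_def)
                  show "length tr4 \<le> length tr + (2 * T * m + 2 * cc + 1)" "set tr4 \<subseteq> set tr \<union> {Suc k} \<times> {1..k}"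
                    using P4 tr by blast+
                qed
                done
            qed
            done
        qed
        done
    qed
    done
qed

end

section \<open>Set-up, output and the choice of parameters\<close>

definition SETUP :: com where
  "SETUP = LET vPw (N 1) ;; LET vLg (N 0) ;;
     WHILE (\<section>vN \<ominus> \<section>vPw) (LET vPw (\<section>vPw \<oplus> \<section>vPw) ;; LET vLg (\<section>vLg \<oplus> N 1)) ;;
     MUL vE \<section>vG \<section>vG ;; MUL vM (N 256) \<section>vE ;;
     MUL vE (\<section>vB \<oplus> N 6) \<section>vE ;; MUL vE \<section>vLg \<section>vE ;;
     MUL vT (N 32) \<section>vE ;; MUL vV \<section>vT \<section>vM ;; MUL vW (N 10) \<section>vV ;; MUL vCC (N 60) \<section>vV ;;
     SET vPOW (N 0) (N 1) ;; LET vi (N 0) ;;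
     WHILE (\<section>vW \<oplus> \<section>vW \<ominus> \<section>vi)
       (SET vPOW (\<section>vi \<oplus> N 1) (X vPOW \<section>vi \<oplus> X vPOW \<section>vi) ;; LET vi (\<section>vi \<oplus> N 1)) ;;
     LET vSZ (X vPOW (\<section>vW \<oplus> \<section>vW)) ;;
     TBL vROW (\<section>vN \<oplus> N 1) (\<section>vN \<oplus> N 1) ;; TBL vBV \<section>vV (\<section>vN \<oplus> N 1) ;; TBL vPB \<section>vSZ (\<section>vN \<oplus> N 1) ;;
     LET vK (N 1) ;; SET vL (N 0) (N 1)"

text \<open>The output cell of an item has the item itself as address, hence the raw
  \<open>Assign\<close>. Items are at least 1, so these addresses are positive and meet no array at
  a nonnegative index, in particular not cell 0 with \<open>n\<close>.\<close>

definition OUT :: com where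
  "OUT = LET vi (N 0) ;;
     WHILE (\<section>vN \<ominus> \<section>vi) (Assign (cx (X vL \<section>vi)) (cx (\<section>vi \<oplus> N 1)) ;; LET vi (\<section>vi \<oplus> N 1))"

definition PROG :: com where
  "PROG = SETUP ;; WHILE (\<section>vN \<ominus> \<section>vK) STAGE ;; OUT"

definition log2_ceil :: "nat \<Rightarrow> nat" where
  "log2_ceil n = (LEAST l. n \<le> 2 ^ l)"

lemma log2_ceil: "n \<le> 2 ^ log2_ceil n" "l < log2_ceil n \<Longrightarrow> 2 ^ l < n"
proof -
  show "n \<le> 2 ^ log2_ceil n" unfolding log2_ceil_def by (rule LeastI[of _ n]) (simp add: less_imp_le)
  show "l < log2_ceil n \<Longrightarrow> 2 ^ l < n"
    unfolding log2_ceil_def using not_less_Least by (metis not_le)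
qed

locale params =
  fixes n g b :: nat
  assumes n: "2 \<le> n" and g: "1 \<le> g"
begin

text \<open>The number \<open>T\<close> of rounds is so large that the search succeeds unless \<open>e\<close> of them contain a wrong
  test. A test consists of \<open>m\<close> queries, which makes the probability of \<open>e\<close> wrong ones small enough for
  a union bound over the \<open>4 ^ T\<close> transcripts. The insertion point is off by at most \<open>7 V\<close>, whence the
  window \<open>w\<close> and the query radius \<open>cc\<close>.\<close>

definition "lg = log2_ceil n"
definition "e = lg * ((b + 6) * (g * g))"
definition "m = 256 * (g * g)"
definition "T = 32 * e"
definition "V = T * m"
definition "w = 10 * V"
definition "cc = 60 * V"
text \<open>The number of states \<open>2 ^ (2 * w) = 2 ^ (20 * V)\<close> dominates all loop
  counts; the extra \<open>V\<close> leaves room for \<open>n\<close> and the bounds linear in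
  \<open>V\<close>. As \<open>V\<close> is a multiple of \<open>lg\<close>, \<open>Y\<close> is
  polynomial in \<open>n\<close>.\<close>

definition "Y = (2 :: nat) ^ (21 * V)"

lemma lg: "1 \<le> lg"
proof (rule ccontr)
  assume "\<not> 1 \<le> lg"
  then have "log2_ceil n = 0" by (simp add: lg_def)
  then have "n \<le> 1" using log2_ceil(1)[of n] by simp
  then show False using n by simp
qed

lemma sizes: "lg \<le> V" "b + 6 \<le> V" "g \<le> V" "T \<le> V" "m \<le> V" "8192 \<le> V" "0 < T" "0 < m" "0 < e"
proof -
  have gg: "1 \<le> g * g" "g \<le> g * g" using g by auto
  have mul: "x \<le> x * y" "x \<le> y * x" if "1 \<le> y" for x y :: nat using that by auto
  have e: "lg \<le> e" "b + 6 \<le> e" "g * g \<le> e" "1 \<le> e"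
  proof -
    have "1 \<le> (b + 6) * (g * g)" "b + 6 \<le> (b + 6) * (g * g)" "g * g \<le> (b + 6) * (g * g)"
      using gg by (auto intro!: mul)
    moreover have "(b + 6) * (g * g) \<le> e" "lg \<le> e" unfolding e_def using lg calculation(1) by (auto intro!: mul)
    ultimately show "lg \<le> e" "b + 6 \<le> e" "g * g \<le> e" "1 \<le> e" by linarith+
  qed
  have m: "256 \<le> m" using gg by (simp add: m_def)
  have T: "32 \<le> T" "e \<le> T" using e by (simp_all add: T_def)
  have V: "T \<le> V" "m \<le> V" "32 * 256 \<le> V"
    using m T mult_le_mono[of 32 T 256 m] unfolding V_def by (auto intro!: mul)
  show "lg \<le> V" "b + 6 \<le> V" "g \<le> V" "T \<le> V" "m \<le> V" "8192 \<le> V" "0 < T" "0 < m" "0 < e"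
    using e gg T V m by linarith+
qed

lemma V_le_Y: "V * 21 < Y" "2 ^ V + 2 \<le> Y"
proof -
  show "V * 21 < Y" unfolding Y_def using less_exp[of "21 * V"] by (simp add: mult.commute)
  have "(2::nat) ^ V + 2 \<le> 2 ^ V + 2 ^ V" using sizes(6) power_increasing[of 1 V "2::nat"] by simp
  also have "\<dots> = 2 ^ (V + 1)" by simp
  also have "\<dots> \<le> Y" unfolding Y_def using sizes(6) by (intro power_increasing) auto
  finally show "2 ^ V + 2 \<le> Y" .
qed

lemma n_le: "n \<le> 2 ^ V"
proof -
  have "n \<le> 2 ^ lg" unfolding lg_def by (rule log2_ceil)
  also have "(2::nat) ^ lg \<le> 2 ^ V" using sizes(1) by (intro power_increasing) auto
  finally show ?thesis .
qed

sublocale machine n m T V w cc Y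
proof
  show "V = T * m" "0 < T" "0 < m" using sizes by (auto simp: V_def)
  show "n + 2 \<le> Y" using n_le V_le_Y by linarith
  show "T \<le> Y" "m \<le> Y" "2 * w + 1 \<le> Y" "3 \<le> Y" using sizes V_le_Y by (auto simp: w_def)
  show "2 ^ (2 * w) \<le> Y" unfolding Y_def w_def by (intro power_increasing) auto
qed

lemma H_SETUP:
  assumes h: "h vN 0 = int n" "h vG 0 = int g" "h vB 0 = int b" "\<And>i. h vF i = 0" "\<And>i. h vTAB i = 0"
  shows "H q Y SETUP h tr (\<lambda>h' tr'. tr' = tr \<and> ST h' 1 [1] (\<lambda>_ _. 0))"
proof -
  have Yb: "lg \<le> Y" "b + 6 \<le> Y" "g \<le> Y" "T \<le> Y" "256 \<le> Y" "n + 1 \<le> Y" "2 * w \<le> Y"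
    using sizes V_le_Y Y by (linarith, linarith, linarith, linarith, linarith, linarith, linarith)
  define h0 where "h0 = h"
  let ?A = "{vPw, vLg, vi, vTMP, vE, vM, vT, vV, vW, vCC, vPOW, vSZ, vROW, vBV, vPB}"
  define B where "B h' \<longleftrightarrow> h' vN 0 = int n \<and> h' vG 0 = int g \<and> h' vB 0 = int b \<and> (\<forall>i. h' vF i = 0) \<and> (\<forall>i. h' vTAB i = 0)" for h' :: arrs
  have B: "B h''" if "eqx A h' h''" "A \<inter> {vN, vG, vB, vF, vTAB} = {}" "B h'" for A h' h''
  proof -
    have "h'' vN = h' vN" "h'' vG = h' vG" "h'' vB = h' vB" "h'' vF = h' vF" "h'' vTAB = h' vTAB"
      using that(1,2) by (auto intro!: eqxD[where A = A])
    then show ?thesis using that(3) by (simp add: B_def)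
  qed
  show ?thesis
    unfolding SETUP_def
    apply (rule Hseq H_set)+
    apply (rule Hwhile[where K = lg and I = "\<lambda>i h' tr'. tr' = tr \<and> B h' \<and> h' vPw 0 = 2 ^ i \<and> h' vLg 0 = int i"])
    subgoal using h by (simp add: B_def)
    subgoal for i h' tr'
      using log2_ceil(2)[of i n] by (simp add: B_def lg_def; (metis of_nat_less_iff of_nat_le_iff of_nat_numeral of_nat_power)?)
    subgoal for i h' tr'
      apply (rule Hseq H_set)+
      by (simp add: B_def)
    subgoal using log2_ceil(1)[of n] by (simp add: B_def lg_def; (metis of_nat_less_iff of_nat_le_iff of_nat_numeral of_nat_power)?)
    subgoal for h1 tr1
      apply (rule Hseq)
      apply (rule H_MUL[where cv = g and sv = "int g"])
      subgoal by (simp add: eqx_def B_def)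
      subgoal by (simp add: eqx_def B_def)
      subgoal by (rule Yb)
      subgoal by simp
      subgoal for h2
        apply (rule Hseq)
        apply (rule H_MUL[where cv = 256 and sv = "int (g * g)"])
        subgoal by (simp add: eqx_def)
        subgoal by simp
        subgoal by (rule Yb)
        subgoal by simp
        subgoal for h3
          apply (rule Hseq)
          apply (rule H_MUL[where cv = "b + 6" and sv = "int (g * g)"])
          subgoal by (simp add: eqx_def)
          subgoal by (simp add: eqx_def B_def)
          subgoal by (rule Yb)
          subgoal by simp
          subgoal for h4
            apply (rule Hseq)
            apply (rule H_MUL[where cv = lg and sv = "int ((b + 6) * (g * g))"])
            subgoal by (simp add: eqx_def)
            subgoal by (simp add: eqx_def B_def)
            subgoal by (rule Yb)
            subgoal by simp
            subgoal for h5
              apply (rule Hseq)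
              apply (rule H_MUL[where cv = 32 and sv = "int e"])
              subgoal by (simp add: eqx_def e_def)
              subgoal by simp
              subgoal using Yb by linarith
              subgoal by simp
              subgoal for h6
                apply (rule Hseq)
                apply (rule H_MUL[where cv = T and sv = "int m"])
                subgoal by (simp add: eqx_def m_def)
                subgoal by (simp add: eqx_def T_def)
                subgoal by (rule Yb)
                subgoal by simp
                subgoal for h7
                  apply (rule Hseq)
                  apply (rule H_MUL[where cv = 10 and sv = "int V"])
                  subgoal by (simp add: eqx_def V_def)
                  subgoal by simp
                  subgoal using Yb by linarith
                  subgoal by simp
                  subgoal for h8
                    apply (rule Hseq)
                    apply (rule H_MUL[where cv = 60 and sv = "int V"])
                    subgoal by (simp add: eqx_def V_def)
                    subgoal by simp
                    subgoal using Yb by linarith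
                    subgoal by simp
                    subgoal for h9
                    proof -
                      assume a: "tr1 = tr \<and> B h1 \<and> h1 vPw 0 = 2 ^ lg \<and> h1 vLg 0 = int lg"
                        "eqx {vTMP, vi, vE} h1 h2" "eqx {vTMP, vi, vM} h2 h3" "eqx {vTMP, vi, vE} h3 h4"
                        "eqx {vTMP, vi, vE} h4 h5" "eqx {vTMP, vi, vT} h5 h6" "eqx {vTMP, vi, vV} h6 h7"
                        "eqx {vTMP, vi, vW} h7 h8" "eqx {vTMP, vi, vCC} h8 h9"
                        and c: "h3 vM 0 = int 256 * int (g * g)" "h6 vT 0 = int 32 * int e" "h7 vV 0 = int T * int m"
                        "h8 vW 0 = int 10 * int V" "h9 vCC 0 = int 60 * int V"
                      have "B h2" by (rule B[OF a(2)]) (use a(1) in simp_all)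
                      then have "B h3" by (rule B[OF a(3), rotated]) simp
                      then have "B h4" by (rule B[OF a(4), rotated]) simp
                      then have "B h5" by (rule B[OF a(5), rotated]) simp
                      then have "B h6" by (rule B[OF a(6), rotated]) simp
                      then have "B h7" by (rule B[OF a(7), rotated]) simp
                      then have "B h8" by (rule B[OF a(8), rotated]) simp
                      then have B9: "B h9" by (rule B[OF a(9), rotated]) simp
                      have v: "h9 vM 0 = int m" "h9 vT 0 = int T" "h9 vV 0 = int V" "h9 vW 0 = int w" "h9 vCC 0 = int cc"
                        using a(4-9) c by (simp_all add: eqx_def m_def T_def V_def w_def cc_def)
                      show ?thesis
                        apply (rule Hseq H_set)+
                        apply (rule Hwhile[where K = "2 * w" and I = "\<lambda>i h' tr'. tr' = tr \<and> eqx {vPOW, vi} h9 h' \<and>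
                           h' vi 0 = int i \<and> (\<forall>j\<le>i. h' vPOW (int j) = 2 ^ j)"])
                        subgoal using a(1) by (auto intro!: eqx_intros)
                        subgoal using v by (simp add: eqx_def)
                        subgoal for i h' tr'
                          apply (rule Hseq H_set)+
                          by (auto intro!: eqx_intros simp: le_Suc_eq)
                        subgoal using v by (simp add: eqx_def)
                        subgoal for h10 tr10
                        proof -
                          assume I: "tr10 = tr \<and> eqx {vPOW, vi} h9 h10 \<and>
                            h10 vi 0 = int (2 * w) \<and> (\<forall>j\<le>2 * w. h10 vPOW (int j) = 2 ^ j)"
                          have v10: "h10 vM 0 = int m" "h10 vT 0 = int T" "h10 vV 0 = int V" "h10 vW 0 = int w"
                            "h10 vCC 0 = int cc" "h10 vN 0 = int n"
                            using I v B9 by (simp_all add: eqx_def B_def)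
                          let ?h = "up h10 vSZ 0 (2 ^ (2 * w))"
                          have sz: "h10 vPOW (int w + int w) = 2 ^ (2 * w)"
                            using I by (metis le_refl mult_2 of_nat_add)
                          have B11: "B ?h" using I B9 by (simp add: B_def eqx_def)
                          show ?thesis
                            apply (rule Hseq H_set)+
                            apply (subgoal_tac "up h10 vSZ (ev (N 0) h10) (ev (X vPOW (\<section>vW \<oplus> \<section>vW)) h10) = ?h")
                             apply (simp only:)
                             apply (rule H_TBL[where sv = "int n + 1" and cv = "n + 1"])
                            subgoal by simp
                            subgoal using v10 by (simp add: eqx_def)
                            subgoal using v10 by (simp add: eqx_def)
                            subgoal by (rule Yb)
                            subgoal for h12
                              apply (rule Hseq)
                              apply (rule H_TBL[where sv = "int V" and cv = "n + 1"])
                              subgoal by simp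
                              subgoal using v10 by (simp add: eqx_def)
                              subgoal using v10 by (simp add: eqx_def)
                              subgoal by (rule Yb)
                              subgoal for h13
                                apply (rule Hseq)
                                apply (rule H_TBL[where sv = "2 ^ (2 * w)" and cv = "n + 1"])
                                subgoal by simp
                                subgoal by (simp add: eqx_def)
                                subgoal using v10 by (simp add: eqx_def)
                                subgoal by (rule Yb)
                                subgoal for h14
                                proof -
                                  assume r: "eqx {vROW, vi} ?h h12" "\<And>j. j \<le> n + 1 \<Longrightarrow> h12 vROW (int j) = int j * (int n + 1)"
                                    "eqx {vBV, vi} h12 h13" "\<And>j. j \<le> n + 1 \<Longrightarrow> h13 vBV (int j) = int j * int V"
                                    "eqx {vPB, vi} h13 h14" "\<And>j. j \<le> n + 1 \<Longrightarrow> h14 vPB (int j) = int j * 2 ^ (2 * w)"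
                                  have e: "eqx {vROW, vBV, vPB, vi} ?h h14"
                                    by (rule eqx_trans[OF eqx_trans[OF r(1,3), of "{vROW, vBV, vi}"] r(5)]) auto
                                  have B14: "B h14" by (rule B[OF e _ B11]) simp
                                  have "h14 vROW (int j) = int j * (int n + 1)" "h14 vBV (int j) = int j * int V"
                                    if "j \<le> n + 1" for j using r that by (simp_all add: eqx_def)
                                  then have "CON h14"
                                    using v10 e r(6) I B14 by (simp add: CON_def eqx_def B_def algebra_simps)
                                  moreover have "eqx {vK, vL} h14 (up (up h14 vK 0 1) vL 0 1)" by (intro eqx_intros) auto
                                  ultimately have C: "CON (up (up h14 vK 0 1) vL 0 1)"
                                    by (rule CON_eqx) (simp add: con_vars_def)
                                  show ?thesis
                                    apply (rule Hseq H_set)+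
                                    using C B14 I by (simp add: ST_def LST_def TABREL_def B_def)
                                qed
                                done
                              done
                            subgoal using v10 sz by simp
                            done
                        qed
                        subgoal by (rule Yb)
                        done
                    qed
                    done
                  done
                done
              done
            done
          done
        done
      done
    subgoal by (rule Yb)
    done
qed

lemma loc_nonpos: "0 \<le> i \<Longrightarrow> loc a i \<le> 0"
  using addr_range[of a] by (simp add: loc_def)

text \<open>Argued on raw memory, since through \<open>arr\<close> the output cells would appear as
  entries of various arrays at negative indices. Accordingly the invariant preserves arrays at
  nonnegative indices only.\<close>

lemma big_OUT:
  assumes "ST (arr m0) n ys f"
  obtains m' t where "big q OUT m0 m' t []" "t \<le> 5 * Y" "\<And>p. p < n \<Longrightarrow> m' (int (ys ! p)) = int (p + 1)"
proof -
  have s: "arr m0 vN 0 = int n" "LST vL (arr m0) ys" "distinct ys" "set ys = {1..n}" "length ys = n"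
    using assms by (auto simp: ST_def CON_def)
  have ysp: "1 \<le> ys ! p" if "p < n" for p
    using s(4,5) that nth_mem[of p ys] by (simp only: atLeastAtMost_iff)
  define I where "I i m' tr \<longleftrightarrow> tr = [] \<and> (\<forall>a j. 0 \<le> j \<longrightarrow> a \<noteq> vi \<longrightarrow> arr m' a j = arr m0 a j) \<and>
    arr m' vi 0 = int i \<and> (\<forall>p<i. m' (int (ys ! p)) = int (p + 1))" for i m' and tr :: "(nat \<times> nat) list"
  let ?c = "Assign (cx (X vL \<section>vi)) (cx (\<section>vi \<oplus> N 1)) ;; LET vi (\<section>vi \<oplus> N 1)"
  have body: "\<exists>m'' t tr'. big q ?c m' m'' t tr' \<and> t \<le> 3 \<and> I (Suc i) m'' (tr @ tr')"
    if i: "i < n" and inv: "I i m' tr" for i m' tr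
  proof -
    let ?m1 = "m'(int (ys ! i) := int i + 1)"
    let ?m2 = "?m1(loc vi 0 := int i + 1)"
    have v: "arr m' vL (int i) = int (ys ! i)" "arr m' vi 0 = int i"
      using inv LST_nth[OF s(2), of i] i s(5) by (auto simp: I_def)
    have a1: "arr ?m1 a j = arr m' a j" if "0 \<le> j" for a j
      using loc_nonpos[OF that, of a] ysp[OF i] by (auto simp: arr_def)
    have "big q (Assign (cx (X vL \<section>vi)) (cx (\<section>vi \<oplus> N 1))) m' ?m1 (Suc 0) []"
      using big.intros(2)[of q "cx (X vL \<section>vi)" "cx (\<section>vi \<oplus> N 1)" m'] v by (simp del: cx.simps)
    moreover have "big q (LET vi (\<section>vi \<oplus> N 1)) ?m1 ?m2 (Suc 0) []"
      using big.intros(2)[of q "adr vi (cx (N 0))" "cx (\<section>vi \<oplus> N 1)" ?m1] v a1[of 0 vi] by (simp add: SET_def del: cx.simps)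
    ultimately have "big q ?c m' ?m2 (Suc (Suc 0 + Suc 0)) ([] @ [])" by (rule big.intros(4))
    moreover have "I (Suc i) ?m2 tr"
    proof -
      have l0: "loc vi 0 \<noteq> int (ys ! p)" if "p < n" for p using loc_nonpos[of 0 vi] ysp[OF that] by auto
      have ne: "int (ys ! p) \<noteq> int (ys ! i)" if "p < i" for p
        using that i s(3,5) by (simp add: nth_eq_iff_index_eq)
      have "arr ?m2 a j = arr m0 a j" if "0 \<le> j" "a \<noteq> vi" for a j
      proof -
        have "arr m' a j = arr m0 a j" using inv that unfolding I_def by blast
        then show ?thesis using a1[OF that(1), of a] that unfolding arr_update by simp
      qed
      moreover have "arr ?m2 vi 0 = int (Suc i)" unfolding arr_update by simp
      moreover have "?m2 (int (ys ! p)) = int (p + 1)" if "p < Suc i" for p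
        using that inv i ne[of p] l0[of p] by (cases "p = i") (auto simp: I_def)
      ultimately show ?thesis using inv by (simp add: I_def)
    qed
    ultimately show ?thesis by (intro exI[of _ ?m2] exI[of _ "Suc (Suc 0 + Suc 0)"] exI[of _ "[]"]) simp
  qed
  let ?m1 = "m0(loc vi 0 := 0)"
  have I0: "I 0 ?m1 []" unfolding I_def arr_update by simp
  have "\<exists>m' t tr'. big q (Loop (cx (\<section>vN \<ominus> \<section>vi)) ?c) ?m1 m' t tr' \<and> t \<le> (n - 0) * Suc 3 + 1 \<and> I n m' ([] @ tr')"
  proof (rule big_loop_count[where I = I])
    have val: "val (cx (\<section>vN \<ominus> \<section>vi)) m = int n - int i" if "I i m tr" for i m tr
    proof -
      have "arr m vN 0 = arr m0 vN 0" "arr m vi 0 = int i" using that unfolding I_def by auto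
      then show ?thesis using s(1) by (simp del: cx.simps)
    qed
    show "val (cx (\<section>vN \<ominus> \<section>vi)) m' > 0 \<and>
        (\<exists>m'' t tr'. big q ?c m' m'' t tr' \<and> t \<le> 3 \<and> I (Suc i) m'' (tr @ tr'))"
      if "i < n" "I i m' tr" for i m' tr
      using val[OF that(2)] body[OF that] that(1) by (simp del: cx.simps)
    show "val (cx (\<section>vN \<ominus> \<section>vi)) m' \<le> 0" if "I n m' tr" for m' tr
      using val[OF that] by (simp del: cx.simps)
  qed (use I0 in simp_all)
  then obtain m' t tr' where l: "big q (Loop (cx (\<section>vN \<ominus> \<section>vi)) ?c) ?m1 m' t tr'" "t \<le> n * 4 + 1" "I n m' tr'" by auto
  have "big q (LET vi (N 0)) m0 ?m1 (Suc 0) []"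
    using big.intros(2)[of q "adr vi (cx (N 0))" "cx (N 0)" m0] by (simp add: SET_def del: cx.simps)
  from big.intros(4)[OF this l(1)] l(3) have "big q OUT m0 m' (Suc (Suc 0 + t)) []"
    by (simp add: OUT_def WHILE_def I_def)
  moreover have "Suc (Suc 0 + t) \<le> 5 * Y" using l(2) Y(1) by linarith
  moreover have "m' (int (ys ! p)) = int (p + 1)" if "p < n" for p using l(3) that by (simp add: I_def)
  ultimately show thesis by (rule that)
qed

end

section \<open>Exactness of one insertion\<close>

text \<open>Turns scores into sums over sets of ordered pairs, in which rankings can be compared
  pair by pair.\<close>

definition before :: "nat list \<Rightarrow> (nat \<times> nat) set" where
  "before xs = {(xs ! i, xs ! j) |i j. i < j \<and> j < length xs}"

lemma before_Cons: "before (x # xs) = {x} \<times> set xs \<union> before xs"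
proof (intro set_eqI iffI)
  fix z assume "z \<in> before (x # xs)"
  then obtain i j where ij: "z = ((x # xs) ! i, (x # xs) ! j)" "i < j" "j < Suc (length xs)"
    by (auto simp: before_def)
  then obtain j' where j': "j = Suc j'" "j' < length xs" by (cases j) auto
  show "z \<in> {x} \<times> set xs \<union> before xs"
    using ij j' by (cases i) (auto simp: before_def)
next
  fix z assume "z \<in> {x} \<times> set xs \<union> before xs"
  then consider j where "z = (x, xs ! j)" "j < length xs" | i j where "z = (xs ! i, xs ! j)" "i < j" "j < length xs"
    by (auto simp: before_def in_set_conv_nth)
  then show "z \<in> before (x # xs)"
  proof cases
    case 1
    then show ?thesis unfolding before_def by (intro CollectI exI[of _ 0] exI[of _ "Suc j"]) simp
  next
    case 2
    then show ?thesis unfolding before_def by (intro CollectI exI[of _ "Suc i"] exI[of _ "Suc j"]) simp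
  qed
qed

lemma before_subset: "before xs \<subseteq> set xs \<times> set xs"
  by (auto simp: before_def)

lemma finite_before: "finite (before xs)"
  by (rule finite_subset[OF before_subset]) simp

lemma lscore_before: "distinct xs \<Longrightarrow> lscore g xs = (\<Sum>(u, v)\<in>before xs. g v u)"
proof (induction xs)
  case (Cons x xs)
  have "{x} \<times> set xs \<inter> before xs = {}" using Cons.prems before_subset[of xs] by auto
  then have "(\<Sum>(u, v)\<in>before (x # xs). g v u) = (\<Sum>(u, v)\<in>{x} \<times> set xs. g v u) + (\<Sum>(u, v)\<in>before xs. g v u)"
    unfolding before_Cons by (intro sum.union_disjoint finite_before) auto
  also have "(\<Sum>(u, v)\<in>{x} \<times> set xs. g v u) = (\<Sum>v\<in>set xs. g v x)"
    by (simp add: sum.cartesian_product[symmetric])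
  finally show ?case using Cons by (simp add: sum_list_distinct_conv_sum_set)
qed (simp add: before_def)

lemma lscore_map: "lscore q (map h xs) = lscore (\<lambda>a b. q (h a) (h b)) xs"
  by (induction xs) (simp_all add: o_def)

lemma lscore_diff: "lscore (\<lambda>a b. g a b - g' a b) xs = lscore g xs - lscore g' xs"
  by (induction xs) (simp_all add: sum_list_subtractf)

text \<open>Feasible rankings agree on the order of items that are more than \<open>2 w\<close> positions apart.\<close>

lemma lscore_far:
  assumes "feasible K w js" "length js = K"
    and d: "\<And>a b. a < K \<Longrightarrow> b < K \<Longrightarrow> a \<noteq> b \<Longrightarrow> a \<le> b + 2 * w \<Longrightarrow> b \<le> a + 2 * w \<Longrightarrow> d a b = 0"
  shows "lscore d js = (\<Sum>(u, v)\<in>{(u, v). u + 2 * w < v \<and> v < K}. d v u)"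
proof -
  let ?F = "{(u, v). u + 2 * w < v \<and> v < K}"
  have js: "distinct js" "set js = {..<K}" "\<And>i. i < K \<Longrightarrow> js ! i < K \<and> js ! i \<le> i + w \<and> i \<le> js ! i + w"
    using assms(1,2) code_complete(2)[OF assms(1,2)] by (auto simp: feasible_def)
  have sub: "?F \<subseteq> before js"
  proof (clarify)
    fix u v assume uv: "u + 2 * w < v" "v < K"
    then have "u \<in> set js" "v \<in> set js" using js(2) by auto
    then obtain i j where ij: "i < K" "j < K" "u = js ! i" "v = js ! j" using assms(2) by (auto simp: in_set_conv_nth)
    with js(3)[of i] js(3)[of j] uv have "i < j" by linarith
    with ij assms(2) show "(u, v) \<in> before js" by (auto simp: before_def)
  qed
  have zero: "d v u = 0" if uv: "(u, v) \<in> before js - ?F" for u v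
  proof -
    from uv obtain i j where ij: "i < j" "j < K" "u = js ! i" "v = js ! j" using assms(2) by (auto simp: before_def)
    have "u \<noteq> v" using ij js(1) assms(2) by (simp add: nth_eq_iff_index_eq)
    moreover have "v \<le> u + 2 * w" using uv ij js(3)[of j] by auto
    moreover have "u \<le> v + 2 * w" using ij js(3)[of i] js(3)[of j] by linarith
    ultimately show ?thesis using d[of v u] js(3)[of i] js(3)[of j] ij by auto
  qed
  show ?thesis
    unfolding lscore_before[OF js(1)]
    by (rule sum.mono_neutral_right[OF finite_before sub]) (use zero in auto)
qed

lemma ex_opt_list:
  assumes "finite A"
  shows "\<exists>xs. opt_list q A xs"
proof -
  let ?S = "{xs. distinct xs \<and> set xs = A}"
  have "?S \<subseteq> {xs. set xs \<subseteq> A \<and> distinct xs}" by auto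
  then have fin: "finite ?S" using finite_subset_distinct[OF assms] finite_subset by blast
  obtain xs0 where "xs0 \<in> ?S" using finite_distinct_list[OF assms] by auto
  then have ne: "lscore q ` ?S \<noteq> {}" by blast
  have "Max (lscore q ` ?S) \<in> lscore q ` ?S" using fin ne by (intro Max_in) auto
  then obtain xs where xs: "xs \<in> ?S" "Max (lscore q ` ?S) = lscore q xs" by blast
  have "lscore q ys \<le> lscore q xs" if "ys \<in> ?S" for ys
    unfolding xs(2)[symmetric] using fin that by (intro Max_ge) auto
  with xs(1) show ?thesis by (auto simp: opt_list_def)
qed

lemma rank_in_Suc: "rank_in \<pi> (Suc k) i = rank_in \<pi> k i + (if \<pi> (Suc k) < \<pi> i then 1 else 0)"
proof -
  have "{j \<in> {1..Suc k}. \<pi> j < \<pi> i} =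
      (if \<pi> (Suc k) < \<pi> i then insert (Suc k) {j \<in> {1..k}. \<pi> j < \<pi> i} else {j \<in> {1..k}. \<pi> j < \<pi> i})"
    by (auto simp: le_Suc_eq)
  then show ?thesis by (simp add: rank_in_def)
qed

lemma rank_in_le: "rank_in \<pi> k i \<le> k"
proof -
  have "{j \<in> {1..k}. \<pi> j < \<pi> i} \<subseteq> {1..k}" by auto
  from card_mono[OF _ this] show ?thesis by (simp add: rank_in_def)
qed

text \<open>The gap counts the items between \<open>a\<close> and \<open>b\<close>, and more items
  can only increase it. So a pair that is close now was also close when its later member was
  inserted.\<close>

lemma rank_in_gap_mono:
  assumes "k \<le> k'" "rank_in \<pi> k' b \<le> rank_in \<pi> k' a + d"
  shows "rank_in \<pi> k b \<le> rank_in \<pi> k a + d"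
proof (cases "\<pi> b \<le> \<pi> a")
  case True
  then show ?thesis using rank_in_mono[of \<pi> b a k] by simp
next
  case False
  define S where "S k = {j \<in> {1..k}. \<pi> a \<le> \<pi> j \<and> \<pi> j < \<pi> b}" for k
  have "rank_in \<pi> k b = rank_in \<pi> k a + card (S k)" for k
  proof -
    have "{j \<in> {1..k}. \<pi> j < \<pi> b} = {j \<in> {1..k}. \<pi> j < \<pi> a} \<union> S k" using False by (auto simp: S_def)
    moreover have "card ({j \<in> {1..k}. \<pi> j < \<pi> a} \<union> S k) = card {j \<in> {1..k}. \<pi> j < \<pi> a} + card (S k)"
      by (rule card_Un_disjoint) (auto simp: S_def)
    ultimately show ?thesis by (simp add: rank_in_def)
  qed
  moreover have "card (S k) \<le> card (S k')" using assms(1) by (intro card_mono) (auto simp: S_def)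
  ultimately show ?thesis using assms(2) by simp
qed

text \<open>The new item is off by 6 blocks from the search and by less than one more because only
  its block is found; this gives \<open>7 V\<close>. For old items an insertion changes position and
  rank by at most 1, which the slack absorbs.\<close>

lemma near_sorted_insert:
  assumes ns: "near_sorted \<pi> k V ys" and V: "1 \<le> V" and r: "r \<le> rank_in \<pi> k (Suc k) div V + 6"
    "rank_in \<pi> k (Suc k) div V \<le> r + 6" and pos: "pos = r * V" "pos \<le> k"
  shows "near_sorted \<pi> (Suc k) (7 * V) (insert_at pos (Suc k) ys)"
proof -
  have ys: "distinct ys" "set ys = {1..k}" "\<And>p. p < k \<Longrightarrow> p \<le> rank_in \<pi> k (ys ! p) + V \<and> rank_in \<pi> k (ys ! p) \<le> p + V"
    using ns by (auto simp: near_sorted_def)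
  have len: "length ys = k" using distinct_card[OF ys(1)] ys(2) by simp
  note z = insert_at_props[OF ys(1,2) len pos(2)]
  let ?X = "rank_in \<pi> k (Suc k) div V"
  have X: "?X * V \<le> rank_in \<pi> k (Suc k)" "rank_in \<pi> k (Suc k) < ?X * V + V"
    using V div_mult_mod_eq[of "rank_in \<pi> k (Suc k)" V] mod_less_divisor[of V "rank_in \<pi> k (Suc k)"] by linarith+
  have "r * V \<le> (?X + 6) * V" "?X * V \<le> (r + 6) * V" using r by (intro mult_le_mono1; simp)+
  then have p: "pos \<le> ?X * V + 6 * V" "?X * V \<le> pos + 6 * V" by (simp_all add: pos(1) add_mult_distrib)
  have "p \<le> rank_in \<pi> (Suc k) (insert_at pos (Suc k) ys ! p) + 7 * V \<and>
      rank_in \<pi> (Suc k) (insert_at pos (Suc k) ys ! p) \<le> p + 7 * V" if pk: "p < Suc k" for p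
  proof -
    consider "p < pos" | "p = pos" | "pos < p" by linarith
    then show ?thesis
    proof cases
      case 1
      then have "insert_at pos (Suc k) ys ! p = ys ! p" using pos(2) len by (simp add: insert_at_def nth_append)
      then show ?thesis using ys(3)[of p] 1 pos(2) V by (simp add: rank_in_Suc)
    next
      case 2
      then have "rank_in \<pi> (Suc k) (insert_at pos (Suc k) ys ! p) = rank_in \<pi> k (Suc k)"
        using z(4) by (simp add: rank_in_Suc)
      then show ?thesis using 2 X p by linarith
    next
      case 3
      then have "insert_at pos (Suc k) ys ! p = ys ! (p - 1)"
        using pos(2) len pk by (simp add: insert_at_def nth_append nth_Cons' )
      moreover have "rank_in \<pi> (Suc k) i \<le> rank_in \<pi> k i + 1" "rank_in \<pi> k i \<le> rank_in \<pi> (Suc k) i" for i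
        by (simp_all add: rank_in_Suc)
      moreover have "p - 1 < k" using 3 pk by linarith
      ultimately have "p - 1 \<le> rank_in \<pi> (Suc k) (insert_at pos (Suc k) ys ! p) + V"
        "rank_in \<pi> (Suc k) (insert_at pos (Suc k) ys ! p) \<le> p - 1 + V + 1"
        using ys(3)[of "p - 1"] by (fastforce intro: order_trans)+
      then show ?thesis using 3 V by linarith
    qed
  qed
  with z(1,2) show ?thesis by (simp add: near_sorted_def)
qed

text \<open>Closeness refers to the stage \<open>max a b\<close>, at which the later of the two
  items was inserted and the pair was possibly asked. \<open>rank_in_gap_mono\<close> transfers
  closeness from later stages back to it.\<close>

definition known :: "(nat \<Rightarrow> nat) \<Rightarrow> nat \<Rightarrow> outcomes \<Rightarrow> nat \<Rightarrow> outcomes \<Rightarrow> bool" where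
  "known \<pi> D q k f \<longleftrightarrow> (\<forall>a\<in>{1..k}. \<forall>b\<in>{1..k}. a \<noteq> b \<longrightarrow>
     rank_in \<pi> (max a b) a \<le> rank_in \<pi> (max a b) b + D \<longrightarrow>
     rank_in \<pi> (max a b) b \<le> rank_in \<pi> (max a b) a + D \<longrightarrow> f a b = q a b)"

lemma near_sorted_index:
  assumes "near_sorted \<pi> k d zs" "a \<in> {1..k}"
  obtains i where "i < k" "zs ! i = a" "i \<le> rank_in \<pi> k a + d" "rank_in \<pi> k a \<le> i + d"
proof -
  have zs: "distinct zs" "set zs = {1..k}" using assms(1) by (auto simp: near_sorted_def)
  have "length zs = k" using distinct_card[OF zs(1)] zs(2) by simp
  with zs(2) assms(2) obtain i where "i < k" "zs ! i = a" by (metis in_set_conv_nth)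
  with assms(1) that show thesis unfolding near_sorted_def by metis
qed

text \<open>Displacement at most \<open>d\<close> in \<open>zs\<close> turns rank distance
  \<open>D\<close> into position distance at most \<open>D + 2 d\<close>, which the query radius
  covers.\<close>

lemma known_asked:
  assumes kn: "known \<pi> D q k f" and ns: "near_sorted \<pi> (Suc k) d zs" and z: "zs ! pos = Suc k" "pos < Suc k"
    and cc: "D + 2 * d \<le> cc" and legal: "legal q {1..Suc k}"
  shows "known \<pi> D q (Suc k) (asked q (Suc k) ((!) zs ` {i. i < Suc k \<and> near cc pos i}) f)"
proof -
  let ?N = "(!) zs ` {i. i < Suc k \<and> near cc pos i}"
  have zs: "distinct zs" "set zs = {1..Suc k}" using ns by (auto simp: near_sorted_def)
  have len: "length zs = Suc k" using distinct_card[OF zs(1)] zs(2) by simp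
  have posr: "pos \<le> rank_in \<pi> (Suc k) (Suc k) + d" "rank_in \<pi> (Suc k) (Suc k) \<le> pos + d"
    using ns z unfolding near_sorted_def by metis+
  have N: "b \<in> ?N" if "b \<in> {1..k}" "rank_in \<pi> (Suc k) (Suc k) \<le> rank_in \<pi> (Suc k) b + D"
    "rank_in \<pi> (Suc k) b \<le> rank_in \<pi> (Suc k) (Suc k) + D" for b
  proof -
    have "b \<in> {1..Suc k}" using that(1) by simp
    from near_sorted_index[OF ns this] obtain i where i: "i < Suc k" "zs ! i = b"
      "i \<le> rank_in \<pi> (Suc k) b + d" "rank_in \<pi> (Suc k) b \<le> i + d" .
    have "i \<noteq> pos" using i z that(1) by auto
    moreover have "i \<le> pos + cc" "pos \<le> i + cc" using i posr that cc by linarith+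
    ultimately show ?thesis using i by (auto simp: near_def)
  qed
  show ?thesis
    unfolding known_def
  proof (intro ballI impI)
    fix a b assume ab: "a \<in> {1..Suc k}" "b \<in> {1..Suc k}" "a \<noteq> b"
      and r: "rank_in \<pi> (max a b) a \<le> rank_in \<pi> (max a b) b + D" "rank_in \<pi> (max a b) b \<le> rank_in \<pi> (max a b) a + D"
    consider "a = Suc k" "b \<in> {1..k}" | "b = Suc k" "a \<in> {1..k}" | "a \<in> {1..k}" "b \<in> {1..k}"
      using ab by fastforce
    then show "asked q (Suc k) ?N f a b = q a b"
    proof cases
      case 1
      then have "max a b = Suc k" by auto
      then show ?thesis using N[of b] 1 r by (simp add: asked_def)
    next
      case 2
      then have "max a b = Suc k" by auto
      then have "asked q (Suc k) ?N f a b = - q (Suc k) a" using N[of a] 2 r ab(3) by (simp add: asked_def)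
      moreover have "q a (Suc k) = - q (Suc k) a" using legal ab 2 unfolding legal_def by metis
      ultimately show ?thesis using 2 by simp
    next
      case 3
      then have "asked q (Suc k) ?N f a b = f a b" by (auto simp: asked_def)
      then show ?thesis using kn 3 ab(3) r unfolding known_def by metis
    qed
  qed
qed

text \<open>Pairs on which \<open>q\<close> and \<open>f\<close> disagree are more than
  \<open>2 w\<close> positions apart in \<open>zs\<close>, so by \<open>lscore_far\<close> the
  scores under \<open>q\<close> and \<open>f\<close> of any feasible arrangement differ by the same
  constant \<open>C\<close>. Maximizing with \<open>f\<close> thus maximizes with \<open>q\<close>
  among feasible arrangements. The optimum \<open>xs\<close> is among these, because it and
  \<open>zs\<close> both follow the true order, up to \<open>d'\<close> and
  \<open>d\<close>.\<close>

lemma best_is_optimal: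
  assumes ns: "near_sorted \<pi> K d zs" and kn: "known \<pi> D q K f" and D: "2 * w + 2 * d \<le> D"
    and opt: "opt_list q {1..K} xs" "near_sorted \<pi> K d' xs" "d + d' \<le> w"
    and js: "feasible K w js" "length js = K"
      "\<And>js'. feasible K w js' \<Longrightarrow> length js' = K \<Longrightarrow> lscore (gain zs f) js' \<le> lscore (gain zs f) js"
  shows "opt_list q {1..K} (map ((!) zs) js)"
proof -
  have zs: "distinct zs" "set zs = {1..K}" using ns by (auto simp: near_sorted_def)
  have len: "length zs = K" using distinct_card[OF zs(1)] zs(2) by simp
  have inj: "inj_on ((!) zs) {..<K}" using zs(1) len by (auto intro: inj_on_nth)
  have img: "(!) zs ` {..<K} = {1..K}" using zs(2) len by (auto simp: set_conv_nth)
  let ?d = "\<lambda>a b. gain zs q a b - gain zs f a b"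
  have d0: "?d a b = 0" if "a < K" "b < K" "a \<noteq> b" "a \<le> b + 2 * w" "b \<le> a + 2 * w" for a b
  proof -
    have ab: "zs ! a \<in> {1..K}" "zs ! b \<in> {1..K}" "zs ! a \<noteq> zs ! b"
      using that zs len nth_mem[of a zs] nth_mem[of b zs] by (auto simp: nth_eq_iff_index_eq)
    have "a \<le> rank_in \<pi> K (zs ! a) + d" "rank_in \<pi> K (zs ! a) \<le> a + d"
      "b \<le> rank_in \<pi> K (zs ! b) + d" "rank_in \<pi> K (zs ! b) \<le> b + d"
      using ns that unfolding near_sorted_def by blast+
    then have "rank_in \<pi> K (zs ! a) \<le> rank_in \<pi> K (zs ! b) + D" "rank_in \<pi> K (zs ! b) \<le> rank_in \<pi> K (zs ! a) + D"
      using that D by linarith+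
    moreover have "max (zs ! a) (zs ! b) \<le> K" using ab by simp
    ultimately have "f (zs ! a) (zs ! b) = q (zs ! a) (zs ! b)"
      using kn ab rank_in_gap_mono[of "max (zs ! a) (zs ! b)" K \<pi>] unfolding known_def by blast
    then show ?thesis by simp
  qed
  define C where "C = (\<Sum>(u, v)\<in>{(u, v). u + 2 * w < v \<and> v < K}. ?d v u)"
  have shift: "lscore q (map ((!) zs) is) = lscore (gain zs f) is + C" if "feasible K w is" "length is = K" for "is"
    using lscore_far[OF that, of ?d, OF d0] unfolding lscore_map lscore_diff C_def by simp
  have xs: "distinct xs" "set xs = {1..K}" using opt(1) by (auto simp: opt_list_def)
  have xlen: "length xs = K" using distinct_card[OF xs(1)] xs(2) by simp
  define idx where "idx = inv_into {..<K} ((!) zs)"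
  have idx: "idx a < K" "zs ! idx a = a" if "a \<in> {1..K}" for a
    using inv_into_into[of a "(!) zs" "{..<K}"] f_inv_into_f[of a "(!) zs" "{..<K}"] that img
    by (auto simp: idx_def)
  define jo where "jo = map idx xs"
  have jo: "map ((!) zs) jo = xs" unfolding jo_def map_map by (rule map_idI) (use idx(2) xs(2) in simp)
  have jl: "length jo = K" using xlen by (simp add: jo_def)
  have djo: "distinct jo" using xs(1) jo by (metis distinct_map)
  have sjo: "set jo = {..<K}"
  proof (rule card_subset_eq)
    show "set jo \<subseteq> {..<K}" using idx(1) xs(2) by (auto simp: jo_def)
    show "card (set jo) = card {..<K}" using djo jl by (simp add: distinct_card)
  qed simp
  have fjo: "feasible K w jo"
  proof (rule feasible_permutation[OF djo sjo])
    fix i assume i: "i < K"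
    have x: "xs ! i \<in> {1..K}" using i xs(2) xlen nth_mem by metis
    have j: "jo ! i = idx (xs ! i)" using i xlen by (simp add: jo_def)
    have "jo ! i \<le> rank_in \<pi> K (xs ! i) + d" "rank_in \<pi> K (xs ! i) \<le> jo ! i + d"
      using ns idx[OF x] unfolding near_sorted_def j by metis+
    moreover have "i \<le> rank_in \<pi> K (xs ! i) + d'" "rank_in \<pi> K (xs ! i) \<le> i + d'"
      using opt(2) i unfolding near_sorted_def by blast+
    ultimately show "jo ! i \<le> i + w \<and> i \<le> jo ! i + w" using opt(3) by linarith
  qed
  have "lscore q xs \<le> lscore q (map ((!) zs) js)"
    using shift[OF fjo jl] shift[OF js(1,2)] js(3)[OF fjo jl] jo by simp
  moreover have "set js = {..<K}" by (rule code_complete(2)[OF js(1,2)])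
  then have "set (map ((!) zs) js) = {1..K}" using img by simp
  moreover have "distinct (map ((!) zs) js)"
    using js(1) inj \<open>set js = {..<K}\<close> by (simp add: distinct_map feasible_def)
  ultimately show ?thesis
    using opt(1) unfolding opt_list_def by (metis order_trans)
qed

section \<open>Correctness with high probability\<close>

locale full = params n g b + noisy n \<gamma> \<pi> Q
  for n g b :: nat and \<gamma> :: real and \<pi> :: "nat \<Rightarrow> nat" and Q :: "outcomes pmf" +
  fixes \<beta> :: real
  assumes \<beta>: "0 < \<beta>" and gb: "1 / \<gamma> \<le> real g" "\<beta> \<le> real b"
begin

definition minit :: mem where
  "minit = (\<lambda>_. 0)(0 := int n, -1 := int g, -2 := int b)"

abbreviation queries :: nat where "queries \<equiv> 2 * T * m + 2 * cc + 1"

lemma arr_minit: "arr minit = up (up (up (\<lambda>_ _. 0) vN 0 (int n)) vG 0 (int g)) vB 0 (int b)"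
proof -
  have "loc vN 0 = 0" "loc vG 0 = -1" "loc vB 0 = -2" by (simp_all add: loc_def addr_def)
  then have "minit = (((\<lambda>_. 0)(loc vN 0 := int n))(loc vG 0 := int g))(loc vB 0 := int b)"
    by (simp add: minit_def)
  moreover have "arr (\<lambda>_. 0) = (\<lambda>_ _. 0)" by (simp add: arr_def fun_eq_iff)
  ultimately show ?thesis by (simp only: arr_update)
qed

lemma ex_setup: "\<exists>m'. \<exists>t\<le>Y ^ ex SETUP. (\<forall>q. big q SETUP minit m' t []) \<and> ST (arr m') 1 [1] (\<lambda>_ _. 0)"
proof -
  \<comment> \<open>\<open>SETUP\<close> asks nothing, so its run for one arbitrary table is its run
    for all tables.\<close>
  have "H undefined Y SETUP (arr minit) [] (\<lambda>h' tr'. tr' = [] \<and> ST h' 1 [1] (\<lambda>_ _. 0))"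
    by (rule H_SETUP) (simp_all add: arr_minit)
  then obtain m' t where mt: "big undefined SETUP minit m' t []" "t \<le> Y ^ ex SETUP" "ST (arr m') 1 [1] (\<lambda>_ _. 0)"
    unfolding H_def by auto
  have "big q SETUP minit m' t []" for q by (rule big_local[OF mt(1)]) simp
  with mt show ?thesis by blast
qed

definition mstart :: mem where
  "mstart = (SOME m'. \<exists>t\<le>Y ^ ex SETUP. (\<forall>q. big q SETUP minit m' t []) \<and> ST (arr m') 1 [1] (\<lambda>_ _. 0))"

lemma mstart: "\<exists>t\<le>Y ^ ex SETUP. \<forall>q. big q SETUP minit mstart t []" "ST (arr mstart) 1 [1] (\<lambda>_ _. 0)"
  using someI_ex[OF ex_setup] unfolding mstart_def by blast+

text \<open>The memory after \<open>j\<close> insertions as a function of \<open>q\<close>; runs are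
  deterministic, so the choice is unique where a run exists. The ranking starts with one item and so
  has \<open>j + 1\<close> items at this point.\<close>

primrec stage_mem :: "outcomes \<Rightarrow> nat \<Rightarrow> mem" where
  "stage_mem q 0 = mstart"
| "stage_mem q (Suc j) = (SOME m'. \<exists>t tr. big q STAGE (stage_mem q j) m' t tr)"

lemma stage_mem_step:
  assumes "ST (arr (stage_mem q j)) (Suc j) ys f" "Suc j < n"
  obtains t tr ys' f' where "big q STAGE (stage_mem q j) (stage_mem q (Suc j)) t tr" "t \<le> Y ^ ex STAGE"
    "stage q ys f ys' f'" "ST (arr (stage_mem q (Suc j))) (Suc (Suc j)) ys' f'"
    "length tr \<le> queries" "set tr \<subseteq> {Suc (Suc j)} \<times> {1..Suc j}"
proof -
  from H_STAGE[OF assms, of q "[]"] obtain m' t tr ys' f' where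
    b: "big q STAGE (stage_mem q j) m' t tr" "t \<le> Y ^ ex STAGE" and
    r: "stage q ys f ys' f'" "ST (arr m') (Suc (Suc j)) ys' f'"
    "length tr \<le> queries" "set tr \<subseteq> {Suc (Suc j)} \<times> {1..Suc j}"
    unfolding H_def by auto
  have "\<exists>t tr. big q STAGE (stage_mem q j) (stage_mem q (Suc j)) t tr"
    unfolding stage_mem.simps by (rule someI[of _ m']) (use b in blast)
  then have "stage_mem q (Suc j) = m'" using big_det[OF b(1)] by blast
  with b r that show thesis by blast
qed

lemma stage_mem_ST: "Suc j \<le> n \<Longrightarrow> \<exists>ys f. ST (arr (stage_mem q j)) (Suc j) ys f"
proof (induction j)
  case 0
  then show ?case using mstart(2) by (auto simp: numeral_eq_Suc)
next
  case (Suc j)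
  then obtain ys f where "ST (arr (stage_mem q j)) (Suc j) ys f" by auto
  then show ?case using stage_mem_step[of q j ys f] Suc.prems by (metis Suc_le_lessD)
qed

text \<open>The fact behind the conditioning: earlier insertions have not looked at any outcome that
  involves the item to be searched for next.\<close>

lemma stage_mem_local:
  assumes "\<And>x y. 1 \<le> y \<Longrightarrow> y < x \<Longrightarrow> x \<le> Suc j \<Longrightarrow> q x y = q' x y" "Suc j \<le> n"
  shows "stage_mem q j = stage_mem q' j"
  using assms
proof (induction j)
  case (Suc j)
  then have eq: "stage_mem q j = stage_mem q' j" by simp
  obtain ys f where "ST (arr (stage_mem q j)) (Suc j) ys f" using stage_mem_ST[of j q] Suc.prems by auto
  then obtain t tr where b: "big q STAGE (stage_mem q j) (stage_mem q (Suc j)) t tr" and tr: "set tr \<subseteq> {Suc (Suc j)} \<times> {1..Suc j}"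
    using stage_mem_step[of q j ys f] Suc.prems by (metis Suc_le_lessD)
  have b': "big q' STAGE (stage_mem q' j) (stage_mem q (Suc j)) t tr"
    unfolding eq[symmetric] by (rule big_local[OF b]) (use tr Suc.prems(1) in auto)
  have "\<exists>t tr. big q' STAGE (stage_mem q' j) (stage_mem q' (Suc j)) t tr"
    unfolding stage_mem.simps by (rule someI[of _ "stage_mem q (Suc j)"]) (use b' in blast)
  then show ?case using big_det[OF b'] by blast
qed simp

definition ysl :: "outcomes \<Rightarrow> nat \<Rightarrow> nat list" where
  "ysl q j = map (\<lambda>i. nat (arr (stage_mem q j) vL (int i))) [0..<Suc j]"

lemma ysl: "ST (arr (stage_mem q j)) (Suc j) ys f \<Longrightarrow> ys = ysl q j"
  unfolding ST_def ysl_def LST_def by (intro nth_equalityI) (auto simp del: upt_Suc)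

lemma run:
  obtains m' t tr where "big q PROG minit m' t tr"
    "t \<le> Y ^ (ex SETUP + ex STAGE + 6)" "length tr \<le> n * queries"
    "\<And>p. p < n \<Longrightarrow> m' (int (ysl q (n - 1) ! p)) = int (p + 1)"
proof -
  obtain t1 where b1: "big q SETUP minit mstart t1 []" "t1 \<le> Y ^ ex SETUP" using mstart(1) by blast
  define I where "I i m' tr \<longleftrightarrow> m' = stage_mem q i \<and> length tr \<le> i * queries" for i m' and tr :: "(nat \<times> nat) list"
  have val: "val (cx (\<section>vN \<ominus> \<section>vK)) (stage_mem q i) = int n - int (Suc i)" if "i < n" for i
  proof -
    obtain ys f where "ST (arr (stage_mem q i)) (Suc i) ys f" using stage_mem_ST[of i q] \<open>i < n\<close> by auto
    then show ?thesis by (simp add: ST_def CON_def del: cx.simps)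
  qed
  have "\<exists>m' t tr'. big q (Loop (cx (\<section>vN \<ominus> \<section>vK)) STAGE) mstart m' t tr' \<and>
      t \<le> (n - 1 - 0) * Suc (Y ^ ex STAGE) + 1 \<and> I (n - 1) m' ([] @ tr')"
  proof (rule big_loop_count[where I = I])
    fix i m' tr assume i: "i < n - 1" and inv: "I i m' tr"
    have mem_eq: "m' = stage_mem q i" using inv by (simp add: I_def)
    have "Suc i \<le> n" "Suc i < n" using i by linarith+
    then obtain ys f where "ST (arr (stage_mem q i)) (Suc i) ys f" using stage_mem_ST[of i q] by auto
    then obtain t tr' where b: "big q STAGE (stage_mem q i) (stage_mem q (Suc i)) t tr'" "t \<le> Y ^ ex STAGE" "length tr' \<le> queries"
      using stage_mem_step[of q i ys f] \<open>Suc i < n\<close> by metis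
    have "I (Suc i) (stage_mem q (Suc i)) (tr @ tr')" using inv b(3) by (simp add: I_def)
    moreover have "val (cx (\<section>vN \<ominus> \<section>vK)) m' > 0"
      using val[of i] \<open>Suc i < n\<close> mem_eq by (simp del: cx.simps stage_mem.simps)
    ultimately show "val (cx (\<section>vN \<ominus> \<section>vK)) m' > 0 \<and>
        (\<exists>m'' t tr'. big q STAGE m' m'' t tr' \<and> t \<le> Y ^ ex STAGE \<and> I (Suc i) m'' (tr @ tr'))"
      using b(1,2) mem_eq by blast
  next
    fix m' tr assume "I (n - 1) m' tr"
    then show "val (cx (\<section>vN \<ominus> \<section>vK)) m' \<le> 0" using val[of "n - 1"] n by (simp add: I_def del: cx.simps)
  qed (simp_all add: I_def)
  then obtain m2 t2 tr where b2: "big q (Loop (cx (\<section>vN \<ominus> \<section>vK)) STAGE) mstart m2 t2 tr"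
    "t2 \<le> (n - 1) * Suc (Y ^ ex STAGE) + 1" "m2 = stage_mem q (n - 1)" "length tr \<le> (n - 1) * queries"
    by (auto simp: I_def)
  have n1: "Suc (n - 1) = n" using n by simp
  obtain ys f where st: "ST (arr (stage_mem q (n - 1))) n ys f" using stage_mem_ST[of "n - 1" q] n1 by auto
  have ys: "ys = ysl q (n - 1)" using ysl[of q "n - 1" ys f] st n1 by simp
  obtain m' t3 where b3: "big q OUT m2 m' t3 []" "t3 \<le> 5 * Y" "\<And>p. p < n \<Longrightarrow> m' (int (ys ! p)) = int (p + 1)"
    using big_OUT[OF st, of q] unfolding b2(3) by blast
  have b: "big q PROG minit m' (Suc (t1 + Suc (t2 + t3))) ([] @ (tr @ []))"
    unfolding PROG_def WHILE_def by (intro big.intros(4)[OF b1(1)] big.intros(4)[OF b2(1) b3(1)])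
  have "Suc (t1 + Suc (t2 + t3)) \<le> Y ^ (ex SETUP + ex STAGE + 6)"
  proof -
    define A B where "A = Y ^ ex SETUP" and "B = Y ^ ex STAGE"
    have AB: "1 \<le> A" "1 \<le> B" using Y(6) by (auto simp: A_def B_def)
    have le: "A \<le> A * B * Y" "Y * B \<le> A * B * Y" "Y \<le> A * B * Y" "1 \<le> A * B * Y"
      using AB Y(6) by (auto simp: mult.commute mult.left_commute)
    have "n - 1 \<le> Y" using Y(1) by linarith
    then have "t2 \<le> Y * Suc B + 1"
      using b2(2)[folded B_def] mult_le_mono1[of "n - 1" Y "Suc B"] by linarith
    then have "Suc (t1 + Suc (t2 + t3)) \<le> A + Y * B + 6 * Y + 3" using b1(2) b3(2) by (simp add: A_def)
    also have "\<dots> \<le> 11 * (A * B * Y)" using le by linarith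
    \<comment> \<open>A generous way to absorb the constant 11, as \<open>Y \<ge> 3\<close>. With
      the remaining factor \<open>Y\<close> this makes up the 6 in the exponent.\<close>
    also have "\<dots> \<le> Y ^ 5 * (A * B * Y)"
    proof -
      have "(3::nat) ^ 5 \<le> Y ^ 5" using Y(6) by (intro power_mono) auto
      then show ?thesis by (intro mult_le_mono1) simp
    qed
    also have "\<dots> = Y ^ (ex SETUP + ex STAGE + 6)"
      by (simp add: A_def B_def power_add eval_nat_numeral mult_ac)
    finally show ?thesis .
  qed
  moreover have "length ([] @ (tr @ [])) \<le> n * queries"
    using b2(4) mult_le_mono1[of "n - 1" n queries] by simp
  ultimately show thesis using that[OF b] b3(3) ys by blast
qed

text \<open>The total number of failure events, weighted suitably, is at most \<open>n ^ 6\<close>,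
  hence the margin of 6 over \<open>\<beta>\<close>.\<close>

definition bp :: real where "bp = \<beta> + 6"

definition up_ok :: "outcomes \<Rightarrow> nat \<Rightarrow> nat \<Rightarrow> nat \<Rightarrow> bool" where
  "up_ok q k i c \<longleftrightarrow> (let J = {j \<in> {1..k}. rank_in \<pi> k i < rank_in \<pi> k j \<and> rank_in \<pi> k j \<le> c} in
     2 * bp * ln n / \<gamma>\<^sup>2 \<le> card J \<longrightarrow> real_of_int (\<Sum>j\<in>J. q j i) > \<gamma> / 2 * card J)"

definition down_ok :: "outcomes \<Rightarrow> nat \<Rightarrow> nat \<Rightarrow> nat \<Rightarrow> bool" where
  "down_ok q k i c \<longleftrightarrow> (let J = {j \<in> {1..k}. c \<le> rank_in \<pi> k j \<and> rank_in \<pi> k j < rank_in \<pi> k i} in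
     2 * bp * ln n / \<gamma>\<^sup>2 \<le> card J \<longrightarrow> real_of_int (\<Sum>j\<in>J. q i j) > \<gamma> / 2 * card J)"

definition cut_ok :: "outcomes \<Rightarrow> nat \<Rightarrow> nat \<Rightarrow> nat list \<Rightarrow> bool" where
  "cut_ok q k c xs \<longleftrightarrow> (let M = inversions (\<lambda>x. rank_in \<pi> k x < c) xs in
     (real (length xs) + bp) * ln n \<le> \<gamma>\<^sup>2 / 2 * card M \<longrightarrow>
     real_of_int (\<Sum>(u, v)\<in>M. q v u) > \<gamma> / 2 * card M)"

text \<open>The guard makes the failure probability of each search boundable by itself, without
  assuming that the earlier stages went well.\<close>

definition search_ok :: "outcomes \<Rightarrow> nat \<Rightarrow> bool" where
  "search_ok q j \<longleftrightarrow> (near_sorted \<pi> (Suc j) V (ysl q j) \<longrightarrow>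
     \<not> lying_search \<pi> q (ysl q j) V m (Suc (Suc j)) T e)"

definition good :: "outcomes \<Rightarrow> bool" where
  "good q \<longleftrightarrow> q \<in> set_pmf Q \<and>
     (\<forall>k\<in>{1..n}. \<forall>i\<in>{1..k}. \<forall>c<k. up_ok q k i c \<and> down_ok q k i c) \<and>
     (\<forall>k\<in>{1..n}. \<forall>c\<le>k. \<forall>xs. distinct xs \<longrightarrow> set xs \<subseteq> {1..k} \<longrightarrow> cut_ok q k c xs) \<and>
     (\<forall>j. Suc j < n \<longrightarrow> search_ok q j)"

lemma ln_bounds: "1 / 2 \<le> ln (real n)" "ln (real n) \<le> real lg"
proof -
  have "exp (1 / 2 :: real) \<le> 1 + 1 / 2 + (1 / 2)\<^sup>2" by (rule exp_bound) auto
  then have "exp (1 / 2) \<le> real n" using n by (simp add: power2_eq_square)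
  then show "1 / 2 \<le> ln (real n)" by (rule ln_ge_iff[THEN iffD2, rotated]) (use n in simp)
  have "real n \<le> real (2 ^ lg)" unfolding lg_def of_nat_le_iff by (rule log2_ceil)
  then have "real n \<le> 2 ^ lg" by simp
  then have "ln (real n) \<le> ln (2 ^ lg)" using n by (subst ln_le_cancel_iff) auto
  also have "\<dots> = real lg * ln 2" by (simp add: ln_realpow)
  also have "\<dots> \<le> real lg * 1" using ln_2_less_1 by (intro mult_left_mono) auto
  finally show "ln (real n) \<le> real lg" by simp
qed

lemma legal: "q \<in> set_pmf Q \<Longrightarrow> k \<le> n \<Longrightarrow> legal q {1..k}"
  unfolding legal_def using outcome_values by auto

lemma displacement_V: "max (2 * bp * ln n / \<gamma>\<^sup>2) (384 * ln n / \<gamma> ^ 4) \<le> real V"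
proof -
  have gg: "1 / \<gamma>\<^sup>2 \<le> (real g)\<^sup>2"
    using power_mono[OF gb(1), of 2] \<gamma> by (simp add: power_one_over)
  have g4: "1 / \<gamma> ^ 4 \<le> real g ^ 4"
    using power_mono[OF gb(1), of 4] \<gamma> by (simp add: power_one_over)
  have g1: "1 \<le> (real g)\<^sup>2" using g by simp
  have V: "real V = 8192 * (real lg * ((real b + 6) * (real g ^ 4)))"
    by (simp add: V_def T_def e_def m_def power4_eq_xxxx)
  have l: "0 \<le> ln (real n)" "ln (real n) \<le> real lg" using ln_bounds by auto
  have "2 * bp * ln n / \<gamma>\<^sup>2 = 2 * (bp * ln n * (1 / \<gamma>\<^sup>2))" by simp
  also have "\<dots> \<le> 2 * ((real b + 6) * real lg * (real g)\<^sup>2)"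
    using gg l gb(2) \<beta> \<gamma> by (intro mult_left_mono mult_mono) (auto simp: bp_def)
  also have "\<dots> \<le> 8192 * ((real b + 6) * real lg * ((real g)\<^sup>2 * (real g)\<^sup>2))"
    using g1 by (intro mult_mono mult_left_mono) (auto simp: mult_left_mono[of 1 "(real g)\<^sup>2" "(real g)\<^sup>2", simplified])
  also have "\<dots> = real V" by (simp add: V power4_eq_xxxx power2_eq_square)
  finally have 1: "2 * bp * ln n / \<gamma>\<^sup>2 \<le> real V" .
  have "384 * ln n / \<gamma> ^ 4 = 384 * (ln n * (1 / \<gamma> ^ 4))" by simp
  also have "\<dots> \<le> 8192 * (real lg * ((real b + 6) * real g ^ 4))"
  proof (intro mult_mono l)
    have "1 / \<gamma> ^ 4 \<le> 1 * real g ^ 4" using g4 by simp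
    also have "\<dots> \<le> (real b + 6) * real g ^ 4" by (intro mult_right_mono) auto
    finally show "1 / \<gamma> ^ 4 \<le> (real b + 6) * real g ^ 4" .
  qed (use l \<gamma> in auto)
  also have "\<dots> = real V" by (simp add: V)
  finally show ?thesis using 1 by simp
qed

lemma optimal_near_sorted:
  assumes q: "good q" and k: "1 \<le> k" "k \<le> n" and opt: "opt_list q {1..k} xs"
  shows "near_sorted \<pi> k V xs"
proof -
  interpret ordered_items "{1..k}" "rank_in \<pi> k" k q xs
    by unfold_locales (use rank_in_bij[OF inj_pi] legal q k opt in \<open>auto simp: good_def\<close>)
  have kk: "k \<in> {1..n}" using k by simp
  have "\<bar>real (rank_in \<pi> k (xs ! p)) - real p\<bar> \<le> real V" if p: "p < k" for p
  proof -
    have "\<bar>real (rank_in \<pi> k (xs ! p)) - real p\<bar> \<le> max (2 * bp * ln n / \<gamma>\<^sup>2) (384 * ln n / \<gamma> ^ 4)"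
    proof (rule displacement[OF \<gamma> ln_bounds(1)])
      show "bp > 0" using \<beta> by (simp add: bp_def)
    next
      fix i c assume a: "i \<in> {1..k}" "c < k"
        "2 * bp * ln (real n) / \<gamma>\<^sup>2 \<le> real (card {j \<in> {1..k}. rank_in \<pi> k i < rank_in \<pi> k j \<and> rank_in \<pi> k j \<le> c})"
      have "up_ok q k i c" using q a(1,2) kk unfolding good_def by blast
      then show "\<gamma> / 2 * real (card {j \<in> {1..k}. rank_in \<pi> k i < rank_in \<pi> k j \<and> rank_in \<pi> k j \<le> c})
        < real_of_int (\<Sum>j \<in> {j \<in> {1..k}. rank_in \<pi> k i < rank_in \<pi> k j \<and> rank_in \<pi> k j \<le> c}. q j i)"
        using a(3) unfolding up_ok_def Let_def by blast
    next
      fix i c assume a: "i \<in> {1..k}" "c < k"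
        "2 * bp * ln (real n) / \<gamma>\<^sup>2 \<le> real (card {j \<in> {1..k}. c \<le> rank_in \<pi> k j \<and> rank_in \<pi> k j < rank_in \<pi> k i})"
      have "down_ok q k i c" using q a(1,2) kk unfolding good_def by blast
      then show "\<gamma> / 2 * real (card {j \<in> {1..k}. c \<le> rank_in \<pi> k j \<and> rank_in \<pi> k j < rank_in \<pi> k i})
        < real_of_int (\<Sum>j \<in> {j \<in> {1..k}. c \<le> rank_in \<pi> k j \<and> rank_in \<pi> k j < rank_in \<pi> k i}. q i j)"
        using a(3) unfolding down_ok_def Let_def by blast
    next
      fix ws c assume a: "distinct ws" "set ws \<subseteq> {1..k}" "c \<le> k"
        "(real (length ws) + bp) * ln (real n) \<le> \<gamma>\<^sup>2 / 2 * real (card (inversions (\<lambda>x. rank_in \<pi> k x < c) ws))"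
      have "cut_ok q k c ws" using q a(1-3) kk unfolding good_def by blast
      then show "\<gamma> / 2 * real (card (inversions (\<lambda>x. rank_in \<pi> k x < c) ws))
        < real_of_int (\<Sum>(u, v)\<in>inversions (\<lambda>x. rank_in \<pi> k x < c) ws. q v u)"
        using a(4) unfolding cut_ok_def Let_def by blast
    qed (rule p)
    with displacement_V show ?thesis by linarith
  qed
  note disp = this
  have "p \<le> rank_in \<pi> k (xs ! p) + V \<and> rank_in \<pi> k (xs ! p) \<le> p + V" if p: "p < k" for p
  proof -
    have "real p \<le> real (rank_in \<pi> k (xs ! p) + V)" "real (rank_in \<pi> k (xs ! p)) \<le> real (p + V)"
      using disp[OF p] by linarith+
    then show ?thesis by (simp only: of_nat_le_iff)
  qed
  then show ?thesis using dist set_xs by (simp add: near_sorted_def)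
qed

lemma V1: "1 \<le> V" using sizes(6) by simp

text \<open>The constants fit together as follows. The search leaves \<open>zs\<close> with
  displacement \<open>7 V\<close>, and an optimal ranking has displacement \<open>V\<close>, so
  \<open>w = 10 V\<close> suffices. Feasible arrangements may swap pairs up to \<open>2 w\<close>
  apart, so outcomes must be known up to rank distance \<open>20 V + 2 * 7 V = 34 V\<close>. Asking
  for these takes a radius of \<open>34 V + 2 * 7 V = 48 V\<close>, which is below
  \<open>cc = 60 V\<close>.\<close>

lemma stage_good:
  assumes q: "good q" and j: "Suc j < n" and st: "stage q (ysl q j) f ys' f'"
    and opt: "opt_list q {1..Suc j} (ysl q j)" and kn: "known \<pi> (34 * V) q (Suc j) f"
  shows "opt_list q {1..Suc (Suc j)} ys' \<and> known \<pi> (34 * V) q (Suc (Suc j)) f'"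
proof -
  define k where "k = Suc j"
  define ys where "ys = ysl q j"
  have ns: "near_sorted \<pi> k V ys" unfolding ys_def k_def by (rule optimal_near_sorted[OF q _ _ opt]) (use j in auto)
  have ys: "distinct ys" "set ys = {1..k}" using ns by (auto simp: near_sorted_def)
  have len: "length ys = k" using distinct_card[OF ys(1)] ys(2) by simp
  from st obtain \<omega> pos zs js where s: "transcript q ys (k div V) V m (Suc k) T \<omega>"
     "pos = pivot (k div V) \<omega> T * V" "zs = insert_at pos (Suc k) ys"
     "f' = asked q (Suc k) ((!) zs ` {i. i < Suc k \<and> near cc pos i}) f"
     "ys' = map ((!) zs) js" "feasible (Suc k) w js" "length js = Suc k"
     "\<And>js'. feasible (Suc k) w js' \<Longrightarrow> length js' = Suc k \<Longrightarrow> lscore (gain zs f') js' \<le> lscore (gain zs f') js"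
    unfolding stage_def ys_def[symmetric] len by blast
  let ?X = "rank_in \<pi> k (Suc k) div V"
  have "search_ok q j" using q j by (simp add: good_def)
  then have "\<not> lying_search \<pi> q ys V m (Suc k) T e" using ns by (simp add: search_ok_def ys_def k_def)
  then have few: "card (lies (k div V) \<omega> ?X (32 * e)) < e"
    using s(1) unfolding lying_search_def T_def by auto
  have XB: "?X \<le> k div V" by (intro div_le_mono rank_in_le)
  have "(real (k div V) + 1)\<^sup>2 < 256 ^ e"
  proof -
    have "k div V + 1 \<le> n" using j div_le_dividend[of k V] unfolding k_def by linarith
    also have "n \<le> 2 ^ lg" unfolding lg_def by (rule log2_ceil)
    also have "(2::nat) ^ lg \<le> 2 ^ e" using g by (intro power_increasing) (auto simp: e_def)
    finally have "real (k div V + 1) \<le> real (2 ^ e)" by (simp only: of_nat_le_iff)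
    then have "(real (k div V) + 1)\<^sup>2 \<le> (2 ^ e)\<^sup>2" by (intro power_mono) auto
    also have "\<dots> = 4 ^ e" by (simp add: power2_eq_square flip: power_mult_distrib)
    also have "\<dots> < (256::real) ^ e" using sizes(9) by (intro power_strict_mono) auto
    finally show ?thesis .
  qed
  from search_correct[OF XB this few] have piv: "pivot (k div V) \<omega> T \<le> ?X + 6" "?X \<le> pivot (k div V) \<omega> T + 6"
    by (auto simp: T_def)
  have pk: "pos \<le> k"
  proof -
    have "pivot (k div V) \<omega> T \<le> k div V" by (rule median_props(1)[OF weights_pos])
    then have "pos \<le> k div V * V" unfolding s(2) by (rule mult_le_mono1)
    then show ?thesis using div_times_less_eq_dividend[of k V] by linarith
  qed
  have zns: "near_sorted \<pi> (Suc k) (7 * V) zs"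
    unfolding s(3) by (rule near_sorted_insert[OF ns V1 piv s(2) pk])
  have kn': "known \<pi> (34 * V) q (Suc k) f'"
    unfolding s(4)
  proof (rule known_asked[OF kn[folded k_def] zns])
    show "zs ! pos = Suc k" unfolding s(3) by (rule insert_at_props(4)[OF ys len pk])
    show "legal q {1..Suc k}" using legal q j by (auto simp: good_def k_def)
  qed (use pk in \<open>auto simp: cc_def\<close>)
  obtain xs where xs: "opt_list q {1..Suc k} xs" using ex_opt_list[of "{1..Suc k}" q] by auto
  have xns: "near_sorted \<pi> (Suc k) V xs"
    by (rule optimal_near_sorted[OF q _ _ xs]) (use j in \<open>auto simp: k_def\<close>)
  have "opt_list q {1..Suc k} ys'"
    unfolding s(5)
    by (rule best_is_optimal[OF zns kn' _ xs xns _ s(6,7,8)]) (simp_all add: w_def)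
  with kn' show ?thesis by (simp add: k_def)
qed

lemma good_run:
  assumes q: "good q"
  shows "Suc j \<le> n \<Longrightarrow> opt_list q {1..Suc j} (ysl q j) \<and>
    (\<exists>f. ST (arr (stage_mem q j)) (Suc j) (ysl q j) f \<and> known \<pi> (34 * V) q (Suc j) f)"
proof (induction j)
  case 0
  have "ST (arr (stage_mem q 0)) (Suc 0) [1] (\<lambda>_ _. 0)" using mstart(2) by simp
  moreover from ysl[OF this] have "ysl q 0 = [1]" by simp
  moreover have "opt_list q {1..Suc 0} [1]"
  proof -
    have "ys = [1]" if "distinct ys" "set ys = {1..Suc 0}" for ys :: "nat list"
    proof -
      have "length ys = 1" using distinct_card[OF that(1)] that(2) by simp
      then obtain a where "ys = [a]" by (cases ys) auto
      then show ?thesis using that(2) by simp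
    qed
    then have "lscore q ys \<le> lscore q [1]" if "distinct ys" "set ys = {1..Suc 0}" for ys using that by simp
    then show ?thesis by (simp add: opt_list_def)
  qed
  moreover have "known \<pi> (34 * V) q (Suc 0) (\<lambda>_ _. 0)" by (auto simp: known_def)
  ultimately show ?case by auto
next
  case (Suc j)
  then obtain f where IH: "opt_list q {1..Suc j} (ysl q j)" "ST (arr (stage_mem q j)) (Suc j) (ysl q j) f"
    "known \<pi> (34 * V) q (Suc j) f" by auto
  from Suc.prems have jn: "Suc j < n" by simp
  from stage_mem_step[OF IH(2) jn] obtain ys' f' where st: "stage q (ysl q j) f ys' f'"
    "ST (arr (stage_mem q (Suc j))) (Suc (Suc j)) ys' f'" by metis
  from stage_good[OF q jn st(1) IH(1,3)] ysl[OF st(2)] st(2) show ?case by blast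
qed

end

section \<open>Failure probabilities and their sum\<close>

context full
begin

definition eps :: real where "eps = exp (- (bp * ln (real n)))"

lemma prob_UN_le:
  assumes "finite S" "\<And>i. i \<in> S \<Longrightarrow> measure_pmf.prob Q (A i) \<le> \<delta>"
  shows "measure_pmf.prob Q (\<Union>i\<in>S. A i) \<le> real (card S) * \<delta>"
proof -
  have "measure_pmf.prob Q (\<Union>i\<in>S. A i) \<le> (\<Sum>i\<in>S. measure_pmf.prob Q (A i))"
    using assms(1) by (intro measure_pmf.finite_measure_subadditive_finite) auto
  also have "\<dots> \<le> real (card S) * \<delta>" using sum_bounded_above[of S, OF assms(2)] by simp
  finally show ?thesis .
qed

lemma exp_card_le:
  assumes "2 * bp * ln (real n) / \<gamma>\<^sup>2 \<le> real c"
  shows "exp (- (\<gamma>\<^sup>2 / 2 * real c)) \<le> eps"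
  using assms \<gamma> by (simp add: eps_def field_simps)

lemma prob_up:
  assumes "k \<in> {1..n}" "i \<in> {1..k}"
  shows "measure_pmf.prob Q {q. \<not> up_ok q k i c} \<le> eps"
proof -
  let ?J = "{j \<in> {1..k}. rank_in \<pi> k i < rank_in \<pi> k j \<and> rank_in \<pi> k j \<le> c}"
  show ?thesis
  proof (cases "2 * bp * ln (real n) / \<gamma>\<^sup>2 \<le> card ?J")
    case True
    let ?M = "(\<lambda>j. (i, j)) ` ?J"
    have inj: "inj_on (\<lambda>j. (i, j)) ?J" by (auto simp: inj_on_def)
    have sum: "(\<Sum>(u, v)\<in>?M. q v u) = (\<Sum>j\<in>?J. q j i)" for q :: outcomes
      unfolding sum.reindex[OF inj] by simp
    have set_eq: "{q. \<not> up_ok q k i c} = {q. real_of_int (\<Sum>(u, v)\<in>?M. q v u) \<le> \<gamma> / 2 * real (card ?M)}"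
      unfolding up_ok_def Let_def sum card_image[OF inj] using True by (auto simp: not_less)
    have "measure_pmf.prob Q {q. \<not> up_ok q k i c} \<le> exp (- (\<gamma>\<^sup>2 / 2 * real (card ?M)))"
      unfolding set_eq
    proof (rule chernoff_unconditional)
      fix u v assume "(u, v) \<in> ?M"
      then have "u = i" "v \<in> {1..k}" "rank_in \<pi> k i < rank_in \<pi> k v" by auto
      then show "u \<in> {1..n} \<and> v \<in> {1..n} \<and> \<pi> u < \<pi> v"
        using assms(1,2) rank_in_lessD[of \<pi> k i v] by simp
    qed simp
    also have "\<dots> \<le> eps" unfolding card_image[OF inj] by (rule exp_card_le[OF True])
    finally show ?thesis .
  next
    case False
    then have "{q. \<not> up_ok q k i c} = {}" unfolding up_ok_def Let_def by blast
    then show ?thesis by (simp add: eps_def)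
  qed
qed

lemma prob_down:
  assumes "k \<in> {1..n}" "i \<in> {1..k}"
  shows "measure_pmf.prob Q {q. \<not> down_ok q k i c} \<le> eps"
proof -
  let ?J = "{j \<in> {1..k}. c \<le> rank_in \<pi> k j \<and> rank_in \<pi> k j < rank_in \<pi> k i}"
  show ?thesis
  proof (cases "2 * bp * ln (real n) / \<gamma>\<^sup>2 \<le> card ?J")
    case True
    let ?M = "(\<lambda>j. (j, i)) ` ?J"
    have inj: "inj_on (\<lambda>j. (j, i)) ?J" by (auto simp: inj_on_def)
    have sum: "(\<Sum>(u, v)\<in>?M. q v u) = (\<Sum>j\<in>?J. q i j)" for q :: outcomes
      unfolding sum.reindex[OF inj] by simp
    have set_eq: "{q. \<not> down_ok q k i c} = {q. real_of_int (\<Sum>(u, v)\<in>?M. q v u) \<le> \<gamma> / 2 * real (card ?M)}"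
      unfolding down_ok_def Let_def sum card_image[OF inj] using True by (auto simp: not_less)
    have "measure_pmf.prob Q {q. \<not> down_ok q k i c} \<le> exp (- (\<gamma>\<^sup>2 / 2 * real (card ?M)))"
      unfolding set_eq
    proof (rule chernoff_unconditional)
      fix u v assume "(u, v) \<in> ?M"
      then have "v = i" "u \<in> {1..k}" "rank_in \<pi> k u < rank_in \<pi> k i" by auto
      then show "u \<in> {1..n} \<and> v \<in> {1..n} \<and> \<pi> u < \<pi> v"
        using assms(1,2) rank_in_lessD[of \<pi> k u i] by simp
    qed simp
    also have "\<dots> \<le> eps" unfolding card_image[OF inj] by (rule exp_card_le[OF True])
    finally show ?thesis .
  next
    case False
    then have "{q. \<not> down_ok q k i c} = {}" unfolding down_ok_def Let_def by blast
    then show ?thesis by (simp add: eps_def)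
  qed
qed

text \<open>The factor \<open>(1 / n) ^ length xs\<close> pays for the union bound over the at most
  \<open>n ^ length xs\<close> lists of this length.\<close>

lemma prob_cut:
  assumes "k \<in> {1..n}" "set xs \<subseteq> {1..k}"
  shows "measure_pmf.prob Q {q. \<not> cut_ok q k c xs} \<le> (1 / real n) ^ length xs * eps"
proof -
  let ?M = "inversions (\<lambda>x. rank_in \<pi> k x < c) xs"
  have pow: "exp (- ((real (length xs) + bp) * ln (real n))) = (1 / real n) ^ length xs * eps"
  proof -
    have "exp (- (real (length xs) * ln (real n))) = (1 / real n) ^ length xs"
      using n by (simp add: exp_minus exp_of_nat_mult power_one_over inverse_eq_divide)
    moreover have "exp (- ((real (length xs) + bp) * ln (real n))) = exp (- (real (length xs) * ln (real n))) * eps"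
      unfolding eps_def exp_add[symmetric] by (simp add: algebra_simps)
    ultimately show ?thesis by simp
  qed
  show ?thesis
  proof (cases "(real (length xs) + bp) * ln (real n) \<le> \<gamma>\<^sup>2 / 2 * card ?M")
    case True
    have set_eq: "{q. \<not> cut_ok q k c xs} = {q. real_of_int (\<Sum>(u, v)\<in>?M. q v u) \<le> \<gamma> / 2 * real (card ?M)}"
      unfolding cut_ok_def Let_def using True by (auto simp: not_less)
    have "measure_pmf.prob Q {q. \<not> cut_ok q k c xs} \<le> exp (- (\<gamma>\<^sup>2 / 2 * real (card ?M)))"
      unfolding set_eq
    proof (rule chernoff_unconditional[OF finite_inversions])
      fix u v assume "(u, v) \<in> ?M"
      then have "u \<in> set xs" "v \<in> set xs" "rank_in \<pi> k u < rank_in \<pi> k v"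
        using inversions_subset[of "\<lambda>x. rank_in \<pi> k x < c" xs] by auto
      then show "u \<in> {1..n} \<and> v \<in> {1..n} \<and> \<pi> u < \<pi> v"
        using assms rank_in_lessD[of \<pi> k u v] by auto
    qed
    also have "\<dots> \<le> exp (- ((real (length xs) + bp) * ln (real n)))" using True by simp
    finally show ?thesis by (simp only: pow)
  next
    case False
    then have "{q. \<not> cut_ok q k c xs} = {}" unfolding cut_ok_def Let_def by blast
    then show ?thesis by (simp add: eps_def)
  qed
qed

text \<open>The number of transcripts is \<open>4 ^ (32 e) = 2 ^ (64 e) \<le> exp (64 e)\<close>.
  Since \<open>m = 256 g^2\<close> and \<open>\<gamma> g \<ge> 1\<close>, the Chernoff exponent is
  at least \<open>128 e\<close>, twice what is needed to cancel it; the remaining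
  \<open>64 e\<close> exceeds \<open>bp * ln n\<close>.\<close>

lemma lie_prob: "4 ^ T * exp (- (\<gamma>\<^sup>2 / 2 * real (m * e))) \<le> eps"
proof -
  have "1 \<le> \<gamma> * real g" using gb(1) \<gamma> by (simp add: field_simps)
  then have "1 \<le> (\<gamma> * real g)\<^sup>2" by (simp add: one_le_power)
  then have "256 * real e \<le> 256 * (\<gamma> * real g)\<^sup>2 * real e" by (intro mult_right_mono) auto
  then have ge: "128 * real e \<le> \<gamma>\<^sup>2 / 2 * real (m * e)"
    by (simp add: m_def power2_eq_square algebra_simps)
  have "(4::real) ^ T = (2 ^ 2) ^ (32 * e)" by (simp add: T_def)
  also have "\<dots> = 2 ^ (64 * e)" by (simp only: power_mult[symmetric]) simp
  also have "\<dots> \<le> exp 1 ^ (64 * e)"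
    using exp_ge_add_one_self[of "1::real"] by (intro power_mono) auto
  also have "\<dots> = exp (64 * real e)" by (simp flip: exp_of_nat_mult)
  finally have "4 ^ T * exp (- (\<gamma>\<^sup>2 / 2 * real (m * e))) \<le> exp (64 * real e) * exp (- (128 * real e))"
    using ge by (intro mult_mono) auto
  also have "\<dots> = exp (- (64 * real e))" by (simp flip: exp_add)
  also have "\<dots> \<le> eps"
  proof -
    have "bp * ln (real n) \<le> (real b + 6) * real lg"
      using gb(2) ln_bounds \<beta> by (intro mult_mono) (auto simp: bp_def)
    also have "\<dots> = (real b + 6) * real lg * 1" by simp
    also have "\<dots> \<le> (real b + 6) * real lg * (real g * real g)"
    proof -
      have "1 \<le> real (g * g)" using g by (simp del: of_nat_mult)
      then show ?thesis by (intro mult_left_mono) auto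
    qed
    also have "\<dots> = real e" by (simp add: e_def)
    also have "\<dots> \<le> 64 * real e" by simp
    finally show ?thesis by (simp add: eps_def)
  qed
  finally show ?thesis .
qed

text \<open>The outcomes between earlier items split the space into cells. On each cell the ranking
  \<open>ys\<close> is constant, so \<open>lying_search_bound\<close> applies to it; the cells are
  disjoint, so the conditional bounds add up to the same bound.\<close>

lemma prob_search:
  assumes j: "Suc j < n"
  shows "measure_pmf.prob Q {q. \<not> search_ok q j} \<le> eps"
proof -
  define k where "k = Suc j"
  define I where "I = prefix_pairs k"
  have I: "I \<subseteq> pairs" unfolding I_def using j by (intro prefix_pairs_subset) (simp add: k_def)
  have finI: "finite I" using I finite_pairs finite_subset by blast
  define F where "F = PiE I (\<lambda>_. {1, -1 :: int})"
  have finF: "finite F" unfolding F_def using finI by (intro finite_PiE) auto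
  have cover: "\<exists>f\<in>F. q \<in> agree I f" if "q \<in> set_pmf Q" for q
  proof -
    have "q (fst p) (snd p) \<in> {1, -1}" if "p \<in> I" for p
      using outcome_values(1)[OF \<open>q \<in> set_pmf Q\<close>, of "fst p" "snd p"] that I by (auto simp: pairs_def)
    then have "restrict (\<lambda>p. q (fst p) (snd p)) I \<in> F" by (auto simp: F_def)
    moreover have "q \<in> agree I (restrict (\<lambda>p. q (fst p) (snd p)) I)" by (simp add: agree_def)
    ultimately show ?thesis by blast
  qed
  have disj: "disjoint_family_on (agree I) F"
    unfolding disjoint_family_on_def
  proof (intro ballI impI)
    fix f f' assume ff: "f \<in> F" "f' \<in> F" "f \<noteq> f'"
    show "agree I f \<inter> agree I f' = {}"
    proof (rule ccontr)
      assume "agree I f \<inter> agree I f' \<noteq> {}"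
      then obtain q where "\<And>p. p \<in> I \<Longrightarrow> f p = f' p" by (auto simp: agree_def)
      then have "f = f'" using ff(1,2) unfolding F_def by (intro PiE_ext)
      with ff(3) show False by simp
    qed
  qed
  let ?bad = "{q. \<not> search_ok q j}"
  have part: "measure_pmf.prob Q (agree I f \<inter> ?bad) \<le> measure_pmf.prob Q (agree I f) * eps" if "f \<in> F" for f
  proof (cases "agree I f \<inter> set_pmf Q = {}")
    case True
    then have "measure_pmf.prob Q (agree I f \<inter> ?bad) = 0"
      by (subst measure_pmf_zero_iff) blast
    then show ?thesis by (simp add: eps_def)
  next
    case False
    then obtain q0 where q0: "q0 \<in> agree I f" "q0 \<in> set_pmf Q" by blast
    define ys where "ys = ysl q0 j"
    have same: "ysl q j = ys" if q: "q \<in> agree I f" "q \<in> set_pmf Q" for q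
    proof -
      have "stage_mem q j = stage_mem q0 j"
      proof (rule stage_mem_local)
        fix x y assume xy: "1 \<le> y" "y < x" "x \<le> Suc j"
        then have "(y, x) \<in> I" by (simp add: I_def prefix_pairs_def k_def)
        moreover have "\<forall>p\<in>I. q (fst p) (snd p) = q0 (fst p) (snd p)" using q(1) q0(1) by (simp add: agree_def)
        ultimately have "q (fst (y, x)) (snd (y, x)) = q0 (fst (y, x)) (snd (y, x))" by blast
        then have "q y x = q0 y x" by simp
        moreover have "y \<in> {1..n}" "x \<in> {1..n}" "y \<noteq> x" using xy j by auto
        ultimately show "q x y = q0 x y" using outcome_values(2)[OF q(2)] outcome_values(2)[OF q0(2)] by metis
      qed (use j in simp)
      then show ?thesis by (simp add: ysl_def ys_def)
    qed
    have "measure_pmf.prob Q (agree I f \<inter> ?bad) = measure_pmf.prob Q (agree I f \<inter> ?bad \<inter> set_pmf Q)"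
      by (simp add: measure_Int_set_pmf)
    also have "\<dots> \<le> measure_pmf.prob Q (agree I f) * eps"
    proof (cases "near_sorted \<pi> k V ys")
      case True
      have "measure_pmf.prob Q (agree I f \<inter> ?bad \<inter> set_pmf Q) \<le>
          measure_pmf.prob Q (agree I f \<inter> {q. lying_search \<pi> q ys V m (Suc k) T e})"
        by (intro measure_pmf.finite_measure_mono) (auto simp: search_ok_def same k_def)
      also have "\<dots> \<le> measure_pmf.prob Q (agree I f) * (4 ^ T * exp (- (\<gamma>\<^sup>2 / 2 * real (m * e))))"
        unfolding I_def by (rule lying_search_bound[OF refl _ True V]) (use j in \<open>simp add: k_def\<close>)
      also have "\<dots> \<le> measure_pmf.prob Q (agree I f) * eps" by (intro mult_left_mono lie_prob) auto
      finally show ?thesis .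
    next
      case False
      then have "agree I f \<inter> ?bad \<inter> set_pmf Q = {}" by (auto simp: search_ok_def same k_def)
      then show ?thesis by (simp add: eps_def)
    qed
    finally show ?thesis .
  qed
  have "measure_pmf.prob Q ?bad = measure_pmf.prob Q (?bad \<inter> set_pmf Q)"
    by (simp add: measure_Int_set_pmf)
  also have "\<dots> \<le> measure_pmf.prob Q (\<Union>f\<in>F. agree I f \<inter> ?bad)"
    by (intro measure_pmf.finite_measure_mono) (use cover in auto)
  also have "\<dots> \<le> (\<Sum>f\<in>F. measure_pmf.prob Q (agree I f \<inter> ?bad))"
    using finF by (intro measure_pmf.finite_measure_subadditive_finite) auto
  also have "\<dots> \<le> (\<Sum>f\<in>F. measure_pmf.prob Q (agree I f) * eps)" by (intro sum_mono part)
  also have "\<dots> = measure_pmf.prob Q (\<Union>f\<in>F. agree I f) * eps"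
    using measure_pmf.finite_measure_finite_Union[OF finF _ disj, of Q] by (simp add: sum_distrib_right)
  also have "\<dots> \<le> 1 * eps" by (intro mult_right_mono) (auto simp: eps_def)
  finally show ?thesis by simp
qed

lemma prob_good: "measure_pmf.prob Q {q. good q} \<ge> 1 - real n powr (- \<beta>)"
proof -
  let ?P = "measure_pmf.prob Q"
  have eps0: "0 \<le> eps" by (simp add: eps_def)
  define S1 where "S1 = {(k, i, c). k \<in> {1..n} \<and> i \<in> {1..k} \<and> c < k}"
  \<comment> \<open>The last component is the length of the list, so the lists of one length can be
    handled together inside \<open>C\<close>.\<close>
  define S2 where "S2 = {1..n} \<times> {..n} \<times> {..n}"
  define S3 where "S3 = {j. Suc j < n}"
  define L where "L k N = {xs. set xs \<subseteq> {1..k} \<and> length xs = N}" for k N :: nat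
  have sub1: "S1 \<subseteq> {1..n} \<times> {1..n} \<times> {..<n}" by (auto simp: S1_def)
  have fin: "finite S1" "finite S2" "finite S3"
    using finite_subset[OF sub1] by (auto simp: S2_def S3_def intro: finite_subset[of _ "{..<n}"])
  have card1: "card S1 \<le> n ^ 3"
    using card_mono[OF _ sub1] by (simp add: card_cartesian_product power3_eq_cube)
  have card2: "card S2 = n * (n + 1) ^ 2" by (simp add: S2_def card_cartesian_product power2_eq_square)
  have card3: "card S3 \<le> n"
    using card_mono[of "{..<n}" S3] by (simp add: S3_def subset_eq)
  define A where "A = (\<Union>z\<in>S1. {q. \<not> up_ok q (fst z) (fst (snd z)) (snd (snd z))})"
  define B where "B = (\<Union>z\<in>S1. {q. \<not> down_ok q (fst z) (fst (snd z)) (snd (snd z))})"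
  define C where "C = (\<Union>z\<in>S2. \<Union>xs\<in>L (fst z) (snd (snd z)). {q. \<not> cut_ok q (fst z) (fst (snd z)) xs})"
  define D where "D = (\<Union>j\<in>S3. {q. \<not> search_ok q j})"
  have PA: "?P A \<le> real (card S1) * eps" unfolding A_def
    by (rule prob_UN_le[OF fin(1)], rule prob_up) (auto simp: S1_def)
  have PB: "?P B \<le> real (card S1) * eps" unfolding B_def
    by (rule prob_UN_le[OF fin(1)], rule prob_down) (auto simp: S1_def)
  have PD: "?P D \<le> real (card S3) * eps" unfolding D_def
    by (rule prob_UN_le[OF fin(3)], rule prob_search) (auto simp: S3_def)
  have PC: "?P C \<le> real (card S2) * eps" unfolding C_def
  proof (rule prob_UN_le[OF fin(2)])
    fix z assume z: "z \<in> S2"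
    let ?k = "fst z" and ?N = "snd (snd z)"
    have fL: "finite (L ?k ?N)" unfolding L_def using finite_lists_length_eq[of "{1..?k}" ?N] by simp
    have "card (L ?k ?N) = ?k ^ ?N" unfolding L_def using card_lists_length_eq[of "{1..?k}" ?N] by simp
    then have cL: "real (card (L ?k ?N)) \<le> real n ^ ?N" using z by (auto simp: S2_def intro: power_mono)
    have "?P (\<Union>xs\<in>L ?k ?N. {q. \<not> cut_ok q ?k (fst (snd z)) xs}) \<le> real (card (L ?k ?N)) * ((1 / real n) ^ ?N * eps)"
    proof (rule prob_UN_le[OF fL])
      fix xs assume xs: "xs \<in> L ?k ?N"
      have "?P {q. \<not> cut_ok q ?k (fst (snd z)) xs} \<le> (1 / real n) ^ length xs * eps"
        by (rule prob_cut) (use z xs in \<open>auto simp: S2_def L_def\<close>)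
      then show "?P {q. \<not> cut_ok q ?k (fst (snd z)) xs} \<le> (1 / real n) ^ ?N * eps" using xs by (simp add: L_def)
    qed
    also have "\<dots> \<le> real n ^ ?N * ((1 / real n) ^ ?N * eps)"
      using cL eps0 by (intro mult_right_mono) auto
    also have "\<dots> = eps" using n by (simp add: power_one_over)
    finally show "?P (\<Union>xs\<in>L ?k ?N. {q. \<not> cut_ok q ?k (fst (snd z)) xs}) \<le> eps" .
  qed
  have bad: "- {q. good q} \<inter> set_pmf Q \<subseteq> A \<union> B \<union> C \<union> D"
  proof
    fix q assume "q \<in> - {q. good q} \<inter> set_pmf Q"
    then consider k i c where "k \<in> {1..n}" "i \<in> {1..k}" "c < k" "\<not> up_ok q k i c"
      | k i c where "k \<in> {1..n}" "i \<in> {1..k}" "c < k" "\<not> down_ok q k i c"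
      | k c xs where "k \<in> {1..n}" "c \<le> k" "distinct xs" "set xs \<subseteq> {1..k}" "\<not> cut_ok q k c xs"
      | j where "Suc j < n" "\<not> search_ok q j"
      unfolding good_def by blast
    then show "q \<in> A \<union> B \<union> C \<union> D"
    proof cases
      case 1
      then have "(k, i, c) \<in> S1" by (simp add: S1_def)
      with 1 have "q \<in> A" unfolding A_def by (intro UN_I[of "(k, i, c)"]) auto
      then show ?thesis by simp
    next
      case 2
      then have "(k, i, c) \<in> S1" by (simp add: S1_def)
      with 2 have "q \<in> B" unfolding B_def by (intro UN_I[of "(k, i, c)"]) auto
      then show ?thesis by simp
    next
      case 3
      have "length xs \<le> k" using distinct_card[OF 3(3)] card_mono[OF _ 3(4)] by simp
      then have "(k, c, length xs) \<in> S2" using 3 by (simp add: S2_def)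
      with 3 have "q \<in> C" unfolding C_def by (intro UN_I[of "(k, c, length xs)"]) (auto simp: L_def)
      then show ?thesis by simp
    next
      case 4
      then have "q \<in> D" by (auto simp: D_def S3_def)
      then show ?thesis by simp
    qed
  qed
  have "?P (- {q. good q}) = ?P (- {q. good q} \<inter> set_pmf Q)" by (simp add: measure_Int_set_pmf)
  also have "\<dots> \<le> ?P (A \<union> B \<union> C \<union> D)" by (rule measure_pmf.finite_measure_mono[OF bad]) simp
  also have "\<dots> \<le> ?P A + ?P B + ?P C + ?P D"
    using measure_Un_le[of "A \<union> B \<union> C" "measure_pmf Q" D] measure_Un_le[of "A \<union> B" "measure_pmf Q" C]
      measure_Un_le[of A "measure_pmf Q" B] by simp
  also have "\<dots> \<le> real (n ^ 3) * eps + real (n ^ 3) * eps + real (n * (n + 1) ^ 2) * eps + real n * eps"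
  proof -
    have "real (card S1) * eps \<le> real (n ^ 3) * eps" "real (card S3) * eps \<le> real n * eps"
      using card1 card3 eps0 by (auto intro!: mult_right_mono simp del: of_nat_power)
    then show ?thesis using PA PB PC PD unfolding card2 by linarith
  qed
  also have "\<dots> = real (n ^ 3 + n ^ 3 + n * (n + 1) ^ 2 + n) * eps" by (simp add: algebra_simps)
  also have "\<dots> \<le> real (n ^ 6) * eps"
  proof -
    \<comment> \<open>After this substitution all coefficients are nonnegative and can be compared
      one by one. The bound \<open>8 \<le> n ^ 3\<close> then leads to \<open>n ^ 6\<close>,
      matching \<open>bp\<close>.\<close>
    obtain d where d: "n = d + 2" using n by (metis le_Suc_ex add.commute)
    have "n ^ 3 + n ^ 3 + n * (n + 1) ^ 2 + n \<le> n ^ 3 * 8"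
      unfolding d by (simp add: power2_eq_square power3_eq_cube algebra_simps)
    also have "\<dots> \<le> n ^ 3 * n ^ 3" using power_mono[OF n, of 3] by (intro mult_left_mono) auto
    also have "\<dots> = n ^ 6" by (simp flip: power_add)
    finally have "real (n ^ 3 + n ^ 3 + n * (n + 1) ^ 2 + n) \<le> real (n ^ 6)" by (simp only: of_nat_le_iff)
    then show ?thesis using eps0 by (rule mult_right_mono)
  qed
  also have "\<dots> = real n powr (- \<beta>)"
  proof -
    have "real (n ^ 6) = exp (6 * ln (real n))" using n by (simp add: exp_of_nat_mult[of 6, simplified])
    then show ?thesis using n by (simp add: eps_def bp_def powr_def algebra_simps flip: exp_add)
  qed
  finally have "?P (- {q. good q}) \<le> real n powr (- \<beta>)" .
  moreover have "?P (- {q. good q}) = 1 - ?P {q. good q}"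
    using measure_pmf.prob_compl[of "{q. good q}" Q] by (simp add: Compl_eq_Diff_UNIV)
  ultimately show ?thesis by simp
qed

end

section \<open>From lists to rankings, and the final bounds\<close>

lemma score_eq_lscore:
  assumes ys: "distinct ys" "set ys = {1..n}" and \<sigma>: "\<And>p. p < n \<Longrightarrow> \<sigma> (ys ! p) = p + 1"
  shows "score n q \<sigma> = lscore q ys"
proof -
  let ?R = "{(i, j). i \<in> {1..n} \<and> j \<in> {1..n} \<and> \<sigma> i > \<sigma> j}"
  have len: "length ys = n" using distinct_card[OF ys(1)] ys(2) by simp
  have mem: "(i, j) \<in> ?R \<longleftrightarrow> (j, i) \<in> before ys" for i j
  proof
    assume "(i, j) \<in> ?R"
    then have "i \<in> set ys" "j \<in> set ys" and less: "\<sigma> j < \<sigma> i" using ys(2) by auto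
    then obtain p r where pr: "p < n" "r < n" "i = ys ! p" "j = ys ! r" unfolding in_set_conv_nth len by blast
    with less \<sigma> have "r < p" by simp
    with pr show "(j, i) \<in> before ys" unfolding before_def len by blast
  next
    assume "(j, i) \<in> before ys"
    then obtain p r where pr: "r < p" "p < n" "i = ys ! p" "j = ys ! r" unfolding before_def len by blast
    moreover have "ys ! p \<in> {1..n}" "ys ! r \<in> {1..n}"
      using nth_mem[of p ys] nth_mem[of r ys] pr(1,2) unfolding len ys(2) by simp_all
    ultimately show "(i, j) \<in> ?R" using \<sigma>[of p] \<sigma>[of r] by simp
  qed
  have "(\<Sum>(i, j)\<in>?R. q i j) = (\<Sum>(u, v)\<in>before ys. q v u)"
    by (rule sum.reindex_bij_witness[of _ prod.swap prod.swap]) (use mem in auto)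
  then show ?thesis by (simp add: score_def lscore_before[OF ys(1)])
qed

lemma optimal_ranking_of_list:
  assumes opt: "opt_list q {1..n} ys" and \<sigma>: "\<And>p. p < n \<Longrightarrow> \<sigma> (ys ! p) = p + 1"
    and out: "\<And>i. i \<notin> {1..n} \<Longrightarrow> \<sigma> i = i"
  shows "optimal_ranking n q \<sigma>"
proof -
  have ys: "distinct ys" "set ys = {1..n}" using opt by (auto simp: opt_list_def)
  have len: "length ys = n" using distinct_card[OF ys(1)] ys(2) by simp
  have "\<sigma> ` {1..n} = \<sigma> ` (!) ys ` {..<n}"
    using ys(2) by (simp add: set_conv_nth len image_def) blast
  also have "\<dots> = Suc ` {..<n}" unfolding image_image by (rule image_cong) (use \<sigma> in auto)
  also have "\<dots> = {1..n}" by (simp add: lessThan_Suc_atMost image_Suc_lessThan)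
  finally have img: "\<sigma> ` {1..n} = {1..n}" .
  then have "bij_betw \<sigma> {1..n} {1..n}" unfolding bij_betw_def by (auto intro: eq_card_imp_inj_on)
  then have perm: "\<sigma> permutes {1..n}" by (rule bij_imp_permutes) (use out in blast)
  have "score n q \<tau> \<le> score n q \<sigma>" if \<tau>: "\<tau> permutes {1..n}" for \<tau>
  proof -
    \<comment> \<open>The inverse of \<open>\<tau>\<close> lists the items in the order of their
      positions.\<close>
    define zs where "zs = map (inv \<tau>) [1..<Suc n]"
    have inv: "inv \<tau> permutes {1..n}" using \<tau> by (rule permutes_inv)
    have zs: "distinct zs" "set zs = {1..n}"
      using permutes_image[OF inv] permutes_inj[OF inv]
      by (auto simp: zs_def distinct_map inj_on_def inj_def atLeastLessThanSuc_atLeastAtMost simp del: upt_Suc)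
    have "\<tau> (zs ! p) = p + 1" if "p < n" for p
      using that permutes_inverses(1)[OF \<tau>] by (simp add: zs_def del: upt_Suc)
    from score_eq_lscore[OF zs this] score_eq_lscore[OF ys \<sigma>] opt zs
    show ?thesis by (simp add: opt_list_def)
  qed
  with perm show ?thesis by (simp add: optimal_ranking_def)
qed

text \<open>The factors are: 2 from \<open>2 ^ lg \<le> n\<^sup>2\<close>, 21 from \<open>Y\<close>,
  \<open>8192 = 32 * 256\<close> from \<open>V\<close>, 7 and 16 from
  \<open>b + 6 \<le> 7 (\<beta> + 1)\<close> and \<open>g ^ 4 \<le> 16 / \<gamma> ^ 4\<close>, and
  finally the exponent of \<open>Y\<close> in the running time.\<close>

definition time_exponent :: real where
  "time_exponent = 2 * 21 * 8192 * 7 * 16 * real (ex SETUP + ex STAGE + 6)"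

text \<open>An insertion makes at most \<open>2 V + 120 V + 1 \<le> 123 V\<close> queries, for the
  search and for the comparisons around the place found; the 4 comes from
  \<open>lg \<le> 4 ln n\<close>.\<close>

definition query_factor :: "real \<Rightarrow> real \<Rightarrow> real" where
  "query_factor \<beta> \<gamma> = 123 * 8192 * 4 * (real (nat \<lceil>\<beta>\<rceil>) + 6) * real (nat \<lceil>1 / \<gamma>\<rceil>) ^ 4"

context params
begin

lemma V_eq: "V = lg * (8192 * (b + 6) * g ^ 4)"
  by (simp add: V_def T_def e_def m_def power4_eq_xxxx mult_ac)

lemma two_power_lg: "2 ^ lg \<le> n\<^sup>2"
proof -
  have "2 ^ (lg - 1) < n" using lg by (intro log2_ceil(2)) (simp add: lg_def)
  then have "2 * 2 ^ (lg - 1) \<le> n * n" using n by (intro mult_le_mono) auto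
  then show ?thesis using lg by (simp add: power2_eq_square flip: power_Suc)
qed

lemma lg_le_ln: "real lg \<le> 4 * ln (real n)"
proof -
  have "real lg * (1 / 2) \<le> real lg * ln 2"
    using ln2_ge_two_thirds by (intro mult_left_mono) auto
  also have "\<dots> = ln (real (2 ^ lg))" by (simp add: ln_realpow)
  also have "\<dots> \<le> ln (real (n\<^sup>2))"
    using two_power_lg n by (subst ln_le_cancel_iff) (auto simp del: of_nat_power)
  also have "\<dots> = 2 * ln (real n)" using n by (simp add: ln_realpow)
  finally show ?thesis by simp
qed

lemma Y_power_le: "Y ^ j \<le> n ^ (2 * (21 * (8192 * (b + 6) * g ^ 4) * j))"
proof -
  have "Y ^ j = (2 ^ lg) ^ (21 * (8192 * (b + 6) * g ^ 4) * j)"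
    unfolding Y_def V_eq by (simp only: power_mult[symmetric] mult_ac)
  also have "\<dots> \<le> (n\<^sup>2) ^ (21 * (8192 * (b + 6) * g ^ 4) * j)"
    by (rule power_mono[OF two_power_lg]) simp
  finally show ?thesis by (simp only: power_mult)
qed

end

theorem theorem3:
  "\<exists>(P :: com) (K :: real) (C :: real \<Rightarrow> real \<Rightarrow> real).
     \<forall>(\<gamma> :: real) (\<beta> :: real) (n :: nat) (\<pi> :: nat \<Rightarrow> nat) (Q :: outcomes pmf).
       0 < \<gamma> \<longrightarrow> \<gamma> < 1 / 2 \<longrightarrow> 0 < \<beta> \<longrightarrow> 1 \<le> n \<longrightarrow> noisy_sorting n \<gamma> \<pi> Q \<longrightarrow>
       measure_pmf.prob
         (execution P n \<gamma> \<beta> Q (nat \<lfloor>real n powr (K * ((\<beta> + 1) / \<gamma> ^ 4))\<rfloor>))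
         {(q, (cs, m, k)). cs = [] \<and> optimal_ranking n q (output_ranking n m) \<and>
            real k \<le> C \<beta> \<gamma> * real n * ln (real n)}
       \<ge> 1 - real n powr (- \<beta>)"
proof (intro exI[of _ PROG] exI[of _ time_exponent] exI[of _ query_factor] allI impI)
  fix \<gamma> \<beta> :: real and n :: nat and \<pi> :: "nat \<Rightarrow> nat" and Q :: "outcomes pmf"
  assume \<gamma>: "0 < \<gamma>" "\<gamma> < 1 / 2" and \<beta>: "0 < \<beta>" and n: "1 \<le> n" and model: "noisy_sorting n \<gamma> \<pi> Q"
  define t where "t = nat \<lfloor>real n powr (time_exponent * ((\<beta> + 1) / \<gamma> ^ 4))\<rfloor>"
  define success :: "(outcomes \<times> config) set" where "success = {(q, (cs, m, k)). cs = [] \<and> optimal_ranking n q (output_ranking n m) \<and>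
            real k \<le> query_factor \<beta> \<gamma> * real n * ln (real n)}"
  have "1 - real n powr (- \<beta>) \<le> measure_pmf.prob (execution PROG n \<gamma> \<beta> Q t) success"
  \<comment> \<open>For \<open>n = 1\<close> the claimed probability is 0; the parameters require
    \<open>n \<ge> 2\<close>.\<close>
  proof (cases "n = 1")
    case False
    define g where "g = nat \<lceil>1 / \<gamma>\<rceil>"
    define b where "b = nat \<lceil>\<beta>\<rceil>"
    have "0 < 1 / \<gamma>" using \<gamma> by simp
    then have ceil: "0 < \<lceil>1 / \<gamma>\<rceil>" "0 < \<lceil>\<beta>\<rceil>" using \<beta> by (simp_all only: zero_less_ceiling)
    then have int: "int g = \<lceil>1 / \<gamma>\<rceil>" "int b = \<lceil>\<beta>\<rceil>"
      using nat_0_le[of "\<lceil>1 / \<gamma>\<rceil>"] nat_0_le[of "\<lceil>\<beta>\<rceil>"] unfolding g_def b_def by linarith+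
    have gb: "1 / \<gamma> \<le> real g" "\<beta> \<le> real b" by (simp_all add: g_def b_def real_nat_ceiling_ge)
    have gb_up: "real g \<le> 1 / \<gamma> + 1" "real b \<le> \<beta> + 1"
      using int ceiling_correct[of "1 / \<gamma>"] ceiling_correct[of \<beta>] by linarith+
    have "1 \<le> g" using int(1) ceil(1) by linarith
    then interpret full n g b \<gamma> \<pi> Q \<beta>
      by unfold_locales (use False n \<gamma> \<beta> gb model in auto)
    define J where "J = ex SETUP + ex STAGE + 6"
    have "real g ^ 4 \<le> (2 / \<gamma>) ^ 4"
    proof (rule power_mono)
      have "1 \<le> 1 / \<gamma>" using \<gamma> by simp
      then show "real g \<le> 2 / \<gamma>" using gb_up(1) by simp
    qed simp
    then have g4: "real g ^ 4 \<le> 16 * (1 / \<gamma> ^ 4)" by (simp add: power_divide)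
    have b7: "real (b + 6) \<le> 7 * (\<beta> + 1)" using gb_up(2) \<beta> by simp
    have time: "Y ^ J \<le> t"
    proof -
      define M where "M = 2 * (21 * (8192 * (b + 6) * g ^ 4) * J)"
      have "real M = 2 * 21 * 8192 * real J * (real (b + 6) * real g ^ 4)" by (simp add: M_def)
      also have "\<dots> \<le> 2 * 21 * 8192 * real J * ((7 * (\<beta> + 1)) * (16 * (1 / \<gamma> ^ 4)))"
        using g4 b7 \<beta> by (intro mult_left_mono mult_mono) auto
      also have "\<dots> = time_exponent * ((\<beta> + 1) / \<gamma> ^ 4)" unfolding time_exponent_def J_def[symmetric] by (simp add: algebra_simps)
      finally have M: "real M \<le> time_exponent * ((\<beta> + 1) / \<gamma> ^ 4)" .
      have "real (Y ^ J) \<le> real (n ^ M)" unfolding M_def of_nat_le_iff by (rule Y_power_le)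
      also have "\<dots> = real n powr real M" using n by (simp add: powr_realpow)
      also have "\<dots> \<le> real n powr (time_exponent * ((\<beta> + 1) / \<gamma> ^ 4))"
        using n M by (intro powr_mono) auto
      finally show ?thesis unfolding t_def by (rule le_nat_floor)
    qed
    have quer: "real (n * queries) \<le> query_factor \<beta> \<gamma> * real n * ln (real n)"
    proof -
      have "queries \<le> 123 * V" using V1 by (simp add: V_def cc_def)
      then have "real (n * queries) \<le> real (n * (123 * V))" by (simp only: of_nat_le_iff mult_le_mono2)
      also have "\<dots> = real n * (123 * 8192 * (real b + 6) * real g ^ 4) * real lg" by (simp add: V_eq)
      also have "\<dots> \<le> real n * (123 * 8192 * (real b + 6) * real g ^ 4) * (4 * ln (real n))"
        by (intro mult_left_mono lg_le_ln) auto
      also have "\<dots> = query_factor \<beta> \<gamma> * real n * ln (real n)" by (simp add: query_factor_def g_def b_def)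
      finally show ?thesis .
    qed
    have init: "initial PROG n \<gamma> \<beta> = ([PROG], minit, 0)" by (simp add: initial_def minit_def int)
    \<comment> \<open>For each table the run ends in a point mass, so the execution is an image of
      \<open>Q\<close> and only the probability of \<open>good\<close> remains.\<close>
    have ex: "\<forall>q. \<exists>c. steps q t (initial PROG n \<gamma> \<beta>) = return_pmf c \<and> (good q \<longrightarrow> (q, c) \<in> success)"
    proof
      fix q
      obtain m' s tr where r: "big q PROG minit m' s tr" "s \<le> Y ^ J" "length tr \<le> n * queries"
        "\<And>p. p < n \<Longrightarrow> m' (int (ysl q (n - 1) ! p)) = int (p + 1)"
        unfolding J_def
      proof (rule run[of q], goal_cases)
        case 1
        from 1(1)[OF 1(2-4) 1(5)] show ?case .
      qed
      have "steps q t (initial PROG n \<gamma> \<beta>) = return_pmf ([], m', 0 + length tr)"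
        unfolding init by (rule big_steps_halt[OF r(1)]) (use r(2) time in linarith)
      moreover have "(q, [], m', 0 + length tr) \<in> success" if "good q"
      proof -
        have "real (length tr) \<le> query_factor \<beta> \<gamma> * real n * ln (real n)"
          using r(3) quer by (meson of_nat_le_iff order_trans)
        moreover have opt: "opt_list q {1..n} (ysl q (n - 1))" using good_run[OF that, of "n - 1"] n by simp
        have "optimal_ranking n q (output_ranking n m')"
        proof (rule optimal_ranking_of_list[OF opt])
          fix p assume p: "p < n"
          have "length (ysl q (n - 1)) = n" using n by (simp add: ysl_def)
          then have "ysl q (n - 1) ! p \<in> set (ysl q (n - 1))" using p by simp
          then have "ysl q (n - 1) ! p \<in> {1..n}" using opt by (simp only: opt_list_def)
          then show "output_ranking n m' (ysl q (n - 1) ! p) = p + 1" using r(4)[OF p] by (simp add: output_ranking_def)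
        qed (auto simp: output_ranking_def)
        ultimately show ?thesis by (simp add: success_def)
      qed
      ultimately show "\<exists>c. steps q t (initial PROG n \<gamma> \<beta>) = return_pmf c \<and> (good q \<longrightarrow> (q, c) \<in> success)"
        by (intro exI conjI impI)
    qed
    obtain F where F: "\<And>q. steps q t (initial PROG n \<gamma> \<beta>) = return_pmf (F q)"
      "\<And>q. good q \<Longrightarrow> (q, F q) \<in> success" using choice[OF ex] by blast
    have "execution PROG n \<gamma> \<beta> Q t = map_pmf (\<lambda>q. (q, F q)) Q"
      unfolding execution_def F(1) by (simp add: bind_return_pmf map_pmf_def)
    then have "measure_pmf.prob (execution PROG n \<gamma> \<beta> Q t) success =
        measure_pmf.prob Q ((\<lambda>q. (q, F q)) -` success)"
      by (simp only: measure_map_pmf)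
    also have "\<dots> \<ge> measure_pmf.prob Q {q. good q}"
      by (intro measure_pmf.finite_measure_mono) (use F(2) in auto)
    finally show ?thesis using prob_good by linarith
  qed simp
  then show "1 - real n powr (- \<beta>) \<le> measure_pmf.prob (execution PROG n \<gamma> \<beta> Q
      (nat \<lfloor>real n powr (time_exponent * ((\<beta> + 1) / \<gamma> ^ 4))\<rfloor>))
      {(q, (cs, m, k)). cs = [] \<and> optimal_ranking n q (output_ranking n m) \<and>
        real k \<le> query_factor \<beta> \<gamma> * real n * ln (real n)}"
    unfolding t_def success_def .
qed

end
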